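(* Let $\alpha,\beta>1/3$, let $x\in\mathcal{CC}_{1,1}^{\alpha,\beta}$ and let $(A^u,B_a^{xu},C^{uv},D_a^{uv},E_a^{xuv},F_a^{xuv})_{u,v\in\{x,\omega\},a\in\{1,2\}}$ be objects satisfying the algebraic hypothesis stated in the context. For $y\in\mathscr K_x^{\alpha,\beta}$ (with associated $y^x,y^\omega$) define, for $u\in\{x,\omega\}$, $$\iint y\,du:=-yA^u-y^xC^{xu}-y^\omega C^{\omega u}+\sum_{a=1,2}\Big(\int_ay\int_{\hat a}du+\int_ay^x\int_{\hat a}dx\,du+\int_ay^\omega\int_{\hat a}d\omega\,du\Big)+r^{u},$$ $$r^{u}:=\Lambda\Big[\delta y\,A^u-\delta\Big(-y^xC^{xu}-y^\omega C^{\omega u}+\sum_{a=1,2}\Big(\int_ay^x\int_{\hat a}dx\,du+\int_ay^\omega\int_{\hat a}d\omega\,du\Big)\Big)\Big].$$ Then $\iint y\,dx$ and $\iint y\,d\omega$ are well defined elements of $\mathcal{CC}_{2,2}^{\alpha,\beta}$ (in particular the arguments of $\Lambda$ are in its domain). Moreover, if $x$ is a smooth sheet and the algebraic objects are the iterated integrals of $x$ given in the context, these definitions coincide with the Riemann–Stieltjes ones: $$\Big(\iint y\,dx\Big)_{s_1s_2;t_1t_2}=\int_{s_1}^{s_2}\int_{t_1}^{t_2}y_{st}\,\partial_s\partial_tx_{st}\,dt\,ds,\qquad \Big(\iint y\,d\omega\Big)_{s_1s_2;t_1t_2}=\int_{s_1}^{s_2}\int_{t_1}^{t_2}y_{st}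\,\partial_sx_{st}\,\partial_tx_{st}\,dt\,ds.$$
   Context: SPACES. $\mathcal{CC}_{k,l}$: continuous $g:[0,1]^k\times[0,1]^l\to\mathbb R$, written $g_{s_1\dots s_k;t_1\dots t_l}$, vanishing when $s_i=s_{i+1}$ or $t_i=t_{i+1}$ for some $i$. On one argument in direction 1, $(\delta_1g)_{s_1s_2;\cdot}=g_{s_2;\cdot}-g_{s_1;\cdot}$; on two arguments, $(\delta_1g)_{s_1s_2s_3;\cdot}=g_{s_1s_3;\cdot}-g_{s_1s_2;\cdot}-g_{s_2s_3;\cdot}$; $\delta_2$ is the same in the $t$ variables; $\delta=\delta_1\delta_2$. Product: $(gh)_{s_1\dots s_{n+k-1};t_1\dots t_{m+l-1}}=g_{s_1\dots s_n;t_1\dots t_m}h_{s_n\dots s_{n+k-1};t_m\dots t_{m+l-1}}$ for $g\in\mathcal{CC}_{n,m}$, $h\in\mathcal{CC}_{k,l}$. Norms: $\mathcal{CC}_{2,2}^{z_1,z_2}$: $\|g\|_{z_1,z_2}=\sup|g_{s_1s_2;t_1t_2}|/(|s_2-s_1|^{z_1}|t_2-t_1|^{z_2})$; $\mathcal{CC}_{2,1}^{z_1,z_2}$: $\sup\frac{|g_{s_1s_2;t}|}{|s_2-s_1|^{z_1}}+\|\delta_2g\|_{z_1,z_2}$; $\mathcal{CC}_{1,2}^{z_1,z_2}$ symmetric; $\mathcal{CC}_{1,1}^{z_1,z_2}$: $\|f\|_\infty+\sup\frac{|\delta_1f_{s_1s_2;t}|}{|s_2-s_1|^{z_1}}+\sup\frac{|\delta_2f_{s;t_1t_2}|}{|t_2-t_1|^{z_2}}+\|\delta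 f\|_{z_1,z_2}$. $\mathcal T_1^{(p,q);r}$: continuous functions $D_{s_1s_2s_3s_4;t_1t_2}$ vanishing if $s_1=s_2$, $s_3=s_4$ or $t_1=t_2$, with norm $\sup|D|/(|s_2-s_1|^p|s_4-s_3|^q|t_2-t_1|^r)$. $\mathcal T_{1,3}^{(p,q);r}$: analogous functions of $(s_1,\dots,s_4;t_1,t_2,t_3)$ vanishing also if $t_2=t_3$, with norm the infimum, over decompositions $F=\sum_iF_i$ and $0<\rho_i<r$, of $\sum_i\sup|F_i|/(|s_2-s_1|^p|s_4-s_3|^q|t_2-t_1|^{\rho_i}|t_3-t_2|^{r-\rho_i})$. $\mathcal T_2,\mathcal T_{2,3}$: directions exchanged. $\mu_1D_{s_1s_2s_3;\cdot}=D_{s_1s_2s_2s_3;\cdot}$; $\delta_1\otimes_11$ and $1\otimes_1\delta_1$ act by $\delta_1$ on the first, resp. second, pair of $s$-variables; $(g\otimes_1h)_{s_1s_2s_3s_4;t_1\dots t_{m+l-1}}=g_{s_1s_2;t_1\dots t_m}h_{s_3s_4;t_m\dots t_{m+l-1}}$ for $g\in\mathcal{CC}_{2,m}$, $h\in\mathcal{CC}_{2,l}$; the same for index 2. $\Lambda_1$: if $h$ has three $s$-arguments, is of the form $\delta_1g$ and has total Hölder exponent $z>1$ in $s$ (a sum of terms bounded by $|s_2-s_1|^{\rho}|s_3-s_2|^{z-\rho}$, $0<\rho<z$), $\Lambda_1h$ is the unique function with two $s$-arguments bounded by $C|s_2-s_1|^z$ with $\delta_1\Lambda_1h=h$. $\Lambda_2$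 is the same in $t$. $\Lambda_a\otimes_a1$ is $\Lambda_a$ acting on the first group of variables. $\Lambda=\Lambda_1\Lambda_2$, defined on $h\in\mathcal{CC}_{3,3}\cap\mathrm{Im}\,\delta$ having total exponents $>1$ in both directions. ALGEBRAIC HYPOTHESIS. $a\in\{1,2\}$, $\hat a=3-a$, $u,v\in\{x,\omega\}$. $A^u\in\mathcal{CC}_{2,2}^{\alpha,\beta}$; $B_1^{xu}\in\mathcal{CC}_{2,2}^{2\alpha,\beta}$, $B_2^{xu}\in\mathcal{CC}_{2,2}^{\alpha,2\beta}$; $C^{uv}\in\mathcal{CC}_{2,2}^{2\alpha,2\beta}$; $D_1^{uv}\in\mathcal T_1^{(\alpha,\alpha);2\beta}$, $D_2^{uv}\in\mathcal T_2^{(\beta,\beta);2\alpha}$; $E_1^{xuv}\in\mathcal T_1^{(2\alpha,\alpha);2\beta}$, $E_2^{xuv}\in\mathcal T_2^{(2\beta,\beta);2\alpha}$; $F_1^{xuv}\in\mathcal T_{1,3}^{(2\alpha,\alpha);3\beta}$, $F_2^{xuv}\in\mathcal T_{2,3}^{(2\beta,\beta);3\alpha}$, with $A^x=\delta x$; $\delta_aA^u=0$; $\delta_aB_a^{xu}=(\delta_ax)A^u$; $\delta_{\hat a}B_a^{xu}=-\mu_{\hat a}D_{\hat a}^{xu}$; $\delta_aC^{uv}=\mu_aD_a^{uv}$; $(1\otimes_a\delta_a)D_a^{uv}=0$; $\delta_{\hat a}D_a^{uv}=A^u\otimes_aA^v$; $(1\otimes_a\delta_a)E_a^{xuv}=0$;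 $(\delta_a\otimes_a1)E_a^{xuv}=(\delta_ax)D_a^{uv}$; $\delta_{\hat a}E_a^{xuv}=F_a^{xuv}+B_a^{xu}\otimes_aA^v$. ITERATED INTEGRALS of a smooth sheet $x$: with $\theta^x=\partial_s\partial_tx$, $\theta^\omega=\partial_sx\,\partial_tx$ (for $a=1$; for $a=2$ exchange directions): $A^u=\int_{s_1}^{s_2}\int_{t_1}^{t_2}\theta^u_{st}dtds$; $B^{xu}_1=\int_{s_1}^{s_2}\int_{t_1}^{t_2}\delta_1x_{s_1s;t_1}\theta^u_{st}dtds$; $C^{uv}=\int_{s_1}^{s_2}\int_{t_1}^{t_2}A^u_{s_1s;t_1t}\theta^v_{st}dtds$; $D^{uv}_{1,s_1s_2s_3s_4;t_1t_2}=\int_{s_3}^{s_4}\int_{t_1}^{t_2}A^u_{s_1s_2;t_1t}\theta^v_{st}dtds$; $E^{xuv}_{1,s_1s_2s_3s_4;t_1t_2}=\int_{s_3}^{s_4}\int_{t_1}^{t_2}B^{xu}_{1,s_1s_2;t_1t}\theta^v_{st}dtds$; $F^{xuv}_{1,s_1s_2s_3s_4;t_1t_2t_3}=-\int_{s_3}^{s_4}\int_{t_2}^{t_3}\big(\int_{s_1}^{s_2}\int_{t_2}^{t}\delta x_{s_1r;t_1t_2}\theta^u_{rr'}dr'dr\big)\theta^v_{st}dtds$. CONTROLLED PATHS. $\mathscr Q_x^{\alpha,\beta}$: functions $y$ on $[0,1]^2$ with, for $a=1,2$, $\delta_ay=y^{x_a}\delta_ax+y^{\sharp a}$, $y^{x_a}\in\mathcal{CC}_{1,1}^{\alpha,\beta}$,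 $y^{\sharp1}\in\mathcal{CC}_{2,1}^{2\alpha,\beta}$, $y^{\sharp2}\in\mathcal{CC}_{1,2}^{\alpha,2\beta}$ (the decomposition being part of the data). BOUNDARY INTEGRALS for $y\in\mathscr Q_x^{\alpha,\beta}$, $u,v\in\{x,\omega\}$: $\int_ay\int_{\hat a}du=yA^u+y^{x_a}B_a^{xu}+\Lambda_a[y^{\sharp a}A^u+\delta_ay^{x_a}B_a^{xu}]$; $\int_ay\int_{\hat a}du\,dv=yC^{uv}+\Lambda_a\big[\delta_ay\,C^{uv}+y^{x_a}\mu_aE_a^{xuv}+\mu_a(\Lambda_a\otimes_a1)(y^{\sharp a}D_a^{uv}+\delta_ay^{x_a}E_a^{xuv})\big]$. CONTROLLED SHEETS. $y\in\mathscr K_x^{\alpha,\beta}$ if there are $y^x,y^\omega$ with $y,y^x,y^\omega\in\mathscr Q_x^{\alpha,\beta}$ and $\delta y=-y^xA^x-y^\omega A^\omega+\sum_{a=1,2}\big(\int_ay^x\int_{\hat a}dx+\int_ay^\omega\int_{\hat a}d\omega\big)+y^\sharp$ with $y^\sharp\in\mathcal{CC}_{2,2}^{2\alpha,2\beta}$. *)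

theory Defs
  imports "HOL-Analysis.Analysis" "HOL-Library.Function_Algebras"
begin

text \<open>
  A function of several variables \<open>(s\<^sub>1, \<dots>, s\<^sub>k; t\<^sub>1, \<dots>, t\<^sub>l)\<close> is represented by
  \<open>g [s\<^sub>1, \<dots>, s\<^sub>k] [t\<^sub>1, \<dots>, t\<^sub>l]\<close>; only its values on \<open>cube k \<times> cube l\<close> matter, and
  identities are stated there.  Sums and differences of such functions are pointwise
  (\<open>Function_Algebras\<close>); the product \<open>gh\<close> of two such functions is \<open>cprod\<close>, not \<open>*\<close>.
\<close>

type_synonym cochain = "real list \<Rightarrow> real list \<Rightarrow> real"

datatype dir = Dir1 | Dir2

fun opp :: "dir \<Rightarrow> dir" where
  "opp Dir1 = Dir2"
| "opp Dir2 = Dir1"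

text \<open>
  Operations in direction 2 are those in direction 1 conjugated by the exchange of the two
  groups of variables.  After \<open>orient a\<close>, the first list always holds the variables of direction
  \<open>a\<close> and the second one those of the opposite direction; \<open>orient a\<close> is an involution.
\<close>

fun orient :: "dir \<Rightarrow> ('a \<Rightarrow> 'a \<Rightarrow> 'b) \<Rightarrow> 'a \<Rightarrow> 'a \<Rightarrow> 'b" where
  "orient Dir1 g = g"
| "orient Dir2 g = (\<lambda>ss ts. g ts ss)"

definition cube :: "nat \<Rightarrow> real list set" where
  "cube k = {ss. length ss = k \<and> set ss \<subseteq> {0..1}}"

text \<open>Equality on the domain, with \<open>n\<close> variables in direction \<open>a\<close> and \<open>m\<close> in the other one.\<close>

definition ceq :: "dir \<Rightarrow> nat \<Rightarrow> nat \<Rightarrow> cochain \<Rightarrow> cochain \<Rightarrow> bool" where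
  "ceq a n m g h \<longleftrightarrow> (\<forall>ss\<in>cube n. \<forall>ts\<in>cube m. orient a g ss ts = orient a h ss ts)"

text \<open>
  Continuity on \<open>[0,1]\<^sup>k \<times> [0,1]\<^sup>l\<close>: the points are read off from sequences with the product
  topology, of which only the first \<open>k\<close>, resp. \<open>l\<close>, entries are used.
\<close>

definition ccont :: "nat \<Rightarrow> nat \<Rightarrow> cochain \<Rightarrow> bool" where
  "ccont k l g \<longleftrightarrow>
     continuous_on ((UNIV \<rightarrow> {0..1}) \<times> (UNIV \<rightarrow> {0..1}))
       (\<lambda>(s :: nat \<Rightarrow> real, t :: nat \<Rightarrow> real). g (map s [0..<k]) (map t [0..<l]))"


section \<open>Increments, products and tensor products\<close>

fun delta1 :: "cochain \<Rightarrow> cochain" where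
  "delta1 g [s1, s2] ts = g [s2] ts - g [s1] ts"
| "delta1 g [s1, s2, s3] ts = g [s1, s3] ts - g [s1, s2] ts - g [s2, s3] ts"
| "delta1 g _ ts = 0"

definition delta :: "dir \<Rightarrow> cochain \<Rightarrow> cochain" where
  "delta a g = orient a (delta1 (orient a g))"

definition ddelta :: "cochain \<Rightarrow> cochain" where
  "ddelta g = delta Dir1 (delta Dir2 g)"

text \<open>
  The product \<open>gh\<close>, where the left factor \<open>g\<close> has \<open>n\<close> variables in direction \<open>a\<close> and \<open>m\<close> in
  the other direction (so that \<open>g \<in> CC\<^bsub>n,m\<^esub>\<close> for \<open>a = 1\<close> and \<open>g \<in> CC\<^bsub>m,n\<^esub>\<close> for \<open>a = 2\<close>).
\<close>

definition cprod :: "dir \<Rightarrow> nat \<Rightarrow> nat \<Rightarrow> cochain \<Rightarrow> cochain \<Rightarrow> cochain" where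
  "cprod a n m g h = orient a (\<lambda>ss ts.
     orient a g (take n ss) (take m ts) * orient a h (drop (n - 1) ss) (drop (m - 1) ts))"

text \<open>\<open>g \<otimes>\<^sub>a h\<close>, where \<open>g\<close> has two variables in direction \<open>a\<close> and \<open>m\<close> in the other one.\<close>

definition ctens :: "dir \<Rightarrow> nat \<Rightarrow> cochain \<Rightarrow> cochain \<Rightarrow> cochain" where
  "ctens a m g h = orient a (\<lambda>ss ts.
     orient a g (take 2 ss) (take m ts) * orient a h (drop 2 ss) (drop (m - 1) ts))"

definition mu :: "dir \<Rightarrow> cochain \<Rightarrow> cochain" where
  "mu a D = orient a (\<lambda>ss ts. orient a D [ss ! 0, ss ! 1, ss ! 1, ss ! 2] ts)"

text \<open>\<open>\<delta>\<^sub>a \<otimes>\<^sub>a 1\<close> and \<open>1 \<otimes>\<^sub>a \<delta>\<^sub>a\<close>; the results have 3 + 2, resp. 2 + 3, variables in direction \<open>a\<close>.\<close>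

definition deltaL :: "dir \<Rightarrow> cochain \<Rightarrow> cochain" where
  "deltaL a D = orient a (\<lambda>ss ts. delta1 (\<lambda>rs. orient a D (rs @ drop 3 ss)) (take 3 ss) ts)"

definition deltaR :: "dir \<Rightarrow> cochain \<Rightarrow> cochain" where
  "deltaR a D = orient a (\<lambda>ss ts. delta1 (\<lambda>rs. orient a D (take 2 ss @ rs)) (drop 2 ss) ts)"


section \<open>Function spaces\<close>

text \<open>
  Norms take values in \<open>ennreal\<close> and membership means that the norm is finite.  In the suprema
  the quotients on the diagonals are \<open>0 / 0 = 0\<close>, since the functions vanish there.
\<close>

definition CC :: "nat \<Rightarrow> nat \<Rightarrow> cochain \<Rightarrow> bool" where
  "CC k l g \<longleftrightarrow> ccont k l g \<and>
     (\<forall>ss\<in>cube k. \<forall>ts\<in>cube l.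
        (\<exists>i. Suc i < k \<and> ss ! i = ss ! Suc i) \<or> (\<exists>j. Suc j < l \<and> ts ! j = ts ! Suc j)
        \<longrightarrow> g ss ts = 0)"

definition norm22 :: "real \<Rightarrow> real \<Rightarrow> cochain \<Rightarrow> ennreal" where
  "norm22 z1 z2 g = (SUP ss\<in>cube 2. SUP ts\<in>cube 2.
     ennreal (\<bar>g ss ts\<bar> / (\<bar>ss ! 1 - ss ! 0\<bar> powr z1 * \<bar>ts ! 1 - ts ! 0\<bar> powr z2)))"

definition norm21 :: "real \<Rightarrow> real \<Rightarrow> cochain \<Rightarrow> ennreal" where
  "norm21 z1 z2 g =
     (SUP ss\<in>cube 2. SUP ts\<in>cube 1. ennreal (\<bar>g ss ts\<bar> / \<bar>ss ! 1 - ss ! 0\<bar> powr z1))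
     + norm22 z1 z2 (delta Dir2 g)"

definition norm12 :: "real \<Rightarrow> real \<Rightarrow> cochain \<Rightarrow> ennreal" where
  "norm12 z1 z2 g =
     (SUP ss\<in>cube 1. SUP ts\<in>cube 2. ennreal (\<bar>g ss ts\<bar> / \<bar>ts ! 1 - ts ! 0\<bar> powr z2))
     + norm22 z1 z2 (delta Dir1 g)"

definition norm11 :: "real \<Rightarrow> real \<Rightarrow> cochain \<Rightarrow> ennreal" where
  "norm11 z1 z2 f =
     (SUP ss\<in>cube 1. SUP ts\<in>cube 1. ennreal \<bar>f ss ts\<bar>)
     + (SUP ss\<in>cube 2. SUP ts\<in>cube 1. ennreal (\<bar>delta Dir1 f ss ts\<bar> / \<bar>ss ! 1 - ss ! 0\<bar> powr z1))
     + (SUP ss\<in>cube 1. SUP ts\<in>cube 2. ennreal (\<bar>delta Dir2 f ss ts\<bar> / \<bar>ts ! 1 - ts ! 0\<bar> powr z2))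
     + norm22 z1 z2 (ddelta f)"

definition CC22 :: "real \<Rightarrow> real \<Rightarrow> cochain \<Rightarrow> bool" where
  "CC22 z1 z2 g \<longleftrightarrow> CC 2 2 g \<and> norm22 z1 z2 g < \<infinity>"

definition CC21 :: "real \<Rightarrow> real \<Rightarrow> cochain \<Rightarrow> bool" where
  "CC21 z1 z2 g \<longleftrightarrow> CC 2 1 g \<and> norm21 z1 z2 g < \<infinity>"

definition CC12 :: "real \<Rightarrow> real \<Rightarrow> cochain \<Rightarrow> bool" where
  "CC12 z1 z2 g \<longleftrightarrow> CC 1 2 g \<and> norm12 z1 z2 g < \<infinity>"

definition CC11 :: "real \<Rightarrow> real \<Rightarrow> cochain \<Rightarrow> bool" where
  "CC11 z1 z2 f \<longleftrightarrow> CC 1 1 f \<and> norm11 z1 z2 f < \<infinity>"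

text \<open>
  The continuous functions of \<open>(s\<^sub>1, \<dots>, s\<^sub>4; t\<^sub>1, \<dots>, t\<^sub>m)\<close> underlying \<open>T\<^sub>1\<close> (\<open>m = 2\<close>) and
  \<open>T\<^bsub>1,3\<^esub>\<close> (\<open>m = 3\<close>).
\<close>

definition Tbase :: "nat \<Rightarrow> cochain \<Rightarrow> bool" where
  "Tbase m D \<longleftrightarrow> ccont 4 m D \<and>
     (\<forall>ss\<in>cube 4. \<forall>ts\<in>cube m.
        ss ! 0 = ss ! 1 \<or> ss ! 2 = ss ! 3 \<or> (\<exists>j. Suc j < m \<and> ts ! j = ts ! Suc j)
        \<longrightarrow> D ss ts = 0)"

definition Tnorm :: "real \<Rightarrow> real \<Rightarrow> real \<Rightarrow> cochain \<Rightarrow> ennreal" where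
  "Tnorm p q r D = (SUP ss\<in>cube 4. SUP ts\<in>cube 2.
     ennreal (\<bar>D ss ts\<bar> / (\<bar>ss ! 1 - ss ! 0\<bar> powr p * \<bar>ss ! 3 - ss ! 2\<bar> powr q
                          * \<bar>ts ! 1 - ts ! 0\<bar> powr r)))"

text \<open>\<open>T\<^sub>a\<close> with exponents \<open>(p,q);r\<close>.\<close>

definition Tspace :: "dir \<Rightarrow> real \<Rightarrow> real \<Rightarrow> real \<Rightarrow> cochain \<Rightarrow> bool" where
  "Tspace a p q r D \<longleftrightarrow> Tbase 2 (orient a D) \<and> Tnorm p q r (orient a D) < \<infinity>"

text \<open>
  The infimum is over all decompositions \<open>F = \<Sum>\<^sub>i G\<^sub>i\<close> into sequences; finite sums are included
  by padding with \<open>0\<close>.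
\<close>

definition T3norm :: "real \<Rightarrow> real \<Rightarrow> real \<Rightarrow> cochain \<Rightarrow> ennreal" where
  "T3norm p q r F = (INF (G, \<rho>) \<in> {(G :: nat \<Rightarrow> cochain, \<rho> :: nat \<Rightarrow> real).
        (\<forall>i. Tbase 3 (G i) \<and> 0 < \<rho> i \<and> \<rho> i < r) \<and>
        (\<forall>ss\<in>cube 4. \<forall>ts\<in>cube 3. (\<lambda>i. G i ss ts) sums F ss ts)}.
     \<Sum>i. SUP ss\<in>cube 4. SUP ts\<in>cube 3.
        ennreal (\<bar>G i ss ts\<bar> / (\<bar>ss ! 1 - ss ! 0\<bar> powr p * \<bar>ss ! 3 - ss ! 2\<bar> powr q
                   * \<bar>ts ! 1 - ts ! 0\<bar> powr \<rho> i * \<bar>ts ! 2 - ts ! 1\<bar> powr (r - \<rho> i))))"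

definition T3space :: "dir \<Rightarrow> real \<Rightarrow> real \<Rightarrow> real \<Rightarrow> cochain \<Rightarrow> bool" where
  "T3space a p q r F \<longleftrightarrow> Tbase 3 (orient a F) \<and> T3norm p q r (orient a F) < \<infinity>"


section \<open>The sewing maps\<close>

text \<open>
  The function \<open>g\<close> with \<open>\<delta>g = h\<close> and \<open>\<bar>g\<^bsub>r1 r2\<^esub>\<bar> \<le> C \<bar>r\<^sub>2 - r\<^sub>1\<bar>\<^sup>z\<close> for some \<open>z > 1\<close>.  Functions
  are total here, so \<open>g\<close> is normalised to vanish off the unit square; it does not depend
  on \<open>z\<close>, because \<open>\<delta>\<close>-closed functions with such a bound are \<open>0\<close>.
\<close>

definition sew :: "(real \<Rightarrow> real \<Rightarrow> real \<Rightarrow> real) \<Rightarrow> real \<Rightarrow> real \<Rightarrow> real" where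
  "sew h = (THE g.
     (\<forall>r1 r2. r1 \<notin> {0..1} \<or> r2 \<notin> {0..1} \<longrightarrow> g r1 r2 = 0) \<and>
     (\<exists>C z. z > 1 \<and> (\<forall>r1\<in>{0..1}. \<forall>r2\<in>{0..1}. \<bar>g r1 r2\<bar> \<le> C * \<bar>r2 - r1\<bar> powr z)) \<and>
     (\<forall>r1\<in>{0..1}. \<forall>r2\<in>{0..1}. \<forall>r3\<in>{0..1}. g r1 r3 - g r1 r2 - g r2 r3 = h r1 r2 r3))"

text \<open>
  \<open>\<Lambda>\<^sub>a\<close> and \<open>\<Lambda>\<^sub>a \<otimes>\<^sub>a 1\<close> (on 3 + 2 variables).  The defining property of \<open>\<Lambda>\<^sub>a h\<close> determines it
  separately for each value of the remaining variables.
\<close>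

definition Lam :: "dir \<Rightarrow> cochain \<Rightarrow> cochain" where
  "Lam a h = orient a (\<lambda>ss ts. sew (\<lambda>r1 r2 r3. orient a h [r1, r2, r3] ts) (ss ! 0) (ss ! 1))"

definition LamL :: "dir \<Rightarrow> cochain \<Rightarrow> cochain" where
  "LamL a h = orient a (\<lambda>ss ts.
     sew (\<lambda>r1 r2 r3. orient a h ([r1, r2, r3] @ drop 2 ss) ts) (ss ! 0) (ss ! 1))"

definition Lam12 :: "cochain \<Rightarrow> cochain" where
  "Lam12 h = Lam Dir1 (Lam Dir2 h)"

text \<open>
  Total exponent \<open>z\<close> in \<open>(s\<^sub>1,s\<^sub>2,s\<^sub>3)\<close>, for a function of \<open>k \<ge> 3\<close> variables \<open>s\<close> and \<open>l\<close>
  variables \<open>t\<close>; as in \<open>T3norm\<close>, the sum of terms may be a sequence with summable constants.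
\<close>

definition total_exponent :: "nat \<Rightarrow> nat \<Rightarrow> real \<Rightarrow> cochain \<Rightarrow> bool" where
  "total_exponent k l z h \<longleftrightarrow> (\<exists>(G :: nat \<Rightarrow> cochain) \<rho> K.
     summable K \<and>
     (\<forall>i. ccont k l (G i) \<and> 0 < \<rho> i \<and> \<rho> i < z) \<and>
     (\<forall>i. \<forall>ss\<in>cube k. \<forall>ts\<in>cube l. \<bar>G i ss ts\<bar>
        \<le> K i * (\<bar>ss ! 1 - ss ! 0\<bar> powr \<rho> i * \<bar>ss ! 2 - ss ! 1\<bar> powr (z - \<rho> i))) \<and>
     (\<forall>ss\<in>cube k. \<forall>ts\<in>cube l. (\<lambda>i. G i ss ts) sums h ss ts))"

definition total_exponents :: "real \<Rightarrow> real \<Rightarrow> cochain \<Rightarrow> bool" where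
  "total_exponents z1 z2 h \<longleftrightarrow> (\<exists>(G :: nat \<Rightarrow> cochain) \<rho> \<sigma> K.
     summable K \<and>
     (\<forall>i. ccont 3 3 (G i) \<and> 0 < \<rho> i \<and> \<rho> i < z1 \<and> 0 < \<sigma> i \<and> \<sigma> i < z2) \<and>
     (\<forall>i. \<forall>ss\<in>cube 3. \<forall>ts\<in>cube 3. \<bar>G i ss ts\<bar>
        \<le> K i * (\<bar>ss ! 1 - ss ! 0\<bar> powr \<rho> i * \<bar>ss ! 2 - ss ! 1\<bar> powr (z1 - \<rho> i)
                * \<bar>ts ! 1 - ts ! 0\<bar> powr \<sigma> i * \<bar>ts ! 2 - ts ! 1\<bar> powr (z2 - \<sigma> i))) \<and>
     (\<forall>ss\<in>cube 3. \<forall>ts\<in>cube 3. (\<lambda>i. G i ss ts) sums h ss ts))"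

text \<open>Domains of \<open>\<Lambda>\<^sub>a\<close> (two variables in the opposite direction), \<open>\<Lambda>\<^sub>a \<otimes>\<^sub>a 1\<close> and \<open>\<Lambda>\<close>.\<close>

definition Lam_dom :: "dir \<Rightarrow> cochain \<Rightarrow> bool" where
  "Lam_dom a h \<longleftrightarrow>
     (\<exists>g. CC 2 2 g \<and> ceq a 3 2 h (delta a g)) \<and>
     (\<exists>z>1. total_exponent 3 2 z (orient a h))"

definition LamL_dom :: "dir \<Rightarrow> cochain \<Rightarrow> bool" where
  "LamL_dom a h \<longleftrightarrow>
     (\<exists>g. Tbase 2 (orient a g) \<and> ceq a 5 2 h (deltaL a g)) \<and>
     (\<exists>z>1. total_exponent 5 2 z (orient a h))"

definition Lam12_dom :: "cochain \<Rightarrow> bool" where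
  "Lam12_dom h \<longleftrightarrow>
     CC 3 3 h \<and>
     (\<exists>g. CC 2 2 g \<and> ceq Dir1 3 3 h (ddelta g)) \<and>
     (\<exists>z1>1. \<exists>z2>1. total_exponents z1 z2 h)"


section \<open>The algebraic hypothesis\<close>

text \<open>The labels \<open>x\<close> and \<open>\<omega>\<close>.\<close>

datatype lbl = LX | LW

text \<open>\<open>rB R a u\<close> is \<open>B\<^sub>a\<^bsup>xu\<^esup>\<close>, \<open>rE R a u v\<close> is \<open>E\<^sub>a\<^bsup>xuv\<^esup>\<close> and \<open>rF R a u v\<close> is \<open>F\<^sub>a\<^bsup>xuv\<^esup>\<close>.\<close>

record rough_data =
  rA :: "lbl \<Rightarrow> cochain"
  rB :: "dir \<Rightarrow> lbl \<Rightarrow> cochain"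
  rC :: "lbl \<Rightarrow> lbl \<Rightarrow> cochain"
  rD :: "dir \<Rightarrow> lbl \<Rightarrow> lbl \<Rightarrow> cochain"
  rE :: "dir \<Rightarrow> lbl \<Rightarrow> lbl \<Rightarrow> cochain"
  rF :: "dir \<Rightarrow> lbl \<Rightarrow> lbl \<Rightarrow> cochain"

definition rough_regularity :: "real \<Rightarrow> real \<Rightarrow> rough_data \<Rightarrow> bool" where
  "rough_regularity \<alpha> \<beta> R \<longleftrightarrow> (\<forall>u v.
     CC22 \<alpha> \<beta> (rA R u) \<and>
     CC22 (2 * \<alpha>) \<beta> (rB R Dir1 u) \<and>
     CC22 \<alpha> (2 * \<beta>) (rB R Dir2 u) \<and>
     CC22 (2 * \<alpha>) (2 * \<beta>) (rC R u v) \<and>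
     Tspace Dir1 \<alpha> \<alpha> (2 * \<beta>) (rD R Dir1 u v) \<and>
     Tspace Dir2 \<beta> \<beta> (2 * \<alpha>) (rD R Dir2 u v) \<and>
     Tspace Dir1 (2 * \<alpha>) \<alpha> (2 * \<beta>) (rE R Dir1 u v) \<and>
     Tspace Dir2 (2 * \<beta>) \<beta> (2 * \<alpha>) (rE R Dir2 u v) \<and>
     T3space Dir1 (2 * \<alpha>) \<alpha> (3 * \<beta>) (rF R Dir1 u v) \<and>
     T3space Dir2 (2 * \<beta>) \<beta> (3 * \<alpha>) (rF R Dir2 u v))"

definition rough_relations :: "cochain \<Rightarrow> rough_data \<Rightarrow> bool" where
  "rough_relations x R \<longleftrightarrow>
     ceq Dir1 2 2 (rA R LX) (ddelta x) \<and>
     (\<forall>a u v.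
       ceq a 3 2 (delta a (rA R u)) 0 \<and>
       ceq a 3 2 (delta a (rB R a u)) (cprod a 2 1 (delta a x) (rA R u)) \<and>
       ceq a 2 3 (delta (opp a) (rB R a u)) (- mu (opp a) (rD R (opp a) LX u)) \<and>
       ceq a 3 2 (delta a (rC R u v)) (mu a (rD R a u v)) \<and>
       ceq a 5 2 (deltaR a (rD R a u v)) 0 \<and>
       ceq a 4 3 (delta (opp a) (rD R a u v)) (ctens a 2 (rA R u) (rA R v)) \<and>
       ceq a 5 2 (deltaR a (rE R a u v)) 0 \<and>
       ceq a 5 2 (deltaL a (rE R a u v)) (cprod a 2 1 (delta a x) (rD R a u v)) \<and>
       ceq a 4 3 (delta (opp a) (rE R a u v)) (rF R a u v + ctens a 2 (rB R a u) (rA R v)))"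

definition algebraic_hypothesis :: "real \<Rightarrow> real \<Rightarrow> cochain \<Rightarrow> rough_data \<Rightarrow> bool" where
  "algebraic_hypothesis \<alpha> \<beta> x R \<longleftrightarrow> rough_regularity \<alpha> \<beta> R \<and> rough_relations x R"


section \<open>Controlled paths and boundary integrals\<close>

text \<open>A path together with its decompositions: \<open>cder Y a\<close> is \<open>y\<^bsup>x\<^sub>a\<^esup>\<close> and \<open>crem Y a\<close> the remainder.\<close>

record cpath =
  cfun :: cochain
  cder :: "dir \<Rightarrow> cochain"
  crem :: "dir \<Rightarrow> cochain"

definition controlled_path :: "real \<Rightarrow> real \<Rightarrow> cochain \<Rightarrow> cpath \<Rightarrow> bool" where
  "controlled_path \<alpha> \<beta> x Y \<longleftrightarrow>
     (\<forall>a. ceq a 2 1 (delta a (cfun Y)) (cprod a 1 1 (cder Y a) (delta a x) + crem Y a)) \<and>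
     (\<forall>a. CC11 \<alpha> \<beta> (cder Y a)) \<and>
     CC21 (2 * \<alpha>) \<beta> (crem Y Dir1) \<and>
     CC12 \<alpha> (2 * \<beta>) (crem Y Dir2)"

text \<open>\<open>\<integral>\<^sub>a y \<integral> du\<close>, the inner integral being in the opposite direction.\<close>

definition bint_arg :: "rough_data \<Rightarrow> dir \<Rightarrow> cpath \<Rightarrow> lbl \<Rightarrow> cochain" where
  "bint_arg R a Y u = cprod a 2 1 (crem Y a) (rA R u) + cprod a 2 1 (delta a (cder Y a)) (rB R a u)"

definition bint :: "rough_data \<Rightarrow> dir \<Rightarrow> cpath \<Rightarrow> lbl \<Rightarrow> cochain" where
  "bint R a Y u =
     cprod a 1 1 (cfun Y) (rA R u) + cprod a 1 1 (cder Y a) (rB R a u) + Lam a (bint_arg R a Y u)"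

text \<open>\<open>\<integral>\<^sub>a y \<integral> du dv\<close>.\<close>

definition bint2_inner :: "rough_data \<Rightarrow> dir \<Rightarrow> cpath \<Rightarrow> lbl \<Rightarrow> lbl \<Rightarrow> cochain" where
  "bint2_inner R a Y u v =
     cprod a 2 1 (crem Y a) (rD R a u v) + cprod a 2 1 (delta a (cder Y a)) (rE R a u v)"

definition bint2_arg :: "rough_data \<Rightarrow> dir \<Rightarrow> cpath \<Rightarrow> lbl \<Rightarrow> lbl \<Rightarrow> cochain" where
  "bint2_arg R a Y u v =
     cprod a 2 1 (delta a (cfun Y)) (rC R u v) + cprod a 1 1 (cder Y a) (mu a (rE R a u v))
     + mu a (LamL a (bint2_inner R a Y u v))"

definition bint2 :: "rough_data \<Rightarrow> dir \<Rightarrow> cpath \<Rightarrow> lbl \<Rightarrow> lbl \<Rightarrow> cochain" where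
  "bint2 R a Y u v = cprod a 1 1 (cfun Y) (rC R u v) + Lam a (bint2_arg R a Y u v)"


section \<open>Controlled sheets and the integral\<close>

definition controlled_sheet ::
  "real \<Rightarrow> real \<Rightarrow> cochain \<Rightarrow> rough_data \<Rightarrow> cpath \<Rightarrow> cpath \<Rightarrow> cpath \<Rightarrow> bool" where
  "controlled_sheet \<alpha> \<beta> x R Y Yx Yw \<longleftrightarrow>
     controlled_path \<alpha> \<beta> x Y \<and> controlled_path \<alpha> \<beta> x Yx \<and> controlled_path \<alpha> \<beta> x Yw \<and>
     (\<exists>yr. CC22 (2 * \<alpha>) (2 * \<beta>) yr \<and>
       ceq Dir1 2 2 (ddelta (cfun Y))
         (- cprod Dir1 1 1 (cfun Yx) (rA R LX) - cprod Dir1 1 1 (cfun Yw) (rA R LW)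
          + (\<Sum>a\<in>{Dir1, Dir2}. bint R a Yx LX + bint R a Yw LW) + yr))"

definition iint_rem_arg :: "rough_data \<Rightarrow> cpath \<Rightarrow> cpath \<Rightarrow> cpath \<Rightarrow> lbl \<Rightarrow> cochain" where
  "iint_rem_arg R Y Yx Yw u =
     cprod Dir1 2 2 (ddelta (cfun Y)) (rA R u)
     - ddelta (- cprod Dir1 1 1 (cfun Yx) (rC R LX u) - cprod Dir1 1 1 (cfun Yw) (rC R LW u)
               + (\<Sum>a\<in>{Dir1, Dir2}. bint2 R a Yx LX u + bint2 R a Yw LW u))"

definition iint :: "rough_data \<Rightarrow> cpath \<Rightarrow> cpath \<Rightarrow> cpath \<Rightarrow> lbl \<Rightarrow> cochain" where
  "iint R Y Yx Yw u =
     - cprod Dir1 1 1 (cfun Y) (rA R u)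
     - cprod Dir1 1 1 (cfun Yx) (rC R LX u) - cprod Dir1 1 1 (cfun Yw) (rC R LW u)
     + (\<Sum>a\<in>{Dir1, Dir2}. bint R a Y u + bint2 R a Yx LX u + bint2 R a Yw LW u)
     + Lam12 (iint_rem_arg R Y Yx Yw u)"

text \<open>Every sewing map occurring in \<open>iint\<close> is applied within its domain.\<close>

definition iint_well_defined :: "rough_data \<Rightarrow> cpath \<Rightarrow> cpath \<Rightarrow> cpath \<Rightarrow> lbl \<Rightarrow> bool" where
  "iint_well_defined R Y Yx Yw u \<longleftrightarrow>
     (\<forall>a. Lam_dom a (bint_arg R a Y u) \<and>
          LamL_dom a (bint2_inner R a Yx LX u) \<and> Lam_dom a (bint2_arg R a Yx LX u) \<and>
          LamL_dom a (bint2_inner R a Yw LW u) \<and> Lam_dom a (bint2_arg R a Yw LW u)) \<and>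
     Lam12_dom (iint_rem_arg R Y Yx Yw u)"


section \<open>Smooth sheets and iterated integrals\<close>

text \<open>Partial derivatives on the unit square, one-sided on its boundary.\<close>

fun pd :: "dir \<Rightarrow> (real \<Rightarrow> real \<Rightarrow> real) \<Rightarrow> real \<Rightarrow> real \<Rightarrow> real" where
  "pd Dir1 f s t = vector_derivative (\<lambda>r. f r t) (at s within {0..1})"
| "pd Dir2 f s t = vector_derivative (\<lambda>r. f s r) (at t within {0..1})"

definition smooth :: "(real \<Rightarrow> real \<Rightarrow> real) \<Rightarrow> bool" where
  "smooth f \<longleftrightarrow> (\<forall>w :: dir list. let h = foldr pd w f in
     continuous_on ({0..1} \<times> {0..1}) (\<lambda>(s, t). h s t) \<and>
     (\<forall>s\<in>{0..1}. \<forall>t\<in>{0..1}.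
        (\<lambda>r. h r t) differentiable (at s within {0..1}) \<and>
        (\<lambda>r. h s r) differentiable (at t within {0..1})))"

definition sheet :: "cochain \<Rightarrow> real \<Rightarrow> real \<Rightarrow> real" where
  "sheet x s t = x [s] [t]"

fun theta :: "cochain \<Rightarrow> lbl \<Rightarrow> real \<Rightarrow> real \<Rightarrow> real" where
  "theta x LX = pd Dir1 (pd Dir2 (sheet x))"
| "theta x LW = (\<lambda>s t. pd Dir1 (sheet x) s t * pd Dir2 (sheet x) s t)"

text \<open>
  The iterated integrals for \<open>a = 1\<close>, with \<open>\<theta>\<close>, \<open>\<theta>'\<close> in the roles of \<open>\<theta>\<^sup>u\<close>, \<open>\<theta>\<^sup>v\<close>.  The limits
  of integration are not ordered; the interval integral is the signed one.
\<close>

definition itA :: "(real \<Rightarrow> real \<Rightarrow> real) \<Rightarrow> cochain" where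
  "itA \<theta> ss ts = (LBINT s=ss!0..ss!1. (LBINT t=ts!0..ts!1. \<theta> s t))"

definition itB :: "cochain \<Rightarrow> (real \<Rightarrow> real \<Rightarrow> real) \<Rightarrow> cochain" where
  "itB x \<theta> ss ts =
     (LBINT s=ss!0..ss!1. (LBINT t=ts!0..ts!1. delta Dir1 x [ss!0, s] [ts!0] * \<theta> s t))"

definition itC :: "(real \<Rightarrow> real \<Rightarrow> real) \<Rightarrow> (real \<Rightarrow> real \<Rightarrow> real) \<Rightarrow> cochain" where
  "itC \<theta> \<theta>' ss ts =
     (LBINT s=ss!0..ss!1. (LBINT t=ts!0..ts!1. itA \<theta> [ss!0, s] [ts!0, t] * \<theta>' s t))"

definition itD :: "(real \<Rightarrow> real \<Rightarrow> real) \<Rightarrow> (real \<Rightarrow> real \<Rightarrow> real) \<Rightarrow> cochain" where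
  "itD \<theta> \<theta>' ss ts =
     (LBINT s=ss!2..ss!3. (LBINT t=ts!0..ts!1. itA \<theta> [ss!0, ss!1] [ts!0, t] * \<theta>' s t))"

definition itE :: "cochain \<Rightarrow> (real \<Rightarrow> real \<Rightarrow> real) \<Rightarrow> (real \<Rightarrow> real \<Rightarrow> real) \<Rightarrow> cochain" where
  "itE x \<theta> \<theta>' ss ts =
     (LBINT s=ss!2..ss!3. (LBINT t=ts!0..ts!1. itB x \<theta> [ss!0, ss!1] [ts!0, t] * \<theta>' s t))"

definition itF :: "cochain \<Rightarrow> (real \<Rightarrow> real \<Rightarrow> real) \<Rightarrow> (real \<Rightarrow> real \<Rightarrow> real) \<Rightarrow> cochain" where
  "itF x \<theta> \<theta>' ss ts =
     - (LBINT s=ss!2..ss!3. (LBINT t=ts!1..ts!2.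
          (LBINT r=ss!0..ss!1. (LBINT r'=ts!1..t.
             ddelta x [ss!0, r] [ts!0, ts!1] * \<theta> r r')) * \<theta>' s t))"

definition iterated_integrals :: "cochain \<Rightarrow> rough_data \<Rightarrow> bool" where
  "iterated_integrals x R \<longleftrightarrow> (\<forall>a u v.
     ceq Dir1 2 2 (rA R u) (itA (theta x u)) \<and>
     ceq a 2 2 (rB R a u) (orient a (itB (orient a x) (orient a (theta x u)))) \<and>
     ceq Dir1 2 2 (rC R u v) (itC (theta x u) (theta x v)) \<and>
     ceq a 4 2 (rD R a u v) (orient a (itD (orient a (theta x u)) (orient a (theta x v)))) \<and>
     ceq a 4 2 (rE R a u v)
       (orient a (itE (orient a x) (orient a (theta x u)) (orient a (theta x v)))) \<and>
     ceq a 4 3 (rF R a u v)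
       (orient a (itF (orient a x) (orient a (theta x u)) (orient a (theta x v)))))"

end

theory Submission
  imports Defs
begin

text \<open>
  The proof rests on the sewing lemma: if \<open>h = \<delta>g\<close> with \<open>g\<close> continuous and
  \<open>\<bar>h\<^bsub>abc\<^esub>\<bar> \<le> M max(\<bar>b - a\<bar>, \<bar>c - b\<bar>)\<^sup>z\<close> with \<open>z > 1\<close>, there is exactly one primitive of \<open>h\<close> of
  size \<open>\<bar>b - a\<bar>\<^sup>z\<close>.  It is the sum over all dyadic levels of the defects \<open>h\<close> at midpoints, so it depends continuously on parameters, and uniqueness is quantitative:
  a function of exponent \<open>> 1\<close> is bounded by its own \<open>\<delta>\<close> (\<open>sewing_bound\<close>, \<open>sew_eq_dyadic_sum\<close>).  The
  two-parameter map \<open>\<Lambda>\<close> is obtained by sewing twice (\<open>Lam12_properties\<close>).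

  Everything about boundary integrals is proved in direction 1; direction 2 follows by exchanging the
  two groups of variables.  Since \<open>\<delta>\<^sub>1(yA + y\<^sup>xB\<^sub>1) = -(y\<^sup>\<sharp>A + \<delta>\<^sub>1y\<^sup>x B\<^sub>1)\<close>, of total exponent \<open>3\<alpha> > 1\<close>, sewing
  turns \<open>yA + y\<^sup>xB\<^sub>1\<close> into an additive function of the interval, the boundary integral.  In the same way
  \<open>I = yD\<^sub>1 + y\<^sup>xE\<^sub>1 + (\<Lambda>\<^sub>1 \<otimes>\<^sub>1 1)(y\<^sup>\<sharp>D\<^sub>1 + \<delta>\<^sub>1y\<^sup>x E\<^sub>1)\<close> is additive in each of its two pairs of variables \<open>s\<close>.
  Hence \<open>\<mu>\<^sub>1I\<close> is closed, therefore exact, and \<open>\<integral>\<^sub>1y\<integral>\<^sub>2dw du\<close> is its primitive that is close to \<open>yC\<close>.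

  For the integral over the sheet the point is that the argument of \<open>\<Lambda>\<close> in \<open>r\<^sup>u\<close> has total exponents
  \<open>3\<alpha>\<close> and \<open>3\<beta>\<close>.  As \<open>\<Lambda>\<^sub>1\<close> commutes with \<open>\<delta>\<^sub>2\<close>, up to terms of these exponents
  \<open>\<delta>(\<integral>\<^sub>1y\<integral>\<^sub>2dw du)\<close> is \<open>(\<integral>\<^sub>1y\<integral>\<^sub>2dw) A\<^sup>u - \<delta>\<^sub>2y \<mu>\<^sub>1D\<^sub>1\<close> (\<open>dominated_dbl_rest\<close>), and likewise in direction 2, while
  \<open>\<delta>(yC) = y A\<^sup>w A\<^sup>u - \<delta>\<^sub>2y \<mu>\<^sub>1D\<^sub>1 - \<delta>\<^sub>1y \<mu>\<^sub>2D\<^sub>2 + \<delta>y C\<close>, where \<open>\<delta>y C\<close> has them too.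
  In \<open>\<delta>(-yC + \<integral>\<^sub>1y\<integral>\<^sub>2dw du + \<integral>\<^sub>2y\<integral>\<^sub>1dw du)\<close> the terms in \<open>D\<close> cancel, and what is left is
  \<open>(-yA\<^sup>w + \<integral>\<^sub>1y\<integral>\<^sub>2dw + \<integral>\<^sub>2y\<integral>\<^sub>1dw) A\<^sup>u\<close>.  Applied to \<open>y\<^sup>x\<close> with \<open>w = x\<close> and to \<open>y\<^sup>\<omega>\<close> with \<open>w = \<omega>\<close>, this is
  the expansion of \<open>\<delta>y\<close> in the definition of a controlled sheet, multiplied by \<open>A\<^sup>u\<close>; so the argument of
  \<open>\<Lambda>\<close> reduces to \<open>y\<^sup>\<sharp>A\<^sup>u\<close>, which has these exponents (\<open>dominated_iint_rem_arg\<close>).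
  It lies in the image of \<open>\<delta>\<close> because \<open>\<delta>y A\<^sup>u = \<delta>(yA\<^sup>u)\<close>.
  The bound on \<open>F\<close> is a sum of infinitely many products with different exponents, and so are all
  bounds derived from it; the decompositions that define total exponents are recovered by splitting a
  function proportionally to the summands of its bound (\<open>dominated_partition\<close>).

  For a smooth sheet, each integral defined by sewing is compared with the Riemann integral it should
  be.  Both have the same \<open>\<delta>\<close> after subtraction of the explicit leading terms, and both differences have
  exponent \<open>> 1\<close>: the Riemann integral of a remainder of exponent \<open>2\<alpha>\<close> against a continuous density has
  exponent \<open>2\<alpha> + 1\<close>.  By uniqueness they agree, first for the boundary integrals (\<open>bnd_eq_integral\<close>,
  \<open>dbl_eq_integral\<close>), and then, by expanding \<open>y\<close> from a corner of the rectangle, for the integral over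
  the sheet (\<open>ddelta_unique\<close>, \<open>iint_eq_integral\<close>).
\<close>

section \<open>Sewing on the unit interval\<close>

abbreviation (input) J :: "real set" where "J \<equiv> {0..1}"

definition bisect :: "(real \<Rightarrow> real \<Rightarrow> real) \<Rightarrow> real \<Rightarrow> real \<Rightarrow> real" where
  "bisect f a b = f a ((a + b) / 2) + f ((a + b) / 2) b"

definition midpoint_defect :: "(real \<Rightarrow> real \<Rightarrow> real \<Rightarrow> real) \<Rightarrow> real \<Rightarrow> real \<Rightarrow> real" where
  "midpoint_defect h a b = h a ((a + b) / 2) b"

text \<open>
  An explicit formula for the sewing map: each step replaces \<open>[a, b]\<close> by its two halves and collects the
  defects there.  It involves \<open>h\<close> alone and not a primitive of \<open>h\<close>.
\<close>

definition dyadic_sum :: "(real \<Rightarrow> real \<Rightarrow> real \<Rightarrow> real) \<Rightarrow> real \<Rightarrow> real \<Rightarrow> real" where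
  "dyadic_sum h a b = (\<Sum>n. (bisect ^^ n) (midpoint_defect h) a b)"

text \<open>
  The sum of the geometric series with ratio \<open>2\<^bsup>1-z\<^esup>\<close>: bisecting doubles the number of intervals and
  scales each bound by \<open>2\<^bsup>-z\<^esup>\<close>.
\<close>

definition sewing_const :: "real \<Rightarrow> real" where
  "sewing_const z = 1 / (1 - 2 powr (1 - z))"

lemma midpoint_mem: "a \<in> J \<Longrightarrow> b \<in> J \<Longrightarrow> (a + b) / 2 \<in> J"
  by auto

lemma sewing_ratio: "z > 1 \<Longrightarrow> 0 < 2 powr (1 - z) \<and> 2 powr (1 - z) < (1::real)"
  by (smt (verit) powr_gt_zero powr_less_one)

lemma sewing_const_pos: "z > 1 \<Longrightarrow> sewing_const z > 0"
  using sewing_ratio[of z] by (simp add: sewing_const_def)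

lemma half_powr: "(r / 2) powr z = r powr z * 2 powr (- z)" if "r \<ge> 0" for r z :: real
  using that by (simp add: powr_divide powr_minus_divide)

lemma bisect_powr_bound:
  assumes "\<And>a b. a \<in> J \<Longrightarrow> b \<in> J \<Longrightarrow> \<bar>f a b\<bar> \<le> M * \<bar>b - a\<bar> powr z"
    and "a \<in> J" "b \<in> J"
  shows "\<bar>(bisect ^^ n) f a b\<bar> \<le> M * \<bar>b - a\<bar> powr z * (2 powr (1 - z)) ^ n"
  using assms(2,3)
proof (induction n arbitrary: a b)
  case 0
  then show ?case using assms(1) by simp
next
  case (Suc n)
  define m where "m = (a + b) / 2"
  have m: "m \<in> J" using midpoint_mem Suc.prems by (auto simp: m_def)
  have e: "\<bar>m - a\<bar> = \<bar>b - a\<bar> / 2" "\<bar>b - m\<bar> = \<bar>b - a\<bar> / 2" by (auto simp: m_def field_simps)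
  have p: "(\<bar>b - a\<bar> / 2) powr z = \<bar>b - a\<bar> powr z * 2 powr (- z)"
    by (rule half_powr) simp
  have "\<bar>(bisect ^^ Suc n) f a b\<bar> \<le> \<bar>(bisect ^^ n) f a m\<bar> + \<bar>(bisect ^^ n) f m b\<bar>"
    by (simp add: bisect_def m_def)
  also have "\<dots> \<le> 2 * (M * (\<bar>b - a\<bar> / 2) powr z * (2 powr (1 - z)) ^ n)"
    using Suc.IH[OF Suc.prems(1) m] Suc.IH[OF m Suc.prems(2)] unfolding e by linarith
  also have "\<dots> = M * \<bar>b - a\<bar> powr z * (2 * 2 powr (- z)) * (2 powr (1 - z)) ^ n"
    unfolding p by (simp add: algebra_simps)
  also have "2 * 2 powr (- z) = 2 powr (1 - z)" by (simp add: powr_diff powr_minus_divide)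
  finally show ?case by (simp add: algebra_simps)
qed

context
  fixes h :: "real \<Rightarrow> real \<Rightarrow> real \<Rightarrow> real" and M z :: real
  assumes z: "z > 1"
    and mid: "\<forall>a\<in>J. \<forall>b\<in>J. \<bar>h a ((a + b) / 2) b\<bar> \<le> M * \<bar>b - a\<bar> powr z"
begin

lemma dyadic_term_bound:
  assumes "a \<in> J" "b \<in> J"
  shows "\<bar>(bisect ^^ n) (midpoint_defect h) a b\<bar> \<le> M * \<bar>b - a\<bar> powr z * (2 powr (1 - z)) ^ n"
  using bisect_powr_bound[of "midpoint_defect h" M z] mid assms
  by (auto simp: midpoint_defect_def)

lemma dyadic_bound_sums:
  "(\<lambda>n. M * r * (2 powr (1 - z)) ^ n) sums (M * r * sewing_const z)"
  unfolding sewing_const_def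
  using sewing_ratio[OF z] by (intro sums_mult geometric_sums) auto

lemma dyadic_summable:
  assumes "a \<in> J" "b \<in> J"
  shows "summable (\<lambda>n. (bisect ^^ n) (midpoint_defect h) a b)"
  by (rule summable_comparison_test'[OF sums_summable[OF dyadic_bound_sums[of "\<bar>b - a\<bar> powr z"]]])
     (use dyadic_term_bound[OF assms] in auto)

lemma dyadic_sum_bound:
  assumes "a \<in> J" "b \<in> J"
  shows "\<bar>dyadic_sum h a b\<bar> \<le> sewing_const z * M * \<bar>b - a\<bar> powr z"
proof -
  have "norm (\<Sum>n. (bisect ^^ n) (midpoint_defect h) a b)
      \<le> (\<Sum>n. M * \<bar>b - a\<bar> powr z * (2 powr (1 - z)) ^ n)"
    using dyadic_term_bound[OF assms]
    by (intro norm_suminf_le sums_summable[OF dyadic_bound_sums]) auto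
  also have "\<dots> = M * \<bar>b - a\<bar> powr z * sewing_const z"
    by (rule sums_unique[OF dyadic_bound_sums, symmetric])
  finally show ?thesis by (simp add: dyadic_sum_def algebra_simps)
qed

lemma dyadic_sum_midpoint:
  assumes "a \<in> J" "b \<in> J"
  shows "dyadic_sum h a b = h a ((a + b) / 2) b
    + dyadic_sum h a ((a + b) / 2) + dyadic_sum h ((a + b) / 2) b"
proof -
  define m where "m = (a + b) / 2"
  have m: "m \<in> J" using midpoint_mem assms by (auto simp: m_def)
  let ?H = "\<lambda>n. (bisect ^^ n) (midpoint_defect h)"
  have "dyadic_sum h a b = ?H 0 a b + (\<Sum>n. ?H (Suc n) a b)"
    unfolding dyadic_sum_def using suminf_split_head[OF dyadic_summable[OF assms]] by simp
  also have "(\<Sum>n. ?H (Suc n) a b) = (\<Sum>n. ?H n a m + ?H n m b)"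
    by (simp add: bisect_def m_def)
  also have "\<dots> = dyadic_sum h a m + dyadic_sum h m b"
    unfolding dyadic_sum_def
    by (rule suminf_add[symmetric]) (intro dyadic_summable assms m)+
  finally show ?thesis by (simp add: midpoint_defect_def m_def)
qed

end

text \<open>
  Iterating additivity at midpoints writes \<open>f a b\<close> as a sum of \<open>2\<^sup>n\<close> terms, of total size at most
  \<open>C 2\<^bsup>n(1-z)\<^esup>\<bar>b - a\<bar>\<^sup>z \<longlonglongrightarrow> 0\<close>.
\<close>

lemma midpoint_additive_null:
  assumes z: "z > 1"
    and bd: "\<And>a b. a \<in> J \<Longrightarrow> b \<in> J \<Longrightarrow> \<bar>f a b\<bar> \<le> C * \<bar>b - a\<bar> powr z"
    and add: "\<And>a b. a \<in> J \<Longrightarrow> b \<in> J \<Longrightarrow> f a b = f a ((a + b) / 2) + f ((a + b) / 2) b"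
    and ab: "a \<in> J" "b \<in> J"
  shows "f a b = 0"
proof -
  have *: "(bisect ^^ n) f a b = f a b" if "a \<in> J" "b \<in> J" for n a b
    using that
  proof (induction n arbitrary: a b)
    case (Suc n)
    then show ?case using add[of a b] midpoint_mem[of a b] by (simp add: bisect_def)
  qed simp
  have "\<bar>f a b\<bar> \<le> C * \<bar>b - a\<bar> powr z * (2 powr (1 - z)) ^ n" for n
    using bisect_powr_bound[OF bd ab, of n] *[OF ab, of n] by simp
  moreover have "(\<lambda>n. C * \<bar>b - a\<bar> powr z * (2 powr (1 - z)) ^ n) \<longlonglongrightarrow> 0"
    using sewing_ratio[OF z] by (intro tendsto_mult_right_zero LIMSEQ_power_zero) auto
  ultimately have "\<bar>f a b\<bar> \<le> 0"
    by (intro LIMSEQ_le_const) auto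
  then show ?thesis by simp
qed

text \<open>
  The quantitative form of uniqueness.  The conclusion depends on the defect of \<open>d\<close> only, and neither
  on \<open>C\<close> nor on \<open>z'\<close>: a crude bound of some exponent \<open>> 1\<close> upgrades to a sharp one.  Combinations of sewn
  functions are estimated in this way.
\<close>

lemma sewing_bound:
  assumes z': "z' > 1" and z: "z > 1"
    and bd: "\<And>a b. a \<in> J \<Longrightarrow> b \<in> J \<Longrightarrow> \<bar>d a b\<bar> \<le> C * \<bar>b - a\<bar> powr z'"
    and mid: "\<And>a b. a \<in> J \<Longrightarrow> b \<in> J \<Longrightarrow>
       \<bar>d a b - d a ((a + b) / 2) - d ((a + b) / 2) b\<bar> \<le> M * \<bar>b - a\<bar> powr z"
    and ab: "a \<in> J" "b \<in> J"
  shows "\<bar>d a b\<bar> \<le> sewing_const z * M * \<bar>b - a\<bar> powr z"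
proof -
  let ?h = "\<lambda>a b c. d a c - d a b - d b c"
  let ?M = "\<bar>M\<bar>"
  have M0: "M \<ge> 0" using mid[of 0 1] by simp
  have mid': "\<forall>a\<in>J. \<forall>b\<in>J. \<bar>?h a ((a + b) / 2) b\<bar> \<le> M * \<bar>b - a\<bar> powr z"
    using mid by blast
  have "\<bar>d a b - dyadic_sum ?h a b\<bar>
      \<le> (\<bar>C\<bar> + sewing_const z * M) * \<bar>b - a\<bar> powr (min z z')" if "a \<in> J" "b \<in> J" for a b
  proof -
    have "\<bar>b - a\<bar> \<le> 1" using that by auto
    then have p: "\<bar>b - a\<bar> powr z \<le> \<bar>b - a\<bar> powr (min z z')"
         "\<bar>b - a\<bar> powr z' \<le> \<bar>b - a\<bar> powr (min z z')"
      using z z' by (auto intro!: powr_mono' )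
    have "\<bar>d a b - dyadic_sum ?h a b\<bar> \<le> \<bar>C\<bar> * \<bar>b - a\<bar> powr z' + sewing_const z * M * \<bar>b - a\<bar> powr z"
      using bd[OF that] dyadic_sum_bound[of z ?h M, OF z mid' that]
      by (smt (verit, ccfv_threshold) mult_right_mono powr_ge_zero)
    also have "\<dots> \<le> \<bar>C\<bar> * \<bar>b - a\<bar> powr (min z z') + sewing_const z * M * \<bar>b - a\<bar> powr (min z z')"
      using p sewing_const_pos[OF z] M0 by (intro add_mono mult_left_mono) auto
    finally show ?thesis by (simp add: algebra_simps)
  qed
  note near = this
  \<comment> \<open>The dyadic sum of the defect of \<open>d\<close> has the same defect at midpoints as \<open>d\<close>.\<close>
  have "d a b - dyadic_sum ?h a b = 0"
  proof (rule midpoint_additive_null[where f = "\<lambda>a b. d a b - dyadic_sum ?h a b", OF _ near])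
    fix a b assume "a \<in> J" "b \<in> J"
    from dyadic_sum_midpoint[of z ?h M, OF z mid' this]
    show "d a b - dyadic_sum ?h a b = d a ((a + b) / 2) - dyadic_sum ?h a ((a + b) / 2)
        + (d ((a + b) / 2) b - dyadic_sum ?h ((a + b) / 2) b)" by simp
  qed (use z z' ab in auto)
  then show ?thesis using dyadic_sum_bound[of z ?h M, OF z mid' ab] by simp
qed

definition equipart_sum :: "(real \<Rightarrow> real \<Rightarrow> real) \<Rightarrow> nat \<Rightarrow> real \<Rightarrow> real \<Rightarrow> real" where
  "equipart_sum f N a b =
     (\<Sum>k<N. f (a + real k * ((b - a) / real N)) (a + real (Suc k) * ((b - a) / real N)))"

lemma equipart_mem:
  assumes "a \<in> J" "b \<in> J" "k \<le> N"
  shows "a + real k * ((b - a) / real N) \<in> J"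
proof (cases "N = 0")
  case False
  define t where "t = real k / real N"
  have t: "0 \<le> t" "t \<le> 1" using assms False by (auto simp: t_def)
  have "a + real k * ((b - a) / real N) = (1 - t) * a + t * b"
    by (simp add: t_def algebra_simps diff_divide_distrib)
  moreover have "(1 - t) * a + t * b \<le> (1 - t) * 1 + t * 1"
    using assms t by (intro add_mono mult_left_mono) auto
  moreover have "(1 - t) * a + t * b \<ge> 0"
    using assms t by auto
  ultimately show ?thesis by auto
qed (use assms in auto)

text \<open>
  The sum of \<open>f\<close> over \<open>N\<close> equal pieces is again additive at midpoints and differs from \<open>f\<close> by a function of
  exponent \<open>z > 1\<close>, so it equals \<open>f\<close>.  This gives additivity at rational points of an interval, then
  everywhere by continuity.
\<close>

lemma midpoint_additive_imp_additive:
  assumes z: "z > 1"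
    and cont: "continuous_on (J \<times> J) (\<lambda>(a, b). f a b)"
    and add: "\<And>a b. a \<in> J \<Longrightarrow> b \<in> J \<Longrightarrow> f a b = f a ((a + b) / 2) + f ((a + b) / 2) b"
    and near: "\<And>a b c. a \<in> J \<Longrightarrow> b \<in> J \<Longrightarrow> c \<in> J \<Longrightarrow>
        \<bar>f a c - f a b - f b c\<bar> \<le> M * (max \<bar>b - a\<bar> \<bar>c - b\<bar>) powr z"
    and J: "a \<in> J" "b \<in> J" "c \<in> J"
  shows "f a c = f a b + f b c"
proof -
  have "0 \<le> \<bar>f 0 1 - f 0 0 - f 0 1\<bar>" by simp
  also have "\<dots> \<le> M" using near[of 0 0 1] by simp
  finally have M0: "M \<ge> 0" .
  have split_even: "(\<Sum>k<2 * N. g k) = (\<Sum>k<N. g (2 * k) + g (Suc (2 * k)))" for g :: "nat \<Rightarrow> real" and N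
    by (induction N) auto
  have split_at: "(\<Sum>k<n + m. g k) = (\<Sum>k<n. g k) + (\<Sum>k<m. g (n + k))"
    for g :: "nat \<Rightarrow> real" and n m
    by (induction m) auto
  have diag: "f a a = 0" if "a \<in> J" for a
    using add[of a a] that by simp
  \<comment> \<open>Split off the last of the pieces, one after the other.\<close>
  have near_part: "\<exists>C. \<forall>a\<in>J. \<forall>b\<in>J. \<bar>f a b - equipart_sum f (Suc N) a b\<bar> \<le> C * \<bar>b - a\<bar> powr z" for N
  proof (induction N)
    case 0
    show ?case by (auto simp: equipart_sum_def intro!: exI[of _ 0])
  next
    case (Suc N)
    then obtain C where C: "\<And>a b. a \<in> J \<Longrightarrow> b \<in> J \<Longrightarrow>
      \<bar>f a b - equipart_sum f (Suc N) a b\<bar> \<le> C * \<bar>b - a\<bar> powr z" by blast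
    have "\<bar>f a b - equipart_sum f (Suc (Suc N)) a b\<bar> \<le> (M + \<bar>C\<bar>) * \<bar>b - a\<bar> powr z"
      if ab: "a \<in> J" "b \<in> J" for a b
    proof -
      define e where "e = a + real (Suc N) * ((b - a) / real (Suc (Suc N)))"
      have e: "e \<in> J" unfolding e_def using ab by (rule equipart_mem) simp
      have ea: "e - a = real (Suc N) * ((b - a) / real (Suc (Suc N)))" by (simp add: e_def)
      have step: "(e - a) / real (Suc N) = (b - a) / real (Suc (Suc N))"
        unfolding ea by (simp del: of_nat_Suc)
      define r where "r = (b - a) / real (Suc (Suc N))"
      have ba: "b - a = real (Suc (Suc N)) * r" by (simp add: r_def del: of_nat_Suc)
      have er: "e = a + real (Suc N) * r" by (simp add: e_def r_def)
      have be: "b - e = r" using ba er by (simp add: algebra_simps)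
      have "a + real (Suc (Suc N)) * ((b - a) / real (Suc (Suc N))) = b"
        using ba by (simp add: r_def del: of_nat_Suc)
      then have dec: "equipart_sum f (Suc (Suc N)) a b = equipart_sum f (Suc N) a e + f e b"
        unfolding equipart_sum_def step e_def by (subst sum.lessThan_Suc) simp
      have l1: "\<bar>e - a\<bar> \<le> \<bar>b - a\<bar>" and l2: "\<bar>b - e\<bar> \<le> \<bar>b - a\<bar>"
      proof -
        have "\<bar>e - a\<bar> = real (Suc N) * \<bar>r\<bar>" using er by (simp add: abs_mult)
        moreover have "\<bar>b - a\<bar> = real (Suc (Suc N)) * \<bar>r\<bar>"
          by (simp only: ba abs_mult abs_of_nat)
        moreover have "1 * \<bar>r\<bar> \<le> real (Suc (Suc N)) * \<bar>r\<bar>" by (intro mult_right_mono) auto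
        ultimately show "\<bar>e - a\<bar> \<le> \<bar>b - a\<bar>" "\<bar>b - e\<bar> \<le> \<bar>b - a\<bar>"
          using be by (auto simp: mult_right_mono)
      qed
      have "\<bar>f a b - f a e - f e b\<bar> \<le> M * (max \<bar>e - a\<bar> \<bar>b - e\<bar>) powr z"
        by (rule near) (use ab e in auto)
      also have "\<dots> \<le> M * \<bar>b - a\<bar> powr z"
        using l1 l2 z M0 by (intro mult_left_mono powr_mono2) auto
      finally have n1: "\<bar>f a b - f a e - f e b\<bar> \<le> M * \<bar>b - a\<bar> powr z" .
      have "\<bar>f a e - equipart_sum f (Suc N) a e\<bar> \<le> \<bar>C\<bar> * \<bar>e - a\<bar> powr z"
        using C[OF ab(1) e] by (smt (verit, ccfv_threshold) mult_right_mono powr_ge_zero)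
      also have "\<dots> \<le> \<bar>C\<bar> * \<bar>b - a\<bar> powr z"
        using l1 z by (intro mult_left_mono powr_mono2) auto
      finally show ?thesis using n1 dec by (simp add: algebra_simps)
    qed
    then show ?case by blast
  qed
  have part: "f a b = equipart_sum f N a b" if N: "N > 0" and ab: "a \<in> J" "b \<in> J" for N a b
  proof -
    obtain N' where N': "N = Suc N'" using N by (cases N) auto
    obtain C where C: "\<And>a b. a \<in> J \<Longrightarrow> b \<in> J \<Longrightarrow>
      \<bar>f a b - equipart_sum f N a b\<bar> \<le> C * \<bar>b - a\<bar> powr z" using near_part[of N'] unfolding N' by blast
    have mid: "equipart_sum f N a b = equipart_sum f N a ((a + b) / 2) + equipart_sum f N ((a + b) / 2) b"
      if ab: "a \<in> J" "b \<in> J" for a b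
    proof -
      define g where "g k = f (a + real k * ((b - a) / (2 * real N))) (a + real (Suc k) * ((b - a) / (2 * real N)))" for k
      have "equipart_sum f N a b = (\<Sum>k<N. g (2 * k) + g (Suc (2 * k)))"
        unfolding equipart_sum_def
      proof (rule sum.cong)
        fix k assume k: "k \<in> {..<N}"
        let ?u = "a + real k * ((b - a) / real N)" and ?v = "a + real (Suc k) * ((b - a) / real N)"
        have "?u \<in> J" "?v \<in> J" by (rule equipart_mem; use ab k in auto)+
        then have "f ?u ?v = f ?u ((?u + ?v) / 2) + f ((?u + ?v) / 2) ?v" by (rule add)
        also have "f ?u ((?u + ?v) / 2) = g (2 * k)"
          unfolding g_def using N by (intro arg_cong2[where f = f]) (auto simp: field_simps)
        also have "f ((?u + ?v) / 2) ?v = g (Suc (2 * k))"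
          unfolding g_def using N by (intro arg_cong2[where f = f]) (auto simp: field_simps)
        finally show "f ?u ?v = g (2 * k) + g (Suc (2 * k))" .
      qed simp
      also have "\<dots> = (\<Sum>k<2 * N. g k)" by (rule split_even[symmetric])
      also have "\<dots> = (\<Sum>k<N. g k) + (\<Sum>k<N. g (N + k))"
        using split_at[of g N N] by (simp add: mult_2)
      also have "(\<Sum>k<N. g k) = equipart_sum f N a ((a + b) / 2)"
        unfolding equipart_sum_def g_def using N
        by (intro sum.cong arg_cong2[where f = f]) (auto simp: field_simps)
      also have "(\<Sum>k<N. g (N + k)) = equipart_sum f N ((a + b) / 2) b"
        unfolding equipart_sum_def g_def using N
        by (intro sum.cong arg_cong2[where f = f]) (auto simp: field_simps)
      finally show ?thesis .
    qed
    have "f a b - equipart_sum f N a b = 0"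
    proof (rule midpoint_additive_null[OF z, of "\<lambda>a b. f a b - equipart_sum f N a b" C])
      fix a b assume "a \<in> J" "b \<in> J"
      then show "f a b - equipart_sum f N a b =
        f a ((a + b) / 2) - equipart_sum f N a ((a + b) / 2)
        + (f ((a + b) / 2) b - equipart_sum f N ((a + b) / 2) b)"
        using add[of a b] mid[of a b] by linarith
    qed (use C ab in auto)
    then show ?thesis by simp
  qed
  \<comment> \<open>Group the \<open>N\<close> pieces of \<open>[a, c]\<close> into the first \<open>j\<close> and the last \<open>N - j\<close>.\<close>
  have rational: "f a c = f a (a + real j * ((c - a) / real N)) + f (a + real j * ((c - a) / real N)) c"
    if ac: "a \<in> J" "c \<in> J" and jN: "0 < j" "j < N" for a c j N
  proof -
    let ?b = "a + real j * ((c - a) / real N)"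
    have b: "?b \<in> J" using ac by (rule equipart_mem) (use jN in auto)
    define g where "g k = f (a + real k * ((c - a) / real N)) (a + real (Suc k) * ((c - a) / real N))" for k
    have s1: "(?b - a) / real j = (c - a) / real N" using jN by (simp add: field_simps)
    have s2: "(c - ?b) / real (N - j) = (c - a) / real N"
    proof -
      have "c - ?b = real (N - j) * ((c - a) / real N)"
        using jN by (simp add: field_simps of_nat_diff)
      then show ?thesis using jN by simp
    qed
    have "f a c = (\<Sum>k<N. g k)" using part[OF _ ac, of N] jN by (simp add: equipart_sum_def g_def)
    also have "\<dots> = (\<Sum>k<j. g k) + (\<Sum>k<N-j. g (j + k))"
      using split_at[of g j "N - j"] jN by simp
    also have "(\<Sum>k<j. g k) = f a ?b"
      using part[OF _ ac(1) b, of j] jN by (simp add: equipart_sum_def s1 g_def)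
    also have "(\<Sum>k<N-j. g (j + k)) = equipart_sum f (N - j) ?b c"
      unfolding equipart_sum_def s2 g_def
      by (intro sum.cong arg_cong2[where f = f]) (auto simp: algebra_simps add_divide_distrib diff_divide_distrib)
    also have "\<dots> = f ?b c" using part[OF _ b ac(2), of "N - j"] jN by simp
    finally show ?thesis .
  qed
  have contf: "continuous_on T (\<lambda>r. f (u r) (v r))"
    if "continuous_on T u" "continuous_on T v" "u ` T \<subseteq> J" "v ` T \<subseteq> J" for T :: "real set" and u v
    using continuous_on_compose2[OF cont continuous_on_Pair[OF that(1,2)]] that(3,4) by auto
  have between: "f a c = f a b + f b c" if "a \<in> J" "c \<in> J" "b = a + t * (c - a)" "0 \<le> t" "t \<le> 1"
    for a b c t
  proof -
    let ?b = "\<lambda>t. a + t * (c - a)"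
    let ?Z = "{t \<in> {0..1}. f a (?b t) + f (?b t) c - f a c = 0}"
    have bJ: "?b t \<in> J" if "t \<in> {0..1}" for t
    proof -
      have "?b t = (1 - t) * a + t * c" by (simp add: algebra_simps)
      moreover have "(1 - t) * a + t * c \<le> (1 - t) * 1 + t * 1"
        using that \<open>a \<in> J\<close> \<open>c \<in> J\<close> by (intro add_mono mult_left_mono) auto
      moreover have "(1 - t) * a + t * c \<ge> 0" using that \<open>a \<in> J\<close> \<open>c \<in> J\<close> by auto
      ultimately show ?thesis by auto
    qed
    have "continuous_on {0..1} (\<lambda>t. f a (?b t) + f (?b t) c - f a c)"
      by (intro continuous_intros contf image_subsetI bJ \<open>a \<in> J\<close> \<open>c \<in> J\<close>)
    then have clo: "closed ?Z"
      by (intro continuous_closed_preimage_constant) auto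
    have rat: "t \<in> ?Z" if "t \<in> \<rat>" "t \<in> {0<..<1}" for t
    proof -
      obtain j N :: nat where jN: "N \<noteq> 0" "\<bar>t\<bar> = real j / real N"
        using \<open>t \<in> \<rat>\<close> Rats_abs_nat_div_natE by blast
      then have t: "t = real j / real N" using that by auto
      have "0 < j" "j < N" using that jN by (auto simp: t field_simps)
      from rational[OF \<open>a \<in> J\<close> \<open>c \<in> J\<close> this] show ?thesis
        using that by (simp add: t)
    qed
    have "{0<..<1} \<subseteq> closure ({0<..<1} \<inter> \<rat> :: real set)"
    proof -
      have "closure \<rat> = (UNIV :: real set)" by (rule Rats_closure_real)
      then show ?thesis
        using open_Int_closure_subset[of "{0<..<1::real}" \<rat>] by auto
    qed
    also have "\<dots> \<subseteq> ?Z" using rat by (intro closure_minimal clo) auto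
    finally have "{0<..<1} \<subseteq> ?Z" .
    moreover have "0 \<in> ?Z" "1 \<in> ?Z" using diag that by auto
    moreover have "t = 0 \<or> t = 1 \<or> t \<in> {0<..<1}" using that by auto
    ultimately have "t \<in> ?Z" by blast
    then show ?thesis using that by auto
  qed
  \<comment> \<open>Needed for points \<open>a\<close>, \<open>b\<close>, \<open>c\<close> that are not in increasing order.\<close>
  have anti: "f b a = - f a b" if ab: "a \<in> J" "b \<in> J" for a b
  proof -
    have "f a b + f b a = 0"
    proof (rule midpoint_additive_null[OF z, of "\<lambda>a b. f a b + f b a" M])
      fix a b assume "a \<in> J" "b \<in> J"
      then show "\<bar>f a b + f b a\<bar> \<le> M * \<bar>b - a\<bar> powr z"
        using near[of a b a] diag[of a] by (simp add: abs_minus_commute)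
    next
      fix a b assume "a \<in> J" "b \<in> J"
      then show "f a b + f b a = f a ((a + b) / 2) + f ((a + b) / 2) a
          + (f ((a + b) / 2) b + f b ((a + b) / 2))"
        using add[of a b] add[of b a] by (simp add: add.commute)
    qed (use ab in auto)
    then show ?thesis by simp
  qed
  have ordered: "f a c = f a b + f b c" if "a \<in> J" "b \<in> J" "c \<in> J" "a \<le> b" "b \<le> c" for a b c
  proof (cases "a = c")
    case True
    then have "b = a" using that by simp
    then show ?thesis using diag that True by auto
  next
    case False
    then show ?thesis
      using that by (intro between[of a c b "(b - a) / (c - a)"]) auto
  qed
  consider "a \<le> b" "b \<le> c" | "a \<le> c" "c \<le> b" | "b \<le> a" "a \<le> c" | "b \<le> c" "c \<le> a"
    | "c \<le> a" "a \<le> b" | "c \<le> b" "b \<le> a" by linarith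
  then show ?thesis
    by cases (use J ordered[of a b c] ordered[of a c b] ordered[of b a c] ordered[of b c a]
        ordered[of c a b] ordered[of c b a] anti in \<open>smt (verit)\<close>)+
qed

lemma bisect_Suc:
  "(bisect ^^ Suc n) f a b = (bisect ^^ n) f a ((a + b) / 2) + (bisect ^^ n) f ((a + b) / 2) b"
  by (simp add: bisect_def)

text \<open>
  The series converges uniformly, as the bound \<open>M\<close> is uniform in the parameter \<open>q\<close>.
\<close>

lemma continuous_on_dyadic_sum:
  fixes T :: "'p::topological_space set"
  assumes z: "z > 1"
    and cont: "continuous_on (T \<times> J \<times> J \<times> J) (\<lambda>(q, a, b, c). h q a b c)"
    and mid: "\<And>q a b. q \<in> T \<Longrightarrow> a \<in> J \<Longrightarrow> b \<in> J \<Longrightarrow>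
        \<bar>h q a ((a + b) / 2) b\<bar> \<le> M * \<bar>b - a\<bar> powr z"
  shows "continuous_on (T \<times> J \<times> J) (\<lambda>(q, a, b). dyadic_sum (h q) a b)"
proof -
  let ?H = "\<lambda>n q a b. (bisect ^^ n) (midpoint_defect (h q)) a b"
  have contH: "continuous_on (T \<times> J \<times> J) (\<lambda>(q, a, b). ?H n q a b)" for n
  proof (induction n)
    case 0
    have "continuous_on (T \<times> J \<times> J) (\<lambda>p. (\<lambda>(q, a, b, c). h q a b c)
        (fst p, fst (snd p), (fst (snd p) + snd (snd p)) / 2, snd (snd p)))"
      by (rule continuous_on_compose2[OF cont]) (auto intro!: continuous_intros)
    then show ?case by (simp add: midpoint_defect_def split_def)
  next
    case (Suc n)
    have "continuous_on (T \<times> J \<times> J) (\<lambda>p. (\<lambda>(q, a, b). ?H n q a b)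
        (fst p, fst (snd p), (fst (snd p) + snd (snd p)) / 2))"
      by (rule continuous_on_compose2[OF Suc]) (auto intro!: continuous_intros)
    moreover have "continuous_on (T \<times> J \<times> J) (\<lambda>p. (\<lambda>(q, a, b). ?H n q a b)
        (fst p, (fst (snd p) + snd (snd p)) / 2, snd (snd p)))"
      by (rule continuous_on_compose2[OF Suc]) (auto intro!: continuous_intros)
    ultimately show ?case
      by (simp add: bisect_Suc split_def continuous_on_add del: funpow.simps)
  qed
  have "uniform_limit (T \<times> J \<times> J) (\<lambda>n p. \<Sum>i<n. ?H i (fst p) (fst (snd p)) (snd (snd p)))
     (\<lambda>p. \<Sum>i. ?H i (fst p) (fst (snd p)) (snd (snd p))) sequentially"
  proof (rule Weierstrass_m_test)
    show "norm (?H n (fst p) (fst (snd p)) (snd (snd p))) \<le> \<bar>M\<bar> * 1 * (2 powr (1 - z)) ^ n"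
      if "p \<in> T \<times> J \<times> J" for n p
    proof -
      from that obtain q a b where p: "p = (q, a, b)" "q \<in> T" "a \<in> J" "b \<in> J" by auto
      have "\<bar>?H n q a b\<bar> \<le> M * \<bar>b - a\<bar> powr z * (2 powr (1 - z)) ^ n"
        using p mid by (intro dyadic_term_bound[OF z]) auto
      also have "\<dots> \<le> \<bar>M\<bar> * 1 * (2 powr (1 - z)) ^ n"
        using p z by (intro mult_right_mono mult_mono powr_le1) auto
      finally show ?thesis by (simp add: p)
    qed
    show "summable (\<lambda>n. \<bar>M\<bar> * 1 * (2 powr (1 - z)) ^ n)"
        using sewing_ratio[OF z] by (intro summable_mult summable_geometric) auto
  qed
  then have "continuous_on (T \<times> J \<times> J) (\<lambda>p. \<Sum>i. ?H i (fst p) (fst (snd p)) (snd (snd p)))"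
    using contH by (intro uniform_limit_theorem) (auto intro!: always_eventually continuous_on_sum simp: split_def)
  then show ?thesis by (simp add: dyadic_sum_def split_def)
qed

text \<open>
  A domain of the sewing map, with explicit constants.  Functions of total exponent \<open>z\<close> satisfy the bound
  by the larger increment, which is simpler to verify.
\<close>

definition sewable :: "real \<Rightarrow> real \<Rightarrow> (real \<Rightarrow> real \<Rightarrow> real \<Rightarrow> real) \<Rightarrow> bool" where
  "sewable z M h \<longleftrightarrow> z > 1 \<and>
     (\<exists>g. continuous_on (J \<times> J) (\<lambda>(a, b). g a b) \<and>
        (\<forall>a\<in>J. \<forall>b\<in>J. \<forall>c\<in>J. h a b c = g a c - g a b - g b c)) \<and>
     (\<forall>a\<in>J. \<forall>b\<in>J. \<forall>c\<in>J. \<bar>h a b c\<bar> \<le> M * max \<bar>b - a\<bar> \<bar>c - b\<bar> powr z)"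

lemma sewable_nonneg:
  assumes "sewable z M h"
  shows "M \<ge> 0"
proof -
  have "\<forall>a\<in>J. \<forall>b\<in>J. \<forall>c\<in>J. \<bar>h a b c\<bar> \<le> M * max \<bar>b - a\<bar> \<bar>c - b\<bar> powr z"
    using assms by (simp add: sewable_def)
  then have "\<bar>h 0 0 1\<bar> \<le> M * max \<bar>0 - 0\<bar> \<bar>1 - 0\<bar> powr z"
    by (metis atLeastAtMost_iff order_refl zero_le_one)
  then show ?thesis by simp
qed

lemma sewable_midpoint:
  assumes "sewable z M h"
  shows "\<forall>a\<in>J. \<forall>b\<in>J. \<bar>h a ((a + b) / 2) b\<bar> \<le> M * \<bar>b - a\<bar> powr z"
proof (intro ballI)
  fix a b assume ab: "a \<in> J" "b \<in> J"
  have M: "M \<ge> 0" by (rule sewable_nonneg[OF assms(1)])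
  have "\<bar>h a ((a + b) / 2) b\<bar> \<le> M * max \<bar>(a + b) / 2 - a\<bar> \<bar>b - (a + b) / 2\<bar> powr z"
    using assms ab midpoint_mem[of a b] unfolding sewable_def by blast
  also have "\<dots> \<le> M * \<bar>b - a\<bar> powr z"
    using M assms(1) unfolding sewable_def
    by (intro mult_left_mono powr_mono2) (auto simp: field_simps)
  finally show "\<bar>h a ((a + b) / 2) b\<bar> \<le> M * \<bar>b - a\<bar> powr z" .
qed

text \<open>
  By construction the dyadic sum has the defect \<open>h\<close> at midpoints.  If \<open>g\<close> is a continuous primitive of \<open>h\<close>,
  the difference of \<open>g\<close> and the dyadic sum is therefore additive at midpoints, hence additive.
\<close>

lemma sewable_dyadic_sum:
  assumes sw: "sewable z M h" and J: "a \<in> J" "b \<in> J" "c \<in> J"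
  shows "dyadic_sum h a c - dyadic_sum h a b - dyadic_sum h b c = h a b c"
proof -
  obtain g where g: "continuous_on (J \<times> J) (\<lambda>(a, b). g a b)"
    and h: "\<And>a b c. a \<in> J \<Longrightarrow> b \<in> J \<Longrightarrow> c \<in> J \<Longrightarrow> h a b c = g a c - g a b - g b c"
    and z: "z > 1"
    and bd: "\<And>a b c. a \<in> J \<Longrightarrow> b \<in> J \<Longrightarrow> c \<in> J \<Longrightarrow>
       \<bar>h a b c\<bar> \<le> M * max \<bar>b - a\<bar> \<bar>c - b\<bar> powr z"
    using sw unfolding sewable_def by metis
  note mid = sewable_midpoint[OF sw]
  let ?f = "\<lambda>a b. g a b - dyadic_sum h a b"
  have gc: "continuous_on T (\<lambda>p. g (u p) (v p))"
    if "continuous_on T u" "continuous_on T v" "\<And>p. p \<in> T \<Longrightarrow> u p \<in> J" "\<And>p. p \<in> T \<Longrightarrow> v p \<in> J"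
    for T :: "(real \<times> real \<times> real \<times> real) set" and u v
  proof -
    have "(\<lambda>p. (u p, v p)) ` T \<subseteq> J \<times> J" using that(3,4) by blast
    from continuous_on_compose2[OF g continuous_on_Pair[OF that(1,2)] this] show ?thesis by simp
  qed
  have "continuous_on (UNIV \<times> J \<times> J) (\<lambda>(q :: real, a, b). dyadic_sum h a b)"
  proof (rule continuous_on_dyadic_sum[where M = M, OF z])
    have "continuous_on (UNIV \<times> J \<times> J \<times> J) (\<lambda>p :: real \<times> real \<times> real \<times> real.
       g (fst (snd p)) (snd (snd (snd p))) - g (fst (snd p)) (fst (snd (snd p)))
        - g (fst (snd (snd p))) (snd (snd (snd p))))"
      by (intro continuous_intros gc) auto
    also have "?this \<longleftrightarrow> continuous_on (UNIV \<times> J \<times> J \<times> J) (\<lambda>(q :: real, a, b, c). h a b c)"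
      by (rule continuous_on_cong) (auto simp: h)
    finally show \<dots> .
  qed (use mid in auto)
  then have "continuous_on (J \<times> J) (\<lambda>p. (\<lambda>(q :: real, a, b). dyadic_sum h a b) (0, fst p, snd p))"
    by (rule continuous_on_compose2) (auto intro!: continuous_intros)
  then have contf: "continuous_on (J \<times> J) (\<lambda>(a, b). ?f a b)"
    using g by (auto intro: continuous_on_diff simp: split_def)
  have "?f a c = ?f a b + ?f b c"
  proof (rule midpoint_additive_imp_additive[OF z contf, where M = "M * (1 + 4 * sewing_const z * 2 powr z)"])
    fix a b assume "a \<in> J" "b \<in> J"
    then show "?f a b = ?f a ((a + b) / 2) + ?f ((a + b) / 2) b"
      using dyadic_sum_midpoint[where h = h and M = M, OF z mid, of a b] h[of a "(a + b) / 2" b] midpoint_mem[of a b] by simp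
  next
    fix a b c assume J: "a \<in> J" "b \<in> J" "c \<in> J"
    let ?m = "max \<bar>b - a\<bar> \<bar>c - b\<bar>"
    have M0: "M \<ge> 0" by (rule sewable_nonneg[OF sw])
    have s0: "sewing_const z > 0" by (rule sewing_const_pos[OF z])
    have p: "(2 * ?m) powr z = 2 powr z * ?m powr z" by (rule powr_mult)
    have D: "\<bar>dyadic_sum h u v\<bar> \<le> sewing_const z * M * (2 powr z * ?m powr z)"
      if "u \<in> J" "v \<in> J" "\<bar>v - u\<bar> \<le> 2 * ?m" for u v
    proof -
      have "\<bar>dyadic_sum h u v\<bar> \<le> sewing_const z * M * \<bar>v - u\<bar> powr z"
        by (rule dyadic_sum_bound[where h = h and M = M, OF z mid that(1,2)])
      also have "\<dots> \<le> sewing_const z * M * (2 * ?m) powr z"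
        using that(3) z s0 M0 by (intro mult_left_mono powr_mono2) auto
      finally show ?thesis unfolding p .
    qed
    have "\<bar>?f a c - ?f a b - ?f b c\<bar>
       \<le> \<bar>h a b c\<bar> + \<bar>dyadic_sum h a c\<bar> + \<bar>dyadic_sum h a b\<bar> + \<bar>dyadic_sum h b c\<bar>"
      using h[OF J] by linarith
    also have "\<dots> \<le> M * ?m powr z + 3 * (sewing_const z * M * (2 powr z * ?m powr z))"
    proof -
      have "\<bar>b - a\<bar> \<le> m \<Longrightarrow> \<bar>c - b\<bar> \<le> m \<Longrightarrow>
          \<bar>c - a\<bar> \<le> 2 * m \<and> \<bar>b - a\<bar> \<le> 2 * m \<and> \<bar>c - b\<bar> \<le> 2 * m" for m
        by linarith
      then have "\<bar>c - a\<bar> \<le> 2 * ?m" "\<bar>b - a\<bar> \<le> 2 * ?m" "\<bar>c - b\<bar> \<le> 2 * ?m"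
        by (metis max.cobounded1 max.cobounded2)+
      from D[OF J(1,3) this(1)] D[OF J(1,2) this(2)] D[OF J(2,3) this(3)] bd[OF J]
      show ?thesis by linarith
    qed
    also have "\<dots> \<le> M * ?m powr z + 4 * (sewing_const z * M * (2 powr z * ?m powr z))"
      using s0 M0 by (intro add_left_mono mult_right_mono) auto
    also have "\<dots> = M * (1 + 4 * sewing_const z * 2 powr z) * ?m powr z"
      by (simp add: algebra_simps)
    finally show "\<bar>?f a c - ?f a b - ?f b c\<bar> \<le> M * (1 + 4 * sewing_const z * 2 powr z) * ?m powr z" .
  qed (use J in auto)
  then show ?thesis using h[OF J] by simp
qed

text \<open>
  Two primitives of exponent \<open>> 1\<close> differ by a midpoint additive function of exponent \<open>> 1\<close>, which is zero.
\<close>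

lemma sew_eq_dyadic_sum:
  assumes sw: "sewable z M h"
  shows "sew h = (\<lambda>a b. if a \<in> J \<and> b \<in> J then dyadic_sum h a b else 0)" (is "_ = ?L")
  unfolding sew_def
proof (rule the_equality)
  have z: "z > 1" using sw by (simp add: sewable_def)
  note mid = sewable_midpoint[OF sw]
  note bd = dyadic_sum_bound[where h = h and M = M, OF z mid]
  show "(\<forall>r1 r2. r1 \<notin> J \<or> r2 \<notin> J \<longrightarrow> ?L r1 r2 = 0) \<and>
     (\<exists>C z. z > 1 \<and> (\<forall>r1\<in>J. \<forall>r2\<in>J. \<bar>?L r1 r2\<bar> \<le> C * \<bar>r2 - r1\<bar> powr z)) \<and>
     (\<forall>r1\<in>J. \<forall>r2\<in>J. \<forall>r3\<in>J. ?L r1 r3 - ?L r1 r2 - ?L r2 r3 = h r1 r2 r3)"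
    using z bd sewable_dyadic_sum[OF sw] by (intro conjI exI[of _ "sewing_const z * M"] exI[of _ z]) auto
  fix f assume f: "(\<forall>r1 r2. r1 \<notin> J \<or> r2 \<notin> J \<longrightarrow> f r1 r2 = 0) \<and>
     (\<exists>C z. z > 1 \<and> (\<forall>r1\<in>J. \<forall>r2\<in>J. \<bar>f r1 r2\<bar> \<le> C * \<bar>r2 - r1\<bar> powr z)) \<and>
     (\<forall>r1\<in>J. \<forall>r2\<in>J. \<forall>r3\<in>J. f r1 r3 - f r1 r2 - f r2 r3 = h r1 r2 r3)"
  then obtain C z' where z': "z' > 1" and C: "\<And>a b. a \<in> J \<Longrightarrow> b \<in> J \<Longrightarrow> \<bar>f a b\<bar> \<le> C * \<bar>b - a\<bar> powr z'"
    by blast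
  have del: "f a b - f a ((a + b) / 2) - f ((a + b) / 2) b = h a ((a + b) / 2) b"
    if "a \<in> J" "b \<in> J" for a b
    using f that midpoint_mem[OF that] by blast
  have "f a b - dyadic_sum h a b = 0" if ab: "a \<in> J" "b \<in> J" for a b
  proof -
    have C': "\<bar>f a b - dyadic_sum h a b\<bar> \<le> (\<bar>C\<bar> + \<bar>sewing_const z * M\<bar>) * \<bar>b - a\<bar> powr min z z'"
      if "a \<in> J" "b \<in> J" for a b
    proof -
      have "\<bar>b - a\<bar> \<le> 1" using that by auto
      then have p: "\<bar>b - a\<bar> powr z \<le> \<bar>b - a\<bar> powr (min z z')"
           "\<bar>b - a\<bar> powr z' \<le> \<bar>b - a\<bar> powr (min z z')"
        using z z' by (auto intro!: powr_mono')
      have "\<bar>f a b\<bar> \<le> \<bar>C\<bar> * \<bar>b - a\<bar> powr min z z'"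
        using C[OF that] p(2) by (smt (verit, ccfv_threshold) mult_mono powr_ge_zero mult_right_mono mult_left_mono)
      moreover have "\<bar>dyadic_sum h a b\<bar> \<le> \<bar>sewing_const z * M\<bar> * \<bar>b - a\<bar> powr min z z'"
        using bd[OF that] p(1) by (smt (verit, ccfv_threshold) powr_ge_zero mult_right_mono mult_left_mono)
      ultimately show ?thesis unfolding distrib_right by linarith
    qed
    have "\<bar>f a b - dyadic_sum h a b\<bar> \<le> sewing_const 2 * 0 * \<bar>b - a\<bar> powr 2"
    proof (rule sewing_bound[where d = "\<lambda>a b. f a b - dyadic_sum h a b", OF _ _ C'])
      fix a b assume "a \<in> J" "b \<in> J"
      then show "\<bar>f a b - dyadic_sum h a b - (f a ((a + b) / 2) - dyadic_sum h a ((a + b) / 2))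
         - (f ((a + b) / 2) b - dyadic_sum h ((a + b) / 2) b)\<bar> \<le> 0 * \<bar>b - a\<bar> powr 2"
        using del[of a b] dyadic_sum_midpoint[where h = h and M = M, OF z mid, of a b] by simp
    qed (use z z' ab in auto)
    then show ?thesis by simp
  qed
  then show "f = ?L" using f by (intro ext) auto
qed

lemma sew_coboundary:
  assumes "sewable z M h" "a \<in> J" "b \<in> J" "c \<in> J"
  shows "sew h a c - sew h a b - sew h b c = h a b c"
  using sewable_dyadic_sum[OF assms] assms by (simp add: sew_eq_dyadic_sum[OF assms(1)])

lemma sew_bound:
  assumes "sewable z M h" "a \<in> J" "b \<in> J"
  shows "\<bar>sew h a b\<bar> \<le> sewing_const z * M * \<bar>b - a\<bar> powr z"
  using dyadic_sum_bound[where h = h and M = M and z = z, OF _ sewable_midpoint[OF assms(1)], of a b] assms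
  by (simp add: sew_eq_dyadic_sum[OF assms(1)] sewable_def)

lemma coboundary_unique:
  assumes "z1 > 1" "z2 > 1"
    and "\<And>a b. a \<in> J \<Longrightarrow> b \<in> J \<Longrightarrow> \<bar>f a b\<bar> \<le> C1 * \<bar>b - a\<bar> powr z1"
    and "\<And>a b. a \<in> J \<Longrightarrow> b \<in> J \<Longrightarrow> \<bar>g a b\<bar> \<le> C2 * \<bar>b - a\<bar> powr z2"
    and eq: "\<And>a b c. a \<in> J \<Longrightarrow> b \<in> J \<Longrightarrow> c \<in> J \<Longrightarrow> f a c - f a b - f b c = g a c - g a b - g b c"
    and ab: "a \<in> J" "b \<in> J"
  shows "f a b = g a b"
proof -
  have bd: "\<bar>f a b - g a b\<bar> \<le> (\<bar>C1\<bar> + \<bar>C2\<bar>) * \<bar>b - a\<bar> powr min z1 z2"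
    if "a \<in> J" "b \<in> J" for a b
  proof -
    have "\<bar>b - a\<bar> \<le> 1" using that by auto
    then have p: "\<bar>b - a\<bar> powr z1 \<le> \<bar>b - a\<bar> powr (min z1 z2)"
         "\<bar>b - a\<bar> powr z2 \<le> \<bar>b - a\<bar> powr (min z1 z2)"
      using assms by (auto intro!: powr_mono')
    have "\<bar>f a b\<bar> \<le> \<bar>C1\<bar> * \<bar>b - a\<bar> powr min z1 z2"
      using assms(3)[OF that] p(1) by (smt (verit, ccfv_threshold) powr_ge_zero mult_right_mono mult_left_mono)
    moreover have "\<bar>g a b\<bar> \<le> \<bar>C2\<bar> * \<bar>b - a\<bar> powr min z1 z2"
      using assms(4)[OF that] p(2) by (smt (verit, ccfv_threshold) powr_ge_zero mult_right_mono mult_left_mono)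
    ultimately show ?thesis unfolding distrib_right by linarith
  qed
  have "\<bar>f a b - g a b\<bar> \<le> sewing_const 2 * 0 * \<bar>b - a\<bar> powr 2"
  proof (rule sewing_bound[where d = "\<lambda>a b. f a b - g a b", OF _ _ bd])
    fix a b assume "a \<in> J" "b \<in> J"
    then show "\<bar>f a b - g a b - (f a ((a + b) / 2) - g a ((a + b) / 2))
       - (f ((a + b) / 2) b - g ((a + b) / 2) b)\<bar> \<le> 0 * \<bar>b - a\<bar> powr 2"
      using eq[of a "(a + b) / 2" b] midpoint_mem[of a b] by simp
  qed (use assms ab in auto)
  then show ?thesis by simp
qed

lemma continuous_on_sew:
  fixes T :: "'p::topological_space set"
  assumes "\<And>q. q \<in> T \<Longrightarrow> sewable z M (h q)"
    and cont: "continuous_on (T \<times> J \<times> J \<times> J) (\<lambda>(q, a, b, c). h q a b c)"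
  shows "continuous_on (T \<times> J \<times> J) (\<lambda>(q, a, b). sew (h q) a b)"
proof (cases "T = {}")
  case False
  then have "z > 1" using assms by (auto simp: sewable_def)
  then have "continuous_on (T \<times> J \<times> J) (\<lambda>(q, a, b). dyadic_sum (h q) a b)"
    using sewable_midpoint[OF assms(1)] by (intro continuous_on_dyadic_sum[where M = M and z = z, OF _ cont]) auto
  then show ?thesis
    by (rule continuous_on_eq) (use sew_eq_dyadic_sum[OF assms(1)] in auto)
qed simp

section \<open>Continuity and Hoelder bounds in several variables\<close>

lemma ball_cube:
  "(\<forall>ss\<in>cube 1. P ss) \<longleftrightarrow> (\<forall>a\<in>J. P [a])"
  "(\<forall>ss\<in>cube 2. P ss) \<longleftrightarrow> (\<forall>a\<in>J. \<forall>b\<in>J. P [a, b])"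
  "(\<forall>ss\<in>cube 3. P ss) \<longleftrightarrow> (\<forall>a\<in>J. \<forall>b\<in>J. \<forall>c\<in>J. P [a, b, c])"
  "(\<forall>ss\<in>cube 4. P ss) \<longleftrightarrow> (\<forall>a\<in>J. \<forall>b\<in>J. \<forall>c\<in>J. \<forall>d\<in>J. P [a, b, c, d])"
  "(\<forall>ss\<in>cube 5. P ss) \<longleftrightarrow> (\<forall>a\<in>J. \<forall>b\<in>J. \<forall>c\<in>J. \<forall>d\<in>J. \<forall>e\<in>J. P [a, b, c, d, e])"
  by (auto simp: cube_def numeral_eq_Suc length_Suc_conv Ball_def; blast)+

lemma mem_cube_Cons [simp]:
  "[] \<in> cube k \<longleftrightarrow> k = 0"
  "a # ss \<in> cube k \<longleftrightarrow> 0 < k \<and> a \<in> J \<and> ss \<in> cube (k - 1)"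
  by (cases k; auto simp: cube_def)+

definition seqs :: "(nat \<Rightarrow> real) set" where "seqs = UNIV \<rightarrow> J"

definition maps_into :: "'p::topological_space set \<Rightarrow> ('p \<Rightarrow> real) \<Rightarrow> bool" where
  "maps_into T f \<longleftrightarrow> continuous_on T f \<and> f ` T \<subseteq> J"

lemma maps_into_const [simp]: "maps_into T (\<lambda>_. c) \<longleftrightarrow> T = {} \<or> c \<in> J"
  by (auto simp: maps_into_def)

lemma ccont_iff:
  "ccont k l g \<longleftrightarrow> continuous_on (seqs \<times> seqs) (\<lambda>p. g (map (fst p) [0..<k]) (map (snd p) [0..<l]))"
  by (simp add: ccont_def seqs_def split_def)

lemma map_seqs_cube: "s \<in> seqs \<Longrightarrow> map s [0..<k] \<in> cube k"
  by (auto simp: seqs_def cube_def)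

text \<open>
  A function that is continuous in the sense of \<open>ccont\<close> takes its arguments from two sequences; finitely
  many coordinate maps are completed to a sequence by zeros.
\<close>

lemma ccont_compose:
  fixes T :: "'p::topological_space set"
  assumes g: "ccont (length fs) (length gs) g"
    and fs: "\<forall>f\<in>set fs. maps_into T f" and gs: "\<forall>f\<in>set gs. maps_into T f"
  shows "continuous_on T (\<lambda>p. g (map (\<lambda>f. f p) fs) (map (\<lambda>f. f p) gs))"
proof -
  define point where "point fs p = (\<lambda>i. if i < length fs then (fs ! i) p else 0)"
    for fs :: "('p \<Rightarrow> real) list" and p
  have cont: "continuous_on T (point hs)" and mem: "point hs ` T \<subseteq> seqs"
    if "\<forall>f\<in>set hs. maps_into T f" for hs
  proof -
    show "continuous_on T (point hs)"
    proof (rule continuous_on_coordinatewise_then_product)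
      show "continuous_on T (\<lambda>p. point hs p i)" for i
        using that by (cases "i < length hs") (auto simp: point_def maps_into_def)
    qed
    show "point hs ` T \<subseteq> seqs"
    proof
      fix x assume "x \<in> point hs ` T"
      then obtain p where p: "p \<in> T" "x = point hs p" by blast
      have "x i \<in> J" for i
      proof (cases "i < length hs")
        case True
        then have "maps_into T (hs ! i)" using that by simp
        then show ?thesis using True p unfolding maps_into_def point_def by auto
      qed (simp add: p point_def)
      then show "x \<in> seqs" by (auto simp: seqs_def)
    qed
  qed
  have "continuous_on T (\<lambda>p. (point fs p, point gs p))"
    by (intro continuous_on_Pair cont fs gs)
  moreover have "(\<lambda>p. (point fs p, point gs p)) ` T \<subseteq> seqs \<times> seqs"
    using mem[OF fs] mem[OF gs] by blast
  ultimately have "continuous_on T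
      (\<lambda>p. g (map (point fs p) [0..<length fs]) (map (point gs p) [0..<length gs]))"
    using continuous_on_compose2[OF g[unfolded ccont_iff]] by fastforce
  moreover have "map (point hs p) [0..<length hs] = map (\<lambda>f. f p) hs" for hs p
    by (rule nth_equalityI) (auto simp: point_def)
  ultimately show ?thesis by simp
qed

lemma ccont_compose_intros:
  fixes T :: "'p::topological_space set"
  shows "ccont 1 1 g \<Longrightarrow> maps_into T a \<Longrightarrow> maps_into T c \<Longrightarrow> continuous_on T (\<lambda>p. g [a p] [c p])"
  and "ccont 2 1 g \<Longrightarrow> maps_into T a \<Longrightarrow> maps_into T b \<Longrightarrow> maps_into T c \<Longrightarrow>
    continuous_on T (\<lambda>p. g [a p, b p] [c p])"
  and "ccont 2 2 g \<Longrightarrow> maps_into T a \<Longrightarrow> maps_into T b \<Longrightarrow> maps_into T c \<Longrightarrow> maps_into T d \<Longrightarrow>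
    continuous_on T (\<lambda>p. g [a p, b p] [c p, d p])"
  and "ccont 3 2 g \<Longrightarrow> maps_into T a \<Longrightarrow> maps_into T b \<Longrightarrow> maps_into T e \<Longrightarrow>
    maps_into T c \<Longrightarrow> maps_into T d \<Longrightarrow> continuous_on T (\<lambda>p. g [a p, b p, e p] [c p, d p])"
  and "ccont 3 3 g \<Longrightarrow> maps_into T a \<Longrightarrow> maps_into T b \<Longrightarrow> maps_into T e \<Longrightarrow>
    maps_into T c \<Longrightarrow> maps_into T d \<Longrightarrow> maps_into T f \<Longrightarrow>
    continuous_on T (\<lambda>p. g [a p, b p, e p] [c p, d p, f p])"
  and "ccont 4 2 g \<Longrightarrow> maps_into T a \<Longrightarrow> maps_into T b \<Longrightarrow> maps_into T e \<Longrightarrow> maps_into T f \<Longrightarrow>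
    maps_into T c \<Longrightarrow> maps_into T d \<Longrightarrow> continuous_on T (\<lambda>p. g [a p, b p, e p, f p] [c p, d p])"
  and "ccont 4 3 g \<Longrightarrow> maps_into T a \<Longrightarrow> maps_into T b \<Longrightarrow> maps_into T e \<Longrightarrow> maps_into T f \<Longrightarrow>
    maps_into T c \<Longrightarrow> maps_into T d \<Longrightarrow> maps_into T k \<Longrightarrow>
    continuous_on T (\<lambda>p. g [a p, b p, e p, f p] [c p, d p, k p])"
  and "ccont 5 2 g \<Longrightarrow> maps_into T a \<Longrightarrow> maps_into T b \<Longrightarrow> maps_into T e \<Longrightarrow> maps_into T f \<Longrightarrow>
    maps_into T k \<Longrightarrow> maps_into T c \<Longrightarrow> maps_into T d \<Longrightarrow>
    continuous_on T (\<lambda>p. g [a p, b p, e p, f p, k p] [c p, d p])"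
  using ccont_compose[where fs = "[a]" and gs = "[c]" and T = T and g = g]
    ccont_compose[where fs = "[a, b]" and gs = "[c]" and T = T and g = g]
    ccont_compose[where fs = "[a, b]" and gs = "[c, d]" and T = T and g = g]
    ccont_compose[where fs = "[a, b, e]" and gs = "[c, d]" and T = T and g = g]
    ccont_compose[where fs = "[a, b, e]" and gs = "[c, d, f]" and T = T and g = g]
    ccont_compose[where fs = "[a, b, e, f]" and gs = "[c, d]" and T = T and g = g]
    ccont_compose[where fs = "[a, b, e, f]" and gs = "[c, d, k]" and T = T and g = g]
    ccont_compose[where fs = "[a, b, e, f, k]" and gs = "[c, d]" and T = T and g = g]
  by (simp_all add: numeral_eq_Suc)

lemma maps_into_coord [simp]:
  "maps_into (seqs \<times> seqs) (\<lambda>p. fst p i)" "maps_into (seqs \<times> seqs) (\<lambda>p. snd p i)"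
proof -
  have c: "continuous_on UNIV (\<lambda>s :: nat \<Rightarrow> real. s i)" by (rule continuous_on_product_coordinates)
  have "continuous_on (seqs \<times> seqs) (\<lambda>p. fst p i)" "continuous_on (seqs \<times> seqs) (\<lambda>p. snd p i)"
    by (rule continuous_on_compose2[OF c]; intro continuous_on_fst continuous_on_snd continuous_on_id subset_UNIV)+
  then show "maps_into (seqs \<times> seqs) (\<lambda>p. fst p i)" "maps_into (seqs \<times> seqs) (\<lambda>p. snd p i)"
    by (force simp: maps_into_def seqs_def)+
qed

text \<open>
  With \<open>ccont_compose_intros\<close>, this reduces continuity of an expression to that of its constituents.
\<close>

lemma ccont_unfold:
  "ccont 1 1 g \<longleftrightarrow> continuous_on (seqs \<times> seqs) (\<lambda>p. g [fst p 0] [snd p 0])"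
  "ccont 2 1 g \<longleftrightarrow> continuous_on (seqs \<times> seqs) (\<lambda>p. g [fst p 0, fst p 1] [snd p 0])"
  "ccont 2 2 g \<longleftrightarrow> continuous_on (seqs \<times> seqs) (\<lambda>p. g [fst p 0, fst p 1] [snd p 0, snd p 1])"
  "ccont 3 2 g \<longleftrightarrow> continuous_on (seqs \<times> seqs)
     (\<lambda>p. g [fst p 0, fst p 1, fst p 2] [snd p 0, snd p 1])"
  "ccont 3 3 g \<longleftrightarrow> continuous_on (seqs \<times> seqs)
     (\<lambda>p. g [fst p 0, fst p 1, fst p 2] [snd p 0, snd p 1, snd p 2])"
  "ccont 4 2 g \<longleftrightarrow> continuous_on (seqs \<times> seqs)
     (\<lambda>p. g [fst p 0, fst p 1, fst p 2, fst p 3] [snd p 0, snd p 1])"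
  "ccont 5 2 g \<longleftrightarrow> continuous_on (seqs \<times> seqs)
     (\<lambda>p. g [fst p 0, fst p 1, fst p 2, fst p 3, fst p 4] [snd p 0, snd p 1])"
  unfolding ccont_iff by (simp_all add: upt_rec numeral_eq_Suc)

lemma ccont_cong:
  assumes "ccont k l g" and "\<And>ss ts. ss \<in> cube k \<Longrightarrow> ts \<in> cube l \<Longrightarrow> h ss ts = g ss ts"
  shows "ccont k l h"
  using assms(1) unfolding ccont_iff
  by (rule continuous_on_eq) (auto simp: assms(2) map_seqs_cube)

lemma ccont_swap: "ccont k l g \<Longrightarrow> ccont l k (\<lambda>ss ts. g ts ss)"
proof -
  assume g: "ccont k l g"
  have "continuous_on (seqs \<times> seqs) (\<lambda>p. prod.swap p :: (nat \<Rightarrow> real) \<times> (nat \<Rightarrow> real))"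
    unfolding prod.swap_def
    by (intro continuous_on_Pair continuous_on_fst continuous_on_snd continuous_on_id)
  moreover have "prod.swap ` (seqs \<times> seqs) \<subseteq> seqs \<times> seqs" by auto
  ultimately show ?thesis
    unfolding ccont_iff using continuous_on_compose2[OF g[unfolded ccont_iff]] by fastforce
qed

text \<open>
  Since \<open>0\<close> to any power is \<open>0\<close>, a bound by \<open>pw z\<close> contains that the bounded function vanishes on the diagonal.
\<close>

definition pw :: "real \<Rightarrow> real \<Rightarrow> real \<Rightarrow> real" where "pw z a b = \<bar>b - a\<bar> powr z"

lemma pw_nonneg [simp]: "0 \<le> pw z a b"
  by (simp add: pw_def)

lemma pw_same [simp]: "pw z a a = 0"
  by (simp add: pw_def)

lemma pw_eq_0 [simp]: "pw z a b = 0 \<longleftrightarrow> a = b"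
  by (auto simp: pw_def)

lemma pw_le_1: "z \<ge> 0 \<Longrightarrow> a \<in> J \<Longrightarrow> b \<in> J \<Longrightarrow> pw z a b \<le> 1"
  unfolding pw_def by (rule powr_le1) auto

lemma pw_antimono: "z \<le> z' \<Longrightarrow> a \<in> J \<Longrightarrow> b \<in> J \<Longrightarrow> pw z' a b \<le> pw z a b"
  unfolding pw_def by (rule powr_mono') auto

lemma pw_mult_le_max:
  assumes "\<rho> \<ge> 0" "\<sigma> \<ge> 0"
  shows "pw \<rho> a b * pw \<sigma> b c \<le> max \<bar>b - a\<bar> \<bar>c - b\<bar> powr (\<rho> + \<sigma>)"
  unfolding powr_add pw_def using assms by (intro mult_mono powr_mono2) auto

lemma continuous_on_pw:
  "z > 0 \<Longrightarrow> continuous_on T f \<Longrightarrow> continuous_on T g \<Longrightarrow> continuous_on T (\<lambda>p. pw z (f p) (g p))"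
  unfolding pw_def by (intro continuous_on_powr' continuous_intros) auto

lemma SUP_SUP_finite_iff:
  fixes f :: "'a \<Rightarrow> 'b \<Rightarrow> real"
  shows "(SUP ss\<in>A. SUP ts\<in>B. ennreal (f ss ts)) < \<infinity> \<longleftrightarrow> (\<exists>K\<ge>0. \<forall>ss\<in>A. \<forall>ts\<in>B. f ss ts \<le> K)"
    (is "?S < \<infinity> \<longleftrightarrow> ?B")
proof
  assume "?S < \<infinity>"
  then obtain K where K: "K \<ge> 0" "?S = ennreal K" by (cases ?S) auto
  have "ennreal (f ss ts) \<le> ennreal K" if "ss \<in> A" "ts \<in> B" for ss ts
    unfolding K(2)[symmetric] using that by (meson SUP_upper SUP_upper2)
  then show ?B using K(1) by (intro exI[of _ K]) (auto simp: ennreal_le_iff)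
next
  assume ?B
  then obtain K where "K \<ge> 0" "\<forall>ss\<in>A. \<forall>ts\<in>B. f ss ts \<le> K" by blast
  then have "?S \<le> ennreal K" by (intro SUP_least ennreal_leI) auto
  then show "?S < \<infinity>" by (rule order.strict_trans1) simp
qed

lemma quotient_le_iff:
  "d \<ge> 0 \<Longrightarrow> (d = 0 \<Longrightarrow> x = 0) \<Longrightarrow> K \<ge> 0 \<Longrightarrow> \<bar>x\<bar> / d \<le> K \<longleftrightarrow> \<bar>x\<bar> \<le> K * (d :: real)"
  by (cases "d = 0") (auto simp: divide_le_eq)

text \<open>
  Finiteness of the norms, as bounds with one constant for all terms of a norm.  They are homogeneous
  inequalities instead of quotients, which makes them valid on the diagonals as well.
\<close>

definition holder11 :: "real \<Rightarrow> real \<Rightarrow> cochain \<Rightarrow> bool" where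
  "holder11 p q f \<longleftrightarrow> ccont 1 1 f \<and> (\<exists>K\<ge>0. \<forall>s1\<in>J. \<forall>s2\<in>J. \<forall>t1\<in>J. \<forall>t2\<in>J.
     \<bar>f [s1] [t1]\<bar> \<le> K \<and> \<bar>f [s2] [t1] - f [s1] [t1]\<bar> \<le> K * pw p s1 s2 \<and>
     \<bar>f [s1] [t2] - f [s1] [t1]\<bar> \<le> K * pw q t1 t2 \<and>
     \<bar>f [s2] [t2] - f [s1] [t2] - f [s2] [t1] + f [s1] [t1]\<bar> \<le> K * (pw p s1 s2 * pw q t1 t2))"

definition holder21 :: "real \<Rightarrow> real \<Rightarrow> cochain \<Rightarrow> bool" where
  "holder21 p q g \<longleftrightarrow> ccont 2 1 g \<and> (\<exists>K\<ge>0. \<forall>s1\<in>J. \<forall>s2\<in>J. \<forall>t1\<in>J. \<forall>t2\<in>J.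
     \<bar>g [s1, s2] [t1]\<bar> \<le> K * pw p s1 s2 \<and>
     \<bar>g [s1, s2] [t2] - g [s1, s2] [t1]\<bar> \<le> K * (pw p s1 s2 * pw q t1 t2))"

definition holder22 :: "real \<Rightarrow> real \<Rightarrow> cochain \<Rightarrow> bool" where
  "holder22 p q g \<longleftrightarrow> ccont 2 2 g \<and> (\<exists>K\<ge>0. \<forall>s1\<in>J. \<forall>s2\<in>J. \<forall>t1\<in>J. \<forall>t2\<in>J.
     \<bar>g [s1, s2] [t1, t2]\<bar> \<le> K * (pw p s1 s2 * pw q t1 t2))"

definition holder42 :: "real \<Rightarrow> real \<Rightarrow> real \<Rightarrow> cochain \<Rightarrow> bool" where
  "holder42 p p' q D \<longleftrightarrow> ccont 4 2 D \<and>
     (\<exists>K\<ge>0. \<forall>s1\<in>J. \<forall>s2\<in>J. \<forall>s3\<in>J. \<forall>s4\<in>J. \<forall>t1\<in>J. \<forall>t2\<in>J.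
       \<bar>D [s1, s2, s3, s4] [t1, t2]\<bar> \<le> K * (pw p s1 s2 * pw p' s3 s4 * pw q t1 t2))"

text \<open>
  What the norm on \<open>T\<^bsub>1,3\<^esub>\<close> provides in the variables \<open>t\<close> after the pieces of a decomposition have been
  added up.
\<close>

definition total_weight :: "real \<Rightarrow> (real \<Rightarrow> real \<Rightarrow> real \<Rightarrow> real) \<Rightarrow> bool" where
  "total_weight z W \<longleftrightarrow> (\<exists>K \<rho>. summable K \<and> (\<forall>i :: nat. 0 \<le> K i \<and> 0 < \<rho> i \<and> \<rho> i < z) \<and>
     (\<forall>a\<in>J. \<forall>b\<in>J. \<forall>c\<in>J. W a b c = (\<Sum>i. K i * (pw (\<rho> i) a b * pw (z - \<rho> i) b c))))"

definition holder43 :: "real \<Rightarrow> real \<Rightarrow> real \<Rightarrow> cochain \<Rightarrow> bool" where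
  "holder43 p p' q F \<longleftrightarrow> ccont 4 3 F \<and>
     (\<exists>W. total_weight q W \<and> (\<forall>s1\<in>J. \<forall>s2\<in>J. \<forall>s3\<in>J. \<forall>s4\<in>J. \<forall>t1\<in>J. \<forall>t2\<in>J. \<forall>t3\<in>J.
       \<bar>F [s1, s2, s3, s4] [t1, t2, t3]\<bar> \<le> pw p s1 s2 * pw p' s3 s4 * W t1 t2 t3))"

lemma CC22_vanish_iff:
  "CC 2 2 g \<longleftrightarrow> ccont 2 2 g \<and> (\<forall>a\<in>J. \<forall>b\<in>J. \<forall>c\<in>J. g [a, a] [b, c] = 0 \<and> g [b, c] [a, a] = 0)"
  by (auto simp: CC_def ball_cube)

text \<open>
  On the diagonals the quotients in the norm are \<open>0 / 0 = 0\<close> and carry no information; there the inequality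
  holds because \<open>g\<close> vanishes.
\<close>

lemma norm22_finite_iff:
  assumes "\<And>a b c. a \<in> J \<Longrightarrow> b \<in> J \<Longrightarrow> c \<in> J \<Longrightarrow> g [a, a] [b, c] = 0 \<and> g [b, c] [a, a] = 0"
  shows "norm22 p q g < \<infinity> \<longleftrightarrow> (\<exists>K\<ge>0. \<forall>s1\<in>J. \<forall>s2\<in>J. \<forall>t1\<in>J. \<forall>t2\<in>J.
     \<bar>g [s1, s2] [t1, t2]\<bar> \<le> K * (pw p s1 s2 * pw q t1 t2))"
proof -
  have *: "\<bar>g [s1, s2] [t1, t2]\<bar> / (pw p s1 s2 * pw q t1 t2) \<le> K \<longleftrightarrow>
     \<bar>g [s1, s2] [t1, t2]\<bar> \<le> K * (pw p s1 s2 * pw q t1 t2)"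
    if "K \<ge> 0" "s1 \<in> J" "s2 \<in> J" "t1 \<in> J" "t2 \<in> J" for K s1 s2 t1 t2
    using that assms by (intro quotient_le_iff) auto
  show ?thesis
    unfolding norm22_def SUP_SUP_finite_iff ball_cube
    by (intro ex_cong1 conj_cong refl ball_cong) (use * in \<open>simp add: pw_def\<close>)
qed

lemma CC22_iff_holder22: "CC22 p q g \<longleftrightarrow> holder22 p q g"
proof
  assume "CC22 p q g"
  then show "holder22 p q g"
    using norm22_finite_iff[of g p q] by (auto simp: CC22_def holder22_def CC22_vanish_iff)
next
  assume g: "holder22 p q g"
  then obtain K where "\<And>s1 s2 t1 t2. s1 \<in> J \<Longrightarrow> s2 \<in> J \<Longrightarrow> t1 \<in> J \<Longrightarrow> t2 \<in> J \<Longrightarrow>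
     \<bar>g [s1, s2] [t1, t2]\<bar> \<le> K * (pw p s1 s2 * pw q t1 t2)"
    unfolding holder22_def by blast
  from this[of a a b c for a b c] this[of b c a a for a b c]
  have "a \<in> J \<Longrightarrow> b \<in> J \<Longrightarrow> c \<in> J \<Longrightarrow> g [a, a] [b, c] = 0 \<and> g [b, c] [a, a] = 0" for a b c
    by (simp del: atLeastAtMost_iff)
  then show "CC22 p q g"
    using norm22_finite_iff[of g p q] g by (auto simp: CC22_def holder22_def CC22_vanish_iff)
qed

lemma orient_orient [simp]: "orient a (orient a g) = g"
  by (cases a) auto

lemma orient_delta: "orient a (delta a g) = delta1 (orient a g)"
  by (simp add: delta_def)

lemma delta_Dir1 [simp]: "delta Dir1 g = delta1 g"
  by (simp add: delta_def)

lemma delta_Dir2 [simp]: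
  "delta Dir2 g ss [t1, t2] = g ss [t2] - g ss [t1]"
  "delta Dir2 g ss [t1, t2, t3] = g ss [t1, t3] - g ss [t1, t2] - g ss [t2, t3]"
  by (simp_all add: delta_def)

lemma ddelta_apply [simp]:
  "ddelta g [s1, s2] [t1, t2] = g [s2] [t2] - g [s2] [t1] - g [s1] [t2] + g [s1] [t1]"
  "ddelta g [s1, s2, s3] [t1, t2, t3] =
     (g [s1, s3] [t1, t3] - g [s1, s3] [t1, t2] - g [s1, s3] [t2, t3])
     - (g [s1, s2] [t1, t3] - g [s1, s2] [t1, t2] - g [s1, s2] [t2, t3])
     - (g [s2, s3] [t1, t3] - g [s2, s3] [t1, t2] - g [s2, s3] [t2, t3])"
  by (simp_all add: ddelta_def)

lemma holder11_swap: "holder11 p q f \<Longrightarrow> holder11 q p (orient Dir2 f)"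
  unfolding holder11_def
  by (auto intro!: ccont_swap elim!: ex_forward simp: algebra_simps)

lemma holder22_swap: "holder22 p q f \<Longrightarrow> holder22 q p (orient Dir2 f)"
  unfolding holder22_def
  by (auto intro!: ccont_swap elim!: ex_forward simp: algebra_simps)

lemma CC11_imp_holder11:
  assumes f: "CC11 p q f"
  shows "holder11 p q f"
proof -
  have fin: "(SUP ss\<in>cube 1. SUP ts\<in>cube 1. ennreal \<bar>f ss ts\<bar>) < \<infinity>"
    "(SUP ss\<in>cube 2. SUP ts\<in>cube 1. ennreal (\<bar>delta Dir1 f ss ts\<bar> / \<bar>ss ! 1 - ss ! 0\<bar> powr p)) < \<infinity>"
    "(SUP ss\<in>cube 1. SUP ts\<in>cube 2. ennreal (\<bar>delta Dir2 f ss ts\<bar> / \<bar>ts ! 1 - ts ! 0\<bar> powr q)) < \<infinity>"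
    "norm22 p q (ddelta f) < \<infinity>"
    using f by (auto simp: CC11_def norm11_def ennreal_add_eq_top less_top)
  obtain K1 where K1: "K1 \<ge> 0" "\<forall>s\<in>J. \<forall>t\<in>J. \<bar>f [s] [t]\<bar> \<le> K1"
    using fin(1) unfolding SUP_SUP_finite_iff ball_cube by blast
  obtain K2 where K2: "K2 \<ge> 0"
    "\<And>s1 s2 t. s1 \<in> J \<Longrightarrow> s2 \<in> J \<Longrightarrow> t \<in> J \<Longrightarrow> \<bar>f [s2] [t] - f [s1] [t]\<bar> / pw p s1 s2 \<le> K2"
    using fin(2) unfolding SUP_SUP_finite_iff ball_cube by (auto simp: pw_def)
  obtain K3 where K3: "K3 \<ge> 0"
    "\<And>s t1 t2. s \<in> J \<Longrightarrow> t1 \<in> J \<Longrightarrow> t2 \<in> J \<Longrightarrow> \<bar>f [s] [t2] - f [s] [t1]\<bar> / pw q t1 t2 \<le> K3"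
    using fin(3) unfolding SUP_SUP_finite_iff ball_cube by (auto simp: pw_def)
  obtain K4 where K4: "K4 \<ge> 0"
    "\<And>s1 s2 t1 t2. s1 \<in> J \<Longrightarrow> s2 \<in> J \<Longrightarrow> t1 \<in> J \<Longrightarrow> t2 \<in> J \<Longrightarrow>
      \<bar>ddelta f [s1, s2] [t1, t2]\<bar> \<le> K4 * (pw p s1 s2 * pw q t1 t2)"
    using fin(4) norm22_finite_iff[of "ddelta f" p q] by auto
  define K where "K = K1 + K2 + K3 + K4"
  have K: "K \<ge> 0" "K1 \<le> K" "K2 \<le> K" "K3 \<le> K" "K4 \<le> K" using K1 K2 K3 K4 by (auto simp: K_def)
  have "\<bar>f [s2] [t] - f [s1] [t]\<bar> \<le> K * pw p s1 s2" if "s1 \<in> J" "s2 \<in> J" "t \<in> J" for s1 s2 t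
    using K2(2)[OF that] K by (subst quotient_le_iff[symmetric]) auto
  moreover have "\<bar>f [s] [t2] - f [s] [t1]\<bar> \<le> K * pw q t1 t2" if "s \<in> J" "t1 \<in> J" "t2 \<in> J" for s t1 t2
    using K3(2)[OF that] K by (subst quotient_le_iff[symmetric]) auto
  moreover have "\<bar>f [s2] [t2] - f [s1] [t2] - f [s2] [t1] + f [s1] [t1]\<bar> \<le> K * (pw p s1 s2 * pw q t1 t2)"
    if "s1 \<in> J" "s2 \<in> J" "t1 \<in> J" "t2 \<in> J" for s1 s2 t1 t2
  proof -
    have "K4 * (pw p s1 s2 * pw q t1 t2) \<le> K * (pw p s1 s2 * pw q t1 t2)"
      using K by (intro mult_right_mono) auto
    then show ?thesis using K4(2)[OF that] by (simp add: algebra_simps)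
  qed
  moreover have "\<bar>f [s] [t]\<bar> \<le> K" if "s \<in> J" "t \<in> J" for s t
    using K1 K that by fastforce
  moreover have "ccont 1 1 f" using f by (simp add: CC11_def CC_def)
  ultimately show ?thesis
    unfolding holder11_def using K(1) by (intro conjI exI[of _ K] ballI) auto
qed

lemma CC21_imp_holder21:
  assumes g: "CC21 p q g"
  shows "holder21 p q g"
proof -
  have van: "g [s, s] [t] = 0" if "s \<in> J" "t \<in> J" for s t
    using g that by (auto simp: CC21_def CC_def ball_cube)
  have fin: "(SUP ss\<in>cube 2. SUP ts\<in>cube 1. ennreal (\<bar>g ss ts\<bar> / \<bar>ss ! 1 - ss ! 0\<bar> powr p)) < \<infinity>"
    "norm22 p q (delta Dir2 g) < \<infinity>"
    using g by (auto simp: CC21_def norm21_def ennreal_add_eq_top less_top)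
  obtain K1 where K1: "K1 \<ge> 0"
    "\<And>s1 s2 t. s1 \<in> J \<Longrightarrow> s2 \<in> J \<Longrightarrow> t \<in> J \<Longrightarrow> \<bar>g [s1, s2] [t]\<bar> / pw p s1 s2 \<le> K1"
    using fin(1) unfolding SUP_SUP_finite_iff ball_cube by (auto simp: pw_def)
  obtain K2 where K2: "K2 \<ge> 0"
    "\<And>s1 s2 t1 t2. s1 \<in> J \<Longrightarrow> s2 \<in> J \<Longrightarrow> t1 \<in> J \<Longrightarrow> t2 \<in> J \<Longrightarrow>
      \<bar>delta Dir2 g [s1, s2] [t1, t2]\<bar> \<le> K2 * (pw p s1 s2 * pw q t1 t2)"
    using fin(2) norm22_finite_iff[of "delta Dir2 g" p q] van by auto
  define K where "K = K1 + K2"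
  have K: "K \<ge> 0" "K1 \<le> K" "K2 \<le> K" using K1 K2 by (auto simp: K_def)
  have "\<bar>g [s1, s2] [t]\<bar> \<le> K * pw p s1 s2" if "s1 \<in> J" "s2 \<in> J" "t \<in> J" for s1 s2 t
    using K1(2)[OF that] K van that by (subst quotient_le_iff[symmetric]) auto
  moreover have "\<bar>g [s1, s2] [t2] - g [s1, s2] [t1]\<bar> \<le> K * (pw p s1 s2 * pw q t1 t2)"
    if "s1 \<in> J" "s2 \<in> J" "t1 \<in> J" "t2 \<in> J" for s1 s2 t1 t2
  proof -
    have "K2 * (pw p s1 s2 * pw q t1 t2) \<le> K * (pw p s1 s2 * pw q t1 t2)"
      using K by (intro mult_right_mono) auto
    then show ?thesis using K2(2)[OF that] by simp
  qed
  moreover have "ccont 2 1 g" using g by (simp add: CC21_def CC_def)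
  ultimately show ?thesis
    unfolding holder21_def using K(1) by (intro conjI exI[of _ K] ballI) auto
qed

lemma norm22_swap: "norm22 q p (orient Dir2 g) = norm22 p q g"
  unfolding norm22_def by (subst SUP_commute) (simp add: mult.commute)

lemma CC12_imp_CC21_swap:
  assumes g: "CC12 p q g"
  shows "CC21 q p (orient Dir2 g)"
proof -
  have "norm21 q p (orient Dir2 g) = norm12 p q g"
    unfolding norm21_def norm12_def
    by (subst SUP_commute) (simp add: norm22_swap[of q p "delta1 g", simplified] delta_def)
  moreover have "CC 2 1 (orient Dir2 g)"
    using g ccont_swap[of 1 2 g] by (auto simp: CC12_def CC_def)
  ultimately show ?thesis using g by (simp add: CC12_def CC21_def)
qed

lemma Tspace_imp_holder42:
  assumes D: "Tspace a p p' q D"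
  shows "holder42 p p' q (orient a D)"
proof -
  let ?D = "orient a D"
  have van: "s1 = s2 \<or> s3 = s4 \<or> t1 = t2 \<Longrightarrow> ?D [s1, s2, s3, s4] [t1, t2] = 0"
    if "s1 \<in> J" "s2 \<in> J" "s3 \<in> J" "s4 \<in> J" "t1 \<in> J" "t2 \<in> J" for s1 s2 s3 s4 t1 t2
    using D that unfolding Tspace_def Tbase_def ball_cube by (simp, blast)
  obtain K where K: "K \<ge> 0"
    "\<And>s1 s2 s3 s4 t1 t2. s1 \<in> J \<Longrightarrow> s2 \<in> J \<Longrightarrow> s3 \<in> J \<Longrightarrow> s4 \<in> J \<Longrightarrow> t1 \<in> J \<Longrightarrow> t2 \<in> J \<Longrightarrow>
      \<bar>?D [s1, s2, s3, s4] [t1, t2]\<bar> / (pw p s1 s2 * pw p' s3 s4 * pw q t1 t2) \<le> K"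
    using D unfolding Tspace_def Tnorm_def SUP_SUP_finite_iff ball_cube by (auto simp: pw_def)
  have "\<bar>?D [s1, s2, s3, s4] [t1, t2]\<bar> \<le> K * (pw p s1 s2 * pw p' s3 s4 * pw q t1 t2)"
    if "s1 \<in> J" "s2 \<in> J" "s3 \<in> J" "s4 \<in> J" "t1 \<in> J" "t2 \<in> J" for s1 s2 s3 s4 t1 t2
    using K(2)[OF that] K(1) van[OF that] by (subst quotient_le_iff[symmetric]) auto
  moreover have "ccont 4 2 ?D" using D by (simp add: Tspace_def Tbase_def)
  ultimately show ?thesis
    unfolding holder42_def using K(1) by (intro conjI exI[of _ K] ballI) auto
qed

text \<open>
  The coefficient \<open>K\<^sub>i\<close> of the weight is the norm of the \<open>i\<close>-th piece of a decomposition of finite total norm.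
\<close>

lemma T3space_imp_holder43:
  assumes F: "T3space a p p' q F"
  shows "holder43 p p' q (orient a F)"
proof -
  let ?F = "orient a F"
  let ?d = "\<lambda>\<rho> ss ts. pw p (ss ! 0) (ss ! 1) * pw p' (ss ! 2) (ss ! 3)
                   * pw \<rho> (ts ! 0) (ts ! 1) * pw (q - \<rho>) (ts ! 1) (ts ! 2)"
  have "T3norm p p' q ?F < \<infinity>" using F by (simp add: T3space_def)
  then obtain P where P: "(\<forall>i :: nat. Tbase 3 (fst P i) \<and> 0 < snd P i \<and> snd P i < q) \<and>
      (\<forall>ss\<in>cube 4. \<forall>ts\<in>cube 3. (\<lambda>i. fst P i ss ts) sums ?F ss ts)"
    "(\<Sum>i. SUP ss\<in>cube 4. SUP ts\<in>cube 3. ennreal (\<bar>fst P i ss ts\<bar> / ?d (snd P i) ss ts)) < \<infinity>"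
    unfolding T3norm_def INF_less_iff pw_def split_def mem_Collect_eq by blast
  define G where "G = fst P"
  define \<rho> where "\<rho> = snd P"
  have G: "Tbase 3 (G i)" "0 < \<rho> i" "\<rho> i < q" for i using P(1) by (auto simp: G_def \<rho>_def)
  have sums: "(\<lambda>i. G i ss ts) sums ?F ss ts" if "ss \<in> cube 4" "ts \<in> cube 3" for ss ts
    using P(1) that by (auto simp: G_def)
  have fin: "(\<Sum>i. SUP ss\<in>cube 4. SUP ts\<in>cube 3. ennreal (\<bar>G i ss ts\<bar> / ?d (\<rho> i) ss ts)) < \<infinity>"
    using P(2) by (simp only: G_def \<rho>_def)
  let ?S = "\<lambda>i. SUP ss\<in>cube 4. SUP ts\<in>cube 3. ennreal (\<bar>G i ss ts\<bar> / ?d (\<rho> i) ss ts)"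
  define K where "K i = enn2real (?S i)" for i
  have Sfin: "?S i < \<infinity>" for i
  proof -
    have "?S i \<le> (\<Sum>i. ?S i)" using sum_le_suminf[of ?S "{i}"] by simp
    then show ?thesis using fin by (rule order.strict_trans1)
  qed
  have KS: "ennreal (K i) = ?S i" for i using Sfin[of i] by (simp add: K_def)
  have K0: "K i \<ge> 0" for i by (simp add: K_def)
  have sumK: "summable K"
    using fin K0 by (intro summable_suminf_not_top) (auto simp: KS)
  have le: "\<bar>G i ss ts\<bar> \<le> K i * ?d (\<rho> i) ss ts" if "ss \<in> cube 4" "ts \<in> cube 3" for i ss ts
  proof -
    have "ennreal (\<bar>G i ss ts\<bar> / ?d (\<rho> i) ss ts) \<le> ennreal (K i)"
      unfolding KS using that by (meson SUP_upper SUP_upper2)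
    then have "\<bar>G i ss ts\<bar> / ?d (\<rho> i) ss ts \<le> K i" using K0 by (simp add: ennreal_le_iff)
    moreover have "G i ss ts = 0" if "?d (\<rho> i) ss ts = 0"
    proof -
      have "ss ! 0 = ss ! 1 \<or> ss ! 2 = ss ! 3 \<or> ts ! 0 = ts ! Suc 0 \<or> ts ! Suc 0 = ts ! Suc (Suc 0)"
        using that by (auto simp: numeral_2_eq_2)
      moreover have "Suc 0 < 3" "Suc (Suc 0) < (3 :: nat)" by auto
      ultimately have "ss ! 0 = ss ! 1 \<or> ss ! 2 = ss ! 3 \<or> (\<exists>j. Suc j < 3 \<and> ts ! j = ts ! Suc j)"
        by blast
      then show ?thesis using G(1)[of i] \<open>ss \<in> cube 4\<close> \<open>ts \<in> cube 3\<close> unfolding Tbase_def by blast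
    qed
    ultimately show ?thesis using K0 by (subst quotient_le_iff[symmetric]) auto
  qed
  define W where "W a b c = (\<Sum>i. K i * (pw (\<rho> i) a b * pw (q - \<rho> i) b c))" for a b c
  have "\<bar>?F [s1, s2, s3, s4] [t1, t2, t3]\<bar> \<le> pw p s1 s2 * pw p' s3 s4 * W t1 t2 t3"
    if "s1 \<in> J" "s2 \<in> J" "s3 \<in> J" "s4 \<in> J" "t1 \<in> J" "t2 \<in> J" "t3 \<in> J" for s1 s2 s3 s4 t1 t2 t3
  proof -
    let ?ss = "[s1, s2, s3, s4]" and ?ts = "[t1, t2, t3]"
    have mem: "?ss \<in> cube 4" "?ts \<in> cube 3" using that by (auto simp: cube_def)
    let ?w = "\<lambda>i. K i * (pw (\<rho> i) t1 t2 * pw (q - \<rho> i) t2 t3)"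
    have w: "summable ?w"
    proof (rule summable_comparison_test'[OF sumK])
      fix i
      have "pw (\<rho> i) t1 t2 * pw (q - \<rho> i) t2 t3 \<le> 1 * 1"
        using that G(2,3)[of i] by (intro mult_mono pw_le_1) auto
      then show "norm (?w i) \<le> K i" using mult_left_mono[OF _ K0[of i]] K0[of i] by fastforce
    qed
    let ?c = "pw p s1 s2 * pw p' s3 s4"
    have b: "\<bar>G i ?ss ?ts\<bar> \<le> ?c * ?w i" for i
      using le[OF mem, of i] by (simp add: algebra_simps numeral_3_eq_3 numeral_2_eq_2)
    have "\<bar>\<Sum>i. G i ?ss ?ts\<bar> \<le> (\<Sum>i. ?c * ?w i)"
      using norm_suminf_le[of "\<lambda>i. G i ?ss ?ts" "\<lambda>i. ?c * ?w i"] b w by (simp add: summable_mult)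
    also have "\<dots> = ?c * W t1 t2 t3" unfolding W_def by (rule suminf_mult[OF w])
    finally show ?thesis using sums_unique[OF sums[OF mem]] by simp
  qed
  moreover have "total_weight q W" unfolding total_weight_def
    using sumK K0 G(2,3) by (intro exI[of _ K] exI[of _ \<rho>]) (auto simp: W_def)
  moreover have "ccont 4 3 ?F" using F by (simp add: T3space_def Tbase_def)
  ultimately show ?thesis
    unfolding holder43_def by (intro conjI exI[of _ W] ballI) auto
qed

section \<open>Domination by sums of weights\<close>

text \<open>
  Bounds by convergent sums of weights.  In contrast to a decomposition of \<open>h\<close> itself, such a bound passes
  to sums and to smaller functions.
\<close>

definition dominated :: "cochain set \<Rightarrow> nat \<Rightarrow> nat \<Rightarrow> cochain \<Rightarrow> bool" where
  "dominated \<W> k l h \<longleftrightarrow> (\<exists>K w. summable K \<and> (\<forall>i :: nat. 0 \<le> K i \<and> w i \<in> \<W>) \<and>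
     (\<forall>ss\<in>cube k. \<forall>ts\<in>cube l. \<bar>h ss ts\<bar> \<le> (\<Sum>i. K i * w i ss ts)))"

text \<open>
  Continuity and the bound by 1 make all series \<open>\<Sum>i. K i * w i\<close> with summable coefficients uniformly
  convergent, with continuous sums.
\<close>

definition weights :: "cochain set \<Rightarrow> nat \<Rightarrow> nat \<Rightarrow> bool" where
  "weights \<W> k l \<longleftrightarrow> (\<forall>w\<in>\<W>. ccont k l w \<and> (\<forall>ss\<in>cube k. \<forall>ts\<in>cube l. 0 \<le> w ss ts \<and> w ss ts \<le> 1))"

lemma weights_summable:
  fixes K :: "nat \<Rightarrow> real" and w :: "nat \<Rightarrow> cochain"
  assumes "weights \<W> k l" "summable K" "\<And>i. 0 \<le> K i \<and> w i \<in> \<W>" "ss \<in> cube k" "ts \<in> cube l"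
  shows "summable (\<lambda>i. K i * w i ss ts)"
proof (rule summable_comparison_test'[OF assms(2)])
  fix i
  have "0 \<le> w i ss ts" "w i ss ts \<le> 1" "0 \<le> K i"
    using assms(1,3-5) unfolding weights_def by blast+
  then show "norm (K i * w i ss ts) \<le> K i"
    using mult_left_mono[of "w i ss ts" 1 "K i"] by simp
qed

lemma dominated_single:
  assumes W: "weights \<W> k l" and "w \<in> \<W>" "C \<ge> 0"
    and le: "\<And>ss ts. ss \<in> cube k \<Longrightarrow> ts \<in> cube l \<Longrightarrow> \<bar>h ss ts\<bar> \<le> C * w ss ts"
  shows "dominated \<W> k l h"
proof -
  have "(\<lambda>i. (if i = (0 :: nat) then C else 0) * w ss ts) sums (C * w ss ts)" for ss ts
  proof -
    have "(\<lambda>i. (if i = (0 :: nat) then C else 0) * w ss ts) = (\<lambda>i. if i = 0 then C * w ss ts else 0)"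
      by auto
    then show ?thesis using sums_If_finite[of "\<lambda>i. i = 0" "\<lambda>_. C * w ss ts"] by simp
  qed
  from sums_unique[OF this] show ?thesis
    unfolding dominated_def
    by (intro exI[of _ "\<lambda>i. if i = 0 then C else 0"] exI[of _ "\<lambda>_. w"])
       (use assms in auto)
qed

lemma dominated_add:
  assumes W: "weights \<W> k l" and h: "dominated \<W> k l h" "dominated \<W> k l h'"
    and le: "\<And>ss ts. ss \<in> cube k \<Longrightarrow> ts \<in> cube l \<Longrightarrow> \<bar>f ss ts\<bar> \<le> \<bar>h ss ts\<bar> + \<bar>h' ss ts\<bar>"
  shows "dominated \<W> k l f"
proof -
  obtain K w where K: "summable K" "\<And>i :: nat. 0 \<le> K i \<and> w i \<in> \<W>"
    "\<And>ss ts. ss \<in> cube k \<Longrightarrow> ts \<in> cube l \<Longrightarrow> \<bar>h ss ts\<bar> \<le> (\<Sum>i. K i * w i ss ts)"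
    using h(1) unfolding dominated_def by blast
  obtain K' w' where K': "summable K'" "\<And>i :: nat. 0 \<le> K' i \<and> w' i \<in> \<W>"
    "\<And>ss ts. ss \<in> cube k \<Longrightarrow> ts \<in> cube l \<Longrightarrow> \<bar>h' ss ts\<bar> \<le> (\<Sum>i. K' i * w' i ss ts)"
    using h(2) unfolding dominated_def by blast
  \<comment> \<open>The two sequences of weights are interleaved.\<close>
  let ?K = "\<lambda>i. if even i then K' (i div 2) else K ((i - 1) div 2)"
  let ?w = "\<lambda>i. if even i then w' (i div 2) else w ((i - 1) div 2)"
  have "(\<lambda>i. ?K i) sums (suminf K + suminf K')"
    using sums_if[OF summable_sums[OF K(1)] summable_sums[OF K'(1)]] by (simp add: add.commute)
  then have "summable ?K" by (rule sums_summable)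
  moreover have "\<bar>f ss ts\<bar> \<le> (\<Sum>i. ?K i * ?w i ss ts)" if "ss \<in> cube k" "ts \<in> cube l" for ss ts
  proof -
    have "(\<lambda>i. if even i then K' (i div 2) * w' (i div 2) ss ts
           else K ((i - 1) div 2) * w ((i - 1) div 2) ss ts) sums
         ((\<Sum>i. K i * w i ss ts) + (\<Sum>i. K' i * w' i ss ts))"
      using sums_if[OF summable_sums[OF weights_summable[OF W K(1,2) that]]
          summable_sums[OF weights_summable[OF W K'(1,2) that]]] by (simp add: add.commute)
    also have "(\<lambda>i. if even i then K' (i div 2) * w' (i div 2) ss ts
           else K ((i - 1) div 2) * w ((i - 1) div 2) ss ts) = (\<lambda>i. ?K i * ?w i ss ts)" by auto
    finally have "(\<Sum>i. ?K i * ?w i ss ts) = (\<Sum>i. K i * w i ss ts) + (\<Sum>i. K' i * w' i ss ts)"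
      by (rule sums_unique[symmetric])
    then show ?thesis using le[OF that] K(3)[OF that] K'(3)[OF that] by linarith
  qed
  ultimately show ?thesis
    unfolding dominated_def using K(2) K'(2) by (intro exI[of _ ?K] exI[of _ ?w]) auto
qed

lemma dominated_mono:
  assumes W: "weights \<W> k l" and h: "dominated \<W> k l h" "C \<ge> 0"
    and le: "\<And>ss ts. ss \<in> cube k \<Longrightarrow> ts \<in> cube l \<Longrightarrow> \<bar>f ss ts\<bar> \<le> C * \<bar>h ss ts\<bar>"
  shows "dominated \<W> k l f"
proof -
  obtain K w where K: "summable K" "\<And>i :: nat. 0 \<le> K i \<and> w i \<in> \<W>"
    "\<And>ss ts. ss \<in> cube k \<Longrightarrow> ts \<in> cube l \<Longrightarrow> \<bar>h ss ts\<bar> \<le> (\<Sum>i. K i * w i ss ts)"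
    using h(1) unfolding dominated_def by blast
  have "\<bar>f ss ts\<bar> \<le> (\<Sum>i. C * K i * w i ss ts)" if "ss \<in> cube k" "ts \<in> cube l" for ss ts
  proof -
    have "\<bar>f ss ts\<bar> \<le> C * (\<Sum>i. K i * w i ss ts)"
      using le[OF that] mult_left_mono[OF K(3)[OF that] h(2)] by linarith
    also have "\<dots> = (\<Sum>i. C * K i * w i ss ts)"
      using suminf_mult[OF weights_summable[OF W K(1,2) that], of C] by (simp add: algebra_simps)
    finally show ?thesis .
  qed
  moreover have "summable (\<lambda>i. C * K i)" using K(1) by (rule summable_mult)
  ultimately show ?thesis
    unfolding dominated_def using K(2) h(2) by (intro exI[of _ "\<lambda>i. C * K i"] exI[of _ w]) auto
qed

text \<open>
  A dominated function decomposes into pieces dominated by the single weights, by splitting it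
  proportionally: \<open>G\<^sub>i = h K\<^sub>iw\<^sub>i / \<Sum>\<^sub>j K\<^sub>jw\<^sub>j\<close>.  At a zero of the denominator \<open>h\<close> vanishes too, and \<open>G\<^sub>i\<close> is
  continuous there because \<open>\<bar>G\<^sub>i\<bar> \<le> \<bar>h\<bar>\<close>.
\<close>

lemma dominated_partition:
  assumes W: "weights \<W> k l" and h: "ccont k l h" "dominated \<W> k l h"
  obtains K w G where "summable K" "\<And>i :: nat. 0 \<le> K i \<and> w i \<in> \<W>" "\<And>i. ccont k l (G i)"
    "\<And>i ss ts. ss \<in> cube k \<Longrightarrow> ts \<in> cube l \<Longrightarrow> \<bar>G i ss ts\<bar> \<le> K i * w i ss ts"
    "\<And>ss ts. ss \<in> cube k \<Longrightarrow> ts \<in> cube l \<Longrightarrow> (\<lambda>i. G i ss ts) sums h ss ts"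
proof -
  obtain K w where K: "summable K" "\<And>i :: nat. 0 \<le> K i \<and> w i \<in> \<W>"
    and le: "\<And>ss ts. ss \<in> cube k \<Longrightarrow> ts \<in> cube l \<Longrightarrow> \<bar>h ss ts\<bar> \<le> (\<Sum>i. K i * w i ss ts)"
    using h(2) unfolding dominated_def by blast
  note sumw = weights_summable[OF W K]
  have w: "ccont k l (w i)"
    "\<And>ss ts. ss \<in> cube k \<Longrightarrow> ts \<in> cube l \<Longrightarrow> 0 \<le> w i ss ts \<and> w i ss ts \<le> 1" for i
    using W K(2)[of i] unfolding weights_def by blast+
  let ?W = "\<lambda>ss ts. \<Sum>i. K i * w i ss ts"
  define G where "G i ss ts = h ss ts * (K i * w i ss ts) / ?W ss ts" for i ss ts
  have W0: "?W ss ts \<ge> 0" if "ss \<in> cube k" "ts \<in> cube l" for ss ts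
    using K(2) w that by (intro suminf_nonneg sumw that) auto
  have Gle: "\<bar>G i ss ts\<bar> \<le> K i * w i ss ts" if "ss \<in> cube k" "ts \<in> cube l" for i ss ts
  proof (cases "?W ss ts = 0")
    case False
    then have W1: "?W ss ts > 0" using W0[OF that] by linarith
    have "\<bar>h ss ts\<bar> / ?W ss ts \<le> 1" using le[OF that] W1 by simp
    moreover have "0 \<le> K i * w i ss ts" using K(2) w that by simp
    ultimately have "\<bar>h ss ts\<bar> / ?W ss ts * (K i * w i ss ts) \<le> 1 * (K i * w i ss ts)"
      by (intro mult_right_mono)
    moreover have "K i \<ge> 0" "w i ss ts \<ge> 0" using K(2) w that by auto
    ultimately show ?thesis using W1 by (simp add: G_def abs_mult)
  qed (use K(2) w that in \<open>simp add: G_def\<close>)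
  have Gle': "\<bar>G i ss ts\<bar> \<le> \<bar>h ss ts\<bar>" if "ss \<in> cube k" "ts \<in> cube l" for i ss ts
  proof (cases "?W ss ts = 0")
    case False
    then have W1: "?W ss ts > 0" using W0[OF that] by linarith
    have "K i * w i ss ts \<le> ?W ss ts"
      using sum_le_suminf[OF sumw[OF that], of "{i}"] K(2) w that by simp
    then have "K i * w i ss ts / ?W ss ts \<le> 1" using W1 by simp
    then have "\<bar>h ss ts\<bar> * (K i * w i ss ts / ?W ss ts) \<le> \<bar>h ss ts\<bar> * 1"
      by (intro mult_left_mono) auto
    moreover have "K i \<ge> 0" "w i ss ts \<ge> 0" using K(2) w that by auto
    ultimately show ?thesis using W1 by (simp add: G_def abs_mult)
  qed (simp add: G_def)
  have sums: "(\<lambda>i. G i ss ts) sums h ss ts" if "ss \<in> cube k" "ts \<in> cube l" for ss ts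
  proof (cases "?W ss ts = 0")
    case True
    then have "h ss ts = 0" using le[OF that] by simp
    then show ?thesis by (simp add: G_def)
  next
    case False
    have "(\<lambda>i. h ss ts / ?W ss ts * (K i * w i ss ts)) sums (h ss ts / ?W ss ts * ?W ss ts)"
      by (intro sums_mult summable_sums sumw that)
    then show ?thesis using False by (simp add: G_def)
  qed
  let ?T = "seqs \<times> seqs"
  let ?at = "\<lambda>f p. f (map (fst p) [0..<k]) (map (snd p) [0..<l]) :: real"
  have mem: "map (fst p) [0..<k] \<in> cube k" "map (snd p) [0..<l] \<in> cube l" if "p \<in> ?T" for p
    using that by (auto simp: map_seqs_cube)
  have contW: "continuous_on ?T (?at ?W)"
  proof -
    have "uniform_limit ?T (\<lambda>n p. \<Sum>i<n. K i * ?at (w i) p) (?at ?W) sequentially"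
    proof (rule Weierstrass_m_test[OF _ K(1)])
      fix n p assume p: "p \<in> ?T"
      have "K n * ?at (w n) p \<le> K n * 1" using K(2) w(2)[OF mem[OF p]] by (intro mult_left_mono) auto
      then show "norm (K n * ?at (w n) p) \<le> K n" using K(2) w(2)[OF mem[OF p]] by simp
    qed
    then show ?thesis
      using w(1) by (intro uniform_limit_theorem)
        (auto intro!: always_eventually continuous_intros simp: ccont_iff)
  qed
  have "ccont k l (G i)" for i
    unfolding ccont_iff continuous_on_eq_continuous_within
  proof
    fix p assume p: "p \<in> ?T"
    have conth: "continuous (at p within ?T) (?at h)"
      using h(1) p unfolding ccont_iff continuous_on_eq_continuous_within by blast
    have contw: "continuous (at p within ?T) (?at (w i))"
      using w(1)[of i] p unfolding ccont_iff continuous_on_eq_continuous_within by blast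
    have contW': "continuous (at p within ?T) (?at ?W)"
      using contW p unfolding continuous_on_eq_continuous_within by blast
    show "continuous (at p within ?T) (?at (G i))"
    proof (cases "?at ?W p = 0")
      case False
      then show ?thesis
        using conth contw contW' unfolding G_def continuous_within
        by (intro tendsto_divide tendsto_mult tendsto_const)
    next
      case True
      then have h0: "?at h p = 0" using le[OF mem[OF p]] by simp
      then have G0: "?at (G i) p = 0" by (simp add: G_def)
      have "((\<lambda>q. \<bar>?at h q\<bar>) \<longlongrightarrow> 0) (at p within ?T)"
        using conth h0 unfolding continuous_within by (auto intro: tendsto_rabs_zero)
      moreover have "\<forall>\<^sub>F q in at p within ?T. \<bar>?at (G i) q\<bar> \<le> \<bar>?at h q\<bar>"
        using Gle'[OF mem] by (auto simp: eventually_at_filter)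
      ultimately have "((?at (G i)) \<longlongrightarrow> 0) (at p within ?T)"
        unfolding real_norm_def[symmetric] by (rule Lim_null_comparison[rotated])
      then show ?thesis using G0 by (simp add: continuous_within)
    qed
  qed
  then show ?thesis using that[of K w G] K Gle sums by blast
qed

text \<open>
  The weights of total exponent \<open>z\<close> in \<open>s\<close>, and those of total exponents \<open>z1\<close> in \<open>s\<close> and \<open>z2\<close> in \<open>t\<close>.
\<close>

definition weights1 :: "real \<Rightarrow> cochain set" where
  "weights1 z = {\<lambda>ss ts. pw \<rho> (ss ! 0) (ss ! 1) * pw (z - \<rho>) (ss ! 1) (ss ! 2) |\<rho>. 0 < \<rho> \<and> \<rho> < z}"

definition weights2 :: "real \<Rightarrow> real \<Rightarrow> cochain set" where
  "weights2 z1 z2 =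
     {\<lambda>ss ts. pw \<rho> (ss ! 0) (ss ! 1) * pw (z1 - \<rho>) (ss ! 1) (ss ! 2)
              * (pw \<sigma> (ts ! 0) (ts ! 1) * pw (z2 - \<sigma>) (ts ! 1) (ts ! 2))
      |\<rho> \<sigma>. 0 < \<rho> \<and> \<rho> < z1 \<and> 0 < \<sigma> \<and> \<sigma> < z2}"

lemma cube_nth: "ss \<in> cube k \<Longrightarrow> i < k \<Longrightarrow> ss ! i \<in> J"
  using nth_mem[of i ss] unfolding cube_def by blast

lemma pw_pw_le_1:
  "0 < \<rho> \<Longrightarrow> \<rho> < z \<Longrightarrow> a \<in> J \<Longrightarrow> b \<in> J \<Longrightarrow> c \<in> J \<Longrightarrow> pw \<rho> a b * pw (z - \<rho>) b c \<le> 1"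
  using mult_mono[OF pw_le_1 pw_le_1, of \<rho> a b "z - \<rho>" b c] by simp

lemma continuous_on_coord:
  "continuous_on (seqs \<times> seqs) (\<lambda>p. fst p i)" "continuous_on (seqs \<times> seqs) (\<lambda>p. snd p i)"
  using maps_into_coord by (auto simp: maps_into_def)

lemma weights_weights1: "k \<ge> 3 \<Longrightarrow> weights (weights1 z) k l"
  unfolding weights_def weights1_def ccont_iff
  by (auto intro!: continuous_intros continuous_on_pw continuous_on_coord pw_pw_le_1 cube_nth)

lemma weights_weights2: "weights (weights2 z1 z2) 3 3"
  unfolding weights_def weights2_def ccont_iff
proof (intro ballI conjI, goal_cases)
  case (2 w ss ts)
  then show ?case by auto
next
  case (3 w ss ts)
  then obtain \<rho> \<sigma> where w: "w = (\<lambda>ss ts. pw \<rho> (ss ! 0) (ss ! 1) * pw (z1 - \<rho>) (ss ! 1) (ss ! 2)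
        * (pw \<sigma> (ts ! 0) (ts ! 1) * pw (z2 - \<sigma>) (ts ! 1) (ts ! 2)))"
    "0 < \<rho>" "\<rho> < z1" "0 < \<sigma>" "\<sigma> < z2" by blast
  have "w ss ts \<le> 1 * 1"
    unfolding w(1) using 3 w(2-) by (intro mult_mono pw_pw_le_1 cube_nth) auto
  then show ?case by simp
qed (auto intro!: continuous_intros continuous_on_pw continuous_on_coord)

lemma total_exponentI:
  assumes k: "k \<ge> 3" and h: "ccont k l h" "dominated (weights1 z) k l h"
  shows "total_exponent k l z h"
proof -
  obtain K w G where K: "summable K" "\<And>i :: nat. 0 \<le> K i \<and> w i \<in> weights1 z" "\<And>i. ccont k l (G i)"
    "\<And>i ss ts. ss \<in> cube k \<Longrightarrow> ts \<in> cube l \<Longrightarrow> \<bar>G i ss ts\<bar> \<le> K i * w i ss ts"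
    "\<And>ss ts. ss \<in> cube k \<Longrightarrow> ts \<in> cube l \<Longrightarrow> (\<lambda>i. G i ss ts) sums h ss ts"
    using dominated_partition[OF weights_weights1[OF k] h] by metis
  have "\<forall>i. \<exists>\<rho>. 0 < \<rho> \<and> \<rho> < z \<and>
     w i = (\<lambda>ss ts. pw \<rho> (ss ! 0) (ss ! 1) * pw (z - \<rho>) (ss ! 1) (ss ! 2))"
    using K(2) unfolding weights1_def by blast
  from choice[OF this] obtain \<rho> where \<rho>: "\<forall>i. 0 < \<rho> i \<and> \<rho> i < z \<and>
     w i = (\<lambda>ss ts. pw (\<rho> i) (ss ! 0) (ss ! 1) * pw (z - \<rho> i) (ss ! 1) (ss ! 2))" by blast
  show ?thesis unfolding total_exponent_def
    using K \<rho> by (intro exI[of _ G] exI[of _ \<rho>] exI[of _ K]) (auto simp: pw_def)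
qed

lemma total_exponentsI:
  assumes h: "ccont 3 3 h" "dominated (weights2 z1 z2) 3 3 h"
  shows "total_exponents z1 z2 h"
proof -
  obtain K w G where K: "summable K" "\<And>i :: nat. 0 \<le> K i \<and> w i \<in> weights2 z1 z2" "\<And>i. ccont 3 3 (G i)"
    "\<And>i ss ts. ss \<in> cube 3 \<Longrightarrow> ts \<in> cube 3 \<Longrightarrow> \<bar>G i ss ts\<bar> \<le> K i * w i ss ts"
    "\<And>ss ts. ss \<in> cube 3 \<Longrightarrow> ts \<in> cube 3 \<Longrightarrow> (\<lambda>i. G i ss ts) sums h ss ts"
    using dominated_partition[OF weights_weights2 h] by metis
  have "\<forall>i. \<exists>r. 0 < fst r \<and> fst r < z1 \<and> 0 < snd r \<and> snd r < z2 \<and>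
     w i = (\<lambda>ss ts. pw (fst r) (ss ! 0) (ss ! 1) * pw (z1 - fst r) (ss ! 1) (ss ! 2)
        * (pw (snd r) (ts ! 0) (ts ! 1) * pw (z2 - snd r) (ts ! 1) (ts ! 2)))"
    using K(2) unfolding weights2_def by fastforce
  from choice[OF this] obtain r where r: "\<forall>i. 0 < fst (r i) \<and> fst (r i) < z1 \<and>
     0 < snd (r i) \<and> snd (r i) < z2 \<and>
     w i = (\<lambda>ss ts. pw (fst (r i)) (ss ! 0) (ss ! 1) * pw (z1 - fst (r i)) (ss ! 1) (ss ! 2)
        * (pw (snd (r i)) (ts ! 0) (ts ! 1) * pw (z2 - snd (r i)) (ts ! 1) (ts ! 2)))" by blast
  show ?thesis unfolding total_exponents_def
    using K r by (intro exI[of _ G] exI[of _ "\<lambda>i. fst (r i)"] exI[of _ "\<lambda>i. snd (r i)"] exI[of _ K])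
      (auto simp: pw_def mult.assoc)
qed

section \<open>The sewing maps on functions of several variables\<close>

lemma sewableI:
  assumes z: "z > 1"
    and g: "continuous_on (J \<times> J) (\<lambda>(a, b). g a b)"
    and "\<And>a b c. a \<in> J \<Longrightarrow> b \<in> J \<Longrightarrow> c \<in> J \<Longrightarrow> h a b c = g a c - g a b - g b c"
    and "\<And>a b c. a \<in> J \<Longrightarrow> b \<in> J \<Longrightarrow> c \<in> J \<Longrightarrow> \<bar>h a b c\<bar> \<le> M * max \<bar>b - a\<bar> \<bar>c - b\<bar> powr z"
  shows "sewable z M h"
  using assms unfolding sewable_def by (intro conjI exI[of _ g] ballI) auto

lemma sewable_mono:
  assumes "sewable z M h" "M \<le> M'"
  shows "sewable z M' h"
proof -
  have "M * max \<bar>b - a\<bar> \<bar>c - b\<bar> powr z \<le> M' * max \<bar>b - a\<bar> \<bar>c - b\<bar> powr z" for a b c :: real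
    using assms(2) by (intro mult_right_mono) auto
  then show ?thesis using assms(1) unfolding sewable_def by (meson order_trans)
qed

lemma seqs_mem: "s \<in> seqs \<Longrightarrow> 0 \<le> s i \<and> s i \<le> 1"
  by (auto simp: seqs_def)

lemma maps_into_pair:
  "maps_into (J \<times> J) fst" "maps_into (J \<times> J) snd"
  by (auto simp: maps_into_def intro!: continuous_intros)

lemma maps_into_fst_comp:
  "maps_into T f \<Longrightarrow> maps_into (T \<times> X) (\<lambda>p. f (fst p))"
  unfolding maps_into_def
  by (auto intro!: continuous_on_compose2[of T f] continuous_on_fst continuous_on_id)

lemma continuous_on_sew_compose:
  fixes T :: "'p::topological_space set"
  assumes sw: "\<And>q. q \<in> T \<Longrightarrow> sewable z M (h q)"
    and cont: "continuous_on (T \<times> J \<times> J \<times> J)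
       (\<lambda>p. h (fst p) (fst (snd p)) (fst (snd (snd p))) (snd (snd (snd p))))"
    and ab: "maps_into T a" "maps_into T b"
  shows "continuous_on T (\<lambda>q. sew (h q) (a q) (b q))"
proof -
  have "continuous_on (T \<times> J \<times> J) (\<lambda>(q, a, b). sew (h q) a b)"
    using sw cont by (intro continuous_on_sew[where z = z and M = M]) (auto simp: split_def)
  moreover have "continuous_on T (\<lambda>q. (q, a q, b q))"
    using ab by (auto simp: maps_into_def intro!: continuous_intros)
  moreover have "(\<lambda>q. (q, a q, b q)) ` T \<subseteq> T \<times> J \<times> J" using ab by (auto simp: maps_into_def)
  ultimately have "continuous_on T (\<lambda>q. (\<lambda>(q, a, b). sew (h q) a b) (q, a q, b q))"
    by (rule continuous_on_compose2)
  then show ?thesis by simp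
qed

lemma maps_into_snd:
  "maps_into (T \<times> J \<times> J \<times> J) (\<lambda>p. fst (snd p))"
  "maps_into (T \<times> J \<times> J \<times> J) (\<lambda>p. fst (snd (snd p)))"
  "maps_into (T \<times> J \<times> J \<times> J) (\<lambda>p. snd (snd (snd p)))"
  by (auto simp: maps_into_def intro!: continuous_intros)

text \<open>
  \<open>\<Lambda>\<^sub>1\<close> acts for each \<open>(t\<^sub>1, t\<^sub>2)\<close> separately.  The constant of the bound may depend on them, since the
  regularity in \<open>t\<close> of the result is read off from it; its boundedness by \<open>K\<close> gives joint continuity.
\<close>

lemma Lam_properties:
  assumes z: "z > 1" and g: "ccont 2 2 g"
    and h': "\<forall>s1\<in>J. \<forall>s2\<in>J. \<forall>s3\<in>J. \<forall>t1\<in>J. \<forall>t2\<in>J.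
       h [s1, s2, s3] [t1, t2] = g [s1, s3] [t1, t2] - g [s1, s2] [t1, t2] - g [s2, s3] [t1, t2]"
    and M': "\<forall>s1\<in>J. \<forall>s2\<in>J. \<forall>s3\<in>J. \<forall>t1\<in>J. \<forall>t2\<in>J.
       \<bar>h [s1, s2, s3] [t1, t2]\<bar> \<le> M t1 t2 * max \<bar>s2 - s1\<bar> \<bar>s3 - s2\<bar> powr z"
    and K': "\<forall>t1\<in>J. \<forall>t2\<in>J.
       M t1 t2 \<le> K"
  shows "ccont 2 2 (Lam Dir1 h)"
    and "\<lbrakk>s1 \<in> J; s2 \<in> J; s3 \<in> J; t1 \<in> J; t2 \<in> J\<rbrakk> \<Longrightarrow> Lam Dir1 h [s1, s3] [t1, t2]
        - Lam Dir1 h [s1, s2] [t1, t2] - Lam Dir1 h [s2, s3] [t1, t2] = h [s1, s2, s3] [t1, t2]"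
    and "\<lbrakk>s1 \<in> J; s2 \<in> J; t1 \<in> J; t2 \<in> J\<rbrakk> \<Longrightarrow>
        \<bar>Lam Dir1 h [s1, s2] [t1, t2]\<bar> \<le> sewing_const z * M t1 t2 * pw z s1 s2"
proof -
  note h = h'[rule_format]
  note M = M'[rule_format]
  note K = K'[rule_format]
  have sw: "sewable z (M t1 t2) (\<lambda>r1 r2 r3. h [r1, r2, r3] [t1, t2])" if "t1 \<in> J" "t2 \<in> J" for t1 t2
  proof (rule sewableI[OF z, of "\<lambda>a b. g [a, b] [t1, t2]"])
    show "continuous_on (J \<times> J) (\<lambda>(a, b). g [a, b] [t1, t2])"
      unfolding split_def using that by (intro ccont_compose_intros(3)[OF g] maps_into_pair) auto
  qed (use h M that in auto)
  show "\<lbrakk>s1 \<in> J; s2 \<in> J; s3 \<in> J; t1 \<in> J; t2 \<in> J\<rbrakk> \<Longrightarrow> Lam Dir1 h [s1, s3] [t1, t2]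
        - Lam Dir1 h [s1, s2] [t1, t2] - Lam Dir1 h [s2, s3] [t1, t2] = h [s1, s2, s3] [t1, t2]"
    using sew_coboundary[OF sw] by (simp add: Lam_def)
  show "\<lbrakk>s1 \<in> J; s2 \<in> J; t1 \<in> J; t2 \<in> J\<rbrakk> \<Longrightarrow>
        \<bar>Lam Dir1 h [s1, s2] [t1, t2]\<bar> \<le> sewing_const z * M t1 t2 * pw z s1 s2"
    using sew_bound[OF sw] by (simp add: Lam_def pw_def)
  have "ccont 3 2 h"
  proof (rule ccont_cong)
    show "ccont 3 2 (\<lambda>ss ts. g [ss ! 0, ss ! 2] ts - g [ss ! 0, ss ! 1] ts - g [ss ! 1, ss ! 2] ts)"
      unfolding ccont_unfold by (auto intro!: continuous_intros ccont_compose_intros(3)[OF g])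
    have "\<forall>ss\<in>cube 3. \<forall>ts\<in>cube 2. h ss ts = g [ss ! 0, ss ! 2] ts - g [ss ! 0, ss ! 1] ts - g [ss ! 1, ss ! 2] ts"
      unfolding ball_cube using h by (simp add: numeral_2_eq_2)
    then show "\<And>ss ts. ss \<in> cube 3 \<Longrightarrow> ts \<in> cube 2 \<Longrightarrow>
      h ss ts = g [ss ! 0, ss ! 2] ts - g [ss ! 0, ss ! 1] ts - g [ss ! 1, ss ! 2] ts" by blast
  qed
  then have "continuous_on ((seqs \<times> seqs) \<times> J \<times> J \<times> J) (\<lambda>p :: ((nat \<Rightarrow> real) \<times> (nat \<Rightarrow> real)) \<times> real \<times> real \<times> real.
     h [fst (snd p), fst (snd (snd p)), snd (snd (snd p))] [snd (fst p) 0, snd (fst p) 1])"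
    by (intro ccont_compose_intros(4) maps_into_snd
        maps_into_fst_comp[OF maps_into_coord(1)] maps_into_fst_comp[OF maps_into_coord(2)])
  then have "continuous_on (seqs \<times> seqs) (\<lambda>p. sew (\<lambda>r1 r2 r3. h [r1, r2, r3] [snd p 0, snd p 1])
     (fst p 0) (fst p 1))"
    by (intro continuous_on_sew_compose[where M = K and z = z
          and h = "\<lambda>p r1 r2 r3. h [r1, r2, r3] [snd p 0, snd p 1]"])
       (auto intro!: sewable_mono[OF sw] K simp: seqs_mem)
  then show "ccont 2 2 (Lam Dir1 h)" unfolding ccont_unfold by (simp add: Lam_def)
qed

text \<open>
  The same for \<open>\<Lambda>\<^sub>1 \<otimes>\<^sub>1 1\<close>, where the second pair of variables \<open>s\<close> consists of parameters as well.
\<close>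

lemma LamL_properties:
  assumes z: "z > 1" and g: "ccont 4 2 g"
    and h': "\<forall>s1\<in>J. \<forall>s2\<in>J. \<forall>s3\<in>J. \<forall>s4\<in>J. \<forall>s5\<in>J. \<forall>t1\<in>J. \<forall>t2\<in>J.
       h [s1, s2, s3, s4, s5] [t1, t2] =
         g [s1, s3, s4, s5] [t1, t2] - g [s1, s2, s4, s5] [t1, t2] - g [s2, s3, s4, s5] [t1, t2]"
    and M': "\<forall>s1\<in>J. \<forall>s2\<in>J. \<forall>s3\<in>J. \<forall>s4\<in>J. \<forall>s5\<in>J. \<forall>t1\<in>J. \<forall>t2\<in>J.
       \<bar>h [s1, s2, s3, s4, s5] [t1, t2]\<bar> \<le> M s4 s5 t1 t2 * max \<bar>s2 - s1\<bar> \<bar>s3 - s2\<bar> powr z"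
    and K': "\<forall>s4\<in>J. \<forall>s5\<in>J. \<forall>t1\<in>J. \<forall>t2\<in>J.
       M s4 s5 t1 t2 \<le> K"
  shows "ccont 4 2 (LamL Dir1 h)"
    and "\<lbrakk>s1 \<in> J; s2 \<in> J; s3 \<in> J; s4 \<in> J; s5 \<in> J; t1 \<in> J; t2 \<in> J\<rbrakk> \<Longrightarrow>
        LamL Dir1 h [s1, s3, s4, s5] [t1, t2] - LamL Dir1 h [s1, s2, s4, s5] [t1, t2]
        - LamL Dir1 h [s2, s3, s4, s5] [t1, t2] = h [s1, s2, s3, s4, s5] [t1, t2]"
    and "\<lbrakk>s1 \<in> J; s2 \<in> J; s4 \<in> J; s5 \<in> J; t1 \<in> J; t2 \<in> J\<rbrakk> \<Longrightarrow>
        \<bar>LamL Dir1 h [s1, s2, s4, s5] [t1, t2]\<bar> \<le> sewing_const z * M s4 s5 t1 t2 * pw z s1 s2"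
proof -
  note h = h'[rule_format]
  note M = M'[rule_format]
  note K = K'[rule_format]
  have sw: "sewable z (M s4 s5 t1 t2) (\<lambda>r1 r2 r3. h [r1, r2, r3, s4, s5] [t1, t2])"
    if "s4 \<in> J" "s5 \<in> J" "t1 \<in> J" "t2 \<in> J" for s4 s5 t1 t2
  proof (rule sewableI[OF z, of "\<lambda>a b. g [a, b, s4, s5] [t1, t2]"])
    show "continuous_on (J \<times> J) (\<lambda>(a, b). g [a, b, s4, s5] [t1, t2])"
      unfolding split_def using that by (intro ccont_compose_intros(6)[OF g] maps_into_pair) auto
  qed (use h M that in auto)
  show "\<lbrakk>s1 \<in> J; s2 \<in> J; s3 \<in> J; s4 \<in> J; s5 \<in> J; t1 \<in> J; t2 \<in> J\<rbrakk> \<Longrightarrow>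
        LamL Dir1 h [s1, s3, s4, s5] [t1, t2] - LamL Dir1 h [s1, s2, s4, s5] [t1, t2]
        - LamL Dir1 h [s2, s3, s4, s5] [t1, t2] = h [s1, s2, s3, s4, s5] [t1, t2]"
    using sew_coboundary[OF sw] by (simp add: LamL_def)
  show "\<lbrakk>s1 \<in> J; s2 \<in> J; s4 \<in> J; s5 \<in> J; t1 \<in> J; t2 \<in> J\<rbrakk> \<Longrightarrow>
        \<bar>LamL Dir1 h [s1, s2, s4, s5] [t1, t2]\<bar> \<le> sewing_const z * M s4 s5 t1 t2 * pw z s1 s2"
    using sew_bound[OF sw] by (simp add: LamL_def pw_def)
  have "ccont 5 2 h"
  proof (rule ccont_cong)
    show "ccont 5 2 (\<lambda>ss ts. g [ss ! 0, ss ! 2, ss ! 3, ss ! 4] ts - g [ss ! 0, ss ! 1, ss ! 3, ss ! 4] ts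
       - g [ss ! 1, ss ! 2, ss ! 3, ss ! 4] ts)"
      unfolding ccont_unfold by (auto intro!: continuous_intros ccont_compose_intros(6)[OF g])
    have "\<forall>ss\<in>cube 5. \<forall>ts\<in>cube 2. h ss ts =
       g [ss ! 0, ss ! 2, ss ! 3, ss ! 4] ts - g [ss ! 0, ss ! 1, ss ! 3, ss ! 4] ts
       - g [ss ! 1, ss ! 2, ss ! 3, ss ! 4] ts"
      unfolding ball_cube using h by simp
    then show "\<And>ss ts. ss \<in> cube 5 \<Longrightarrow> ts \<in> cube 2 \<Longrightarrow> h ss ts =
       g [ss ! 0, ss ! 2, ss ! 3, ss ! 4] ts - g [ss ! 0, ss ! 1, ss ! 3, ss ! 4] ts
       - g [ss ! 1, ss ! 2, ss ! 3, ss ! 4] ts" by blast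
  qed
  then have "continuous_on ((seqs \<times> seqs) \<times> J \<times> J \<times> J) (\<lambda>p :: ((nat \<Rightarrow> real) \<times> (nat \<Rightarrow> real)) \<times> real \<times> real \<times> real.
     h [fst (snd p), fst (snd (snd p)), snd (snd (snd p)), fst (fst p) 2, fst (fst p) 3]
       [snd (fst p) 0, snd (fst p) 1])"
    by (intro ccont_compose_intros(8) maps_into_snd
        maps_into_fst_comp[OF maps_into_coord(1)] maps_into_fst_comp[OF maps_into_coord(2)])
  then have "continuous_on (seqs \<times> seqs)
     (\<lambda>p. sew (\<lambda>r1 r2 r3. h [r1, r2, r3, fst p 2, fst p 3] [snd p 0, snd p 1]) (fst p 0) (fst p 1))"
    by (intro continuous_on_sew_compose[where M = K and z = z
          and h = "\<lambda>p r1 r2 r3. h [r1, r2, r3, fst p 2, fst p 3] [snd p 0, snd p 1]"])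
       (auto intro!: sewable_mono[OF sw] K simp: seqs_mem)
  then show "ccont 4 2 (LamL Dir1 h)" unfolding ccont_unfold by (simp add: LamL_def)
qed

lemma ccont_ddelta:
  assumes g: "ccont 2 2 g"
  shows "ccont 3 3 (\<lambda>ss ts. ddelta g [ss ! 0, ss ! 1, ss ! 2] [ts ! 0, ts ! 1, ts ! 2])"
  unfolding ccont_unfold by (auto intro!: continuous_intros ccont_compose_intros(3)[OF g])

text \<open>
  Sewing in \<open>t\<close> leaves a function of \<open>(s\<^sub>1, s\<^sub>2, s\<^sub>3)\<close> that is closed in direction 1, because its image under
  \<open>\<delta>\<^sub>2\<close> is and \<open>\<delta>\<^sub>2\<close> determines functions of exponent \<open>> 1\<close>.  It is therefore exact and can be sewn in \<open>s\<close>.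
\<close>

lemma Lam12_properties:
  assumes z: "z1 > 1" "z2 > 1" and g: "ccont 2 2 g"
    and h': "\<forall>s1\<in>J. \<forall>s2\<in>J. \<forall>s3\<in>J. \<forall>t1\<in>J. \<forall>t2\<in>J. \<forall>t3\<in>J.
       h [s1, s2, s3] [t1, t2, t3] = ddelta g [s1, s2, s3] [t1, t2, t3]"
    and K': "\<forall>s1\<in>J. \<forall>s2\<in>J. \<forall>s3\<in>J. \<forall>t1\<in>J. \<forall>t2\<in>J. \<forall>t3\<in>J.
       \<bar>h [s1, s2, s3] [t1, t2, t3]\<bar>
       \<le> K * max \<bar>s2 - s1\<bar> \<bar>s3 - s2\<bar> powr z1 * max \<bar>t2 - t1\<bar> \<bar>t3 - t2\<bar> powr z2"
  shows "holder22 z1 z2 (Lam12 h)"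
    and "\<lbrakk>s1 \<in> J; s2 \<in> J; s3 \<in> J; t1 \<in> J; t2 \<in> J; t3 \<in> J\<rbrakk> \<Longrightarrow>
        ddelta (Lam12 h) [s1, s2, s3] [t1, t2, t3] = h [s1, s2, s3] [t1, t2, t3]"
proof -
  note h = h'[rule_format]
  note K = K'[rule_format]
  let ?L = "Lam Dir2 h"
  let ?m = "\<lambda>a b c :: real. max \<bar>b - a\<bar> \<bar>c - b\<bar>"
  define c where "c s1 s2 s3 t1 t2 = g [s1, s3] [t1, t2] - g [s1, s2] [t1, t2] - g [s2, s3] [t1, t2]"
    for s1 s2 s3 t1 t2
  have hc: "h [s1, s2, s3] [t1, t2, t3] = c s1 s2 s3 t1 t3 - c s1 s2 s3 t1 t2 - c s1 s2 s3 t2 t3"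
    if "s1 \<in> J" "s2 \<in> J" "s3 \<in> J" "t1 \<in> J" "t2 \<in> J" "t3 \<in> J" for s1 s2 s3 t1 t2 t3
    using h[OF that] by (simp add: c_def)
  have K0: "K \<ge> 0" using K[of 0 0 1 0 0 1] by simp
  have m1: "?m a b c powr z1 \<le> 1" if "a \<in> J" "b \<in> J" "c \<in> J" for a b c
    using that z by (intro powr_le1) auto
  have sw: "sewable z2 (K * ?m s1 s2 s3 powr z1) (\<lambda>r1 r2 r3. h [s1, s2, s3] [r1, r2, r3])"
    if "s1 \<in> J" "s2 \<in> J" "s3 \<in> J" for s1 s2 s3
  proof (rule sewableI[OF z(2), of "c s1 s2 s3"])
    show "continuous_on (J \<times> J) (\<lambda>(a, b). c s1 s2 s3 a b)"
      unfolding split_def c_def using that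
      by (intro continuous_intros ccont_compose_intros(3)[OF g] maps_into_pair) auto
  qed (use hc K that in auto)
  have swK: "sewable z2 K (\<lambda>r1 r2 r3. h [s1, s2, s3] [r1, r2, r3])"
    if "s1 \<in> J" "s2 \<in> J" "s3 \<in> J" for s1 s2 s3
    using sw[OF that] by (rule sewable_mono) (use m1[OF that] K0 in \<open>auto intro: mult_left_le\<close>)
  have L: "?L [s1, s2, s3] [t1, t2] = sew (\<lambda>r1 r2 r3. h [s1, s2, s3] [r1, r2, r3]) t1 t2"
    for s1 s2 s3 t1 t2 by (simp add: Lam_def)
  have Ld: "?L [s1, s2, s3] [t1, t3] - ?L [s1, s2, s3] [t1, t2] - ?L [s1, s2, s3] [t2, t3]
      = h [s1, s2, s3] [t1, t2, t3]"
    if "s1 \<in> J" "s2 \<in> J" "s3 \<in> J" "t1 \<in> J" "t2 \<in> J" "t3 \<in> J" for s1 s2 s3 t1 t2 t3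
    using sew_coboundary[OF sw] that by (simp add: L)
  have Lb: "\<bar>?L [s1, s2, s3] [t1, t2]\<bar> \<le> sewing_const z2 * K * pw z2 t1 t2 * ?m s1 s2 s3 powr z1"
    if "s1 \<in> J" "s2 \<in> J" "s3 \<in> J" "t1 \<in> J" "t2 \<in> J" for s1 s2 s3 t1 t2
    using sew_bound[OF sw] that by (simp add: L pw_def algebra_simps)
  have c3: "ccont 3 3 h"
  proof (rule ccont_cong)
    let ?h = "\<lambda>ss ts. ddelta g [ss ! 0, ss ! 1, ss ! 2] [ts ! 0, ts ! 1, ts ! 2]"
    show "ccont 3 3 ?h" by (rule ccont_ddelta[OF g])
    have "\<forall>ss\<in>cube 3. \<forall>ts\<in>cube 3. h ss ts = ?h ss ts"
      unfolding ball_cube using h by (simp add: numeral_2_eq_2)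
    then show "\<And>ss ts. ss \<in> cube 3 \<Longrightarrow> ts \<in> cube 3 \<Longrightarrow> h ss ts = ?h ss ts" by blast
  qed
  have "continuous_on ((seqs \<times> seqs) \<times> J \<times> J \<times> J) (\<lambda>p :: ((nat \<Rightarrow> real) \<times> (nat \<Rightarrow> real)) \<times> real \<times> real \<times> real.
     h [fst (fst p) 0, fst (fst p) 1, fst (fst p) 2] [fst (snd p), fst (snd (snd p)), snd (snd (snd p))])"
    by (intro ccont_compose_intros(5)[OF c3] maps_into_snd
        maps_into_fst_comp[OF maps_into_coord(1)] maps_into_fst_comp[OF maps_into_coord(2)])
  then have "continuous_on (seqs \<times> seqs)
     (\<lambda>p. sew (\<lambda>r1 r2 r3. h [fst p 0, fst p 1, fst p 2] [r1, r2, r3]) (snd p 0) (snd p 1))"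
    by (intro continuous_on_sew_compose[where M = K and z = z2
          and h = "\<lambda>p r1 r2 r3. h [fst p 0, fst p 1, fst p 2] [r1, r2, r3]"])
       (auto intro!: swK simp: seqs_mem)
  then have cL: "ccont 3 2 ?L" unfolding ccont_unfold L .
  \<comment> \<open>Closedness in direction 1, as the value of a closed function in terms of the base point \<open>0\<close>.\<close>
  have closed: "?L [s1, s2, s3] [t1, t2] =
      - ?L [0, s1, s3] [t1, t2] + ?L [0, s1, s2] [t1, t2] + ?L [0, s2, s3] [t1, t2]"
    if s: "s1 \<in> J" "s2 \<in> J" "s3 \<in> J" and t: "t1 \<in> J" "t2 \<in> J" for s1 s2 s3 t1 t2
  proof (rule coboundary_unique[OF z(2) z(2), where f = "\<lambda>a b. ?L [s1, s2, s3] [a, b]"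
        and g = "\<lambda>a b. - ?L [0, s1, s3] [a, b] + ?L [0, s1, s2] [a, b] + ?L [0, s2, s3] [a, b]"])
    fix a b :: real assume ab: "a \<in> J" "b \<in> J"
    have J0: "(0::real) \<in> J" by simp
    have Lb': "\<bar>?L [u1, u2, u3] [a, b]\<bar> \<le> sewing_const z2 * K * pw z2 a b"
      if "u1 \<in> J" "u2 \<in> J" "u3 \<in> J" for u1 u2 u3
    proof -
      have "sewing_const z2 * K * pw z2 a b * ?m u1 u2 u3 powr z1 \<le> sewing_const z2 * K * pw z2 a b * 1"
        using m1[OF that] K0 sewing_const_pos[OF z(2)] by (intro mult_left_mono) auto
      then show ?thesis using Lb[OF that ab] by linarith
    qed
    show "\<bar>?L [s1, s2, s3] [a, b]\<bar> \<le> (sewing_const z2 * K) * \<bar>b - a\<bar> powr z2"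
      using Lb'[OF s] by (simp add: pw_def)
    show "\<bar>- ?L [0, s1, s3] [a, b] + ?L [0, s1, s2] [a, b] + ?L [0, s2, s3] [a, b]\<bar>
        \<le> (3 * (sewing_const z2 * K)) * \<bar>b - a\<bar> powr z2"
      using Lb'[OF J0 s(1,3)] Lb'[OF J0 s(1,2)] Lb'[OF J0 s(2,3)] by (simp add: pw_def)
  next
    fix a b d :: real assume abc: "a \<in> J" "b \<in> J" "d \<in> J"
    have J0: "(0::real) \<in> J" by simp
    show "?L [s1, s2, s3] [a, d] - ?L [s1, s2, s3] [a, b] - ?L [s1, s2, s3] [b, d] =
      - ?L [0, s1, s3] [a, d] + ?L [0, s1, s2] [a, d] + ?L [0, s2, s3] [a, d]
      - (- ?L [0, s1, s3] [a, b] + ?L [0, s1, s2] [a, b] + ?L [0, s2, s3] [a, b])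
      - (- ?L [0, s1, s3] [b, d] + ?L [0, s1, s2] [b, d] + ?L [0, s2, s3] [b, d])"
      using Ld[OF s abc] Ld[OF J0 s(1,3) abc] Ld[OF J0 s(1,2) abc] Ld[OF J0 s(2,3) abc]
        hc[OF s abc] hc[OF J0 s(1,3) abc] hc[OF J0 s(1,2) abc] hc[OF J0 s(2,3) abc]
      unfolding c_def by linarith
  qed (use t in auto)
  define G where "G ss ts = - ?L (0 # ss) ts" for ss ts
  have cG: "ccont 2 2 G"
    unfolding ccont_unfold G_def
    by (intro continuous_intros ccont_compose_intros(4)[OF cL]) auto
  have LG: "\<forall>s1\<in>J. \<forall>s2\<in>J. \<forall>s3\<in>J. \<forall>t1\<in>J. \<forall>t2\<in>J.
      ?L [s1, s2, s3] [t1, t2] = G [s1, s3] [t1, t2] - G [s1, s2] [t1, t2] - G [s2, s3] [t1, t2]"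
    using closed by (simp add: G_def del: atLeastAtMost_iff)
  have LB: "\<forall>s1\<in>J. \<forall>s2\<in>J. \<forall>s3\<in>J. \<forall>t1\<in>J. \<forall>t2\<in>J.
      \<bar>?L [s1, s2, s3] [t1, t2]\<bar> \<le> sewing_const z2 * K * pw z2 t1 t2 * ?m s1 s2 s3 powr z1"
    using Lb by blast
  have bK: "\<forall>t1\<in>J. \<forall>t2\<in>J. sewing_const z2 * K * pw z2 t1 t2 \<le> sewing_const z2 * K"
    using pw_le_1[of z2] z K0 sewing_const_pos[OF z(2)] by (intro ballI mult_left_le) auto
  note P = Lam_properties[OF z(1) cG LG LB bK]
  have "\<bar>Lam12 h [s1, s2] [t1, t2]\<bar> \<le> (sewing_const z1 * (sewing_const z2 * K)) * (pw z1 s1 s2 * pw z2 t1 t2)"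
    if "s1 \<in> J" "s2 \<in> J" "t1 \<in> J" "t2 \<in> J" for s1 s2 t1 t2
    using P(3)[OF that] by (simp add: Lam12_def algebra_simps)
  then show "holder22 z1 z2 (Lam12 h)"
    unfolding holder22_def using P(1) K0 sewing_const_pos[OF z(1)] sewing_const_pos[OF z(2)]
    by (intro conjI exI[of _ "sewing_const z1 * (sewing_const z2 * K)"]) (auto simp: Lam12_def)
  assume s: "s1 \<in> J" "s2 \<in> J" "s3 \<in> J" and t: "t1 \<in> J" "t2 \<in> J" "t3 \<in> J"
  then show "ddelta (Lam12 h) [s1, s2, s3] [t1, t2, t3] = h [s1, s2, s3] [t1, t2, t3]"
    using P(2)[OF s t(1,3)] P(2)[OF s t(1,2)] P(2)[OF s t(2,3)] Ld[OF s t]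
    by (simp add: Lam12_def)
qed

section \<open>Boundary integrals in one direction\<close>

text \<open>
  The boundary integrals in direction 1 as functions of their constituents.  The pair \<open>(A, B)\<close> may be
  \<open>(A\<^sup>w, B\<^sub>1\<^bsup>xw\<^esup>)\<close> or \<open>(D\<^sub>1\<^bsup>wu\<^esup>, E\<^sub>1\<^bsup>xwu\<^esup>)\<close>: both satisfy the same relations in the first variables \<open>s\<close>.
\<close>

definition bint_arg1 :: "cochain \<Rightarrow> cochain \<Rightarrow> cochain \<Rightarrow> cochain \<Rightarrow> cochain" where
  "bint_arg1 yd yr A B = cprod Dir1 2 1 yr A + cprod Dir1 2 1 (delta1 yd) B"

definition bint1 :: "cochain \<Rightarrow> cochain \<Rightarrow> cochain \<Rightarrow> cochain \<Rightarrow> cochain \<Rightarrow> cochain" where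
  "bint1 y yd yr A B = cprod Dir1 1 1 y A + cprod Dir1 1 1 yd B + Lam Dir1 (bint_arg1 yd yr A B)"

definition bint2_arg1 ::
  "cochain \<Rightarrow> cochain \<Rightarrow> cochain \<Rightarrow> cochain \<Rightarrow> cochain \<Rightarrow> cochain \<Rightarrow> cochain" where
  "bint2_arg1 y yd yr C D E = cprod Dir1 2 1 (delta1 y) C + cprod Dir1 1 1 yd (mu Dir1 E)
     + mu Dir1 (LamL Dir1 (bint_arg1 yd yr D E))"

definition bint21 ::
  "cochain \<Rightarrow> cochain \<Rightarrow> cochain \<Rightarrow> cochain \<Rightarrow> cochain \<Rightarrow> cochain \<Rightarrow> cochain" where
  "bint21 y yd yr C D E = cprod Dir1 1 1 y C + Lam Dir1 (bint2_arg1 y yd yr C D E)"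

lemma orient_plus: "orient a (g + h) = orient a g + orient a h"
  by (cases a) (auto simp: fun_eq_iff)

lemma orient_cprod: "orient a (cprod a n m g h) = cprod Dir1 n m (orient a g) (orient a h)"
  by (simp add: cprod_def)

lemma orient_Lam: "orient a (Lam a h) = Lam Dir1 (orient a h)"
  by (simp add: Lam_def)

lemma orient_LamL: "orient a (LamL a h) = LamL Dir1 (orient a h)"
  by (simp add: LamL_def)

lemma orient_mu: "orient a (mu a h) = mu Dir1 (orient a h)"
  by (simp add: mu_def)

lemmas orient_simps = orient_plus orient_cprod orient_Lam orient_LamL orient_mu orient_delta

lemma orient_bint_arg: "orient a (bint_arg R a Y u) =
    bint_arg1 (orient a (cder Y a)) (orient a (crem Y a)) (orient a (rA R u)) (orient a (rB R a u))"
  by (simp add: bint_arg_def bint_arg1_def orient_simps)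

lemma orient_bint: "orient a (bint R a Y u) = bint1 (orient a (cfun Y)) (orient a (cder Y a))
    (orient a (crem Y a)) (orient a (rA R u)) (orient a (rB R a u))"
  by (simp add: bint_def bint1_def orient_simps orient_bint_arg)

lemma orient_bint2_inner: "orient a (bint2_inner R a Y u v) =
    bint_arg1 (orient a (cder Y a)) (orient a (crem Y a)) (orient a (rD R a u v)) (orient a (rE R a u v))"
  by (simp add: bint2_inner_def bint_arg1_def orient_simps)

lemma orient_bint2_arg: "orient a (bint2_arg R a Y u v) = bint2_arg1 (orient a (cfun Y))
    (orient a (cder Y a)) (orient a (crem Y a)) (orient a (rC R u v)) (orient a (rD R a u v))
    (orient a (rE R a u v))"
  by (simp add: bint2_arg_def bint2_arg1_def orient_simps orient_bint2_inner)

lemma orient_bint2: "orient a (bint2 R a Y u v) = bint21 (orient a (cfun Y))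
    (orient a (cder Y a)) (orient a (crem Y a)) (orient a (rC R u v)) (orient a (rD R a u v))
    (orient a (rE R a u v))"
  by (simp add: bint2_def bint21_def orient_simps orient_bint2_arg)

lemma bint_arg1_apply [simp]:
  "bint_arg1 yd yr A B [s1, s2, s3] [t1, t2] =
     yr [s1, s2] [t1] * A [s2, s3] [t1, t2] + (yd [s2] [t1] - yd [s1] [t1]) * B [s2, s3] [t1, t2]"
  "bint_arg1 yd yr D E [s1, s2, s3, s4, s5] [t1, t2] =
     yr [s1, s2] [t1] * D [s2, s3, s4, s5] [t1, t2]
     + (yd [s2] [t1] - yd [s1] [t1]) * E [s2, s3, s4, s5] [t1, t2]"
  by (simp_all add: bint_arg1_def cprod_def)

lemma bint1_apply:
  "bint1 y yd yr A B [s1, s2] [t1, t2] = y [s1] [t1] * A [s1, s2] [t1, t2]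
     + yd [s1] [t1] * B [s1, s2] [t1, t2] + Lam Dir1 (bint_arg1 yd yr A B) [s1, s2] [t1, t2]"
  by (simp add: bint1_def cprod_def)

lemma bint2_arg1_apply:
  "bint2_arg1 y yd yr C D E [s1, s2, s3] [t1, t2] =
     (y [s2] [t1] - y [s1] [t1]) * C [s2, s3] [t1, t2] + yd [s1] [t1] * E [s1, s2, s2, s3] [t1, t2]
     + LamL Dir1 (bint_arg1 yd yr D E) [s1, s2, s2, s3] [t1, t2]"
  by (simp add: bint2_arg1_def cprod_def mu_def numeral_2_eq_2)

lemma bint21_apply:
  "bint21 y yd yr C D E [s1, s2] [t1, t2] = y [s1] [t1] * C [s1, s2] [t1, t2]
     + Lam Dir1 (bint2_arg1 y yd yr C D E) [s1, s2] [t1, t2]"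
  by (simp add: bint21_def cprod_def)

lemma abs_mult_le: "\<bar>a\<bar> \<le> A \<Longrightarrow> \<bar>b\<bar> \<le> B \<Longrightarrow> \<bar>a * b\<bar> \<le> A * (B :: real)"
  unfolding abs_mult by (intro mult_mono) auto

text \<open>
  The products in \<open>\<delta>\<^sub>1\<close> of a controlled expression pair a factor of exponent \<open>2p\<close> with one of exponent \<open>p\<close>,
  in either order.
\<close>

definition sym_weight :: "real \<Rightarrow> real \<Rightarrow> real \<Rightarrow> real \<Rightarrow> real" where
  "sym_weight p a b c = pw (2 * p) a b * pw p b c + pw p a b * pw (2 * p) b c"

lemma sym_weight_nonneg [simp]: "0 \<le> sym_weight p a b c"
  by (simp add: sym_weight_def)

lemma sym_weight_le_max:
  assumes "p > 0"
  shows "sym_weight p a b c \<le> 2 * max \<bar>b - a\<bar> \<bar>c - b\<bar> powr (3 * p)"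
  using pw_mult_le_max[of "2 * p" p a b c] pw_mult_le_max[of p "2 * p" a b c] assms
  by (simp add: sym_weight_def)

lemma dominated_sym_weight:
  assumes p: "p > 0" and k: "k \<ge> 3" and C: "C \<ge> 0"
    and le: "\<And>ss ts. ss \<in> cube k \<Longrightarrow> ts \<in> cube l \<Longrightarrow>
       \<bar>h ss ts\<bar> \<le> C * sym_weight p (ss ! 0) (ss ! 1) (ss ! 2)"
  shows "dominated (weights1 (3 * p)) k l h"
proof -
  note W = weights_weights1[OF k, of "3 * p" l]
  let ?w1 = "\<lambda>ss ts :: real list. pw (2 * p) (ss ! 0) (ss ! 1) * pw (3 * p - 2 * p) (ss ! 1) (ss ! 2)"
  let ?w2 = "\<lambda>ss ts :: real list. pw p (ss ! 0) (ss ! 1) * pw (3 * p - p) (ss ! 1) (ss ! 2)"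
  have "?w1 \<in> weights1 (3 * p)" unfolding weights1_def mem_Collect_eq
    using p by (intro exI[of _ "2 * p"]) auto
  then have d1: "dominated (weights1 (3 * p)) k l ?w1"
    by (rule dominated_single[OF W, where C = 1]) auto
  have "?w2 \<in> weights1 (3 * p)" unfolding weights1_def mem_Collect_eq
    using p by (intro exI[of _ p]) auto
  then have d2: "dominated (weights1 (3 * p)) k l ?w2"
    by (rule dominated_single[OF W, where C = 1]) auto
  have "dominated (weights1 (3 * p)) k l (\<lambda>ss ts. sym_weight p (ss ! 0) (ss ! 1) (ss ! 2))"
    by (rule dominated_add[OF W d1 d2]) (simp add: sym_weight_def)
  then show ?thesis by (rule dominated_mono[OF W _ C]) (use le in simp)
qed

lemma total_weight_facts:
  assumes "total_weight z W" "a \<in> J" "b \<in> J" "c \<in> J"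
  shows "W a b c \<ge> 0"
proof -
  obtain K \<rho> where K: "summable K" "\<And>i :: nat. 0 \<le> K i \<and> 0 < \<rho> i \<and> \<rho> i < z"
    "W a b c = (\<Sum>i. K i * (pw (\<rho> i) a b * pw (z - \<rho> i) b c))"
    using assms unfolding total_weight_def by blast
  have "summable (\<lambda>i. K i * (pw (\<rho> i) a b * pw (z - \<rho> i) b c))"
  proof (rule summable_comparison_test'[OF K(1)])
    fix i
    have "pw (\<rho> i) a b * pw (z - \<rho> i) b c \<le> 1"
      using K(2)[of i] assms by (intro pw_pw_le_1) auto
    then show "norm (K i * (pw (\<rho> i) a b * pw (z - \<rho> i) b c)) \<le> K i"
      using K(2)[of i] mult_left_le by fastforce
  qed
  then show ?thesis unfolding K(3) using K(2) by (intro suminf_nonneg) auto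
qed

text \<open>
  Used for terms containing \<open>F\<close>, whose exponents in \<open>t\<close> vary over a sequence.
\<close>

lemma dominated_product_weight:
  assumes W: "total_weight z2 W" and \<rho>: "0 < \<rho>" "\<rho> < z1"
  shows "dominated (weights2 z1 z2) 3 3 (\<lambda>ss ts. pw \<rho> (ss ! 0) (ss ! 1)
     * pw (z1 - \<rho>) (ss ! 1) (ss ! 2) * W (ts ! 0) (ts ! 1) (ts ! 2))"
proof -
  obtain K \<sigma> where K: "summable K" "\<And>i :: nat. 0 \<le> K i \<and> 0 < \<sigma> i \<and> \<sigma> i < z2"
    and WK': "\<forall>a\<in>J. \<forall>b\<in>J. \<forall>c\<in>J.
      W a b c = (\<Sum>i. K i * (pw (\<sigma> i) a b * pw (z2 - \<sigma> i) b c))"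
    using W unfolding total_weight_def by blast
  note WK = WK'[rule_format]
  let ?w = "\<lambda>i (ss :: real list) (ts :: real list). pw \<rho> (ss ! 0) (ss ! 1) * pw (z1 - \<rho>) (ss ! 1) (ss ! 2)
     * (pw (\<sigma> i) (ts ! 0) (ts ! 1) * pw (z2 - \<sigma> i) (ts ! 1) (ts ! 2))"
  have w: "?w i \<in> weights2 z1 z2" for i
    unfolding weights2_def using K(2)[of i] \<rho> by blast
  have "\<bar>pw \<rho> (ss ! 0) (ss ! 1) * pw (z1 - \<rho>) (ss ! 1) (ss ! 2) * W (ts ! 0) (ts ! 1) (ts ! 2)\<bar>
      \<le> (\<Sum>i. K i * ?w i ss ts)" if ss: "ss \<in> cube 3" and ts: "ts \<in> cube 3" for ss ts
  proof -
    have t: "ts ! 0 \<in> J" "ts ! 1 \<in> J" "ts ! 2 \<in> J" by (rule cube_nth[OF ts], simp)+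
    let ?c = "pw \<rho> (ss ! 0) (ss ! 1) * pw (z1 - \<rho>) (ss ! 1) (ss ! 2)"
    let ?v = "\<lambda>i. K i * (pw (\<sigma> i) (ts ! 0) (ts ! 1) * pw (z2 - \<sigma> i) (ts ! 1) (ts ! 2))"
    have "summable ?v"
    proof (rule summable_comparison_test'[OF K(1)])
      fix i
      have "pw (\<sigma> i) (ts ! 0) (ts ! 1) * pw (z2 - \<sigma> i) (ts ! 1) (ts ! 2) \<le> 1"
        using K(2)[of i] t by (intro pw_pw_le_1) auto
      then show "norm (?v i) \<le> K i" using K(2)[of i] mult_left_le by fastforce
    qed
    from suminf_mult[OF this, of ?c] have "(\<Sum>i. K i * ?w i ss ts) = ?c * W (ts ! 0) (ts ! 1) (ts ! 2)"
      unfolding WK[OF t] by (simp add: algebra_simps)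
    then show ?thesis using total_weight_facts[OF W t] by (simp add: abs_mult)
  qed
  then show ?thesis unfolding dominated_def using K(1,2) w by (intro exI[of _ K] exI[of _ ?w]) auto
qed

lemma weights2_swap:
  "w \<in> weights2 z1 z2 \<Longrightarrow> (\<lambda>ss ts. w ts ss) \<in> weights2 z2 z1"
proof -
  assume "w \<in> weights2 z1 z2"
  then obtain \<rho> \<sigma> where w: "w = (\<lambda>ss ts. pw \<rho> (ss ! 0) (ss ! 1) * pw (z1 - \<rho>) (ss ! 1) (ss ! 2)
        * (pw \<sigma> (ts ! 0) (ts ! 1) * pw (z2 - \<sigma>) (ts ! 1) (ts ! 2)))"
    "0 < \<rho>" "\<rho> < z1" "0 < \<sigma>" "\<sigma> < z2" unfolding weights2_def by blast
  show ?thesis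
    unfolding weights2_def mem_Collect_eq using w(2-)
    by (intro exI[of _ \<sigma>] exI[of _ \<rho>]) (auto simp: w(1) mult.commute)
qed

lemma dominated_swap:
  "dominated (weights2 z1 z2) 3 3 h \<Longrightarrow> dominated (weights2 z2 z1) 3 3 (\<lambda>ss ts. h ts ss)"
proof -
  assume "dominated (weights2 z1 z2) 3 3 h"
  then obtain K w where K: "summable K" "\<And>i :: nat. 0 \<le> K i \<and> w i \<in> weights2 z1 z2"
    "\<And>ss ts. ss \<in> cube 3 \<Longrightarrow> ts \<in> cube 3 \<Longrightarrow> \<bar>h ss ts\<bar> \<le> (\<Sum>i. K i * w i ss ts)"
    unfolding dominated_def by blast
  then show ?thesis unfolding dominated_def
    by (intro exI[of _ K] exI[of _ "\<lambda>i ss ts. w i ts ss"]) (auto intro: weights2_swap)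
qed

text \<open>
  A controlled path and the data of one boundary integral, oriented such that the boundary integral is in
  direction 1: \<open>p\<close> is the exponent in this direction, \<open>q\<close> the one in the other.  Here \<open>yd\<close> and \<open>yr\<close> are
  \<open>y\<^sup>x\<close> and \<open>y\<^sup>\<sharp>\<close> for this direction.  A single constant \<open>K\<close> serves for all norms.
\<close>

locale controlled_integrand =
  fixes p q K :: real and x y yd yr A B :: cochain
  assumes pq: "p > 1/3" "q > 1/3" and K0: "K \<ge> 0"
    and cont: "ccont 1 1 x" "ccont 1 1 y" "ccont 1 1 yd" "ccont 2 1 yr" "ccont 2 2 A" "ccont 2 2 B"
    and dx': "\<forall>s1\<in>J. \<forall>s2\<in>J. \<forall>t\<in>J. \<bar>x [s2] [t] - x [s1] [t]\<bar> \<le> K * pw p s1 s2"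
    and ddx': "\<forall>s1\<in>J. \<forall>s2\<in>J. \<forall>t1\<in>J. \<forall>t2\<in>J.
       \<bar>x [s2] [t2] - x [s1] [t2] - x [s2] [t1] + x [s1] [t1]\<bar> \<le> K * (pw p s1 s2 * pw q t1 t2)"
    and y_bd': "\<forall>s\<in>J. \<forall>t\<in>J. \<bar>y [s] [t]\<bar> \<le> K"
    and yd_bd': "\<forall>s\<in>J. \<forall>t\<in>J. \<bar>yd [s] [t]\<bar> \<le> K"
    and dyd1': "\<forall>s1\<in>J. \<forall>s2\<in>J. \<forall>t\<in>J. \<bar>yd [s2] [t] - yd [s1] [t]\<bar> \<le> K * pw p s1 s2"
    and dyd2': "\<forall>s\<in>J. \<forall>t1\<in>J. \<forall>t2\<in>J. \<bar>yd [s] [t2] - yd [s] [t1]\<bar> \<le> K * pw q t1 t2"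
    and ddyd': "\<forall>s1\<in>J. \<forall>s2\<in>J. \<forall>t1\<in>J. \<forall>t2\<in>J.
       \<bar>yd [s2] [t2] - yd [s1] [t2] - yd [s2] [t1] + yd [s1] [t1]\<bar> \<le> K * (pw p s1 s2 * pw q t1 t2)"
    and yr_bd': "\<forall>s1\<in>J. \<forall>s2\<in>J. \<forall>t\<in>J. \<bar>yr [s1, s2] [t]\<bar> \<le> K * pw (2 * p) s1 s2"
    and dyr': "\<forall>s1\<in>J. \<forall>s2\<in>J. \<forall>t1\<in>J. \<forall>t2\<in>J.
       \<bar>yr [s1, s2] [t2] - yr [s1, s2] [t1]\<bar> \<le> K * (pw (2 * p) s1 s2 * pw q t1 t2)"
    and y_eq': "\<forall>s1\<in>J. \<forall>s2\<in>J. \<forall>t\<in>J.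
       y [s2] [t] = y [s1] [t] + yd [s1] [t] * (x [s2] [t] - x [s1] [t]) + yr [s1, s2] [t]"
    and A_bd': "\<forall>s1\<in>J. \<forall>s2\<in>J. \<forall>t1\<in>J. \<forall>t2\<in>J. \<bar>A [s1, s2] [t1, t2]\<bar> \<le> K * (pw p s1 s2 * pw q t1 t2)"
    and B_bd': "\<forall>s1\<in>J. \<forall>s2\<in>J. \<forall>t1\<in>J. \<forall>t2\<in>J.
       \<bar>B [s1, s2] [t1, t2]\<bar> \<le> K * (pw (2 * p) s1 s2 * pw q t1 t2)"
    and A_eq': "\<forall>s1\<in>J. \<forall>s2\<in>J. \<forall>s3\<in>J. \<forall>t1\<in>J. \<forall>t2\<in>J.
       A [s1, s3] [t1, t2] = A [s1, s2] [t1, t2] + A [s2, s3] [t1, t2]"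
    and B_eq': "\<forall>s1\<in>J. \<forall>s2\<in>J. \<forall>s3\<in>J. \<forall>t1\<in>J. \<forall>t2\<in>J.
       B [s1, s3] [t1, t2] = B [s1, s2] [t1, t2] + B [s2, s3] [t1, t2]
         + (x [s2] [t1] - x [s1] [t1]) * A [s2, s3] [t1, t2]"
begin

lemmas dx = dx'[rule_format] and ddx = ddx'[rule_format] and y_bd = y_bd'[rule_format]
  and yd_bd = yd_bd'[rule_format] and dyd1 = dyd1'[rule_format] and dyd2 = dyd2'[rule_format]
  and ddyd = ddyd'[rule_format] and yr_bd = yr_bd'[rule_format] and dyr = dyr'[rule_format]
  and y_eq = y_eq'[rule_format] and A_bd = A_bd'[rule_format] and B_bd = B_bd'[rule_format]
  and A_eq = A_eq'[rule_format] and B_eq = B_eq'[rule_format]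

lemma p_pos: "p > 0" "q > 0" "3 * p > 1" "3 * q > 1"
  using pq by auto

abbreviation "arg \<equiv> bint_arg1 yd yr A B"
abbreviation "bnd \<equiv> bint1 y yd yr A B"

text \<open>
  A primitive of the argument of \<open>\<Lambda>\<^sub>1\<close> in the boundary integral: in \<open>\<delta>\<^sub>1(yA + y\<^sup>xB)\<close> the terms with \<open>\<delta>\<^sub>1x\<close> from
  \<open>\<delta>\<^sub>1y\<close> and from \<open>\<delta>\<^sub>1B\<close> cancel.
\<close>

definition arg_prim :: cochain where
  "arg_prim ss ts = - (y [ss ! 0] [ts ! 0] * A [ss ! 0, ss ! 1] [ts ! 0, ts ! 1]
                  + yd [ss ! 0] [ts ! 0] * B [ss ! 0, ss ! 1] [ts ! 0, ts ! 1])"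

lemma arg_prim_apply: "arg_prim [s1, s2] [t1, t2] =
    - (y [s1] [t1] * A [s1, s2] [t1, t2] + yd [s1] [t1] * B [s1, s2] [t1, t2])"
  by (simp add: arg_prim_def)

lemma ccont_arg_prim: "ccont 2 2 arg_prim"
  unfolding ccont_unfold arg_prim_def
  by (auto intro!: continuous_intros ccont_compose_intros(1,3) cont)

lemma arg_eq:
  assumes "s1 \<in> J" "s2 \<in> J" "s3 \<in> J" "t1 \<in> J" "t2 \<in> J"
  shows "arg [s1, s2, s3] [t1, t2] = arg_prim [s1, s3] [t1, t2] - arg_prim [s1, s2] [t1, t2] - arg_prim [s2, s3] [t1, t2]"
  unfolding bint_arg1_apply arg_prim_apply y_eq[OF assms(1,2,4)] A_eq[OF assms] B_eq[OF assms]
  by (simp add: algebra_simps)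

lemma arg_bound:
  assumes J: "s1 \<in> J" "s2 \<in> J" "s3 \<in> J" "t1 \<in> J" "t2 \<in> J"
  shows "\<bar>arg [s1, s2, s3] [t1, t2]\<bar> \<le> K * K * pw q t1 t2 * sym_weight p s1 s2 s3"
proof -
  have "\<bar>yr [s1, s2] [t1] * A [s2, s3] [t1, t2]\<bar> \<le> K * pw (2 * p) s1 s2 * (K * (pw p s2 s3 * pw q t1 t2))"
    using J by (intro abs_mult_le yr_bd A_bd)
  moreover have "\<bar>(yd [s2] [t1] - yd [s1] [t1]) * B [s2, s3] [t1, t2]\<bar>
      \<le> K * pw p s1 s2 * (K * (pw (2 * p) s2 s3 * pw q t1 t2))"
    using J by (intro abs_mult_le dyd1 B_bd)
  ultimately have "\<bar>arg [s1, s2, s3] [t1, t2]\<bar> \<le> K * pw (2 * p) s1 s2 * (K * (pw p s2 s3 * pw q t1 t2))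
     + K * pw p s1 s2 * (K * (pw (2 * p) s2 s3 * pw q t1 t2))" by simp
  also have "\<dots> = K * K * pw q t1 t2 * sym_weight p s1 s2 s3"
    by (simp add: sym_weight_def algebra_simps)
  finally show ?thesis .
qed

lemma sym_weight_mult_le_max:
  assumes "c \<ge> 0"
  shows "c * sym_weight p s1 s2 s3 \<le> 2 * c * max \<bar>s2 - s1\<bar> \<bar>s3 - s2\<bar> powr (3 * p)"
  using mult_left_mono[OF sym_weight_le_max[OF p_pos(1), of s1 s2 s3] assms] by simp

lemma
  shows ccont_Lam_arg: "ccont 2 2 (Lam Dir1 arg)"
    and Lam_arg_eq: "\<lbrakk>s1 \<in> J; s2 \<in> J; s3 \<in> J; t1 \<in> J; t2 \<in> J\<rbrakk> \<Longrightarrow> Lam Dir1 arg [s1, s3] [t1, t2]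
        - Lam Dir1 arg [s1, s2] [t1, t2] - Lam Dir1 arg [s2, s3] [t1, t2] = arg [s1, s2, s3] [t1, t2]"
    and Lam_arg_bound: "\<lbrakk>s1 \<in> J; s2 \<in> J; t1 \<in> J; t2 \<in> J\<rbrakk> \<Longrightarrow>
        \<bar>Lam Dir1 arg [s1, s2] [t1, t2]\<bar> \<le> sewing_const (3 * p) * (2 * (K * K * pw q t1 t2)) * pw (3 * p) s1 s2"
proof -
  have bd: "\<bar>arg [s1, s2, s3] [t1, t2]\<bar>
      \<le> 2 * (K * K * pw q t1 t2) * max \<bar>s2 - s1\<bar> \<bar>s3 - s2\<bar> powr (3 * p)"
    if "s1 \<in> J" "s2 \<in> J" "s3 \<in> J" "t1 \<in> J" "t2 \<in> J" for s1 s2 s3 t1 t2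
    by (rule order_trans[OF arg_bound[OF that] sym_weight_mult_le_max]) (use K0 in auto)
  have le: "2 * (K * K * pw q t1 t2) \<le> 2 * (K * K)" if "t1 \<in> J" "t2 \<in> J" for t1 t2
    using pw_le_1[OF _ that, of q] p_pos K0 by (intro mult_left_mono mult_left_le) auto
  note P = Lam_properties[of "3 * p" arg_prim arg "\<lambda>t1 t2. 2 * (K * K * pw q t1 t2)" "2 * (K * K)"]
  show "ccont 2 2 (Lam Dir1 arg)"
    by (rule P(1)[OF p_pos(3) ccont_arg_prim]) (intro ballI arg_eq bd le; assumption)+
  show "\<lbrakk>s1 \<in> J; s2 \<in> J; s3 \<in> J; t1 \<in> J; t2 \<in> J\<rbrakk> \<Longrightarrow> Lam Dir1 arg [s1, s3] [t1, t2]
        - Lam Dir1 arg [s1, s2] [t1, t2] - Lam Dir1 arg [s2, s3] [t1, t2] = arg [s1, s2, s3] [t1, t2]"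
    by (rule P(2)[OF p_pos(3) ccont_arg_prim]; (intro ballI arg_eq bd le)?; assumption)
  show "\<lbrakk>s1 \<in> J; s2 \<in> J; t1 \<in> J; t2 \<in> J\<rbrakk> \<Longrightarrow>
        \<bar>Lam Dir1 arg [s1, s2] [t1, t2]\<bar> \<le> sewing_const (3 * p) * (2 * (K * K * pw q t1 t2)) * pw (3 * p) s1 s2"
    by (rule P(3)[OF p_pos(3) ccont_arg_prim]; (intro ballI arg_eq bd le)?; assumption)
qed

lemma bnd_eq_arg_prim: "bnd [s1, s2] [t1, t2] = Lam Dir1 arg [s1, s2] [t1, t2] - arg_prim [s1, s2] [t1, t2]"
  by (simp add: bint1_apply arg_prim_def)

text \<open>
  Sewing corrects the approximation \<open>yA + y\<^sup>xB\<close> by exactly its defect of additivity.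
\<close>

lemma bnd_additive:
  "\<lbrakk>s1 \<in> J; s2 \<in> J; s3 \<in> J; t1 \<in> J; t2 \<in> J\<rbrakk> \<Longrightarrow>
    bnd [s1, s3] [t1, t2] = bnd [s1, s2] [t1, t2] + bnd [s2, s3] [t1, t2]"
  using Lam_arg_eq[of s1 s2 s3 t1 t2] arg_eq[of s1 s2 s3 t1 t2] by (simp add: bnd_eq_arg_prim)

lemma ccont_bnd: "ccont 2 2 bnd"
  using ccont_Lam_arg ccont_arg_prim unfolding ccont_unfold bnd_eq_arg_prim
  by (intro continuous_intros)

lemma holder22_bnd: "holder22 p q bnd"
  unfolding holder22_def
proof (intro conjI exI[of _ "sewing_const (3 * p) * (2 * (K * K)) + (K * K + K * K)"] ballI)
  show "0 \<le> sewing_const (3 * p) * (2 * (K * K)) + (K * K + K * K)"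
    using K0 sewing_const_pos[OF p_pos(3)] by simp
  fix s1 s2 t1 t2 assume J: "s1 \<in> J" "s2 \<in> J" "t1 \<in> J" "t2 \<in> J"
  have m: "pw (3 * p) s1 s2 \<le> pw p s1 s2" "pw (2 * p) s1 s2 \<le> pw p s1 s2"
    using J p_pos by (auto intro!: pw_antimono)
  have "\<bar>y [s1] [t1] * A [s1, s2] [t1, t2]\<bar> \<le> K * (K * (pw p s1 s2 * pw q t1 t2))"
    using J by (intro abs_mult_le y_bd A_bd)
  moreover have "\<bar>yd [s1] [t1] * B [s1, s2] [t1, t2]\<bar> \<le> K * (K * (pw p s1 s2 * pw q t1 t2))"
  proof -
    have "\<bar>yd [s1] [t1] * B [s1, s2] [t1, t2]\<bar> \<le> K * (K * (pw (2 * p) s1 s2 * pw q t1 t2))"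
      using J by (intro abs_mult_le yd_bd B_bd)
    also have "\<dots> \<le> K * (K * (pw p s1 s2 * pw q t1 t2))"
      using K0 m by (intro mult_left_mono mult_right_mono) auto
    finally show ?thesis .
  qed
  moreover have "\<bar>Lam Dir1 arg [s1, s2] [t1, t2]\<bar>
      \<le> sewing_const (3 * p) * (2 * (K * K * pw q t1 t2)) * pw p s1 s2"
    by (rule order_trans[OF Lam_arg_bound[OF J] mult_left_mono[OF m(1)]])
      (use K0 sewing_const_pos[OF p_pos(3)] in simp)
  ultimately have "\<bar>bnd [s1, s2] [t1, t2]\<bar> \<le> K * (K * (pw p s1 s2 * pw q t1 t2))
      + K * (K * (pw p s1 s2 * pw q t1 t2))
      + sewing_const (3 * p) * (2 * (K * K * pw q t1 t2)) * pw p s1 s2"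
    unfolding bint1_apply by linarith
  then show "\<bar>bnd [s1, s2] [t1, t2]\<bar> \<le> (sewing_const (3 * p) * (2 * (K * K)) + (K * K + K * K))
       * (pw p s1 s2 * pw q t1 t2)"
    by (simp add: algebra_simps)
qed (rule ccont_bnd)

lemma CC22_arg_prim: "CC 2 2 arg_prim"
proof -
  have "arg_prim [a, a] [b, c] = 0 \<and> arg_prim [b, c] [a, a] = 0" if "a \<in> J" "b \<in> J" "c \<in> J" for a b c
    using A_bd[of a a b c] A_bd[of b c a a] B_bd[of a a b c] B_bd[of b c a a] that
    by (simp add: arg_prim_def)
  then show ?thesis using ccont_arg_prim by (simp add: CC22_vanish_iff del: atLeastAtMost_iff)
qed

lemma total_exponent_arg: "total_exponent 3 2 (3 * p) arg"
proof (rule total_exponentI)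
  show "ccont 3 2 arg"
    unfolding ccont_unfold bint_arg1_apply
    by (auto intro!: continuous_intros ccont_compose_intros(1,2,3) cont)
  have "\<forall>ss\<in>cube 3. \<forall>ts\<in>cube 2. \<bar>arg ss ts\<bar> \<le> K * K * sym_weight p (ss ! 0) (ss ! 1) (ss ! 2)"
    unfolding ball_cube
  proof (intro ballI)
    fix s1 s2 s3 t1 t2 assume J: "s1 \<in> J" "s2 \<in> J" "s3 \<in> J" "t1 \<in> J" "t2 \<in> J"
    have "K * K * pw q t1 t2 * sym_weight p s1 s2 s3 \<le> K * K * sym_weight p s1 s2 s3"
      using pw_le_1[of q t1 t2] J p_pos K0 by (intro mult_right_mono mult_left_le) auto
    then show "\<bar>arg [s1, s2, s3] [t1, t2]\<bar>
        \<le> K * K * sym_weight p ([s1, s2, s3] ! 0) ([s1, s2, s3] ! 1) ([s1, s2, s3] ! 2)"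
      using arg_bound[OF J] by (simp del: bint_arg1_apply add: numeral_2_eq_2)
  qed
  then show "dominated (weights1 (3 * p)) 3 2 arg"
    using K0 by (intro dominated_sym_weight[OF p_pos(1), where C = "K * K"]) auto
qed simp

text \<open>
  Since \<open>y\<^sup>\<sharp>\<close> has exponent \<open>2p \<ge> p\<close>, the increments of \<open>y\<close> inherit the regularity of those of \<open>x\<close>.
\<close>

lemma dy_bound:
  "\<lbrakk>s1 \<in> J; s2 \<in> J; t \<in> J\<rbrakk> \<Longrightarrow> \<bar>y [s2] [t] - y [s1] [t]\<bar> \<le> (K * K + K) * pw p s1 s2"
proof -
  assume J: "s1 \<in> J" "s2 \<in> J" "t \<in> J"
  have m: "pw (2 * p) s1 s2 \<le> pw p s1 s2" using J p_pos by (auto intro!: pw_antimono)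
  have "\<bar>yd [s1] [t] * (x [s2] [t] - x [s1] [t])\<bar> \<le> K * (K * pw p s1 s2)"
    using J by (intro abs_mult_le yd_bd dx)
  moreover have "\<bar>yr [s1, s2] [t]\<bar> \<le> K * pw p s1 s2"
    using order_trans[OF yr_bd[OF J] mult_left_mono[OF m K0]] .
  ultimately show ?thesis using y_eq[OF J] by (simp add: algebra_simps)
qed

lemma ddy_bound:
  "\<lbrakk>s1 \<in> J; s2 \<in> J; t1 \<in> J; t2 \<in> J\<rbrakk> \<Longrightarrow>
    \<bar>y [s2] [t2] - y [s1] [t2] - y [s2] [t1] + y [s1] [t1]\<bar>
    \<le> (2 * (K * K) + K) * (pw p s1 s2 * pw q t1 t2)"
proof -
  assume J: "s1 \<in> J" "s2 \<in> J" "t1 \<in> J" "t2 \<in> J"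
  have m: "pw (2 * p) s1 s2 \<le> pw p s1 s2" using J p_pos by (auto intro!: pw_antimono)
  have 1: "\<bar>(yd [s1] [t2] - yd [s1] [t1]) * (x [s2] [t2] - x [s1] [t2])\<bar>
      \<le> K * pw q t1 t2 * (K * pw p s1 s2)"
    using J by (intro abs_mult_le dyd2 dx)
  have 2: "\<bar>yd [s1] [t1] * (x [s2] [t2] - x [s1] [t2] - x [s2] [t1] + x [s1] [t1])\<bar>
      \<le> K * (K * (pw p s1 s2 * pw q t1 t2))"
    using J by (intro abs_mult_le yd_bd ddx)
  have 3: "\<bar>yr [s1, s2] [t2] - yr [s1, s2] [t1]\<bar> \<le> K * (pw p s1 s2 * pw q t1 t2)"
    using J m K0 by (intro order_trans[OF dyr] mult_left_mono mult_right_mono) auto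
  have "y [s2] [t2] - y [s1] [t2] - y [s2] [t1] + y [s1] [t1]
    = (yd [s1] [t2] - yd [s1] [t1]) * (x [s2] [t2] - x [s1] [t2])
     + yd [s1] [t1] * (x [s2] [t2] - x [s1] [t2] - x [s2] [t1] + x [s1] [t1])
     + (yr [s1, s2] [t2] - yr [s1, s2] [t1])"
    using y_eq[OF J(1,2,3)] y_eq[OF J(1,2,4)] by (simp add: algebra_simps)
  then have "\<bar>y [s2] [t2] - y [s1] [t2] - y [s2] [t1] + y [s1] [t1]\<bar>
     \<le> K * pw q t1 t2 * (K * pw p s1 s2) + K * (K * (pw p s1 s2 * pw q t1 t2))
       + K * (pw p s1 s2 * pw q t1 t2)"
    using 1 2 3 by linarith
  then show ?thesis by (simp add: algebra_simps)
qed

end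

text \<open>
  The data of a double boundary integral \<open>\<integral>\<^sub>1y\<integral>\<^sub>2dw du\<close>: \<open>A\<close>, \<open>B\<close> belong to \<open>w\<close> and \<open>Au\<close> is \<open>A\<^sup>u\<close>.  In \<open>D_R\<close>,
  \<open>E_R\<close> and \<open>E_L\<close> the increments are in the second, resp. first, pair of variables \<open>s\<close>; in \<open>D_2\<close> and \<open>E_2\<close> they
  are in \<open>t\<close>.
\<close>

locale controlled_double_integrand = controlled_integrand +
  fixes Au C D E F :: cochain and W :: "real \<Rightarrow> real \<Rightarrow> real \<Rightarrow> real"
  assumes cont2: "ccont 2 2 Au" "ccont 2 2 C" "ccont 4 2 D" "ccont 4 2 E"
    and C_bd': "\<forall>s1\<in>J. \<forall>s2\<in>J. \<forall>t1\<in>J. \<forall>t2\<in>J.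
       \<bar>C [s1, s2] [t1, t2]\<bar> \<le> K * (pw (2 * p) s1 s2 * pw (2 * q) t1 t2)"
    and D_bd': "\<forall>s1\<in>J. \<forall>s2\<in>J. \<forall>s3\<in>J. \<forall>s4\<in>J. \<forall>t1\<in>J. \<forall>t2\<in>J.
       \<bar>D [s1, s2, s3, s4] [t1, t2]\<bar> \<le> K * (pw p s1 s2 * pw p s3 s4 * pw (2 * q) t1 t2)"
    and E_bd': "\<forall>s1\<in>J. \<forall>s2\<in>J. \<forall>s3\<in>J. \<forall>s4\<in>J. \<forall>t1\<in>J. \<forall>t2\<in>J.
       \<bar>E [s1, s2, s3, s4] [t1, t2]\<bar> \<le> K * (pw (2 * p) s1 s2 * pw p s3 s4 * pw (2 * q) t1 t2)"
    and W: "total_weight (3 * q) W"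
    and F_bd': "\<forall>s1\<in>J. \<forall>s2\<in>J. \<forall>s3\<in>J. \<forall>s4\<in>J. \<forall>t1\<in>J. \<forall>t2\<in>J. \<forall>t3\<in>J.
       \<bar>F [s1, s2, s3, s4] [t1, t2, t3]\<bar> \<le> pw (2 * p) s1 s2 * pw p s3 s4 * W t1 t2 t3"
    and C_eq': "\<forall>s1\<in>J. \<forall>s2\<in>J. \<forall>s3\<in>J. \<forall>t1\<in>J. \<forall>t2\<in>J.
       C [s1, s3] [t1, t2] = C [s1, s2] [t1, t2] + C [s2, s3] [t1, t2] + D [s1, s2, s2, s3] [t1, t2]"
    and D_R': "\<forall>s1\<in>J. \<forall>s2\<in>J. \<forall>s3\<in>J. \<forall>s4\<in>J. \<forall>s5\<in>J. \<forall>t1\<in>J. \<forall>t2\<in>J.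
       D [s1, s2, s3, s5] [t1, t2] = D [s1, s2, s3, s4] [t1, t2] + D [s1, s2, s4, s5] [t1, t2]"
    and D_2': "\<forall>s1\<in>J. \<forall>s2\<in>J. \<forall>s3\<in>J. \<forall>s4\<in>J. \<forall>t1\<in>J. \<forall>t2\<in>J. \<forall>t3\<in>J.
       D [s1, s2, s3, s4] [t1, t3] = D [s1, s2, s3, s4] [t1, t2] + D [s1, s2, s3, s4] [t2, t3]
         + A [s1, s2] [t1, t2] * Au [s3, s4] [t2, t3]"
    and E_R': "\<forall>s1\<in>J. \<forall>s2\<in>J. \<forall>s3\<in>J. \<forall>s4\<in>J. \<forall>s5\<in>J. \<forall>t1\<in>J. \<forall>t2\<in>J.
       E [s1, s2, s3, s5] [t1, t2] = E [s1, s2, s3, s4] [t1, t2] + E [s1, s2, s4, s5] [t1, t2]"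
    and E_L': "\<forall>s1\<in>J. \<forall>s2\<in>J. \<forall>s3\<in>J. \<forall>s4\<in>J. \<forall>s5\<in>J. \<forall>t1\<in>J. \<forall>t2\<in>J.
       E [s1, s3, s4, s5] [t1, t2] = E [s1, s2, s4, s5] [t1, t2] + E [s2, s3, s4, s5] [t1, t2]
         + (x [s2] [t1] - x [s1] [t1]) * D [s2, s3, s4, s5] [t1, t2]"
    and E_2': "\<forall>s1\<in>J. \<forall>s2\<in>J. \<forall>s3\<in>J. \<forall>s4\<in>J. \<forall>t1\<in>J. \<forall>t2\<in>J. \<forall>t3\<in>J.
       E [s1, s2, s3, s4] [t1, t3] = E [s1, s2, s3, s4] [t1, t2] + E [s1, s2, s3, s4] [t2, t3]
         + F [s1, s2, s3, s4] [t1, t2, t3] + B [s1, s2] [t1, t2] * Au [s3, s4] [t2, t3]"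
begin

lemmas C_bd = C_bd'[rule_format] and D_bd = D_bd'[rule_format]
  and E_bd = E_bd'[rule_format] and F_bd = F_bd'[rule_format] and C_eq = C_eq'[rule_format]
  and D_R = D_R'[rule_format] and D_2 = D_2'[rule_format] and E_R = E_R'[rule_format]
  and E_L = E_L'[rule_format] and E_2 = E_2'[rule_format]

abbreviation "darg \<equiv> bint_arg1 yd yr D E"
abbreviation "arg2 \<equiv> bint2_arg1 y yd yr C D E"
abbreviation "dbl \<equiv> bint21 y yd yr C D E"

text \<open>
  The algebraic hypothesis gives additivity of \<open>D\<close> in its second pair of variables only.  For the first
  pair it follows from this and from the closedness of \<open>\<mu>\<^sub>1D = \<delta>\<^sub>1C\<close>.
\<close>

lemma D_L:
  assumes "s1 \<in> J" "s2 \<in> J" "s3 \<in> J" "s4 \<in> J" "s5 \<in> J" "t1 \<in> J" "t2 \<in> J"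
  shows "D [s1, s3, s4, s5] [t1, t2] = D [s1, s2, s4, s5] [t1, t2] + D [s2, s3, s4, s5] [t1, t2]"
proof -
  have *: "D [s1, s3, s3, s] [t1, t2] = D [s1, s2, s3, s] [t1, t2] + D [s2, s3, s3, s] [t1, t2]"
    if "s \<in> J" for s
    using C_eq[of s1 s2 s3 t1 t2] C_eq[of s1 s3 s t1 t2] C_eq[of s1 s2 s t1 t2] C_eq[of s2 s3 s t1 t2]
      D_R[of s1 s2 s2 s3 s t1 t2] assms that by simp
  show ?thesis
    using *[of s4] *[of s5] D_R[of s1 s3 s3 s4 s5 t1 t2] D_R[of s1 s2 s3 s4 s5 t1 t2]
      D_R[of s2 s3 s3 s4 s5 t1 t2] assms by simp
qed

definition darg_prim :: cochain where
  "darg_prim ss ts = - (y [ss ! 0] [ts ! 0] * D [ss ! 0, ss ! 1, ss ! 2, ss ! 3] [ts ! 0, ts ! 1]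
     + yd [ss ! 0] [ts ! 0] * E [ss ! 0, ss ! 1, ss ! 2, ss ! 3] [ts ! 0, ts ! 1])"

lemma darg_prim_apply: "darg_prim [s1, s2, s3, s4] [t1, t2] =
    - (y [s1] [t1] * D [s1, s2, s3, s4] [t1, t2] + yd [s1] [t1] * E [s1, s2, s3, s4] [t1, t2])"
  by (simp add: darg_prim_def numeral_3_eq_3 numeral_2_eq_2)

lemma ccont_darg_prim: "ccont 4 2 darg_prim"
  unfolding ccont_unfold darg_prim_apply
  by (auto intro!: continuous_intros ccont_compose_intros(1,6) cont cont2)

lemma inner_eq:
  assumes "s1 \<in> J" "s2 \<in> J" "s3 \<in> J" "s4 \<in> J" "s5 \<in> J" "t1 \<in> J" "t2 \<in> J"
  shows "darg [s1, s2, s3, s4, s5] [t1, t2] = darg_prim [s1, s3, s4, s5] [t1, t2]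
     - darg_prim [s1, s2, s4, s5] [t1, t2] - darg_prim [s2, s3, s4, s5] [t1, t2]"
  unfolding bint_arg1_apply darg_prim_apply y_eq[OF assms(1,2,6)] D_L[OF assms] E_L[OF assms]
  by (simp add: algebra_simps)

lemma inner_bound:
  assumes J: "s1 \<in> J" "s2 \<in> J" "s3 \<in> J" "s4 \<in> J" "s5 \<in> J" "t1 \<in> J" "t2 \<in> J"
  shows "\<bar>darg [s1, s2, s3, s4, s5] [t1, t2]\<bar>
    \<le> K * K * (pw p s4 s5 * pw (2 * q) t1 t2) * sym_weight p s1 s2 s3"
proof -
  have "\<bar>yr [s1, s2] [t1] * D [s2, s3, s4, s5] [t1, t2]\<bar>
      \<le> K * pw (2 * p) s1 s2 * (K * (pw p s2 s3 * pw p s4 s5 * pw (2 * q) t1 t2))"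
    using J by (intro abs_mult_le yr_bd D_bd)
  moreover have "\<bar>(yd [s2] [t1] - yd [s1] [t1]) * E [s2, s3, s4, s5] [t1, t2]\<bar>
      \<le> K * pw p s1 s2 * (K * (pw (2 * p) s2 s3 * pw p s4 s5 * pw (2 * q) t1 t2))"
    using J by (intro abs_mult_le dyd1 E_bd)
  ultimately have "\<bar>darg [s1, s2, s3, s4, s5] [t1, t2]\<bar>
      \<le> K * pw (2 * p) s1 s2 * (K * (pw p s2 s3 * pw p s4 s5 * pw (2 * q) t1 t2))
      + K * pw p s1 s2 * (K * (pw (2 * p) s2 s3 * pw p s4 s5 * pw (2 * q) t1 t2))" by simp
  also have "\<dots> = K * K * (pw p s4 s5 * pw (2 * q) t1 t2) * sym_weight p s1 s2 s3"
    by (simp add: sym_weight_def algebra_simps)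
  finally show ?thesis .
qed

lemma pw_p_2q_le_1: "\<lbrakk>s4 \<in> J; s5 \<in> J; t1 \<in> J; t2 \<in> J\<rbrakk> \<Longrightarrow> pw p s4 s5 * pw (2 * q) t1 t2 \<le> 1"
  using mult_mono[OF pw_le_1 pw_le_1, of p s4 s5 "2 * q" t1 t2] p_pos by simp

definition sc :: real where "sc = sewing_const (3 * p)"

lemma sc_pos: "sc > 0" unfolding sc_def by (rule sewing_const_pos[OF p_pos(3)])

lemma
  shows ccont_LamL_inner: "ccont 4 2 (LamL Dir1 darg)"
    and LamL_inner_eq: "\<lbrakk>s1 \<in> J; s2 \<in> J; s3 \<in> J; s4 \<in> J; s5 \<in> J; t1 \<in> J; t2 \<in> J\<rbrakk> \<Longrightarrow>
        LamL Dir1 darg [s1, s3, s4, s5] [t1, t2] - LamL Dir1 darg [s1, s2, s4, s5] [t1, t2]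
        - LamL Dir1 darg [s2, s3, s4, s5] [t1, t2] = darg [s1, s2, s3, s4, s5] [t1, t2]"
    and LamL_inner_bound: "\<lbrakk>s1 \<in> J; s2 \<in> J; s4 \<in> J; s5 \<in> J; t1 \<in> J; t2 \<in> J\<rbrakk> \<Longrightarrow>
        \<bar>LamL Dir1 darg [s1, s2, s4, s5] [t1, t2]\<bar>
        \<le> sc * (2 * (K * K * (pw p s4 s5 * pw (2 * q) t1 t2))) * pw (3 * p) s1 s2"
proof -
  have bd: "\<bar>darg [s1, s2, s3, s4, s5] [t1, t2]\<bar>
      \<le> 2 * (K * K * (pw p s4 s5 * pw (2 * q) t1 t2)) * max \<bar>s2 - s1\<bar> \<bar>s3 - s2\<bar> powr (3 * p)"
    if "s1 \<in> J" "s2 \<in> J" "s3 \<in> J" "s4 \<in> J" "s5 \<in> J" "t1 \<in> J" "t2 \<in> J" for s1 s2 s3 s4 s5 t1 t2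
    by (rule order_trans[OF inner_bound[OF that] sym_weight_mult_le_max]) (use K0 in auto)
  have le: "2 * (K * K * (pw p s4 s5 * pw (2 * q) t1 t2)) \<le> 2 * (K * K)"
    if "s4 \<in> J" "s5 \<in> J" "t1 \<in> J" "t2 \<in> J" for s4 s5 t1 t2
    using pw_p_2q_le_1[OF that] p_pos K0 by (intro mult_left_mono mult_left_le) auto
  note P = LamL_properties[of "3 * p" darg_prim darg
      "\<lambda>s4 s5 t1 t2. 2 * (K * K * (pw p s4 s5 * pw (2 * q) t1 t2))" "2 * (K * K)"]
  show "ccont 4 2 (LamL Dir1 darg)"
    by (rule P(1)[OF p_pos(3) ccont_darg_prim]) (intro ballI inner_eq bd le; assumption)+
  show "\<lbrakk>s1 \<in> J; s2 \<in> J; s3 \<in> J; s4 \<in> J; s5 \<in> J; t1 \<in> J; t2 \<in> J\<rbrakk> \<Longrightarrow>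
        LamL Dir1 darg [s1, s3, s4, s5] [t1, t2] - LamL Dir1 darg [s1, s2, s4, s5] [t1, t2]
        - LamL Dir1 darg [s2, s3, s4, s5] [t1, t2] = darg [s1, s2, s3, s4, s5] [t1, t2]"
    by (rule P(2)[OF p_pos(3) ccont_darg_prim]; (intro ballI inner_eq bd le)?; assumption)
  show "\<lbrakk>s1 \<in> J; s2 \<in> J; s4 \<in> J; s5 \<in> J; t1 \<in> J; t2 \<in> J\<rbrakk> \<Longrightarrow>
        \<bar>LamL Dir1 darg [s1, s2, s4, s5] [t1, t2]\<bar>
        \<le> sc * (2 * (K * K * (pw p s4 s5 * pw (2 * q) t1 t2))) * pw (3 * p) s1 s2"
    unfolding sc_def
    by (rule P(3)[OF p_pos(3) ccont_darg_prim]; (intro ballI inner_eq bd le)?; assumption)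
qed

lemma Tbase_darg_prim: "Tbase 2 darg_prim"
proof -
  have "darg_prim [s1, s2, s3, s4] [t1, t2] = 0"
    if J: "s1 \<in> J" "s2 \<in> J" "s3 \<in> J" "s4 \<in> J" "t1 \<in> J" "t2 \<in> J" and "s1 = s2 \<or> s3 = s4 \<or> t1 = t2"
    for s1 s2 s3 s4 t1 t2
    using D_bd[OF J] E_bd[OF J] that(7) by (auto simp: darg_prim_apply)
  then show ?thesis
    using ccont_darg_prim unfolding Tbase_def ball_cube by (auto simp del: atLeastAtMost_iff simp: less_Suc_eq)
qed

lemma total_exponent_inner: "total_exponent 5 2 (3 * p) darg"
proof (rule total_exponentI)
  show "ccont 5 2 darg"
    unfolding ccont_unfold bint_arg1_apply
    by (auto intro!: continuous_intros ccont_compose_intros(1,2,6) cont cont2)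
  have "\<forall>ss\<in>cube 5. \<forall>ts\<in>cube 2. \<bar>darg ss ts\<bar> \<le> K * K * sym_weight p (ss ! 0) (ss ! 1) (ss ! 2)"
    unfolding ball_cube
  proof (intro ballI)
    fix s1 s2 s3 s4 s5 t1 t2 assume J: "s1 \<in> J" "s2 \<in> J" "s3 \<in> J" "s4 \<in> J" "s5 \<in> J" "t1 \<in> J" "t2 \<in> J"
    have "K * K * (pw p s4 s5 * pw (2 * q) t1 t2) * sym_weight p s1 s2 s3 \<le> K * K * sym_weight p s1 s2 s3"
      using pw_p_2q_le_1[OF J(4-7)] K0 by (intro mult_right_mono mult_left_le) auto
    then show "\<bar>darg [s1, s2, s3, s4, s5] [t1, t2]\<bar> \<le> K * K * sym_weight p
       ([s1, s2, s3, s4, s5] ! 0) ([s1, s2, s3, s4, s5] ! 1) ([s1, s2, s3, s4, s5] ! 2)"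
      using inner_bound[OF J] by (simp del: bint_arg1_apply add: numeral_2_eq_2)
  qed
  then show "dominated (weights1 (3 * p)) 5 2 darg"
    using K0 by (intro dominated_sym_weight[OF p_pos(1), where C = "K * K"]) auto
qed simp

text \<open>
  \<open>yD + y\<^sup>xE + (\<Lambda>\<^sub>1 \<otimes>\<^sub>1 1)(y\<^sup>\<sharp>D + \<delta>\<^sub>1y\<^sup>x E)\<close>; for iterated integrals, the boundary integral of \<open>y\<close> over the first
  pair of variables \<open>s\<close>, integrated against \<open>du\<close> over the second pair.
\<close>

definition inner_int :: cochain where
  "inner_int ss ts = LamL Dir1 darg ss ts - darg_prim ss ts"

lemma ccont_inner_int: "ccont 4 2 inner_int"
  using ccont_LamL_inner ccont_darg_prim unfolding ccont_unfold inner_int_def by (intro continuous_intros)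

lemma inner_int_L:
  assumes "s1 \<in> J" "s2 \<in> J" "s3 \<in> J" "s4 \<in> J" "s5 \<in> J" "t1 \<in> J" "t2 \<in> J"
  shows "inner_int [s1, s3, s4, s5] [t1, t2] =
     inner_int [s1, s2, s4, s5] [t1, t2] + inner_int [s2, s3, s4, s5] [t1, t2]"
  using LamL_inner_eq[OF assms] inner_eq[OF assms] by (simp add: inner_int_def)

lemma LamL_inner_bound':
  assumes "s1 \<in> J" "s2 \<in> J" "s4 \<in> J" "s5 \<in> J" "t1 \<in> J" "t2 \<in> J"
  shows "\<bar>LamL Dir1 darg [s1, s2, s4, s5] [t1, t2]\<bar> \<le> sc * (2 * (K * K)) * \<bar>s2 - s1\<bar> powr (3 * p)"
proof -
  have "sc * (2 * (K * K * (pw p s4 s5 * pw (2 * q) t1 t2))) * pw (3 * p) s1 s2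
      \<le> sc * (2 * (K * K)) * pw (3 * p) s1 s2"
    using pw_p_2q_le_1[OF assms(3-6)] K0 sc_pos
    by (intro mult_right_mono mult_left_mono mult_left_le) auto
  from order_trans[OF LamL_inner_bound[OF assms] this] show ?thesis by (simp add: pw_def)
qed

text \<open>
  Both sides are sewn in the first pair of variables and have the same image under \<open>\<delta>\<^sub>1 \<otimes>\<^sub>1 1\<close>, because \<open>D\<close>
  and \<open>E\<close> are additive in the second pair.
\<close>

lemma LamL_inner_R:
  assumes s: "s1 \<in> J" "s2 \<in> J" and J: "s3 \<in> J" "s4 \<in> J" "s5 \<in> J" "t1 \<in> J" "t2 \<in> J"
  shows "LamL Dir1 darg [s1, s2, s3, s5] [t1, t2] =
     LamL Dir1 darg [s1, s2, s3, s4] [t1, t2] + LamL Dir1 darg [s1, s2, s4, s5] [t1, t2]"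
proof (rule coboundary_unique[OF p_pos(3) p_pos(3),
    where f = "\<lambda>a b. LamL Dir1 darg [a, b, s3, s5] [t1, t2]"
      and g = "\<lambda>a b. LamL Dir1 darg [a, b, s3, s4] [t1, t2] + LamL Dir1 darg [a, b, s4, s5] [t1, t2]"])
  fix a b :: real assume ab: "a \<in> J" "b \<in> J"
  show "\<bar>LamL Dir1 darg [a, b, s3, s5] [t1, t2]\<bar> \<le> sc * (2 * (K * K)) * \<bar>b - a\<bar> powr (3 * p)"
    by (rule LamL_inner_bound'[OF ab J(1,3,4,5)])
  show "\<bar>LamL Dir1 darg [a, b, s3, s4] [t1, t2] + LamL Dir1 darg [a, b, s4, s5] [t1, t2]\<bar>
      \<le> 2 * (sc * (2 * (K * K))) * \<bar>b - a\<bar> powr (3 * p)"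
    using LamL_inner_bound'[OF ab J(1,2,4,5)] LamL_inner_bound'[OF ab J(2,3,4,5)] by linarith
next
  fix a b c :: real assume abc: "a \<in> J" "b \<in> J" "c \<in> J"
  show "LamL Dir1 darg [a, c, s3, s5] [t1, t2] - LamL Dir1 darg [a, b, s3, s5] [t1, t2]
      - LamL Dir1 darg [b, c, s3, s5] [t1, t2] =
      LamL Dir1 darg [a, c, s3, s4] [t1, t2] + LamL Dir1 darg [a, c, s4, s5] [t1, t2]
      - (LamL Dir1 darg [a, b, s3, s4] [t1, t2] + LamL Dir1 darg [a, b, s4, s5] [t1, t2])
      - (LamL Dir1 darg [b, c, s3, s4] [t1, t2] + LamL Dir1 darg [b, c, s4, s5] [t1, t2])"
    using LamL_inner_eq[OF abc J(1,3,4,5)] LamL_inner_eq[OF abc J(1,2,4,5)]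
      LamL_inner_eq[OF abc J(2,3,4,5)] D_R[OF abc(2,3) J] E_R[OF abc(2,3) J]
    by (simp add: algebra_simps)
qed (use s in auto)

lemma inner_int_R:
  assumes "s1 \<in> J" "s2 \<in> J" "s3 \<in> J" "s4 \<in> J" "s5 \<in> J" "t1 \<in> J" "t2 \<in> J"
  shows "inner_int [s1, s2, s3, s5] [t1, t2] =
     inner_int [s1, s2, s3, s4] [t1, t2] + inner_int [s1, s2, s4, s5] [t1, t2]"
  using LamL_inner_R[OF assms] D_R[OF assms] E_R[OF assms]
  by (simp add: inner_int_def darg_prim_apply algebra_simps)

text \<open>
  The second term is a primitive of \<open>\<mu>\<^sub>1 inner_int\<close>: for a function \<open>I\<close> that is additive in both pairs of
  variables, \<open>\<delta>\<^sub>1\<close> of \<open>(s\<^sub>1, s\<^sub>2) \<mapsto> -I\<^bsub>0 s\<^sub>1 s\<^sub>1 s\<^sub>2\<^esub>\<close> is \<open>\<mu>\<^sub>1I\<close>.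
\<close>

definition arg2_prim :: cochain where
  "arg2_prim ss ts = - (y [ss ! 0] [ts ! 0] * C [ss ! 0, ss ! 1] [ts ! 0, ts ! 1]
     + inner_int [0, ss ! 0, ss ! 0, ss ! 1] [ts ! 0, ts ! 1])"

lemma arg2_prim_apply: "arg2_prim [s1, s2] [t1, t2] =
    - (y [s1] [t1] * C [s1, s2] [t1, t2] + inner_int [0, s1, s1, s2] [t1, t2])"
  by (simp add: arg2_prim_def)

lemma ccont_arg2_prim: "ccont 2 2 arg2_prim"
  unfolding ccont_unfold arg2_prim_apply
  by (intro continuous_intros ccont_compose_intros(1,3,6) cont cont2 ccont_inner_int maps_into_coord) simp

lemma arg2_eq_inner_int:
  assumes "s1 \<in> J" "s2 \<in> J" "s3 \<in> J" "t1 \<in> J" "t2 \<in> J"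
  shows "arg2 [s1, s2, s3] [t1, t2] = inner_int [s1, s2, s2, s3] [t1, t2]
    - (y [s1] [t1] * C [s1, s3] [t1, t2] - y [s1] [t1] * C [s1, s2] [t1, t2] - y [s2] [t1] * C [s2, s3] [t1, t2])"
  unfolding bint2_arg1_apply inner_int_def darg_prim_apply C_eq[OF assms] by (simp add: algebra_simps)

lemma arg2_eq:
  assumes J: "s1 \<in> J" "s2 \<in> J" "s3 \<in> J" "t1 \<in> J" "t2 \<in> J"
  shows "arg2 [s1, s2, s3] [t1, t2] =
    arg2_prim [s1, s3] [t1, t2] - arg2_prim [s1, s2] [t1, t2] - arg2_prim [s2, s3] [t1, t2]"
proof -
  have z: "(0 :: real) \<in> J" by simp
  show ?thesis
    using arg2_eq_inner_int[OF J] inner_int_L[OF z J(1,2,2,3,4,5)] inner_int_R[OF z J(1,1,2,3,4,5)]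
    by (simp add: arg2_prim_apply)
qed

definition K2 :: real where "K2 = (K * K + K) * K + K * K + sc * (2 * (K * K))"

lemma K2_nonneg: "K2 \<ge> 0" unfolding K2_def using K0 sc_pos by simp

lemma arg2_bound:
  assumes J: "s1 \<in> J" "s2 \<in> J" "s3 \<in> J" "t1 \<in> J" "t2 \<in> J"
  shows "\<bar>arg2 [s1, s2, s3] [t1, t2]\<bar> \<le> K2 * pw (2 * q) t1 t2 * sym_weight p s1 s2 s3"
proof -
  let ?T = "pw (2 * q) t1 t2" and ?S = "sym_weight p s1 s2 s3"
  have "\<bar>(y [s2] [t1] - y [s1] [t1]) * C [s2, s3] [t1, t2]\<bar>
      \<le> (K * K + K) * pw p s1 s2 * (K * (pw (2 * p) s2 s3 * ?T))"
    using J by (intro abs_mult_le dy_bound C_bd)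
  also have "\<dots> = (K * K + K) * K * ?T * (pw p s1 s2 * pw (2 * p) s2 s3)" by (simp add: algebra_simps)
  also have "\<dots> \<le> (K * K + K) * K * ?T * ?S"
    using K0 by (intro mult_left_mono) (auto simp: sym_weight_def)
  finally have 1: "\<bar>(y [s2] [t1] - y [s1] [t1]) * C [s2, s3] [t1, t2]\<bar> \<le> (K * K + K) * K * ?T * ?S" .
  have "\<bar>yd [s1] [t1] * E [s1, s2, s2, s3] [t1, t2]\<bar> \<le> K * (K * (pw (2 * p) s1 s2 * pw p s2 s3 * ?T))"
    using J by (intro abs_mult_le yd_bd E_bd)
  also have "\<dots> = K * K * ?T * (pw (2 * p) s1 s2 * pw p s2 s3)" by (simp add: algebra_simps)
  also have "\<dots> \<le> K * K * ?T * ?S"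
    using K0 by (intro mult_left_mono) (auto simp: sym_weight_def)
  finally have 2: "\<bar>yd [s1] [t1] * E [s1, s2, s2, s3] [t1, t2]\<bar> \<le> K * K * ?T * ?S" .
  have "pw (3 * p) s1 s2 \<le> pw (2 * p) s1 s2" using J p_pos by (intro pw_antimono) auto
  then have "sc * (2 * (K * K * (pw p s2 s3 * ?T))) * pw (3 * p) s1 s2
      \<le> sc * (2 * (K * K * (pw p s2 s3 * ?T))) * pw (2 * p) s1 s2"
    using K0 sc_pos by (intro mult_left_mono) auto
  also have "\<dots> = sc * (2 * (K * K)) * ?T * (pw (2 * p) s1 s2 * pw p s2 s3)" by (simp add: algebra_simps)
  also have "\<dots> \<le> sc * (2 * (K * K)) * ?T * ?S"
    using K0 sc_pos by (intro mult_left_mono) (auto simp: sym_weight_def)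
  finally have 3: "\<bar>LamL Dir1 darg [s1, s2, s2, s3] [t1, t2]\<bar> \<le> sc * (2 * (K * K)) * ?T * ?S"
    using LamL_inner_bound[OF J(1,2,2,3,4,5)] by linarith
  have "\<bar>arg2 [s1, s2, s3] [t1, t2]\<bar> \<le> (K * K + K) * K * ?T * ?S + K * K * ?T * ?S
      + sc * (2 * (K * K)) * ?T * ?S"
    using 1 2 3 unfolding bint2_arg1_apply by linarith
  then show ?thesis by (simp add: K2_def algebra_simps)
qed

lemma pw_2q_le_1: "\<lbrakk>t1 \<in> J; t2 \<in> J\<rbrakk> \<Longrightarrow> pw (2 * q) t1 t2 \<le> 1"
  using pw_le_1[of "2 * q" t1 t2] p_pos by simp

lemma
  shows ccont_Lam_arg2: "ccont 2 2 (Lam Dir1 arg2)"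
    and Lam_arg2_eq: "\<lbrakk>s1 \<in> J; s2 \<in> J; s3 \<in> J; t1 \<in> J; t2 \<in> J\<rbrakk> \<Longrightarrow> Lam Dir1 arg2 [s1, s3] [t1, t2]
        - Lam Dir1 arg2 [s1, s2] [t1, t2] - Lam Dir1 arg2 [s2, s3] [t1, t2] = arg2 [s1, s2, s3] [t1, t2]"
    and Lam_arg2_bound: "\<lbrakk>s1 \<in> J; s2 \<in> J; t1 \<in> J; t2 \<in> J\<rbrakk> \<Longrightarrow>
        \<bar>Lam Dir1 arg2 [s1, s2] [t1, t2]\<bar> \<le> sc * (2 * (K2 * pw (2 * q) t1 t2)) * pw (3 * p) s1 s2"
proof -
  have bd: "\<bar>arg2 [s1, s2, s3] [t1, t2]\<bar>
      \<le> 2 * (K2 * pw (2 * q) t1 t2) * max \<bar>s2 - s1\<bar> \<bar>s3 - s2\<bar> powr (3 * p)"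
    if "s1 \<in> J" "s2 \<in> J" "s3 \<in> J" "t1 \<in> J" "t2 \<in> J" for s1 s2 s3 t1 t2
    by (rule order_trans[OF arg2_bound[OF that] sym_weight_mult_le_max]) (use K2_nonneg in auto)
  have le: "2 * (K2 * pw (2 * q) t1 t2) \<le> 2 * K2" if "t1 \<in> J" "t2 \<in> J" for t1 t2
    using pw_2q_le_1[OF that] K2_nonneg by (intro mult_left_mono mult_left_le) auto
  note P = Lam_properties[of "3 * p" arg2_prim arg2 "\<lambda>t1 t2. 2 * (K2 * pw (2 * q) t1 t2)" "2 * K2"]
  show "ccont 2 2 (Lam Dir1 arg2)"
    by (rule P(1)[OF p_pos(3) ccont_arg2_prim]) (intro ballI arg2_eq bd le; assumption)+
  show "\<lbrakk>s1 \<in> J; s2 \<in> J; s3 \<in> J; t1 \<in> J; t2 \<in> J\<rbrakk> \<Longrightarrow> Lam Dir1 arg2 [s1, s3] [t1, t2]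
        - Lam Dir1 arg2 [s1, s2] [t1, t2] - Lam Dir1 arg2 [s2, s3] [t1, t2] = arg2 [s1, s2, s3] [t1, t2]"
    by (rule P(2)[OF p_pos(3) ccont_arg2_prim]; (intro ballI arg2_eq bd le)?; assumption)
  show "\<lbrakk>s1 \<in> J; s2 \<in> J; t1 \<in> J; t2 \<in> J\<rbrakk> \<Longrightarrow>
        \<bar>Lam Dir1 arg2 [s1, s2] [t1, t2]\<bar> \<le> sc * (2 * (K2 * pw (2 * q) t1 t2)) * pw (3 * p) s1 s2"
    unfolding sc_def
    by (rule P(3)[OF p_pos(3) ccont_arg2_prim]; (intro ballI arg2_eq bd le)?; assumption)
qed

lemma CC22_arg2_prim: "CC 2 2 arg2_prim"
proof -
  have J0: "(0 :: real) \<in> J" by simp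
  have "arg2_prim [a, a] [b, c] = 0 \<and> arg2_prim [b, c] [a, a] = 0" if "a \<in> J" "b \<in> J" "c \<in> J" for a b c
    using C_bd[of a a b c] C_bd[of b c a a] D_bd[of 0 a a a b c] D_bd[of 0 b b c a a]
      E_bd[of 0 a a a b c] E_bd[of 0 b b c a a] LamL_inner_bound[of 0 a a a b c]
      LamL_inner_bound[of 0 b b c a a] that J0
    by (simp add: arg2_prim_apply inner_int_def darg_prim_apply)
  then show ?thesis using ccont_arg2_prim by (simp add: CC22_vanish_iff del: atLeastAtMost_iff)
qed

lemma total_exponent_arg2: "total_exponent 3 2 (3 * p) arg2"
proof (rule total_exponentI)
  show "ccont 3 2 arg2"
    unfolding ccont_unfold bint2_arg1_apply
    by (intro continuous_intros ccont_compose_intros(1,3,6) cont cont2 ccont_LamL_inner maps_into_coord)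
  have "\<forall>ss\<in>cube 3. \<forall>ts\<in>cube 2. \<bar>arg2 ss ts\<bar> \<le> K2 * sym_weight p (ss ! 0) (ss ! 1) (ss ! 2)"
    unfolding ball_cube
  proof (intro ballI)
    fix s1 s2 s3 t1 t2 assume J: "s1 \<in> J" "s2 \<in> J" "s3 \<in> J" "t1 \<in> J" "t2 \<in> J"
    have "K2 * pw (2 * q) t1 t2 * sym_weight p s1 s2 s3 \<le> K2 * sym_weight p s1 s2 s3"
      using pw_2q_le_1[OF J(4,5)] K2_nonneg by (intro mult_right_mono mult_left_le) auto
    then show "\<bar>arg2 [s1, s2, s3] [t1, t2]\<bar>
        \<le> K2 * sym_weight p ([s1, s2, s3] ! 0) ([s1, s2, s3] ! 1) ([s1, s2, s3] ! 2)"
      using arg2_bound[OF J] by (simp add: numeral_2_eq_2)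
  qed
  then show "dominated (weights1 (3 * p)) 3 2 arg2"
    using K2_nonneg by (intro dominated_sym_weight[OF p_pos(1), where C = K2]) auto
qed simp

lemma ccont_dbl: "ccont 2 2 dbl"
  unfolding ccont_unfold bint21_apply
  by (intro continuous_intros ccont_compose_intros(1,3) ccont_Lam_arg2 cont cont2 maps_into_coord)

text \<open>
  The argument of \<open>\<Lambda>\<^sub>1\<close> is \<open>\<mu>\<^sub>1 inner_int - \<delta>\<^sub>1(yC)\<close>, so that adding \<open>yC\<close> to the sewn function leaves a
  primitive of \<open>\<mu>\<^sub>1 inner_int\<close>.
\<close>

lemma dbl_delta1:
  assumes "s1 \<in> J" "s2 \<in> J" "s3 \<in> J" "t1 \<in> J" "t2 \<in> J"
  shows "dbl [s1, s3] [t1, t2] - dbl [s1, s2] [t1, t2] - dbl [s2, s3] [t1, t2]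
    = inner_int [s1, s2, s2, s3] [t1, t2]"
  using Lam_arg2_eq[OF assms] arg2_eq_inner_int[OF assms] by (simp add: bint21_apply)

lemma holder22_dbl: "holder22 p q dbl"
  unfolding holder22_def
proof (intro conjI exI[of _ "sc * (2 * K2) + K * K"] ballI)
  show "0 \<le> sc * (2 * K2) + K * K" using K0 sc_pos K2_nonneg by simp
  fix s1 s2 t1 t2 assume J: "s1 \<in> J" "s2 \<in> J" "t1 \<in> J" "t2 \<in> J"
  have m: "pw (3 * p) s1 s2 \<le> pw p s1 s2" "pw (2 * p) s1 s2 \<le> pw p s1 s2"
    "pw (2 * q) t1 t2 \<le> pw q t1 t2"
    using J p_pos by (auto intro!: pw_antimono)
  have "\<bar>y [s1] [t1] * C [s1, s2] [t1, t2]\<bar> \<le> K * (K * (pw (2 * p) s1 s2 * pw (2 * q) t1 t2))"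
    using J by (intro abs_mult_le y_bd C_bd)
  also have "\<dots> \<le> K * (K * (pw p s1 s2 * pw q t1 t2))"
    using K0 m by (intro mult_left_mono mult_mono) auto
  finally have 1: "\<bar>y [s1] [t1] * C [s1, s2] [t1, t2]\<bar> \<le> K * (K * (pw p s1 s2 * pw q t1 t2))" .
  have "\<bar>Lam Dir1 arg2 [s1, s2] [t1, t2]\<bar> \<le> sc * (2 * (K2 * pw (2 * q) t1 t2)) * pw (3 * p) s1 s2"
    by (rule Lam_arg2_bound[OF J])
  also have "\<dots> \<le> sc * (2 * (K2 * pw q t1 t2)) * pw p s1 s2"
    using K2_nonneg sc_pos m by (intro mult_left_mono mult_mono) auto
  finally have "\<bar>dbl [s1, s2] [t1, t2]\<bar> \<le> K * (K * (pw p s1 s2 * pw q t1 t2))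
      + sc * (2 * (K2 * pw q t1 t2)) * pw p s1 s2"
    using 1 unfolding bint21_apply by linarith
  then show "\<bar>dbl [s1, s2] [t1, t2]\<bar> \<le> (sc * (2 * K2) + K * K) * (pw p s1 s2 * pw q t1 t2)"
    by (simp add: algebra_simps)
qed (rule ccont_dbl)

text \<open>
  The part of \<open>\<delta>(\<integral>\<^sub>1y\<integral>\<^sub>2dw du)\<close> of total exponents \<open>3p\<close> and \<open>3q\<close>.  Of the two terms taken away, \<open>bnd * Au\<close>
  belongs to the expansion of a controlled sheet, and the term in \<open>D\<close> is compensated by the product \<open>yC\<close>.
\<close>

definition dbl_rest :: cochain where
  "dbl_rest ss ts = ddelta dbl ss ts - bnd [ss ! 0, ss ! 1] [ts ! 0, ts ! 1] * Au [ss ! 1, ss ! 2] [ts ! 1, ts ! 2]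
     + (y [ss ! 0] [ts ! 1] - y [ss ! 0] [ts ! 0]) * D [ss ! 0, ss ! 1, ss ! 1, ss ! 2] [ts ! 1, ts ! 2]"

text \<open>
  The contribution of the sewing maps to \<open>dbl_rest\<close>.  It would vanish if \<open>\<delta>\<^sub>2(\<Lambda>\<^sub>1 \<otimes>\<^sub>1 1)\<close> of \<open>darg\<close> were the
  product of \<open>\<Lambda>\<^sub>1 arg\<close> with \<open>Au\<close>, in analogy to \<open>\<delta>\<^sub>2D = A \<otimes>\<^sub>1 Au\<close>.
\<close>

definition sewn :: "real \<Rightarrow> real \<Rightarrow> real \<Rightarrow> real \<Rightarrow> real \<Rightarrow> real \<Rightarrow> real \<Rightarrow> real" where
  "sewn s1 s2 s3 s4 t1 t2 t3 = LamL Dir1 darg [s1, s2, s3, s4] [t1, t3]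
     - LamL Dir1 darg [s1, s2, s3, s4] [t1, t2] - LamL Dir1 darg [s1, s2, s3, s4] [t2, t3]
     - Lam Dir1 arg [s1, s2] [t1, t2] * Au [s3, s4] [t2, t3]"

text \<open>
  As a function of \<open>(s\<^sub>1, s\<^sub>2)\<close>, \<open>sewn\<close> has exponent \<open>3p > 1\<close>, so it is bounded by its image under \<open>\<delta>\<^sub>1\<close>.  That
  image is obtained by taking \<open>\<delta>\<^sub>2\<close> of the arguments of the sewing maps; its products with \<open>Au\<close> cancel, and
  every remaining term contains \<open>F\<close> or an increment in \<open>t\<close> of \<open>y\<^sup>x\<close> or \<open>y\<^sup>\<sharp>\<close>.
\<close>

lemma sewn_bound:
  assumes s: "s1 \<in> J" "s2 \<in> J" and J: "s3 \<in> J" "s4 \<in> J" "t1 \<in> J" "t2 \<in> J" "t3 \<in> J"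
  shows "\<bar>sewn s1 s2 s3 s4 t1 t2 t3\<bar>
    \<le> sc * ((2 * (K * K) * (pw q t1 t2 * pw (2 * q) t2 t3) + K * W t1 t2 t3) * pw p s3 s4) * pw (3 * p) s1 s2"
proof -
  let ?Z = "\<lambda>a b. sewn a b s3 s4 t1 t2 t3"
  let ?Q = "pw q t1 t2 * pw (2 * q) t2 t3"
  let ?M = "(2 * (K * K) * ?Q + K * W t1 t2 t3) * pw p s3 s4"
  define k where "k a b c = - (yr [a, b] [t2] - yr [a, b] [t1]) * D [b, c, s3, s4] [t2, t3]
     + (yd [b] [t1] - yd [a] [t1]) * F [b, c, s3, s4] [t1, t2, t3]
     - (yd [b] [t2] - yd [a] [t2] - yd [b] [t1] + yd [a] [t1]) * E [b, c, s3, s4] [t2, t3]" for a b c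
  have W0: "W t1 t2 t3 \<ge> 0" by (rule total_weight_facts[OF W J(3,4,5)])
  \<comment> \<open>Here \<open>k\<close> is what remains of \<open>\<delta>\<^sub>1 sewn\<close> after the products with \<open>Au\<close> have cancelled.\<close>
  have Zk: "?Z a c - ?Z a b - ?Z b c = k a b c" if abc: "a \<in> J" "b \<in> J" "c \<in> J" for a b c
    using LamL_inner_eq[OF abc J(1,2,3,5)] LamL_inner_eq[OF abc J(1,2,3,4)] LamL_inner_eq[OF abc J(1,2,4,5)]
      Lam_arg_eq[OF abc J(3,4)] D_2[OF abc(2,3) J] E_2[OF abc(2,3) J]
    unfolding sewn_def k_def bint_arg1_apply
    by (simp del: atLeastAtMost_iff, algebra)
  have kb: "\<bar>k a b c\<bar> \<le> ?M * max \<bar>b - a\<bar> \<bar>c - b\<bar> powr (3 * p)"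
    if abc: "a \<in> J" "b \<in> J" "c \<in> J" for a b c
  proof -
    let ?m = "max \<bar>b - a\<bar> \<bar>c - b\<bar> powr (3 * p)"
    have m1: "pw (2 * p) a b * pw p b c \<le> ?m" using pw_mult_le_max[of "2 * p" p a b c] p_pos by simp
    have m2: "pw p a b * pw (2 * p) b c \<le> ?m" using pw_mult_le_max[of p "2 * p" a b c] p_pos by simp
    have "\<bar>- (yr [a, b] [t2] - yr [a, b] [t1]) * D [b, c, s3, s4] [t2, t3]\<bar>
       \<le> K * (pw (2 * p) a b * pw q t1 t2) * (K * (pw p b c * pw p s3 s4 * pw (2 * q) t2 t3))"
      using abc J dyr[of a b t1 t2] by (intro abs_mult_le D_bd) auto
    also have "\<dots> = K * K * ?Q * pw p s3 s4 * (pw (2 * p) a b * pw p b c)" by (simp add: algebra_simps)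
    also have "\<dots> \<le> K * K * ?Q * pw p s3 s4 * ?m" using K0 by (intro mult_left_mono m1) auto
    finally have 1: "\<bar>- (yr [a, b] [t2] - yr [a, b] [t1]) * D [b, c, s3, s4] [t2, t3]\<bar>
       \<le> K * K * ?Q * pw p s3 s4 * ?m" .
    have "\<bar>(yd [b] [t1] - yd [a] [t1]) * F [b, c, s3, s4] [t1, t2, t3]\<bar>
       \<le> K * pw p a b * (pw (2 * p) b c * pw p s3 s4 * W t1 t2 t3)"
      using abc J by (intro abs_mult_le dyd1 F_bd)
    also have "\<dots> = K * W t1 t2 t3 * pw p s3 s4 * (pw p a b * pw (2 * p) b c)" by (simp add: algebra_simps)
    also have "\<dots> \<le> K * W t1 t2 t3 * pw p s3 s4 * ?m" using K0 W0 by (intro mult_left_mono m2) auto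
    finally have 2: "\<bar>(yd [b] [t1] - yd [a] [t1]) * F [b, c, s3, s4] [t1, t2, t3]\<bar>
       \<le> K * W t1 t2 t3 * pw p s3 s4 * ?m" .
    have "\<bar>(yd [b] [t2] - yd [a] [t2] - yd [b] [t1] + yd [a] [t1]) * E [b, c, s3, s4] [t2, t3]\<bar>
       \<le> K * (pw p a b * pw q t1 t2) * (K * (pw (2 * p) b c * pw p s3 s4 * pw (2 * q) t2 t3))"
      using abc J by (intro abs_mult_le ddyd E_bd)
    also have "\<dots> = K * K * ?Q * pw p s3 s4 * (pw p a b * pw (2 * p) b c)" by (simp add: algebra_simps)
    also have "\<dots> \<le> K * K * ?Q * pw p s3 s4 * ?m" using K0 by (intro mult_left_mono m2) auto
    finally have 3: "\<bar>(yd [b] [t2] - yd [a] [t2] - yd [b] [t1] + yd [a] [t1]) * E [b, c, s3, s4] [t2, t3]\<bar>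
       \<le> K * K * ?Q * pw p s3 s4 * ?m" .
    have "\<bar>k a b c\<bar> \<le> K * K * ?Q * pw p s3 s4 * ?m + K * W t1 t2 t3 * pw p s3 s4 * ?m
        + K * K * ?Q * pw p s3 s4 * ?m"
      unfolding k_def using 1 2 3 by linarith
    then show ?thesis by (simp add: algebra_simps)
  qed
  have M0: "?M \<ge> 0" using K0 W0 by simp
  have "\<bar>?Z s1 s2\<bar> \<le> sewing_const (3 * p) * ?M * \<bar>s2 - s1\<bar> powr (3 * p)"
  proof (rule sewing_bound[OF p_pos(3) p_pos(3), where d = ?Z])
    fix a b assume ab: "a \<in> J" "b \<in> J"
    let ?L = "sc * (2 * (K * K))" and ?A = "\<bar>Au [s3, s4] [t2, t3]\<bar>"
    have A: "\<bar>Lam Dir1 arg [a, b] [t1, t2] * Au [s3, s4] [t2, t3]\<bar>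
        \<le> sc * (2 * (K * K * pw q t1 t2)) * \<bar>b - a\<bar> powr (3 * p) * ?A"
      using Lam_arg_bound[OF ab J(3,4)] by (intro abs_mult_le) (auto simp: sc_def pw_def)
    \<comment> \<open>A crude bound, whose constant does not enter the conclusion of \<open>sewing_bound\<close>.\<close>
    have "\<bar>?Z a b\<bar> \<le> 3 * (?L * \<bar>b - a\<bar> powr (3 * p))
       + sc * (2 * (K * K * pw q t1 t2)) * \<bar>b - a\<bar> powr (3 * p) * ?A"
      unfolding sewn_def
      using A LamL_inner_bound'[OF ab J(1,2,3,5)] LamL_inner_bound'[OF ab J(1,2,3,4)]
        LamL_inner_bound'[OF ab J(1,2,4,5)] by linarith
    then show "\<bar>?Z a b\<bar> \<le> (3 * ?L + sc * (2 * (K * K * pw q t1 t2)) * ?A) * \<bar>b - a\<bar> powr (3 * p)"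
      by (simp add: algebra_simps)
  next
    fix a b assume ab: "a \<in> J" "b \<in> J"
    have m: "(a + b) / 2 \<in> J" by (rule midpoint_mem[OF ab])
    have "max \<bar>(a + b) / 2 - a\<bar> \<bar>b - (a + b) / 2\<bar> powr (3 * p) \<le> \<bar>b - a\<bar> powr (3 * p)"
      using p_pos by (intro powr_mono2) (auto simp: field_simps)
    then have "\<bar>k a ((a + b) / 2) b\<bar> \<le> ?M * \<bar>b - a\<bar> powr (3 * p)"
      by (rule order_trans[OF kb[OF ab(1) m ab(2)] mult_left_mono[OF _ M0]])
    then show "\<bar>?Z a b - ?Z a ((a + b) / 2) - ?Z ((a + b) / 2) b\<bar> \<le> ?M * \<bar>b - a\<bar> powr (3 * p)"
      using Zk[OF ab(1) m ab(2)] by simp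
  qed (use s in auto)
  then show ?thesis by (simp add: sc_def pw_def)
qed

lemma dbl_rest_eq:
  assumes J: "s1 \<in> J" "s2 \<in> J" "s3 \<in> J" "t1 \<in> J" "t2 \<in> J" "t3 \<in> J"
  shows "dbl_rest [s1, s2, s3] [t1, t2, t3] = sewn s1 s2 s2 s3 t1 t2 t3
     - (yd [s1] [t2] - yd [s1] [t1]) * E [s1, s2, s2, s3] [t2, t3]
     + yd [s1] [t1] * F [s1, s2, s2, s3] [t1, t2, t3]"
proof -
  have "ddelta dbl [s1, s2, s3] [t1, t2, t3] = inner_int [s1, s2, s2, s3] [t1, t3]
     - inner_int [s1, s2, s2, s3] [t1, t2] - inner_int [s1, s2, s2, s3] [t2, t3]"
    using dbl_delta1[OF J(1,2,3,4,6)] dbl_delta1[OF J(1,2,3,4,5)] dbl_delta1[OF J(1,2,3,5,6)]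
    unfolding ddelta_apply by linarith
  then show ?thesis
    unfolding dbl_rest_def sewn_def inner_int_def darg_prim_apply bint1_apply
    using D_2[OF J(1,2,2,3,4,5,6)] E_2[OF J(1,2,2,3,4,5,6)]
    by (simp add: numeral_2_eq_2 bint1_apply algebra_simps del: atLeastAtMost_iff)
qed

lemma dominated_dbl_rest: "dominated (weights2 (3 * p) (3 * q)) 3 3 dbl_rest"
proof -
  note WW = weights_weights2[of "3 * p" "3 * q"]
  let ?w = "\<lambda>ss ts :: real list. pw (2 * p) (ss ! 0) (ss ! 1) * pw (3 * p - 2 * p) (ss ! 1) (ss ! 2)
     * (pw q (ts ! 0) (ts ! 1) * pw (3 * q - q) (ts ! 1) (ts ! 2))"
  have "?w \<in> weights2 (3 * p) (3 * q)"
    unfolding weights2_def mem_Collect_eq using p_pos by (intro exI[of _ "2 * p"] exI[of _ q]) auto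
  then have d1: "dominated (weights2 (3 * p) (3 * q)) 3 3 ?w"
    by (rule dominated_single[OF WW, where C = 1]) auto
  define c1 where "c1 = sc * (2 * (K * K)) + K * K"
  define c2 where "c2 = sc * K + K"
  have c: "c1 \<ge> 0" "c2 \<ge> 0" using K0 sc_pos by (auto simp: c1_def c2_def)
  have d1': "dominated (weights2 (3 * p) (3 * q)) 3 3 (\<lambda>ss ts. c1 * ?w ss ts)"
    by (rule dominated_mono[OF WW d1 c(1)]) (use c in \<open>simp add: abs_mult\<close>)
  let ?w2 = "\<lambda>ss ts :: real list. pw (2 * p) (ss ! 0) (ss ! 1) * pw (3 * p - 2 * p) (ss ! 1) (ss ! 2)
     * W (ts ! 0) (ts ! 1) (ts ! 2)"
  have d2: "dominated (weights2 (3 * p) (3 * q)) 3 3 ?w2"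
    using p_pos by (intro dominated_product_weight W) auto
  have d2': "dominated (weights2 (3 * p) (3 * q)) 3 3 (\<lambda>ss ts. c2 * ?w2 ss ts)"
    by (rule dominated_mono[OF WW d2 c(2)]) (use c in \<open>simp add: abs_mult\<close>)
  have "\<forall>ss\<in>cube 3. \<forall>ts\<in>cube 3. \<bar>dbl_rest ss ts\<bar> \<le> c1 * ?w ss ts + c2 * ?w2 ss ts"
    unfolding ball_cube
  proof (intro ballI)
    fix s1 s2 s3 t1 t2 t3
    assume J: "s1 \<in> J" "s2 \<in> J" "s3 \<in> J" "t1 \<in> J" "t2 \<in> J" "t3 \<in> J"
    let ?Q = "pw q t1 t2 * pw (2 * q) t2 t3" and ?S = "pw (2 * p) s1 s2 * pw p s2 s3"
    have W0: "W t1 t2 t3 \<ge> 0" by (rule total_weight_facts[OF W J(4,5,6)])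
    have m: "pw (3 * p) s1 s2 \<le> pw (2 * p) s1 s2" using J p_pos by (intro pw_antimono) auto
    have "\<bar>sewn s1 s2 s2 s3 t1 t2 t3\<bar>
       \<le> sc * ((2 * (K * K) * ?Q + K * W t1 t2 t3) * pw p s2 s3) * pw (3 * p) s1 s2"
      by (rule sewn_bound[OF J(1,2,2,3,4,5,6)])
    also have "\<dots> \<le> sc * ((2 * (K * K) * ?Q + K * W t1 t2 t3) * pw p s2 s3) * pw (2 * p) s1 s2"
      using K0 W0 sc_pos by (intro mult_left_mono m) auto
    finally have 1: "\<bar>sewn s1 s2 s2 s3 t1 t2 t3\<bar>
       \<le> sc * ((2 * (K * K) * ?Q + K * W t1 t2 t3) * pw p s2 s3) * pw (2 * p) s1 s2" .
    have 2: "\<bar>(yd [s1] [t2] - yd [s1] [t1]) * E [s1, s2, s2, s3] [t2, t3]\<bar>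
       \<le> K * pw q t1 t2 * (K * (pw (2 * p) s1 s2 * pw p s2 s3 * pw (2 * q) t2 t3))"
      using J by (intro abs_mult_le dyd2 E_bd)
    have 3: "\<bar>yd [s1] [t1] * F [s1, s2, s2, s3] [t1, t2, t3]\<bar>
       \<le> K * (pw (2 * p) s1 s2 * pw p s2 s3 * W t1 t2 t3)"
      using J by (intro abs_mult_le yd_bd F_bd)
    have "\<bar>dbl_rest [s1, s2, s3] [t1, t2, t3]\<bar>
      \<le> sc * ((2 * (K * K) * ?Q + K * W t1 t2 t3) * pw p s2 s3) * pw (2 * p) s1 s2
       + K * pw q t1 t2 * (K * (pw (2 * p) s1 s2 * pw p s2 s3 * pw (2 * q) t2 t3))
       + K * (pw (2 * p) s1 s2 * pw p s2 s3 * W t1 t2 t3)"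
      unfolding dbl_rest_eq[OF J] using 1 2 3 by linarith
    also have "\<dots> = c1 * (?S * ?Q) + c2 * (?S * W t1 t2 t3)"
      by (simp add: c1_def c2_def algebra_simps)
    finally show "\<bar>dbl_rest [s1, s2, s3] [t1, t2, t3]\<bar>
       \<le> c1 * ?w [s1, s2, s3] [t1, t2, t3] + c2 * ?w2 [s1, s2, s3] [t1, t2, t3]"
      by (simp add: numeral_2_eq_2)
  qed
  then show ?thesis by (intro dominated_add[OF WW d1' d2']) fastforce
qed

lemma dbl_expansion:
  "\<exists>r. dominated (weights2 (3 * p) (3 * q)) 3 3 r \<and> (\<forall>s1 s2 s3 t1 t2 t3.
     ddelta dbl [s1, s2, s3] [t1, t2, t3] = r [s1, s2, s3] [t1, t2, t3]
       + bnd [s1, s2] [t1, t2] * Au [s2, s3] [t2, t3]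
       - (y [s1] [t2] - y [s1] [t1]) * D [s1, s2, s2, s3] [t2, t3])"
  by (intro exI[of _ dbl_rest] conjI allI dominated_dbl_rest) (simp add: dbl_rest_def numeral_2_eq_2)

lemma dominated_ddelta_C: "dominated (weights2 (3 * p) (3 * q)) 3 3
    (\<lambda>ss ts. ddelta y [ss ! 0, ss ! 1] [ts ! 0, ts ! 1] * C [ss ! 1, ss ! 2] [ts ! 1, ts ! 2])"
proof -
  let ?w = "\<lambda>ss ts :: real list. pw p (ss ! 0) (ss ! 1) * pw (3 * p - p) (ss ! 1) (ss ! 2)
     * (pw q (ts ! 0) (ts ! 1) * pw (3 * q - q) (ts ! 1) (ts ! 2))"
  have w: "?w \<in> weights2 (3 * p) (3 * q)"
    unfolding weights2_def mem_Collect_eq using p_pos by (intro exI[of _ p] exI[of _ q]) auto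
  have "\<forall>ss\<in>cube 3. \<forall>ts\<in>cube 3. \<bar>ddelta y [ss ! 0, ss ! 1] [ts ! 0, ts ! 1]
      * C [ss ! 1, ss ! 2] [ts ! 1, ts ! 2]\<bar> \<le> (2 * (K * K) + K) * K * ?w ss ts"
    unfolding ball_cube
  proof (intro ballI)
    fix s1 s2 s3 t1 t2 t3
    assume J: "s1 \<in> J" "s2 \<in> J" "s3 \<in> J" "t1 \<in> J" "t2 \<in> J" "t3 \<in> J"
    have "\<bar>ddelta y [s1, s2] [t1, t2] * C [s2, s3] [t2, t3]\<bar>
      \<le> (2 * (K * K) + K) * (pw p s1 s2 * pw q t1 t2) * (K * (pw (2 * p) s2 s3 * pw (2 * q) t2 t3))"
      using J ddy_bound[of s1 s2 t1 t2] by (intro abs_mult_le C_bd) (auto simp: algebra_simps)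
    then show "\<bar>ddelta y [[s1, s2, s3] ! 0, [s1, s2, s3] ! 1] [[t1, t2, t3] ! 0, [t1, t2, t3] ! 1]
      * C [[s1, s2, s3] ! 1, [s1, s2, s3] ! 2] [[t1, t2, t3] ! 1, [t1, t2, t3] ! 2]\<bar>
      \<le> (2 * (K * K) + K) * K * ?w [s1, s2, s3] [t1, t2, t3]"
      by (simp add: numeral_2_eq_2 algebra_simps del: ddelta_apply)
  qed
  then show ?thesis
    using K0 by (intro dominated_single[OF weights_weights2 w, where C = "(2 * (K * K) + K) * K"]) auto
qed

end

section \<open>Rough data in either orientation\<close>

fun expo :: "real \<Rightarrow> real \<Rightarrow> dir \<Rightarrow> real" where
  "expo \<alpha> \<beta> Dir1 = \<alpha>"
| "expo \<alpha> \<beta> Dir2 = \<beta>"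

lemma orient_zero: "orient a 0 = (0 :: cochain)"
  by (cases a) (auto simp: fun_eq_iff)

lemma orient_delta_opp:
  "orient a (delta (opp a) g) ss [t1, t2] = orient a g ss [t2] - orient a g ss [t1]"
  "orient a (delta (opp a) g) ss [t1, t2, t3] =
     orient a g ss [t1, t3] - orient a g ss [t1, t2] - orient a g ss [t2, t3]"
  by (cases a; simp)+

lemma orient_CC11: "CC11 \<alpha> \<beta> f \<Longrightarrow> holder11 (expo \<alpha> \<beta> a) (expo \<alpha> \<beta> (opp a)) (orient a f)"
  using CC11_imp_holder11[of \<alpha> \<beta> f] holder11_swap[of \<alpha> \<beta> f] by (cases a) auto

lemma orient_CC22: "CC22 \<alpha> \<beta> g \<Longrightarrow> holder22 (expo \<alpha> \<beta> a) (expo \<alpha> \<beta> (opp a)) (orient a g)"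
  using holder22_swap[of \<alpha> \<beta> g] by (cases a) (auto simp: CC22_iff_holder22)

lemma ccont_orient: "ccont k k g \<Longrightarrow> ccont k k (orient a g)"
  using ccont_swap[of k k g] by (cases a) auto

lemma CC_orient: "CC 2 2 g \<Longrightarrow> CC 2 2 (orient a g)"
  using ccont_swap[of 2 2 g] by (cases a) (auto simp: CC22_vanish_iff)

lemma ceqD2: "ceq a n 2 g h \<Longrightarrow> ss \<in> cube n \<Longrightarrow> t1 \<in> J \<Longrightarrow> t2 \<in> J \<Longrightarrow>
    orient a g ss [t1, t2] = orient a h ss [t1, t2]"
  by (simp add: ceq_def)

lemma ceqD3: "ceq a n 3 g h \<Longrightarrow> ss \<in> cube n \<Longrightarrow> t1 \<in> J \<Longrightarrow> t2 \<in> J \<Longrightarrow> t3 \<in> J \<Longrightarrow>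
    orient a g ss [t1, t2, t3] = orient a h ss [t1, t2, t3]"
  by (simp add: ceq_def)

lemma orient_ctens: "orient a (ctens a m g h) ss ts =
    orient a g (take 2 ss) (take m ts) * orient a h (drop 2 ss) (drop (m - 1) ts)"
  by (simp add: ctens_def)

lemma orient_deltaL: "orient a (deltaL a D) [s1, s2, s3, s4, s5] ts =
    orient a D [s1, s3, s4, s5] ts - orient a D [s1, s2, s4, s5] ts - orient a D [s2, s3, s4, s5] ts"
  by (simp add: deltaL_def)

lemma orient_deltaR: "orient a (deltaR a D) [s1, s2, s3, s4, s5] ts =
    orient a D [s1, s2, s3, s5] ts - orient a D [s1, s2, s3, s4] ts - orient a D [s1, s2, s4, s5] ts"
  by (simp add: deltaR_def)

context
  fixes x :: cochain and R :: rough_data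
  assumes rel: "rough_relations x R"
begin

lemma rough_relationsD:
  "ceq a 3 2 (delta a (rA R u)) 0"
  "ceq a 3 2 (delta a (rB R a u)) (cprod a 2 1 (delta a x) (rA R u))"
  "ceq a 3 2 (delta a (rC R u v)) (mu a (rD R a u v))"
  "ceq a 5 2 (deltaR a (rD R a u v)) 0"
  "ceq a 4 3 (delta (opp a) (rD R a u v)) (ctens a 2 (rA R u) (rA R v))"
  "ceq a 5 2 (deltaR a (rE R a u v)) 0"
  "ceq a 5 2 (deltaL a (rE R a u v)) (cprod a 2 1 (delta a x) (rD R a u v))"
  "ceq a 4 3 (delta (opp a) (rE R a u v)) (rF R a u v + ctens a 2 (rB R a u) (rA R v))"
  using rel unfolding rough_relations_def by blast+

text \<open>
  The relations of the algebraic hypothesis at points, oriented to direction \<open>a\<close> and solved for the value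
  on the longest interval.
\<close>

lemma rough_A: "\<lbrakk>s1 \<in> J; s2 \<in> J; s3 \<in> J; t1 \<in> J; t2 \<in> J\<rbrakk> \<Longrightarrow>
    orient a (rA R u) [s1, s3] [t1, t2] = orient a (rA R u) [s1, s2] [t1, t2] + orient a (rA R u) [s2, s3] [t1, t2]"
  using ceqD2[OF rough_relationsD(1)[of a u], of "[s1, s2, s3]" t1 t2]
  by (simp add: orient_delta orient_zero cube_def)

lemma rough_B: "\<lbrakk>s1 \<in> J; s2 \<in> J; s3 \<in> J; t1 \<in> J; t2 \<in> J\<rbrakk> \<Longrightarrow>
    orient a (rB R a u) [s1, s3] [t1, t2] = orient a (rB R a u) [s1, s2] [t1, t2] + orient a (rB R a u) [s2, s3] [t1, t2]
      + (orient a x [s2] [t1] - orient a x [s1] [t1]) * orient a (rA R u) [s2, s3] [t1, t2]"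
  using ceqD2[OF rough_relationsD(2)[of a u], of "[s1, s2, s3]" t1 t2]
  by (simp add: orient_delta orient_cprod cprod_def cube_def algebra_simps)

lemma rough_C: "\<lbrakk>s1 \<in> J; s2 \<in> J; s3 \<in> J; t1 \<in> J; t2 \<in> J\<rbrakk> \<Longrightarrow>
    orient a (rC R u v) [s1, s3] [t1, t2] = orient a (rC R u v) [s1, s2] [t1, t2] + orient a (rC R u v) [s2, s3] [t1, t2]
      + orient a (rD R a u v) [s1, s2, s2, s3] [t1, t2]"
  using ceqD2[OF rough_relationsD(3)[of a u v], of "[s1, s2, s3]" t1 t2]
  by (simp add: orient_delta orient_mu mu_def cube_def numeral_2_eq_2)

lemma rough_D_R: "\<lbrakk>s1 \<in> J; s2 \<in> J; s3 \<in> J; s4 \<in> J; s5 \<in> J; t1 \<in> J; t2 \<in> J\<rbrakk> \<Longrightarrow>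
    orient a (rD R a u v) [s1, s2, s3, s5] [t1, t2] =
      orient a (rD R a u v) [s1, s2, s3, s4] [t1, t2] + orient a (rD R a u v) [s1, s2, s4, s5] [t1, t2]"
  using ceqD2[OF rough_relationsD(4)[of a u v], of "[s1, s2, s3, s4, s5]" t1 t2]
  by (simp add: orient_deltaR orient_zero cube_def)

lemma rough_D_2: "\<lbrakk>s1 \<in> J; s2 \<in> J; s3 \<in> J; s4 \<in> J; t1 \<in> J; t2 \<in> J; t3 \<in> J\<rbrakk> \<Longrightarrow>
    orient a (rD R a u v) [s1, s2, s3, s4] [t1, t3] =
      orient a (rD R a u v) [s1, s2, s3, s4] [t1, t2] + orient a (rD R a u v) [s1, s2, s3, s4] [t2, t3]
      + orient a (rA R u) [s1, s2] [t1, t2] * orient a (rA R v) [s3, s4] [t2, t3]"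
  using ceqD3[OF rough_relationsD(5)[of a u v], of "[s1, s2, s3, s4]" t1 t2 t3]
  by (simp add: orient_delta_opp orient_ctens cube_def numeral_2_eq_2)

lemma rough_E_R: "\<lbrakk>s1 \<in> J; s2 \<in> J; s3 \<in> J; s4 \<in> J; s5 \<in> J; t1 \<in> J; t2 \<in> J\<rbrakk> \<Longrightarrow>
    orient a (rE R a u v) [s1, s2, s3, s5] [t1, t2] =
      orient a (rE R a u v) [s1, s2, s3, s4] [t1, t2] + orient a (rE R a u v) [s1, s2, s4, s5] [t1, t2]"
  using ceqD2[OF rough_relationsD(6)[of a u v], of "[s1, s2, s3, s4, s5]" t1 t2]
  by (simp add: orient_deltaR orient_zero cube_def)

lemma rough_E_L: "\<lbrakk>s1 \<in> J; s2 \<in> J; s3 \<in> J; s4 \<in> J; s5 \<in> J; t1 \<in> J; t2 \<in> J\<rbrakk> \<Longrightarrow>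
    orient a (rE R a u v) [s1, s3, s4, s5] [t1, t2] =
      orient a (rE R a u v) [s1, s2, s4, s5] [t1, t2] + orient a (rE R a u v) [s2, s3, s4, s5] [t1, t2]
      + (orient a x [s2] [t1] - orient a x [s1] [t1]) * orient a (rD R a u v) [s2, s3, s4, s5] [t1, t2]"
  using ceqD2[OF rough_relationsD(7)[of a u v], of "[s1, s2, s3, s4, s5]" t1 t2]
  by (simp add: orient_deltaL orient_delta orient_cprod cprod_def cube_def algebra_simps)

lemma rough_E_2: "\<lbrakk>s1 \<in> J; s2 \<in> J; s3 \<in> J; s4 \<in> J; t1 \<in> J; t2 \<in> J; t3 \<in> J\<rbrakk> \<Longrightarrow>
    orient a (rE R a u v) [s1, s2, s3, s4] [t1, t3] =
      orient a (rE R a u v) [s1, s2, s3, s4] [t1, t2] + orient a (rE R a u v) [s1, s2, s3, s4] [t2, t3]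
      + orient a (rF R a u v) [s1, s2, s3, s4] [t1, t2, t3]
      + orient a (rB R a u) [s1, s2] [t1, t2] * orient a (rA R v) [s3, s4] [t2, t3]"
  using ceqD3[OF rough_relationsD(8)[of a u v], of "[s1, s2, s3, s4]" t1 t2 t3]
  by (simp add: orient_delta_opp orient_plus orient_ctens cube_def numeral_2_eq_2)

end

lemma rough_regularity_oriented:
  assumes R: "rough_regularity \<alpha> \<beta> R"
  defines "p \<equiv> expo \<alpha> \<beta>"
  shows "holder22 (p a) (p (opp a)) (orient a (rA R u))"
    and "holder22 (2 * p a) (p (opp a)) (orient a (rB R a u))"
    and "holder22 (2 * p a) (2 * p (opp a)) (orient a (rC R u v))"
    and "holder42 (p a) (p a) (2 * p (opp a)) (orient a (rD R a u v))"
    and "holder42 (2 * p a) (p a) (2 * p (opp a)) (orient a (rE R a u v))"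
    and "holder43 (2 * p a) (p a) (3 * p (opp a)) (orient a (rF R a u v))"
proof -
  have reg: "CC22 \<alpha> \<beta> (rA R u)" "CC22 (2 * \<alpha>) \<beta> (rB R Dir1 u)" "CC22 \<alpha> (2 * \<beta>) (rB R Dir2 u)"
     "CC22 (2 * \<alpha>) (2 * \<beta>) (rC R u v)" "Tspace Dir1 \<alpha> \<alpha> (2 * \<beta>) (rD R Dir1 u v)"
     "Tspace Dir2 \<beta> \<beta> (2 * \<alpha>) (rD R Dir2 u v)" "Tspace Dir1 (2 * \<alpha>) \<alpha> (2 * \<beta>) (rE R Dir1 u v)"
     "Tspace Dir2 (2 * \<beta>) \<beta> (2 * \<alpha>) (rE R Dir2 u v)" "T3space Dir1 (2 * \<alpha>) \<alpha> (3 * \<beta>) (rF R Dir1 u v)"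
     "T3space Dir2 (2 * \<beta>) \<beta> (3 * \<alpha>) (rF R Dir2 u v)"
    using R unfolding rough_regularity_def by blast+
  show "holder22 (p a) (p (opp a)) (orient a (rA R u))"
    unfolding p_def by (rule orient_CC22[OF reg(1)])
  show "holder22 (2 * p a) (p (opp a)) (orient a (rB R a u))"
    using orient_CC22[OF reg(2), of a] orient_CC22[OF reg(3), of a] unfolding p_def by (cases a) simp_all
  show "holder22 (2 * p a) (2 * p (opp a)) (orient a (rC R u v))"
    using orient_CC22[OF reg(4), of a] unfolding p_def by (cases a) simp_all
  show "holder42 (p a) (p a) (2 * p (opp a)) (orient a (rD R a u v))"
    using Tspace_imp_holder42[OF reg(5)] Tspace_imp_holder42[OF reg(6)] unfolding p_def by (cases a) simp_all
  show "holder42 (2 * p a) (p a) (2 * p (opp a)) (orient a (rE R a u v))"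
    using Tspace_imp_holder42[OF reg(7)] Tspace_imp_holder42[OF reg(8)] unfolding p_def by (cases a) simp_all
  show "holder43 (2 * p a) (p a) (3 * p (opp a)) (orient a (rF R a u v))"
    using T3space_imp_holder43[OF reg(9)] T3space_imp_holder43[OF reg(10)] unfolding p_def by (cases a) simp_all
qed

lemma controlled_path_oriented:
  assumes Y: "controlled_path \<alpha> \<beta> x Y"
  defines "p \<equiv> expo \<alpha> \<beta>"
  shows "\<forall>s1\<in>J. \<forall>s2\<in>J. \<forall>t\<in>J. orient a (cfun Y) [s2] [t] = orient a (cfun Y) [s1] [t]
      + orient a (cder Y a) [s1] [t] * (orient a x [s2] [t] - orient a x [s1] [t])
      + orient a (crem Y a) [s1, s2] [t]"
    and "holder11 (p a) (p (opp a)) (orient a (cder Y a))"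
    and "holder21 (2 * p a) (p (opp a)) (orient a (crem Y a))"
proof -
  have "ceq a 2 1 (delta a (cfun Y)) (cprod a 1 1 (cder Y a) (delta a x) + crem Y a)"
    using Y unfolding controlled_path_def by blast
  then have "\<forall>s1\<in>J. \<forall>s2\<in>J. \<forall>t\<in>J. orient a (delta a (cfun Y)) [s1, s2] [t]
      = orient a (cprod a 1 1 (cder Y a) (delta a x) + crem Y a) [s1, s2] [t]"
    unfolding ceq_def ball_cube .
  then show "\<forall>s1\<in>J. \<forall>s2\<in>J. \<forall>t\<in>J. orient a (cfun Y) [s2] [t] = orient a (cfun Y) [s1] [t]
      + orient a (cder Y a) [s1] [t] * (orient a x [s2] [t] - orient a x [s1] [t])
      + orient a (crem Y a) [s1, s2] [t]"
    by (simp add: orient_delta orient_plus orient_cprod cprod_def algebra_simps)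
  show "holder11 (p a) (p (opp a)) (orient a (cder Y a))"
    using Y unfolding p_def controlled_path_def by (intro orient_CC11) blast
  have "CC21 (2 * \<alpha>) \<beta> (crem Y Dir1)" "CC12 \<alpha> (2 * \<beta>) (crem Y Dir2)"
    using Y unfolding controlled_path_def by blast+
  then show "holder21 (2 * p a) (p (opp a)) (orient a (crem Y a))"
    using CC21_imp_holder21[of "2 * \<alpha>" \<beta> "crem Y Dir1"]
      CC21_imp_holder21[OF CC12_imp_CC21_swap[of \<alpha> "2 * \<beta>" "crem Y Dir2"]]
    unfolding p_def by (cases a) simp_all
qed

text \<open>
  The decompositions along the two axes, applied on \<open>{0} \<times> [0, t]\<close> and then on \<open>[0, s] \<times> {t}\<close>, express \<open>y\<close> by
  continuous functions and by \<open>y\<^bsub>00\<^esub>\<close>.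
\<close>

lemma controlled_path_regular:
  assumes pq: "\<alpha> > 0" "\<beta> > 0" and x: "CC11 \<alpha> \<beta> x" and Y: "controlled_path \<alpha> \<beta> x Y"
  shows "ccont 1 1 (cfun Y)" and "\<exists>K\<ge>0. \<forall>s\<in>J. \<forall>t\<in>J. \<bar>cfun Y [s] [t]\<bar> \<le> K"
proof -
  note eq1 = controlled_path_oriented(1)[OF Y, of Dir1, simplified orient.simps, rule_format]
  note eq2 = controlled_path_oriented(1)[OF Y, of Dir2, simplified orient.simps, rule_format]
  have J0: "(0 :: real) \<in> J" by simp
  let ?f = "\<lambda>s t. cfun Y [0] [0] + cder Y Dir2 [0] [0] * (x [0] [t] - x [0] [0]) + crem Y Dir2 [0] [0, t]
      + cder Y Dir1 [0] [t] * (x [s] [t] - x [0] [t]) + crem Y Dir1 [0, s] [t]"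
  have f: "cfun Y [s] [t] = ?f s t" if "s \<in> J" "t \<in> J" for s t
    using eq1[OF J0 that] eq2[OF J0 that(2) J0] by simp
  have c: "ccont 1 1 x" "ccont 1 1 (cder Y Dir1)" "ccont 2 1 (crem Y Dir1)" "ccont 1 2 (crem Y Dir2)"
    using x Y unfolding controlled_path_def CC11_def CC12_def CC21_def CC_def by blast+
  have c2: "ccont 2 1 (\<lambda>ss ts. crem Y Dir2 ts ss)" by (rule ccont_swap[OF c(4)])
  have "ccont 1 1 (\<lambda>ss ts. ?f (ss ! 0) (ts ! 0))"
  proof -
    have m: "maps_into (seqs \<times> seqs) (\<lambda>_ :: (nat \<Rightarrow> real) \<times> (nat \<Rightarrow> real). 0)" by simp
    note m' = m maps_into_coord
    show ?thesis
      unfolding ccont_unfold nth_Cons_0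
      by (intro continuous_on_add continuous_on_mult continuous_on_diff continuous_on_const
          ccont_compose_intros(1)[OF c(1)] ccont_compose_intros(1)[OF c(2)]
          ccont_compose_intros(2)[OF c(3)] ccont_compose_intros(2)[OF c2] m')
  qed
  then show "ccont 1 1 (cfun Y)"
  proof (rule ccont_cong)
    have "\<forall>ss\<in>cube 1. \<forall>ts\<in>cube 1. cfun Y ss ts = ?f (ss ! 0) (ts ! 0)"
      unfolding ball_cube nth_Cons_0 by (intro ballI f)
    then show "\<And>ss ts. ss \<in> cube 1 \<Longrightarrow> ts \<in> cube 1 \<Longrightarrow> cfun Y ss ts = ?f (ss ! 0) (ts ! 0)" by blast
  qed
  obtain K1 where K1: "K1 \<ge> 0" "\<And>s t. s \<in> J \<Longrightarrow> t \<in> J \<Longrightarrow> \<bar>x [s] [t]\<bar> \<le> K1"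
    using CC11_imp_holder11[OF x] unfolding holder11_def by blast
  obtain K2 where K2: "K2 \<ge> 0" "\<And>s t. s \<in> J \<Longrightarrow> t \<in> J \<Longrightarrow> \<bar>cder Y Dir1 [s] [t]\<bar> \<le> K2"
    using controlled_path_oriented(2)[OF Y, of Dir1] unfolding holder11_def orient.simps by blast
  obtain K3 where K3: "K3 \<ge> 0" "\<And>s1 s2 t. s1 \<in> J \<Longrightarrow> s2 \<in> J \<Longrightarrow> t \<in> J \<Longrightarrow>
      \<bar>crem Y Dir1 [s1, s2] [t]\<bar> \<le> K3 * pw (2 * \<alpha>) s1 s2"
    using controlled_path_oriented(3)[OF Y, of Dir1] unfolding holder21_def orient.simps expo.simps by blast
  obtain K4 where K4: "K4 \<ge> 0" "\<And>s1 s2 t. s1 \<in> J \<Longrightarrow> s2 \<in> J \<Longrightarrow> t \<in> J \<Longrightarrow>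
      \<bar>crem Y Dir2 [t] [s1, s2]\<bar> \<le> K4 * pw (2 * \<beta>) s1 s2"
    using controlled_path_oriented(3)[OF Y, of Dir2] unfolding holder21_def orient.simps expo.simps by blast
  let ?K = "\<bar>cfun Y [0] [0]\<bar> + \<bar>cder Y Dir2 [0] [0]\<bar> * (2 * K1) + K4 + K2 * (2 * K1) + K3"
  have "\<bar>cfun Y [s] [t]\<bar> \<le> ?K" if st: "s \<in> J" "t \<in> J" for s t
  proof -
    have dx: "\<bar>x [a] [b] - x [c] [d]\<bar> \<le> 2 * K1" if "a \<in> J" "b \<in> J" "c \<in> J" "d \<in> J" for a b c d
      using K1(2)[OF that(1,2)] K1(2)[OF that(3,4)] by linarith
    have 1: "\<bar>cder Y Dir2 [0] [0] * (x [0] [t] - x [0] [0])\<bar> \<le> \<bar>cder Y Dir2 [0] [0]\<bar> * (2 * K1)"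
      by (rule abs_mult_le[OF order_refl dx[OF J0 st(2) J0 J0]])
    have 2: "\<bar>cder Y Dir1 [0] [t] * (x [s] [t] - x [0] [t])\<bar> \<le> K2 * (2 * K1)"
      by (rule abs_mult_le[OF K2(2)[OF J0 st(2)] dx[OF st J0 st(2)]])
    have 3: "\<bar>crem Y Dir2 [0] [0, t]\<bar> \<le> K4 * 1"
      by (rule order_trans[OF K4(2)[OF J0 st(2) J0] mult_left_mono[OF pw_le_1]]) (use pq st K4(1) J0 in auto)
    have 4: "\<bar>crem Y Dir1 [0, s] [t]\<bar> \<le> K3 * 1"
      by (rule order_trans[OF K3(2)[OF J0 st] mult_left_mono[OF pw_le_1]]) (use pq st K3(1) J0 in auto)
    show ?thesis unfolding f[OF st] using 1 2 3 4 by linarith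
  qed
  moreover have "?K \<ge> 0" using K1 K2 K3 K4 by simp
  ultimately show "\<exists>K\<ge>0. \<forall>s\<in>J. \<forall>t\<in>J. \<bar>cfun Y [s] [t]\<bar> \<le> K" by blast
qed

lemma le_scale: "a \<le> k * X \<Longrightarrow> k \<le> K \<Longrightarrow> 0 \<le> X \<Longrightarrow> a \<le> K * (X :: real)"
  by (meson mult_right_mono order_trans)

text \<open>
  The constant \<open>K\<close> is the sum of the constants in all the norms involved.
\<close>

lemma controlled_double_integrand_exists:
  assumes pq: "\<alpha> > 1/3" "\<beta> > 1/3" and x: "CC11 \<alpha> \<beta> x"
    and R: "algebraic_hypothesis \<alpha> \<beta> x R" and Y: "controlled_path \<alpha> \<beta> x Y"
  shows "\<exists>K W. controlled_double_integrand (expo \<alpha> \<beta> a) (expo \<alpha> \<beta> (opp a)) K (orient a x)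
      (orient a (cfun Y)) (orient a (cder Y a)) (orient a (crem Y a)) (orient a (rA R w)) (orient a (rB R a w))
      (orient a (rA R u)) (orient a (rC R w u)) (orient a (rD R a w u)) (orient a (rE R a w u))
      (orient a (rF R a w u)) W"
proof -
  define p where "p = expo \<alpha> \<beta> a"
  define q where "q = expo \<alpha> \<beta> (opp a)"
  have reg: "rough_regularity \<alpha> \<beta> R" and rel: "rough_relations x R"
    using R by (auto simp: algebraic_hypothesis_def)
  note reg' = rough_regularity_oriented[OF reg, of a, folded p_def q_def]
  note rels = rough_A[OF rel] rough_B[OF rel] rough_C[OF rel] rough_D_R[OF rel] rough_D_2[OF rel]
    rough_E_R[OF rel] rough_E_L[OF rel] rough_E_2[OF rel]
  note path = controlled_path_oriented[OF Y, of a, folded p_def q_def]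
  have pos: "\<alpha> > 0" "\<beta> > 0" using pq by auto
  have hx: "holder11 p q (orient a x)" unfolding p_def q_def by (rule orient_CC11[OF x])
  obtain Kx where Kx: "Kx \<ge> 0" "\<And>s1 s2 t1 t2. s1 \<in> J \<Longrightarrow> s2 \<in> J \<Longrightarrow> t1 \<in> J \<Longrightarrow> t2 \<in> J \<Longrightarrow>
     \<bar>orient a x [s1] [t1]\<bar> \<le> Kx \<and> \<bar>orient a x [s2] [t1] - orient a x [s1] [t1]\<bar> \<le> Kx * pw p s1 s2 \<and>
     \<bar>orient a x [s1] [t2] - orient a x [s1] [t1]\<bar> \<le> Kx * pw q t1 t2 \<and>
     \<bar>orient a x [s2] [t2] - orient a x [s1] [t2] - orient a x [s2] [t1] + orient a x [s1] [t1]\<bar>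
       \<le> Kx * (pw p s1 s2 * pw q t1 t2)"
    using hx unfolding holder11_def by blast
  let ?d = "orient a (cder Y a)" and ?r = "orient a (crem Y a)"
  obtain Kd where Kd: "Kd \<ge> 0" "\<And>s1 s2 t1 t2. s1 \<in> J \<Longrightarrow> s2 \<in> J \<Longrightarrow> t1 \<in> J \<Longrightarrow> t2 \<in> J \<Longrightarrow>
     \<bar>?d [s1] [t1]\<bar> \<le> Kd \<and> \<bar>?d [s2] [t1] - ?d [s1] [t1]\<bar> \<le> Kd * pw p s1 s2 \<and>
     \<bar>?d [s1] [t2] - ?d [s1] [t1]\<bar> \<le> Kd * pw q t1 t2 \<and>
     \<bar>?d [s2] [t2] - ?d [s1] [t2] - ?d [s2] [t1] + ?d [s1] [t1]\<bar> \<le> Kd * (pw p s1 s2 * pw q t1 t2)"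
    using path(2) unfolding holder11_def by blast
  obtain Kr where Kr: "Kr \<ge> 0" "\<And>s1 s2 t1 t2. s1 \<in> J \<Longrightarrow> s2 \<in> J \<Longrightarrow> t1 \<in> J \<Longrightarrow> t2 \<in> J \<Longrightarrow>
     \<bar>?r [s1, s2] [t1]\<bar> \<le> Kr * pw (2 * p) s1 s2 \<and>
     \<bar>?r [s1, s2] [t2] - ?r [s1, s2] [t1]\<bar> \<le> Kr * (pw (2 * p) s1 s2 * pw q t1 t2)"
    using path(3) unfolding holder21_def by blast
  obtain Ky where Ky: "Ky \<ge> 0" "\<And>s t. s \<in> J \<Longrightarrow> t \<in> J \<Longrightarrow> \<bar>cfun Y [s] [t]\<bar> \<le> Ky"
    using controlled_path_regular(2)[OF pos x Y] by blast
  have b22: "\<exists>K\<ge>0. \<forall>s1\<in>J. \<forall>s2\<in>J. \<forall>t1\<in>J. \<forall>t2\<in>J.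
      \<bar>g [s1, s2] [t1, t2]\<bar> \<le> K * (pw p' s1 s2 * pw q' t1 t2)"
    if "holder22 p' q' g" for p' q' g using that unfolding holder22_def by blast
  have b42: "\<exists>K\<ge>0. \<forall>s1\<in>J. \<forall>s2\<in>J. \<forall>s3\<in>J. \<forall>s4\<in>J. \<forall>t1\<in>J. \<forall>t2\<in>J.
       \<bar>g [s1, s2, s3, s4] [t1, t2]\<bar> \<le> K * (pw p' s1 s2 * pw p'' s3 s4 * pw q' t1 t2)"
    if "holder42 p' p'' q' g" for p' p'' q' g using that unfolding holder42_def by blast
  obtain KA where KA: "KA \<ge> 0" "\<forall>s1\<in>J. \<forall>s2\<in>J. \<forall>t1\<in>J. \<forall>t2\<in>J.
      \<bar>orient a (rA R w) [s1, s2] [t1, t2]\<bar> \<le> KA * (pw p s1 s2 * pw q t1 t2)"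
    using b22[OF reg'(1)] by blast
  obtain KB where KB: "KB \<ge> 0" "\<forall>s1\<in>J. \<forall>s2\<in>J. \<forall>t1\<in>J. \<forall>t2\<in>J.
      \<bar>orient a (rB R a w) [s1, s2] [t1, t2]\<bar> \<le> KB * (pw (2 * p) s1 s2 * pw q t1 t2)"
    using b22[OF reg'(2)] by blast
  obtain KC where KC: "KC \<ge> 0" "\<forall>s1\<in>J. \<forall>s2\<in>J. \<forall>t1\<in>J. \<forall>t2\<in>J.
      \<bar>orient a (rC R w u) [s1, s2] [t1, t2]\<bar> \<le> KC * (pw (2 * p) s1 s2 * pw (2 * q) t1 t2)"
    using b22[OF reg'(3)] by blast
  obtain KD where KD: "KD \<ge> 0" "\<forall>s1\<in>J. \<forall>s2\<in>J. \<forall>s3\<in>J. \<forall>s4\<in>J. \<forall>t1\<in>J. \<forall>t2\<in>J.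
      \<bar>orient a (rD R a w u) [s1, s2, s3, s4] [t1, t2]\<bar> \<le> KD * (pw p s1 s2 * pw p s3 s4 * pw (2 * q) t1 t2)"
    using b42[OF reg'(4)] by blast
  obtain KE where KE: "KE \<ge> 0" "\<forall>s1\<in>J. \<forall>s2\<in>J. \<forall>s3\<in>J. \<forall>s4\<in>J. \<forall>t1\<in>J. \<forall>t2\<in>J.
      \<bar>orient a (rE R a w u) [s1, s2, s3, s4] [t1, t2]\<bar>
        \<le> KE * (pw (2 * p) s1 s2 * pw p s3 s4 * pw (2 * q) t1 t2)"
    using b42[OF reg'(5)] by blast
  obtain W where W: "total_weight (3 * q) W" "\<forall>s1\<in>J. \<forall>s2\<in>J. \<forall>s3\<in>J. \<forall>s4\<in>J. \<forall>t1\<in>J. \<forall>t2\<in>J. \<forall>t3\<in>J.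
       \<bar>orient a (rF R a w u) [s1, s2, s3, s4] [t1, t2, t3]\<bar> \<le> pw (2 * p) s1 s2 * pw p s3 s4 * W t1 t2 t3"
    using reg'(6)[of w u] unfolding holder43_def by blast
  define K where "K = Kx + Kd + Kr + Ky + KA + KB + KC + KD + KE"
  have K: "K \<ge> 0" "Kx \<le> K" "Kd \<le> K" "Kr \<le> K" "Ky \<le> K" "KA \<le> K" "KB \<le> K" "KC \<le> K"
    "KD \<le> K" "KE \<le> K"
    using Kx(1) Kd(1) Kr(1) Ky(1) KA(1) KB(1) KC(1) KD(1) KE(1) unfolding K_def by auto
  have b1: "\<forall>s1\<in>J. \<forall>s2\<in>J. \<forall>t\<in>J. \<bar>orient a x [s2] [t] - orient a x [s1] [t]\<bar> \<le> K * pw p s1 s2"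
    by (intro ballI, rule le_scale[OF _ K(2)], use Kx(2) in blast, simp)
  have b2: "\<forall>s1\<in>J. \<forall>s2\<in>J. \<forall>t1\<in>J. \<forall>t2\<in>J.
      \<bar>orient a x [s2] [t2] - orient a x [s1] [t2] - orient a x [s2] [t1] + orient a x [s1] [t1]\<bar> \<le> K * (pw p s1 s2 * pw q t1 t2)"
    by (intro ballI, rule le_scale[OF _ K(2)], use Kx(2) in blast, simp)
  have b3: "\<forall>s\<in>J. \<forall>t\<in>J. \<bar>?d [s] [t]\<bar> \<le> K"
    by (intro ballI, rule order_trans[OF _ K(3)], use Kd(2) in blast)
  have b4: "\<forall>s1\<in>J. \<forall>s2\<in>J. \<forall>t\<in>J. \<bar>?d [s2] [t] - ?d [s1] [t]\<bar> \<le> K * pw p s1 s2"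
    by (intro ballI, rule le_scale[OF _ K(3)], use Kd(2) in blast, simp)
  have b5: "\<forall>s\<in>J. \<forall>t1\<in>J. \<forall>t2\<in>J. \<bar>?d [s] [t2] - ?d [s] [t1]\<bar> \<le> K * pw q t1 t2"
    by (intro ballI, rule le_scale[OF _ K(3)], use Kd(2) in blast, simp)
  have b6: "\<forall>s1\<in>J. \<forall>s2\<in>J. \<forall>t1\<in>J. \<forall>t2\<in>J.
      \<bar>?d [s2] [t2] - ?d [s1] [t2] - ?d [s2] [t1] + ?d [s1] [t1]\<bar> \<le> K * (pw p s1 s2 * pw q t1 t2)"
    by (intro ballI, rule le_scale[OF _ K(3)], use Kd(2) in blast, simp)
  have b7: "\<forall>s1\<in>J. \<forall>s2\<in>J. \<forall>t\<in>J. \<bar>?r [s1, s2] [t]\<bar> \<le> K * pw (2 * p) s1 s2"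
    by (intro ballI, rule le_scale[OF _ K(4)], use Kr(2) in blast, simp)
  have b8: "\<forall>s1\<in>J. \<forall>s2\<in>J. \<forall>t1\<in>J. \<forall>t2\<in>J.
      \<bar>?r [s1, s2] [t2] - ?r [s1, s2] [t1]\<bar> \<le> K * (pw (2 * p) s1 s2 * pw q t1 t2)"
    by (intro ballI, rule le_scale[OF _ K(4)], use Kr(2) in blast, simp)
  have b9: "\<forall>s1\<in>J. \<forall>s2\<in>J. \<forall>t1\<in>J. \<forall>t2\<in>J.
      \<bar>orient a (rA R w) [s1, s2] [t1, t2]\<bar> \<le> K * (pw p s1 s2 * pw q t1 t2)"
    by (intro ballI, rule le_scale[OF _ K(6)], use KA(2) in blast, simp)
  have b10: "\<forall>s1\<in>J. \<forall>s2\<in>J. \<forall>t1\<in>J. \<forall>t2\<in>J.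
      \<bar>orient a (rB R a w) [s1, s2] [t1, t2]\<bar> \<le> K * (pw (2 * p) s1 s2 * pw q t1 t2)"
    by (intro ballI, rule le_scale[OF _ K(7)], use KB(2) in blast, simp)
  have b11: "\<forall>s1\<in>J. \<forall>s2\<in>J. \<forall>t1\<in>J. \<forall>t2\<in>J.
      \<bar>orient a (rC R w u) [s1, s2] [t1, t2]\<bar> \<le> K * (pw (2 * p) s1 s2 * pw (2 * q) t1 t2)"
    by (intro ballI, rule le_scale[OF _ K(8)], use KC(2) in blast, simp)
  have b12: "\<forall>s1\<in>J. \<forall>s2\<in>J. \<forall>s3\<in>J. \<forall>s4\<in>J. \<forall>t1\<in>J. \<forall>t2\<in>J.
      \<bar>orient a (rD R a w u) [s1, s2, s3, s4] [t1, t2]\<bar> \<le> K * (pw p s1 s2 * pw p s3 s4 * pw (2 * q) t1 t2)"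
    by (intro ballI, rule le_scale[OF _ K(9)], use KD(2) in blast, simp)
  have b13: "\<forall>s1\<in>J. \<forall>s2\<in>J. \<forall>s3\<in>J. \<forall>s4\<in>J. \<forall>t1\<in>J. \<forall>t2\<in>J.
      \<bar>orient a (rE R a w u) [s1, s2, s3, s4] [t1, t2]\<bar> \<le> K * (pw (2 * p) s1 s2 * pw p s3 s4 * pw (2 * q) t1 t2)"
    by (intro ballI, rule le_scale[OF _ K(10)], use KE(2) in blast, simp)
  note facts = K(1) W path(1) b1 b2 b3 b4 b5 b6 b7 b8 b9 b10 b11 b12 b13
  have "controlled_double_integrand p q K (orient a x)
      (orient a (cfun Y)) ?d ?r (orient a (rA R w)) (orient a (rB R a w))
      (orient a (rA R u)) (orient a (rC R w u)) (orient a (rD R a w u)) (orient a (rE R a w u))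
      (orient a (rF R a w u)) W"
  proof
    show "1 / 3 < p" "1 / 3 < q" using pq by (cases a; simp add: p_def q_def)+
    show "ccont 1 1 (orient a x)" "ccont 1 1 ?d" using hx path(2) by (auto simp: holder11_def)
    show "ccont 1 1 (orient a (cfun Y))"
      by (rule ccont_orient[OF controlled_path_regular(1)[OF pos x Y]])
    show "ccont 2 1 ?r" using path(3) by (simp add: holder21_def)
    show "ccont 2 2 (orient a (rA R w))" "ccont 2 2 (orient a (rB R a w))" "ccont 2 2 (orient a (rA R u))"
      "ccont 2 2 (orient a (rC R w u))"
      using reg'(1)[of w] reg'(1)[of u] reg'(2)[of w] reg'(3)[of w u] by (auto simp: holder22_def)
    show "ccont 4 2 (orient a (rD R a w u))" "ccont 4 2 (orient a (rE R a w u))"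
      using reg'(4)[of w u] reg'(5)[of w u] by (auto simp: holder42_def)
    show "\<forall>s\<in>J. \<forall>t\<in>J. \<bar>orient a (cfun Y) [s] [t]\<bar> \<le> K"
      using Ky(2) K(5) by (cases a) (auto simp del: atLeastAtMost_iff intro: order_trans)
  qed (rule facts | (intro ballI, rule rels; assumption))+
  then show ?thesis unfolding p_def q_def by blast
qed

context controlled_integrand
begin

lemma Lam_dom_arg:
  assumes h: "orient a h = arg"
  shows "Lam_dom a h"
  unfolding Lam_dom_def h
proof (intro conjI exI[of _ "orient a arg_prim"] exI[of _ "3 * p"])
  show "CC 2 2 (orient a arg_prim)" by (rule CC_orient[OF CC22_arg_prim])
  show "ceq a 3 2 h (delta a (orient a arg_prim))"
    unfolding ceq_def h ball_cube using arg_eq by (simp add: orient_delta del: bint_arg1_apply)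
qed (use p_pos total_exponent_arg in auto)

end

context controlled_double_integrand
begin

lemma LamL_dom_darg:
  assumes h: "orient a h = darg"
  shows "LamL_dom a h"
  unfolding LamL_dom_def h
proof (intro conjI exI[of _ "orient a darg_prim"] exI[of _ "3 * p"])
  show "Tbase 2 (orient a (orient a darg_prim))" using Tbase_darg_prim by simp
  show "ceq a 5 2 h (deltaL a (orient a darg_prim))"
    unfolding ceq_def h ball_cube using inner_eq by (simp add: orient_deltaL del: bint_arg1_apply)
qed (use p_pos total_exponent_inner in auto)

lemma Lam_dom_arg2:
  assumes h: "orient a h = arg2"
  shows "Lam_dom a h"
  unfolding Lam_dom_def h
proof (intro conjI exI[of _ "orient a arg2_prim"] exI[of _ "3 * p"])
  show "CC 2 2 (orient a arg2_prim)" by (rule CC_orient[OF CC22_arg2_prim])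
  show "ceq a 3 2 h (delta a (orient a arg2_prim))"
    unfolding ceq_def h ball_cube using arg2_eq by (simp add: orient_delta)
qed (use p_pos total_exponent_arg2 in auto)

end

section \<open>The integral over a controlled sheet\<close>

lemma holder22_unorient:
  assumes "holder22 (expo \<alpha> \<beta> a) (expo \<alpha> \<beta> (opp a)) (orient a g)"
  shows "holder22 \<alpha> \<beta> g"
  using assms holder22_swap[of \<beta> \<alpha> "orient Dir2 g"] by (cases a) auto

lemma holder22_combine:
  assumes f: "holder22 p q f" and g: "holder22 p q g"
    and h: "\<forall>s1\<in>J. \<forall>s2\<in>J. \<forall>t1\<in>J. \<forall>t2\<in>J. h [s1, s2] [t1, t2] = f [s1, s2] [t1, t2] + c * g [s1, s2] [t1, t2]"
  shows "holder22 p q h"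
proof -
  obtain K where K: "K \<ge> 0" "\<forall>s1\<in>J. \<forall>s2\<in>J. \<forall>t1\<in>J. \<forall>t2\<in>J.
     \<bar>f [s1, s2] [t1, t2]\<bar> \<le> K * (pw p s1 s2 * pw q t1 t2)" using f unfolding holder22_def by blast
  obtain K' where K': "K' \<ge> 0" "\<forall>s1\<in>J. \<forall>s2\<in>J. \<forall>t1\<in>J. \<forall>t2\<in>J.
     \<bar>g [s1, s2] [t1, t2]\<bar> \<le> K' * (pw p s1 s2 * pw q t1 t2)" using g unfolding holder22_def by blast
  have "\<bar>h [s1, s2] [t1, t2]\<bar> \<le> (K + \<bar>c\<bar> * K') * (pw p s1 s2 * pw q t1 t2)"
    if J: "s1 \<in> J" "s2 \<in> J" "t1 \<in> J" "t2 \<in> J" for s1 s2 t1 t2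
  proof -
    have "\<bar>c * g [s1, s2] [t1, t2]\<bar> \<le> \<bar>c\<bar> * (K' * (pw p s1 s2 * pw q t1 t2))"
      using K'(2) J by (intro abs_mult_le) blast+
    moreover have "\<bar>f [s1, s2] [t1, t2]\<bar> \<le> K * (pw p s1 s2 * pw q t1 t2)" using K(2) J by blast
    moreover have "h [s1, s2] [t1, t2] = f [s1, s2] [t1, t2] + c * g [s1, s2] [t1, t2]" using h J by blast
    ultimately show ?thesis unfolding distrib_right by linarith
  qed
  moreover have "ccont 2 2 h"
  proof (rule ccont_cong)
    have "ccont 2 2 f" "ccont 2 2 g" using f g by (auto simp: holder22_def)
    then show "ccont 2 2 (\<lambda>ss ts. f ss ts + c * g ss ts)"
      unfolding ccont_iff by (intro continuous_intros)
    have "\<forall>ss\<in>cube 2. \<forall>ts\<in>cube 2. h ss ts = f ss ts + c * g ss ts" unfolding ball_cube by (rule h)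
    then show "\<And>ss ts. ss \<in> cube 2 \<Longrightarrow> ts \<in> cube 2 \<Longrightarrow> h ss ts = f ss ts + c * g ss ts" by blast
  qed
  moreover have "K + \<bar>c\<bar> * K' \<ge> 0" using K(1) K'(1) by simp
  ultimately show ?thesis unfolding holder22_def by blast
qed

lemma holder22_plus: "holder22 p q f \<Longrightarrow> holder22 p q g \<Longrightarrow> holder22 p q (f + g)"
  by (rule holder22_combine[where c = 1 and f = f and g = g]) auto

lemma holder22_minus: "holder22 p q f \<Longrightarrow> holder22 p q g \<Longrightarrow> holder22 p q (f - g)"
  by (rule holder22_combine[where c = "- 1" and f = f and g = g]) auto

lemma holder22_uminus: "holder22 p q f \<Longrightarrow> holder22 p q (- f)"
  by (rule holder22_combine[where c = "- 2" and f = f and g = f]) auto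

lemma holder22_mono:
  assumes g: "holder22 p' q' g" and le: "p \<le> p'" "q \<le> q'"
  shows "holder22 p q g"
proof -
  obtain K where K: "K \<ge> 0" "\<forall>s1\<in>J. \<forall>s2\<in>J. \<forall>t1\<in>J. \<forall>t2\<in>J.
     \<bar>g [s1, s2] [t1, t2]\<bar> \<le> K * (pw p' s1 s2 * pw q' t1 t2)" using g unfolding holder22_def by blast
  have "\<bar>g [s1, s2] [t1, t2]\<bar> \<le> K * (pw p s1 s2 * pw q t1 t2)"
    if J: "s1 \<in> J" "s2 \<in> J" "t1 \<in> J" "t2 \<in> J" for s1 s2 t1 t2
  proof -
    have "K * (pw p' s1 s2 * pw q' t1 t2) \<le> K * (pw p s1 s2 * pw q t1 t2)"
      using K(1) J le by (intro mult_left_mono mult_mono pw_antimono) auto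
    moreover have "\<bar>g [s1, s2] [t1, t2]\<bar> \<le> K * (pw p' s1 s2 * pw q' t1 t2)" using K(2) J by blast
    ultimately show ?thesis by linarith
  qed
  then show ?thesis using K(1) g unfolding holder22_def by blast
qed

lemma holder22_cprod:
  assumes y: "ccont 1 1 y" "\<exists>K\<ge>0. \<forall>s\<in>J. \<forall>t\<in>J. \<bar>y [s] [t]\<bar> \<le> K" and g: "holder22 p q g"
  shows "holder22 p q (cprod Dir1 1 1 y g)"
proof -
  obtain K where K: "K \<ge> 0" "\<forall>s\<in>J. \<forall>t\<in>J. \<bar>y [s] [t]\<bar> \<le> K" using y(2) by blast
  obtain K' where K': "K' \<ge> 0" "\<forall>s1\<in>J. \<forall>s2\<in>J. \<forall>t1\<in>J. \<forall>t2\<in>J.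
     \<bar>g [s1, s2] [t1, t2]\<bar> \<le> K' * (pw p s1 s2 * pw q t1 t2)" using g unfolding holder22_def by blast
  have "\<bar>cprod Dir1 1 1 y g [s1, s2] [t1, t2]\<bar> \<le> (K * K') * (pw p s1 s2 * pw q t1 t2)"
    if J: "s1 \<in> J" "s2 \<in> J" "t1 \<in> J" "t2 \<in> J" for s1 s2 t1 t2
  proof -
    have "\<bar>y [s1] [t1] * g [s1, s2] [t1, t2]\<bar> \<le> K * (K' * (pw p s1 s2 * pw q t1 t2))"
      using K(2) K'(2) J by (intro abs_mult_le) blast+
    then show ?thesis by (simp add: cprod_def algebra_simps)
  qed
  moreover have "ccont 2 2 (cprod Dir1 1 1 y g)"
  proof -
    have c: "ccont 2 2 g" using g by (simp add: holder22_def)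
    have "continuous_on (seqs \<times> seqs) (\<lambda>p. y [fst p 0] [snd p 0] * g [fst p 0, fst p 1] [snd p 0, snd p 1])"
      by (intro continuous_on_mult ccont_compose_intros(1)[OF y(1)] ccont_compose_intros(3)[OF c] maps_into_coord)
    then show ?thesis unfolding ccont_unfold by (simp add: cprod_def)
  qed
  moreover have "K * K' \<ge> 0" using K(1) K'(1) by simp
  ultimately show ?thesis unfolding holder22_def by blast
qed

lemma ddelta_linear:
  fixes f g :: cochain
  shows "ddelta (f + g) [s1, s2, s3] [t1, t2, t3] = ddelta f [s1, s2, s3] [t1, t2, t3] + ddelta g [s1, s2, s3] [t1, t2, t3]"
    and "ddelta (f - g) [s1, s2, s3] [t1, t2, t3] = ddelta f [s1, s2, s3] [t1, t2, t3] - ddelta g [s1, s2, s3] [t1, t2, t3]"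
    and "ddelta (- f) [s1, s2, s3] [t1, t2, t3] = - ddelta f [s1, s2, s3] [t1, t2, t3]"
  by simp_all

lemma dominated_plus:
  "weights \<W> k l \<Longrightarrow> dominated \<W> k l f \<Longrightarrow> dominated \<W> k l g \<Longrightarrow> dominated \<W> k l (\<lambda>ss ts. f ss ts + g ss ts)"
  by (rule dominated_add[where h = f and h' = g]) auto

lemma dominated_minus:
  "weights \<W> k l \<Longrightarrow> dominated \<W> k l f \<Longrightarrow> dominated \<W> k l g \<Longrightarrow> dominated \<W> k l (\<lambda>ss ts. f ss ts - g ss ts)"
  by (rule dominated_add[where h = f and h' = g]) auto

text \<open>
  The bound that sewing needs: the exponents of the single weights no longer matter.
\<close>

lemma dominated_weights2_max:
  assumes h: "dominated (weights2 z1 z2) 3 3 h"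
  shows "\<exists>K. \<forall>s1\<in>J. \<forall>s2\<in>J. \<forall>s3\<in>J. \<forall>t1\<in>J. \<forall>t2\<in>J. \<forall>t3\<in>J. \<bar>h [s1, s2, s3] [t1, t2, t3]\<bar>
     \<le> K * max \<bar>s2 - s1\<bar> \<bar>s3 - s2\<bar> powr z1 * max \<bar>t2 - t1\<bar> \<bar>t3 - t2\<bar> powr z2"
proof -
  obtain K w where K: "summable K" "\<And>i :: nat. 0 \<le> K i \<and> w i \<in> weights2 z1 z2"
    and le: "\<And>ss ts. ss \<in> cube 3 \<Longrightarrow> ts \<in> cube 3 \<Longrightarrow> \<bar>h ss ts\<bar> \<le> (\<Sum>i. K i * w i ss ts)"
    using h unfolding dominated_def by blast
  have "\<bar>h [s1, s2, s3] [t1, t2, t3]\<bar>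
     \<le> suminf K * max \<bar>s2 - s1\<bar> \<bar>s3 - s2\<bar> powr z1 * max \<bar>t2 - t1\<bar> \<bar>t3 - t2\<bar> powr z2"
    if J: "s1 \<in> J" "s2 \<in> J" "s3 \<in> J" "t1 \<in> J" "t2 \<in> J" "t3 \<in> J" for s1 s2 s3 t1 t2 t3
  proof -
    let ?m = "max \<bar>s2 - s1\<bar> \<bar>s3 - s2\<bar> powr z1 * max \<bar>t2 - t1\<bar> \<bar>t3 - t2\<bar> powr z2"
    have mem: "[s1, s2, s3] \<in> cube 3" "[t1, t2, t3] \<in> cube 3" using J by (auto simp: cube_def)
    have w: "w i [s1, s2, s3] [t1, t2, t3] \<le> ?m" for i
    proof -
      obtain \<rho> \<sigma> where w: "w i = (\<lambda>ss ts. pw \<rho> (ss ! 0) (ss ! 1) * pw (z1 - \<rho>) (ss ! 1) (ss ! 2)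
        * (pw \<sigma> (ts ! 0) (ts ! 1) * pw (z2 - \<sigma>) (ts ! 1) (ts ! 2)))"
        "0 < \<rho>" "\<rho> < z1" "0 < \<sigma>" "\<sigma> < z2" using K(2)[of i] unfolding weights2_def by blast
      have "pw \<rho> s1 s2 * pw (z1 - \<rho>) s2 s3 \<le> max \<bar>s2 - s1\<bar> \<bar>s3 - s2\<bar> powr z1"
        using pw_mult_le_max[of \<rho> "z1 - \<rho>" s1 s2 s3] w(2,3) by simp
      moreover have "pw \<sigma> t1 t2 * pw (z2 - \<sigma>) t2 t3 \<le> max \<bar>t2 - t1\<bar> \<bar>t3 - t2\<bar> powr z2"
        using pw_mult_le_max[of \<sigma> "z2 - \<sigma>" t1 t2 t3] w(4,5) by simp
      ultimately show ?thesis unfolding w(1)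
        by (simp add: numeral_2_eq_2 mult_mono)
    qed
    have "\<bar>h [s1, s2, s3] [t1, t2, t3]\<bar> \<le> (\<Sum>i. K i * w i [s1, s2, s3] [t1, t2, t3])" by (rule le[OF mem])
    also have "\<dots> \<le> (\<Sum>i. K i * ?m)"
      using K(2) w by (intro suminf_le mult_left_mono weights_summable[OF weights_weights2 K mem] summable_mult2 K(1)) auto
    also have "\<dots> = suminf K * ?m" by (rule suminf_mult2[symmetric, OF K(1)])
    finally show ?thesis by (simp add: mult.assoc)
  qed
  then show ?thesis by blast
qed

locale rough_sheet =
  fixes \<alpha> \<beta> :: real and x :: cochain and R :: rough_data
  assumes ab: "\<alpha> > 1/3" "\<beta> > 1/3" and x: "CC11 \<alpha> \<beta> x" and R: "algebraic_hypothesis \<alpha> \<beta> x R"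
begin

lemma ab_pos: "\<alpha> > 0" "\<beta> > 0" "3 * \<alpha> > 1" "3 * \<beta> > 1"
  using ab by auto

abbreviation oriented_integrand ::
  "dir \<Rightarrow> cpath \<Rightarrow> lbl \<Rightarrow> lbl \<Rightarrow> real \<Rightarrow> (real \<Rightarrow> real \<Rightarrow> real \<Rightarrow> real) \<Rightarrow> bool" where
  "oriented_integrand a Y w u K W \<equiv> controlled_double_integrand (expo \<alpha> \<beta> a) (expo \<alpha> \<beta> (opp a)) K (orient a x)
      (orient a (cfun Y)) (orient a (cder Y a)) (orient a (crem Y a)) (orient a (rA R w)) (orient a (rB R a w))
      (orient a (rA R u)) (orient a (rC R w u)) (orient a (rD R a w u)) (orient a (rE R a w u))
      (orient a (rF R a w u)) W"

lemma oriented_integrand_exists: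
  assumes Y: "controlled_path \<alpha> \<beta> x Y"
  obtains K W where "oriented_integrand a Y w u K W"
  using controlled_double_integrand_exists[OF ab x R Y] by blast

lemma
  assumes Y: "controlled_path \<alpha> \<beta> x Y"
  shows Lam_dom_bint_arg: "Lam_dom a (bint_arg R a Y w)"
    and LamL_dom_bint2_inner: "LamL_dom a (bint2_inner R a Y w u)"
    and Lam_dom_bint2_arg: "Lam_dom a (bint2_arg R a Y w u)"
    and holder22_bint: "holder22 \<alpha> \<beta> (bint R a Y w)"
    and holder22_bint2: "holder22 \<alpha> \<beta> (bint2 R a Y w u)"
    and bint_additive: "\<lbrakk>s1 \<in> J; s2 \<in> J; s3 \<in> J; t1 \<in> J; t2 \<in> J\<rbrakk> \<Longrightarrow>
      orient a (bint R a Y w) [s1, s3] [t1, t2] = orient a (bint R a Y w) [s1, s2] [t1, t2]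
        + orient a (bint R a Y w) [s2, s3] [t1, t2]"
proof -
  obtain K W where loc: "oriented_integrand a Y w u K W" by (rule oriented_integrand_exists[OF Y])
  note loc1 = controlled_double_integrand.axioms(1)[OF loc]
  show "Lam_dom a (bint_arg R a Y w)" by (rule controlled_integrand.Lam_dom_arg[OF loc1 orient_bint_arg])
  show "LamL_dom a (bint2_inner R a Y w u)"
    by (rule controlled_double_integrand.LamL_dom_darg[OF loc orient_bint2_inner])
  show "Lam_dom a (bint2_arg R a Y w u)"
    by (rule controlled_double_integrand.Lam_dom_arg2[OF loc orient_bint2_arg])
  show "holder22 \<alpha> \<beta> (bint R a Y w)"
    by (rule holder22_unorient[of _ _ a]) (simp only: orient_bint controlled_integrand.holder22_bnd[OF loc1])
  show "holder22 \<alpha> \<beta> (bint2 R a Y w u)"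
    by (rule holder22_unorient[of _ _ a]) (simp only: orient_bint2 controlled_double_integrand.holder22_dbl[OF loc])
  show "\<lbrakk>s1 \<in> J; s2 \<in> J; s3 \<in> J; t1 \<in> J; t2 \<in> J\<rbrakk> \<Longrightarrow>
      orient a (bint R a Y w) [s1, s3] [t1, t2] = orient a (bint R a Y w) [s1, s2] [t1, t2]
        + orient a (bint R a Y w) [s2, s3] [t1, t2]"
    unfolding orient_bint by (rule controlled_integrand.bnd_additive[OF loc1])
qed

lemma ddelta_bint2_Dir1:
  assumes Y: "controlled_path \<alpha> \<beta> x Y"
  shows "\<exists>r. dominated (weights2 (3 * \<alpha>) (3 * \<beta>)) 3 3 r \<and> (\<forall>s1 s2 s3 t1 t2 t3.
     ddelta (bint2 R Dir1 Y w u) [s1, s2, s3] [t1, t2, t3] = r [s1, s2, s3] [t1, t2, t3]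
       + bint R Dir1 Y w [s1, s2] [t1, t2] * rA R u [s2, s3] [t2, t3]
       - (cfun Y [s1] [t2] - cfun Y [s1] [t1]) * rD R Dir1 w u [s1, s2, s2, s3] [t2, t3])"
proof -
  obtain K W where loc: "oriented_integrand Dir1 Y w u K W" by (rule oriented_integrand_exists[OF Y])
  show ?thesis
    using controlled_double_integrand.dbl_expansion[OF loc]
    unfolding orient_bint[symmetric] orient_bint2[symmetric] by simp
qed

lemma ddelta_bint2_Dir2:
  assumes Y: "controlled_path \<alpha> \<beta> x Y"
  shows "\<exists>r. dominated (weights2 (3 * \<alpha>) (3 * \<beta>)) 3 3 r \<and> (\<forall>s1 s2 s3 t1 t2 t3.
     ddelta (bint2 R Dir2 Y w u) [s1, s2, s3] [t1, t2, t3] = r [s1, s2, s3] [t1, t2, t3]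
       + bint R Dir2 Y w [s1, s2] [t1, t2] * rA R u [s2, s3] [t2, t3]
       - (cfun Y [s2] [t1] - cfun Y [s1] [t1]) * rD R Dir2 w u [s2, s3] [t1, t2, t2, t3])"
proof -
  obtain K W where loc: "oriented_integrand Dir2 Y w u K W" by (rule oriented_integrand_exists[OF Y])
  obtain r where r: "dominated (weights2 (3 * \<beta>) (3 * \<alpha>)) 3 3 r" "\<And>s1 s2 s3 t1 t2 t3.
      ddelta (orient Dir2 (bint2 R Dir2 Y w u)) [t1, t2, t3] [s1, s2, s3] = r [t1, t2, t3] [s1, s2, s3]
       + bint R Dir2 Y w [s1, s2] [t1, t2] * rA R u [s2, s3] [t2, t3]
       - (cfun Y [s2] [t1] - cfun Y [s1] [t1]) * rD R Dir2 w u [s2, s3] [t1, t2, t2, t3]"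
    using controlled_double_integrand.dbl_expansion[OF loc]
    unfolding orient_bint[symmetric] orient_bint2[symmetric] by (auto simp del: ddelta_apply)
  have "ddelta (bint2 R Dir2 Y w u) [s1, s2, s3] [t1, t2, t3]
      = ddelta (orient Dir2 (bint2 R Dir2 Y w u)) [t1, t2, t3] [s1, s2, s3]" for s1 s2 s3 t1 t2 t3
    unfolding ddelta_apply orient.simps by simp
  then show ?thesis
    using dominated_swap[OF r(1)] r(2) by (intro exI[of _ "\<lambda>ss ts. r ts ss"]) (simp del: ddelta_apply)
qed

text \<open>
  Both relations \<open>\<delta>\<^sub>1C = \<mu>\<^sub>1D\<^sub>1\<close> and \<open>\<delta>\<^sub>2C = \<mu>\<^sub>2D\<^sub>2\<close> enter.  The two terms in \<open>D\<close> are exactly those in the two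
  double boundary integrals.
\<close>

lemma ddelta_path_C:
  assumes J: "s1 \<in> J" "s2 \<in> J" "s3 \<in> J" "t1 \<in> J" "t2 \<in> J" "t3 \<in> J"
  shows "ddelta (cprod Dir1 1 1 y (rC R w u)) [s1, s2, s3] [t1, t2, t3] =
      y [s1] [t1] * (rA R w [s1, s2] [t1, t2] * rA R u [s2, s3] [t2, t3])
      - (y [s1] [t2] - y [s1] [t1]) * rD R Dir1 w u [s1, s2, s2, s3] [t2, t3]
      - (y [s2] [t1] - y [s1] [t1]) * rD R Dir2 w u [s2, s3] [t1, t2, t2, t3]
      + ddelta y [s1, s2] [t1, t2] * rC R w u [s2, s3] [t2, t3]"
proof -
  have rel: "rough_relations x R" using R by (simp add: algebraic_hypothesis_def)
  note C1 = rough_C[OF rel, where a = Dir1, unfolded orient.simps]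
  note C2 = rough_C[OF rel, where a = Dir2, unfolded orient.simps]
  note D = rough_D_2[OF rel J(1,2,2,3,4,5,6), where a = Dir1, unfolded orient.simps]
  have c: "cprod Dir1 1 1 y (rC R w u) [a, b] [c, d] = y [a] [c] * rC R w u [a, b] [c, d]" for a b c d
    by (simp add: cprod_def)
  show ?thesis
    unfolding ddelta_apply c C1[OF J(1,2,3,4,5)] C1[OF J(1,2,3,5,6)] C1[OF J(1,2,3,4,6)]
      C2[OF J(4,5,6,1,2)] C2[OF J(4,5,6,2,3)] D
    by (simp add: algebra_simps)
qed

text \<open>
  \<open>A\<close> is additive in both directions, so the only defects come from \<open>y\<close>.
\<close>

lemma ddelta_path_A:
  assumes J: "s1 \<in> J" "s2 \<in> J" "s3 \<in> J" "t1 \<in> J" "t2 \<in> J" "t3 \<in> J"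
  shows "ddelta (cprod Dir1 1 1 y (rA R u)) [s1, s2, s3] [t1, t2, t3] =
     ddelta y [s1, s2] [t1, t2] * rA R u [s2, s3] [t2, t3]"
proof -
  have rel: "rough_relations x R" using R by (simp add: algebraic_hypothesis_def)
  note A1 = rough_A[OF rel, where a = Dir1, unfolded orient.simps]
  note A2 = rough_A[OF rel, where a = Dir2, unfolded orient.simps]
  have c: "cprod Dir1 1 1 y (rA R u) [a, b] [c, d] = y [a] [c] * rA R u [a, b] [c, d]" for a b c d
    by (simp add: cprod_def)
  show ?thesis
    unfolding ddelta_apply c A1[OF J(1,2,3,4,5)] A1[OF J(1,2,3,5,6)] A1[OF J(1,2,3,4,6)]
      A2[OF J(4,5,6,1,2)] A2[OF J(4,5,6,2,3)]
    by (simp add: algebra_simps)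
qed

lemma ddelta_bint:
  assumes Y: "controlled_path \<alpha> \<beta> x Y"
    and J: "s1 \<in> J" "s2 \<in> J" "s3 \<in> J" "t1 \<in> J" "t2 \<in> J" "t3 \<in> J"
  shows "ddelta (bint R a Y u) [s1, s2, s3] [t1, t2, t3] = 0"
proof (cases a)
  case Dir1
  note A = bint_additive[OF Y, where a = Dir1 and w = u, unfolded orient.simps]
  show ?thesis unfolding Dir1 ddelta_apply A[OF J(1,2,3,4,5)] A[OF J(1,2,3,5,6)] A[OF J(1,2,3,4,6)] by simp
next
  case Dir2
  note A = bint_additive[OF Y, where a = Dir2 and w = u, unfolded orient.simps]
  show ?thesis unfolding Dir2 ddelta_apply A[OF J(4,5,6,1,3)] A[OF J(4,5,6,1,2)] A[OF J(4,5,6,2,3)] by simp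
qed

lemma dominated_path_C:
  assumes Y: "controlled_path \<alpha> \<beta> x Y"
  shows "dominated (weights2 (3 * \<alpha>) (3 * \<beta>)) 3 3
    (\<lambda>ss ts. ddelta (cfun Y) [ss ! 0, ss ! 1] [ts ! 0, ts ! 1] * rC R w u [ss ! 1, ss ! 2] [ts ! 1, ts ! 2])"
proof -
  obtain K W where loc: "oriented_integrand Dir1 Y w u K W" by (rule oriented_integrand_exists[OF Y])
  show ?thesis
    using controlled_double_integrand.dominated_ddelta_C[OF loc]
    unfolding orient.simps expo.simps opp.simps .
qed

text \<open>
  The contribution of one of the coefficient paths \<open>y\<^sup>x\<close>, \<open>y\<^sup>\<omega>\<close> to the expansion of \<open>\<delta>y\<close> for a controlled sheet.
\<close>

definition path_part :: "cpath \<Rightarrow> lbl \<Rightarrow> cochain" where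
  "path_part Y w = - cprod Dir1 1 1 (cfun Y) (rA R w) + bint R Dir1 Y w + bint R Dir2 Y w"

lemma path_part_apply: "path_part Y w [s1, s2] [t1, t2] = - (cfun Y [s1] [t1] * rA R w [s1, s2] [t1, t2])
    + bint R Dir1 Y w [s1, s2] [t1, t2] + bint R Dir2 Y w [s1, s2] [t1, t2]"
  by (simp add: path_part_def cprod_def)

text \<open>
  The second-order terms of the integral that belong to a coefficient path reproduce, up to terms of total
  exponents \<open>3\<alpha>\<close> and \<open>3\<beta>\<close>, the contribution of this path to \<open>\<delta>y A\<^sup>u\<close>.
\<close>

lemma path_contribution:
  assumes Y: "controlled_path \<alpha> \<beta> x Y"
  shows "\<exists>r. dominated (weights2 (3 * \<alpha>) (3 * \<beta>)) 3 3 r \<and>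
    (\<forall>s1\<in>J. \<forall>s2\<in>J. \<forall>s3\<in>J. \<forall>t1\<in>J. \<forall>t2\<in>J. \<forall>t3\<in>J.
      ddelta (cprod Dir1 1 1 (cfun Y) (rC R w u)) [s1, s2, s3] [t1, t2, t3]
      - ddelta (bint2 R Dir1 Y w u) [s1, s2, s3] [t1, t2, t3]
      - ddelta (bint2 R Dir2 Y w u) [s1, s2, s3] [t1, t2, t3] =
      r [s1, s2, s3] [t1, t2, t3] - path_part Y w [s1, s2] [t1, t2] * rA R u [s2, s3] [t2, t3])"
proof -
  let ?W = "weights2 (3 * \<alpha>) (3 * \<beta>)"
  obtain r1 where r1: "dominated ?W 3 3 r1" "\<And>s1 s2 s3 t1 t2 t3.
     ddelta (bint2 R Dir1 Y w u) [s1, s2, s3] [t1, t2, t3] = r1 [s1, s2, s3] [t1, t2, t3]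
       + bint R Dir1 Y w [s1, s2] [t1, t2] * rA R u [s2, s3] [t2, t3]
       - (cfun Y [s1] [t2] - cfun Y [s1] [t1]) * rD R Dir1 w u [s1, s2, s2, s3] [t2, t3]"
    using ddelta_bint2_Dir1[OF Y] by blast
  obtain r2 where r2: "dominated ?W 3 3 r2" "\<And>s1 s2 s3 t1 t2 t3.
     ddelta (bint2 R Dir2 Y w u) [s1, s2, s3] [t1, t2, t3] = r2 [s1, s2, s3] [t1, t2, t3]
       + bint R Dir2 Y w [s1, s2] [t1, t2] * rA R u [s2, s3] [t2, t3]
       - (cfun Y [s2] [t1] - cfun Y [s1] [t1]) * rD R Dir2 w u [s2, s3] [t1, t2, t2, t3]"
    using ddelta_bint2_Dir2[OF Y] by blast
  let ?c = "\<lambda>ss ts. ddelta (cfun Y) [ss ! 0, ss ! 1] [ts ! 0, ts ! 1] * rC R w u [ss ! 1, ss ! 2] [ts ! 1, ts ! 2]"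
  have d: "dominated ?W 3 3 (\<lambda>ss ts. ?c ss ts - r1 ss ts - r2 ss ts)"
    by (intro dominated_minus weights_weights2 dominated_path_C[OF Y] r1(1) r2(1))
  show ?thesis
  proof (intro exI[of _ "\<lambda>ss ts. ?c ss ts - r1 ss ts - r2 ss ts"] conjI ballI d)
    fix s1 s2 s3 t1 t2 t3
    assume J: "s1 \<in> J" "s2 \<in> J" "s3 \<in> J" "t1 \<in> J" "t2 \<in> J" "t3 \<in> J"
    show "ddelta (cprod Dir1 1 1 (cfun Y) (rC R w u)) [s1, s2, s3] [t1, t2, t3]
      - ddelta (bint2 R Dir1 Y w u) [s1, s2, s3] [t1, t2, t3]
      - ddelta (bint2 R Dir2 Y w u) [s1, s2, s3] [t1, t2, t3] =
      ?c [s1, s2, s3] [t1, t2, t3] - r1 [s1, s2, s3] [t1, t2, t3] - r2 [s1, s2, s3] [t1, t2, t3]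
      - path_part Y w [s1, s2] [t1, t2] * rA R u [s2, s3] [t2, t3]"
      unfolding ddelta_path_C[OF J] r1(2) r2(2) path_part_apply
      by (simp add: numeral_2_eq_2 algebra_simps del: ddelta_apply)
  qed
qed

lemma sum_dirs: "(\<Sum>a\<in>{Dir1, Dir2}. f a) = f Dir1 + (f Dir2 :: cochain)"
  by simp

text \<open>
  The terms of the integral built from the coefficient paths \<open>y\<^sup>x\<close> and \<open>y\<^sup>\<omega>\<close>; the argument of \<open>\<Lambda>\<close> is
  \<open>\<delta>y A\<^sup>u\<close> minus \<open>\<delta>\<close> of them.
\<close>

definition boundary_part :: "cpath \<Rightarrow> cpath \<Rightarrow> lbl \<Rightarrow> cochain" where
  "boundary_part Yx Yw u =
     - cprod Dir1 1 1 (cfun Yx) (rC R LX u) - cprod Dir1 1 1 (cfun Yw) (rC R LW u)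
     + (\<Sum>a\<in>{Dir1, Dir2}. bint2 R a Yx LX u + bint2 R a Yw LW u)"

lemma iint_rem_arg_primitive:
  assumes J: "s1 \<in> J" "s2 \<in> J" "s3 \<in> J" "t1 \<in> J" "t2 \<in> J" "t3 \<in> J"
  shows "iint_rem_arg R Y Yx Yw u [s1, s2, s3] [t1, t2, t3] =
    ddelta (cprod Dir1 1 1 (cfun Y) (rA R u) - boundary_part Yx Yw u) [s1, s2, s3] [t1, t2, t3]"
proof -
  have "cprod Dir1 2 2 (ddelta (cfun Y)) (rA R u) [s1, s2, s3] [t1, t2, t3]
      = ddelta (cfun Y) [s1, s2] [t1, t2] * rA R u [s2, s3] [t2, t3]"
    by (simp add: cprod_def numeral_2_eq_2 del: ddelta_apply)
  then show ?thesis
    unfolding iint_rem_arg_def boundary_part_def[symmetric] ddelta_linear(2) ddelta_path_A[OF J] minus_apply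
    by (simp only: )
qed

lemma controlled_sheetD:
  assumes S: "controlled_sheet \<alpha> \<beta> x R Y Yx Yw"
  shows "controlled_path \<alpha> \<beta> x Y" "controlled_path \<alpha> \<beta> x Yx" "controlled_path \<alpha> \<beta> x Yw"
    and "\<exists>yr. holder22 (2 * \<alpha>) (2 * \<beta>) yr \<and> (\<forall>s1\<in>J. \<forall>s2\<in>J. \<forall>t1\<in>J. \<forall>t2\<in>J.
      ddelta (cfun Y) [s1, s2] [t1, t2] = path_part Yx LX [s1, s2] [t1, t2]
        + path_part Yw LW [s1, s2] [t1, t2] + yr [s1, s2] [t1, t2])"
proof -
  show "controlled_path \<alpha> \<beta> x Y" "controlled_path \<alpha> \<beta> x Yx" "controlled_path \<alpha> \<beta> x Yw"
    using S unfolding controlled_sheet_def by blast+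
  obtain yr where yr: "CC22 (2 * \<alpha>) (2 * \<beta>) yr" "ceq Dir1 2 2 (ddelta (cfun Y))
         (- cprod Dir1 1 1 (cfun Yx) (rA R LX) - cprod Dir1 1 1 (cfun Yw) (rA R LW)
          + (\<Sum>a\<in>{Dir1, Dir2}. bint R a Yx LX + bint R a Yw LW) + yr)"
    using S unfolding controlled_sheet_def by blast
  have "holder22 (2 * \<alpha>) (2 * \<beta>) yr" using yr(1) by (simp add: CC22_iff_holder22)
  moreover have "ddelta (cfun Y) [s1, s2] [t1, t2] = path_part Yx LX [s1, s2] [t1, t2]
        + path_part Yw LW [s1, s2] [t1, t2] + yr [s1, s2] [t1, t2]"
    if J: "s1 \<in> J" "s2 \<in> J" "t1 \<in> J" "t2 \<in> J" for s1 s2 t1 t2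
  proof -
    have "ddelta (cfun Y) [s1, s2] [t1, t2] = (- cprod Dir1 1 1 (cfun Yx) (rA R LX) - cprod Dir1 1 1 (cfun Yw) (rA R LW)
          + (\<Sum>a\<in>{Dir1, Dir2}. bint R a Yx LX + bint R a Yw LW) + yr) [s1, s2] [t1, t2]"
      using yr(2) J unfolding ceq_def ball_cube orient.simps by blast
    then show ?thesis unfolding sum_dirs path_part_def by (simp del: ddelta_apply)
  qed
  ultimately show "\<exists>yr. holder22 (2 * \<alpha>) (2 * \<beta>) yr \<and> (\<forall>s1\<in>J. \<forall>s2\<in>J. \<forall>t1\<in>J. \<forall>t2\<in>J.
      ddelta (cfun Y) [s1, s2] [t1, t2] = path_part Yx LX [s1, s2] [t1, t2]
        + path_part Yw LW [s1, s2] [t1, t2] + yr [s1, s2] [t1, t2])" by blast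
qed

text \<open>
  Replacing \<open>\<delta>y\<close> by its expansion, the contributions of \<open>y\<^sup>x\<close> and \<open>y\<^sup>\<omega>\<close> cancel against \<open>boundary_part\<close>, and
  \<open>y\<^sup>\<sharp>A\<^sup>u\<close> remains, of exponents \<open>2\<alpha> + \<alpha>\<close> and \<open>2\<beta> + \<beta>\<close>.
\<close>

lemma dominated_iint_rem_arg:
  assumes S: "controlled_sheet \<alpha> \<beta> x R Y Yx Yw"
  shows "dominated (weights2 (3 * \<alpha>) (3 * \<beta>)) 3 3 (iint_rem_arg R Y Yx Yw u)"
proof -
  let ?W = "weights2 (3 * \<alpha>) (3 * \<beta>)"
  note path = controlled_sheetD(1-3)[OF S]
  obtain yr where yr: "holder22 (2 * \<alpha>) (2 * \<beta>) yr" and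
    eq: "\<And>s1 s2 t1 t2. s1 \<in> J \<Longrightarrow> s2 \<in> J \<Longrightarrow> t1 \<in> J \<Longrightarrow> t2 \<in> J \<Longrightarrow>
      ddelta (cfun Y) [s1, s2] [t1, t2] = path_part Yx LX [s1, s2] [t1, t2]
        + path_part Yw LW [s1, s2] [t1, t2] + yr [s1, s2] [t1, t2]"
    using controlled_sheetD(4)[OF S] by blast
  obtain rx where rx: "dominated ?W 3 3 rx" and rx_eq: "\<And>s1 s2 s3 t1 t2 t3. s1 \<in> J \<Longrightarrow> s2 \<in> J \<Longrightarrow> s3 \<in> J \<Longrightarrow>
      t1 \<in> J \<Longrightarrow> t2 \<in> J \<Longrightarrow> t3 \<in> J \<Longrightarrow>
      ddelta (cprod Dir1 1 1 (cfun Yx) (rC R LX u)) [s1, s2, s3] [t1, t2, t3]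
      - ddelta (bint2 R Dir1 Yx LX u) [s1, s2, s3] [t1, t2, t3]
      - ddelta (bint2 R Dir2 Yx LX u) [s1, s2, s3] [t1, t2, t3] =
      rx [s1, s2, s3] [t1, t2, t3] - path_part Yx LX [s1, s2] [t1, t2] * rA R u [s2, s3] [t2, t3]"
    using path_contribution[OF path(2), of LX u] by blast
  obtain rw where rw: "dominated ?W 3 3 rw" and rw_eq: "\<And>s1 s2 s3 t1 t2 t3. s1 \<in> J \<Longrightarrow> s2 \<in> J \<Longrightarrow> s3 \<in> J \<Longrightarrow>
      t1 \<in> J \<Longrightarrow> t2 \<in> J \<Longrightarrow> t3 \<in> J \<Longrightarrow>
      ddelta (cprod Dir1 1 1 (cfun Yw) (rC R LW u)) [s1, s2, s3] [t1, t2, t3]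
      - ddelta (bint2 R Dir1 Yw LW u) [s1, s2, s3] [t1, t2, t3]
      - ddelta (bint2 R Dir2 Yw LW u) [s1, s2, s3] [t1, t2, t3] =
      rw [s1, s2, s3] [t1, t2, t3] - path_part Yw LW [s1, s2] [t1, t2] * rA R u [s2, s3] [t2, t3]"
    using path_contribution[OF path(3), of LW u] by blast
  obtain K where K: "K \<ge> 0" "\<And>s1 s2 t1 t2. s1 \<in> J \<Longrightarrow> s2 \<in> J \<Longrightarrow> t1 \<in> J \<Longrightarrow> t2 \<in> J \<Longrightarrow>
     \<bar>yr [s1, s2] [t1, t2]\<bar> \<le> K * (pw (2 * \<alpha>) s1 s2 * pw (2 * \<beta>) t1 t2)"
    using yr unfolding holder22_def by blast
  have "holder22 \<alpha> \<beta> (rA R u)"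
    using R unfolding algebraic_hypothesis_def rough_regularity_def CC22_iff_holder22 by blast
  then obtain K' where K': "K' \<ge> 0" "\<And>s1 s2 t1 t2. s1 \<in> J \<Longrightarrow> s2 \<in> J \<Longrightarrow> t1 \<in> J \<Longrightarrow> t2 \<in> J \<Longrightarrow>
     \<bar>rA R u [s1, s2] [t1, t2]\<bar> \<le> K' * (pw \<alpha> s1 s2 * pw \<beta> t1 t2)"
    unfolding holder22_def by blast
  let ?w = "\<lambda>ss ts :: real list. pw (2 * \<alpha>) (ss ! 0) (ss ! 1) * pw (3 * \<alpha> - 2 * \<alpha>) (ss ! 1) (ss ! 2)
     * (pw (2 * \<beta>) (ts ! 0) (ts ! 1) * pw (3 * \<beta> - 2 * \<beta>) (ts ! 1) (ts ! 2))"
  let ?f = "\<lambda>ss ts. yr [ss ! 0, ss ! 1] [ts ! 0, ts ! 1] * rA R u [ss ! 1, ss ! 2] [ts ! 1, ts ! 2]"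
  have w: "?w \<in> ?W"
    unfolding weights2_def mem_Collect_eq using ab_pos by (intro exI[of _ "2 * \<alpha>"] exI[of _ "2 * \<beta>"]) auto
  have "\<forall>ss\<in>cube 3. \<forall>ts\<in>cube 3. \<bar>?f ss ts\<bar> \<le> K * K' * ?w ss ts"
    unfolding ball_cube
  proof (intro ballI)
    fix s1 s2 s3 t1 t2 t3
    assume J: "s1 \<in> J" "s2 \<in> J" "s3 \<in> J" "t1 \<in> J" "t2 \<in> J" "t3 \<in> J"
    have "\<bar>yr [s1, s2] [t1, t2] * rA R u [s2, s3] [t2, t3]\<bar>
      \<le> K * (pw (2 * \<alpha>) s1 s2 * pw (2 * \<beta>) t1 t2) * (K' * (pw \<alpha> s2 s3 * pw \<beta> t2 t3))"
      using J by (intro abs_mult_le K(2) K'(2))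
    then show "\<bar>?f [s1, s2, s3] [t1, t2, t3]\<bar> \<le> K * K' * ?w [s1, s2, s3] [t1, t2, t3]"
      by (simp add: numeral_2_eq_2 algebra_simps)
  qed
  then have f: "dominated ?W 3 3 ?f"
    using K(1) K'(1) by (intro dominated_single[OF weights_weights2 w, where C = "K * K'"]) auto
  have d: "dominated ?W 3 3 (\<lambda>ss ts. ?f ss ts + rx ss ts + rw ss ts)"
    by (intro dominated_plus weights_weights2 f rx rw)
  have "\<forall>ss\<in>cube 3. \<forall>ts\<in>cube 3. iint_rem_arg R Y Yx Yw u ss ts = ?f ss ts + rx ss ts + rw ss ts"
    unfolding ball_cube
  proof (intro ballI)
    fix s1 s2 s3 t1 t2 t3
    assume J: "s1 \<in> J" "s2 \<in> J" "s3 \<in> J" "t1 \<in> J" "t2 \<in> J" "t3 \<in> J"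
    have "iint_rem_arg R Y Yx Yw u [s1, s2, s3] [t1, t2, t3] =
       ddelta (cfun Y) [s1, s2] [t1, t2] * rA R u [s2, s3] [t2, t3]
       + (ddelta (cprod Dir1 1 1 (cfun Yx) (rC R LX u)) [s1, s2, s3] [t1, t2, t3]
          - ddelta (bint2 R Dir1 Yx LX u) [s1, s2, s3] [t1, t2, t3]
          - ddelta (bint2 R Dir2 Yx LX u) [s1, s2, s3] [t1, t2, t3])
       + (ddelta (cprod Dir1 1 1 (cfun Yw) (rC R LW u)) [s1, s2, s3] [t1, t2, t3]
          - ddelta (bint2 R Dir1 Yw LW u) [s1, s2, s3] [t1, t2, t3]
          - ddelta (bint2 R Dir2 Yw LW u) [s1, s2, s3] [t1, t2, t3])"
      unfolding iint_rem_arg_primitive[OF J] boundary_part_def sum_dirs ddelta_linear ddelta_path_A[OF J]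
      by linarith
    also have "\<dots> = yr [s1, s2] [t1, t2] * rA R u [s2, s3] [t2, t3]
       + rx [s1, s2, s3] [t1, t2, t3] + rw [s1, s2, s3] [t1, t2, t3]"
      unfolding rx_eq[OF J] rw_eq[OF J] eq[OF J(1,2,4,5)] by (simp add: algebra_simps)
    finally show "iint_rem_arg R Y Yx Yw u [s1, s2, s3] [t1, t2, t3] =
       ?f [s1, s2, s3] [t1, t2, t3] + rx [s1, s2, s3] [t1, t2, t3] + rw [s1, s2, s3] [t1, t2, t3]"
      by (simp add: numeral_2_eq_2)
  qed
  then show ?thesis
    by (intro dominated_mono[OF weights_weights2 d, where C = 1]) auto
qed

lemma holder22_path_A:
  assumes "controlled_path \<alpha> \<beta> x Y"
  shows "holder22 \<alpha> \<beta> (cprod Dir1 1 1 (cfun Y) (rA R u))"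
  using R ab_pos assms controlled_path_regular[OF ab_pos(1,2) x assms]
  unfolding algebraic_hypothesis_def rough_regularity_def CC22_iff_holder22 by (intro holder22_cprod) blast+

lemma holder22_path_C:
  assumes "controlled_path \<alpha> \<beta> x Y"
  shows "holder22 \<alpha> \<beta> (cprod Dir1 1 1 (cfun Y) (rC R w u))"
proof -
  have "holder22 (2 * \<alpha>) (2 * \<beta>) (rC R w u)"
    using R unfolding algebraic_hypothesis_def rough_regularity_def CC22_iff_holder22 by blast
  then have "holder22 \<alpha> \<beta> (rC R w u)" by (rule holder22_mono) (use ab_pos in auto)
  then show ?thesis
    using controlled_path_regular[OF ab_pos(1,2) x assms] by (intro holder22_cprod)
qed

lemma holder22_boundary_part:
  assumes S: "controlled_sheet \<alpha> \<beta> x R Y Yx Yw"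
  shows "holder22 \<alpha> \<beta> (boundary_part Yx Yw u)"
  unfolding boundary_part_def sum_dirs
  by (intro holder22_plus holder22_minus holder22_uminus holder22_path_C holder22_bint2
      controlled_sheetD[OF S])

lemma iint_rem_arg_Lam12:
  assumes S: "controlled_sheet \<alpha> \<beta> x R Y Yx Yw"
  shows "Lam12_dom (iint_rem_arg R Y Yx Yw u)"
    and "holder22 (3 * \<alpha>) (3 * \<beta>) (Lam12 (iint_rem_arg R Y Yx Yw u))"
    and "\<lbrakk>s1 \<in> J; s2 \<in> J; s3 \<in> J; t1 \<in> J; t2 \<in> J; t3 \<in> J\<rbrakk> \<Longrightarrow>
      ddelta (Lam12 (iint_rem_arg R Y Yx Yw u)) [s1, s2, s3] [t1, t2, t3]
      = iint_rem_arg R Y Yx Yw u [s1, s2, s3] [t1, t2, t3]"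
proof -
  let ?h = "iint_rem_arg R Y Yx Yw u"
  let ?g = "cprod Dir1 1 1 (cfun Y) (rA R u) - boundary_part Yx Yw u"
  note path = controlled_sheetD(1-3)[OF S]
  have g: "holder22 \<alpha> \<beta> ?g"
    by (intro holder22_minus holder22_path_A path holder22_boundary_part[OF S])
  have gc: "ccont 2 2 ?g" using g by (simp add: holder22_def)
  have gCC: "CC 2 2 ?g" using g by (simp add: CC22_iff_holder22[symmetric] CC22_def)
  have eq: "\<forall>s1\<in>J. \<forall>s2\<in>J. \<forall>s3\<in>J. \<forall>t1\<in>J. \<forall>t2\<in>J. \<forall>t3\<in>J.
      ?h [s1, s2, s3] [t1, t2, t3] = ddelta ?g [s1, s2, s3] [t1, t2, t3]"
    by (intro ballI iint_rem_arg_primitive)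
  have dom: "dominated (weights2 (3 * \<alpha>) (3 * \<beta>)) 3 3 ?h" by (rule dominated_iint_rem_arg[OF S])
  obtain K where K: "\<forall>s1\<in>J. \<forall>s2\<in>J. \<forall>s3\<in>J. \<forall>t1\<in>J. \<forall>t2\<in>J. \<forall>t3\<in>J. \<bar>?h [s1, s2, s3] [t1, t2, t3]\<bar>
     \<le> K * max \<bar>s2 - s1\<bar> \<bar>s3 - s2\<bar> powr (3 * \<alpha>) * max \<bar>t2 - t1\<bar> \<bar>t3 - t2\<bar> powr (3 * \<beta>)"
    using dominated_weights2_max[OF dom] by blast
  note L = Lam12_properties[OF ab_pos(3,4) gc eq K]
  show "holder22 (3 * \<alpha>) (3 * \<beta>) (Lam12 ?h)" by (rule L(1))
  show "\<lbrakk>s1 \<in> J; s2 \<in> J; s3 \<in> J; t1 \<in> J; t2 \<in> J; t3 \<in> J\<rbrakk> \<Longrightarrow>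
      ddelta (Lam12 ?h) [s1, s2, s3] [t1, t2, t3] = ?h [s1, s2, s3] [t1, t2, t3]" by (rule L(2))
  have "ccont 3 3 ?h"
  proof (rule ccont_cong)
    let ?d = "\<lambda>ss ts. ddelta ?g [ss ! 0, ss ! 1, ss ! 2] [ts ! 0, ts ! 1, ts ! 2]"
    show "ccont 3 3 ?d" by (rule ccont_ddelta[OF gc])
    have "\<forall>ss\<in>cube 3. \<forall>ts\<in>cube 3. ?h ss ts = ?d ss ts"
      unfolding ball_cube using eq by (simp add: numeral_2_eq_2 del: minus_apply fun_diff_def ddelta_apply)
    then show "\<And>ss ts. ss \<in> cube 3 \<Longrightarrow> ts \<in> cube 3 \<Longrightarrow> ?h ss ts = ?d ss ts" by blast
  qed
  have "\<forall>ss\<in>cube 3. \<forall>ts\<in>cube 3. (\<exists>i. Suc i < 3 \<and> ss ! i = ss ! Suc i) \<or> (\<exists>j. Suc j < 3 \<and> ts ! j = ts ! Suc j)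
        \<longrightarrow> ?h ss ts = 0"
    unfolding ball_cube
  proof (intro ballI impI)
    fix s1 s2 s3 t1 t2 t3
    assume J: "s1 \<in> J" "s2 \<in> J" "s3 \<in> J" "t1 \<in> J" "t2 \<in> J" "t3 \<in> J"
    have g0: "?g [a, a] [b, c] = 0" "?g [b, c] [a, a] = 0" if "a \<in> J" "b \<in> J" "c \<in> J" for a b c
      using gCC that unfolding CC22_vanish_iff by blast+
    assume "(\<exists>i. Suc i < 3 \<and> [s1, s2, s3] ! i = [s1, s2, s3] ! Suc i)
        \<or> (\<exists>j. Suc j < 3 \<and> [t1, t2, t3] ! j = [t1, t2, t3] ! Suc j)"
    then have "s1 = s2 \<or> s2 = s3 \<or> t1 = t2 \<or> t2 = t3"
      by (auto simp: less_Suc_eq numeral_3_eq_3)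
    then show "?h [s1, s2, s3] [t1, t2, t3] = 0"
      unfolding iint_rem_arg_primitive[OF J] ddelta_apply
      using g0 J by (elim disjE) (simp_all del: minus_apply fun_diff_def atLeastAtMost_iff)
  qed
  with \<open>ccont 3 3 ?h\<close> have CC3: "CC 3 3 ?h" unfolding CC_def by blast
  show "Lam12_dom ?h"
    unfolding Lam12_dom_def
  proof (intro conjI CC3)
    show "\<exists>g. CC 2 2 g \<and> ceq Dir1 3 3 ?h (ddelta g)"
      using gCC eq unfolding ceq_def ball_cube orient.simps by blast
    show "\<exists>z1>1. \<exists>z2>1. total_exponents z1 z2 ?h"
      using total_exponentsI[OF \<open>ccont 3 3 ?h\<close> dom] ab_pos(3,4) by blast
  qed
qed

lemma iint_eq: "iint R Y Yx Yw u = - cprod Dir1 1 1 (cfun Y) (rA R u)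
     + (bint R Dir1 Y u + bint R Dir2 Y u) + boundary_part Yx Yw u + Lam12 (iint_rem_arg R Y Yx Yw u)"
  unfolding iint_def boundary_part_def sum_dirs by (simp add: algebra_simps)

lemma iint_well_defined_CC22:
  assumes S: "controlled_sheet \<alpha> \<beta> x R Y Yx Yw"
  shows "iint_well_defined R Y Yx Yw u" and "CC22 \<alpha> \<beta> (iint R Y Yx Yw u)"
proof -
  note path = controlled_sheetD(1-3)[OF S]
  show "iint_well_defined R Y Yx Yw u"
    unfolding iint_well_defined_def
    by (intro conjI allI Lam_dom_bint_arg LamL_dom_bint2_inner Lam_dom_bint2_arg path iint_rem_arg_Lam12(1)[OF S])
  have "holder22 \<alpha> \<beta> (Lam12 (iint_rem_arg R Y Yx Yw u))"
    by (rule holder22_mono[OF iint_rem_arg_Lam12(2)[OF S]]) (use ab_pos in auto)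
  then show "CC22 \<alpha> \<beta> (iint R Y Yx Yw u)"
    unfolding CC22_iff_holder22 iint_eq
    by (intro holder22_plus holder22_uminus holder22_path_A holder22_bint path holder22_boundary_part[OF S])
qed

text \<open>
  The integral over the sheet shares this property with the Riemann integral, which is additive in both
  directions; together with the size of \<open>\<Lambda>\<close> it identifies the integral.
\<close>

lemma ddelta_iint:
  assumes S: "controlled_sheet \<alpha> \<beta> x R Y Yx Yw"
    and J: "s1 \<in> J" "s2 \<in> J" "s3 \<in> J" "t1 \<in> J" "t2 \<in> J" "t3 \<in> J"
  shows "ddelta (iint R Y Yx Yw u) [s1, s2, s3] [t1, t2, t3] = 0"
  unfolding iint_eq ddelta_linear iint_rem_arg_Lam12(3)[OF S J] iint_rem_arg_primitive[OF J]
    ddelta_bint[OF controlled_sheetD(1)[OF S] J] by linarith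

end

section \<open>Signed Riemann integrals of continuous functions\<close>

definition sint :: "real \<Rightarrow> real \<Rightarrow> (real \<Rightarrow> real) \<Rightarrow> real" where
  "sint a b f = (if a \<le> b then integral {a..b} f else - integral {b..a} f)"

lemma continuous_on_sub_J: "continuous_on J f \<Longrightarrow> a \<in> J \<Longrightarrow> b \<in> J \<Longrightarrow> continuous_on {a..b} f"
  by (rule continuous_on_subset) auto

lemma integrable_sub_J:
  fixes f :: "real \<Rightarrow> real"
  shows "continuous_on J f \<Longrightarrow> a \<in> J \<Longrightarrow> b \<in> J \<Longrightarrow> f integrable_on {a..b}"
  by (rule integrable_continuous_interval, rule continuous_on_sub_J)

lemma LBINT_eq_sint:
  fixes f :: "real \<Rightarrow> real"
  assumes f: "continuous_on J f" and J: "a \<in> J" "b \<in> J"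
  shows "(LBINT s=a..b. f s) = sint a b f"
proof -
  have le: "(LBINT s=c..d. f s) = integral {c..d} f" if "c \<le> d" "c \<in> J" "d \<in> J" for c d
    by (rule interval_integral_eq_integral[OF that(1)
          borel_integrable_atLeastAtMost'[OF continuous_on_sub_J[OF f that(2,3)]]])
  show ?thesis
  proof (cases "a \<le> b")
    case True
    then show ?thesis using le[OF True J] by (simp add: sint_def)
  next
    case False
    then show ?thesis using le[of b a] J interval_integral_endpoints_reverse[of a b f] by (simp add: sint_def)
  qed
qed

lemma sint_combine:
  assumes f: "continuous_on J f" and J: "a \<in> J" "b \<in> J" "c \<in> J"
  shows "sint a c f = sint a b f + sint b c f"
proof -
  have comb: "integral {u..v} f + integral {v..w} f = integral {u..w} f"
    if "u \<le> v" "v \<le> w" "u \<in> J" "w \<in> J" for u v w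
    by (rule Henstock_Kurzweil_Integration.integral_combine[OF that(1,2) integrable_sub_J[OF f that(3,4)]])
  consider "a \<le> b" "b \<le> c" | "a \<le> c" "c < b" | "b < a" "a \<le> c" | "b \<le> c" "c < a" | "c < a" "a \<le> b" | "c < b" "b < a"
    by linarith
  then show ?thesis
    by cases (use J comb[of a b c] comb[of a c b] comb[of b a c] comb[of b c a] comb[of c a b] comb[of c b a]
      in \<open>simp_all add: sint_def split: if_splits\<close>)
qed

lemma sint_add: "continuous_on J f \<Longrightarrow> continuous_on J g \<Longrightarrow> a \<in> J \<Longrightarrow> b \<in> J \<Longrightarrow>
    sint a b (\<lambda>s. f s + g s) = sint a b f + sint a b g"
  unfolding sint_def using integral_add[of f _ g] integrable_sub_J by auto

lemma sint_cmult: "sint a b (\<lambda>s. k * f s) = k * sint a b f"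
  by (simp add: sint_def)

lemma sint_cong:
  assumes "\<And>s. s \<in> J \<Longrightarrow> f s = g s" "a \<in> J" "b \<in> J"
  shows "sint a b f = sint a b g"
proof -
  have "integral {c..d} f = integral {c..d} g" if "c \<in> J" "d \<in> J" for c d
    by (rule integral_cong) (use assms(1) that in auto)
  then show ?thesis using assms(2,3) by (simp add: sint_def)
qed

lemma sint_bound:
  assumes f: "continuous_on J f" and J: "a \<in> J" "b \<in> J"
    and B: "\<And>s. s \<in> {min a b..max a b} \<Longrightarrow> \<bar>f s\<bar> \<le> B"
  shows "\<bar>sint a b f\<bar> \<le> B * \<bar>b - a\<bar>"
proof (cases "a \<le> b")
  case True
  then show ?thesis
    using integral_bound[OF True continuous_on_sub_J[OF f J], of B] B by (simp add: sint_def)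
next
  case False
  then show ?thesis
    using integral_bound[of b a f B] continuous_on_sub_J[OF f J(2,1)] B by (simp add: sint_def)
qed

definition cont_square :: "(real \<Rightarrow> real \<Rightarrow> real) \<Rightarrow> bool" where
  "cont_square f \<longleftrightarrow> continuous_on (J \<times> J) (\<lambda>p. f (fst p) (snd p))"

lemma cont_square_row: "cont_square f \<Longrightarrow> s \<in> J \<Longrightarrow> continuous_on J (f s)"
  unfolding cont_square_def
  by (rule continuous_on_compose2[where f = "\<lambda>t. (s, t)" and g = "\<lambda>p. f (fst p) (snd p)", simplified])
     (auto intro!: continuous_intros)

lemma cont_square_swap: "cont_square f \<Longrightarrow> cont_square (\<lambda>t s. f s t)"
  unfolding cont_square_def
  by (rule continuous_on_compose2[where f = "\<lambda>p. (snd p, fst p)" and g = "\<lambda>p. f (fst p) (snd p)", simplified])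
     (auto intro!: continuous_intros)

lemma cont_square_sint:
  assumes f: "cont_square f" and J: "c \<in> J" "d \<in> J"
  shows "continuous_on J (\<lambda>s. sint c d (f s))"
proof -
  have *: "continuous_on J (\<lambda>s. integral {u..v} (f s))" if "u \<in> J" "v \<in> J" for u v
  proof -
    have "continuous_on (J \<times> cbox u v) (\<lambda>(s, t). f s t)"
      using f that unfolding cont_square_def split_def by (rule_tac continuous_on_subset) auto
    from integral_continuous_on_param[OF this] show ?thesis by simp
  qed
  show ?thesis using *[OF J] *[OF J(2,1)] by (cases "c \<le> d") (auto simp: sint_def intro!: continuous_on_minus)
qed

definition dint :: "(real \<Rightarrow> real \<Rightarrow> real) \<Rightarrow> real \<Rightarrow> real \<Rightarrow> real \<Rightarrow> real \<Rightarrow> real" where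
  "dint f a b c d = (LBINT s=a..b. (LBINT t=c..d. f s t))"

lemma dint_eq_sint:
  assumes f: "cont_square f" and J: "a \<in> J" "b \<in> J" "c \<in> J" "d \<in> J"
  shows "dint f a b c d = sint a b (\<lambda>s. sint c d (f s))"
proof -
  have "dint f a b c d = (LBINT s=a..b. sint c d (f s))"
    unfolding dint_def
  proof (rule interval_integral_cong)
    fix s assume "s \<in> einterval (min (ereal a) (ereal b)) (max (ereal a) (ereal b))"
    then have "s \<in> J" using J by (auto simp: einterval_iff min_def max_def split: if_splits)
    then show "(LBINT t=c..d. f s t) = sint c d (f s)"
      by (intro LBINT_eq_sint cont_square_row[OF f] J)
  qed
  also have "\<dots> = sint a b (\<lambda>s. sint c d (f s))"
    by (intro LBINT_eq_sint cont_square_sint f J)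
  finally show ?thesis .
qed

lemma dint_cong:
  assumes "\<And>s t. s \<in> J \<Longrightarrow> t \<in> J \<Longrightarrow> f s t = g s t" "a \<in> J" "b \<in> J" "c \<in> J" "d \<in> J"
  shows "dint f a b c d = dint g a b c d"
  unfolding dint_def
proof (intro interval_integral_cong)
  fix s t assume "s \<in> einterval (min (ereal a) (ereal b)) (max (ereal a) (ereal b))"
    and "t \<in> einterval (min (ereal c) (ereal d)) (max (ereal c) (ereal d))"
  then have "s \<in> J" "t \<in> J" using assms(2-) by (auto simp: einterval_iff min_def max_def split: if_splits)
  then show "f s t = g s t" by (rule assms(1))
qed

lemma cont_square_add: "cont_square f \<Longrightarrow> cont_square g \<Longrightarrow> cont_square (\<lambda>s t. f s t + g s t)"
  and cont_square_cmult: "cont_square f \<Longrightarrow> cont_square (\<lambda>s t. k * f s t)"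
  and cont_square_mult: "cont_square f \<Longrightarrow> cont_square g \<Longrightarrow> cont_square (\<lambda>s t. f s t * g s t)"
  unfolding cont_square_def by (intro continuous_intros; assumption)+

lemma cont_square_const: "cont_square (\<lambda>_ _. k)"
  by (simp add: cont_square_def)

lemma dint_add:
  assumes f: "cont_square f" and g: "cont_square g" and J: "a \<in> J" "b \<in> J" "c \<in> J" "d \<in> J"
  shows "dint (\<lambda>s t. f s t + g s t) a b c d = dint f a b c d + dint g a b c d"
proof -
  have "sint a b (\<lambda>s. sint c d (\<lambda>t. f s t + g s t)) = sint a b (\<lambda>s. sint c d (f s) + sint c d (g s))"
    by (rule sint_cong[OF _ J(1,2)]) (intro sint_add cont_square_row f g J)
  then show ?thesis
    using sint_add[OF cont_square_sint[OF f J(3,4)] cont_square_sint[OF g J(3,4)] J(1,2)]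
    by (simp add: dint_eq_sint[OF f J] dint_eq_sint[OF g J] dint_eq_sint[OF cont_square_add[OF f g] J])
qed

lemma dint_cmult:
  assumes f: "cont_square f" and J: "a \<in> J" "b \<in> J" "c \<in> J" "d \<in> J"
  shows "dint (\<lambda>s t. k * f s t) a b c d = k * dint f a b c d"
  by (simp add: dint_eq_sint[OF f J] dint_eq_sint[OF cont_square_cmult[OF f] J] sint_cmult)

lemma dint_combine1:
  assumes f: "cont_square f" and J: "a \<in> J" "b \<in> J" "e \<in> J" "c \<in> J" "d \<in> J"
  shows "dint f a e c d = dint f a b c d + dint f b e c d"
  using sint_combine[OF cont_square_sint[OF f J(4,5)] J(1,2,3)] J by (simp add: dint_eq_sint[OF f])

text \<open>
  Fubini, needed since the iterated integrals for direction 2 integrate in the opposite order.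
\<close>

lemma dint_swap:
  assumes f: "cont_square f" and J: "a \<in> J" "b \<in> J" "c \<in> J" "d \<in> J"
  shows "dint (\<lambda>t s. f s t) c d a b = dint f a b c d"
proof -
  have sw: "integral {u..v} (\<lambda>s. integral {w..z} (f s)) = integral {w..z} (\<lambda>t. integral {u..v} (\<lambda>s. f s t))"
    if "u \<in> J" "v \<in> J" "w \<in> J" "z \<in> J" for u v w z
  proof -
    have "continuous_on (cbox (u, w) (v, z)) (\<lambda>(s, t). f s t)"
      using f that unfolding cont_square_def split_def
      by (rule_tac continuous_on_subset) (auto simp: cbox_Pair_eq)
    from integral_swap_continuous[OF this] show ?thesis by simp
  qed
  show ?thesis
    unfolding dint_eq_sint[OF f J] dint_eq_sint[OF cont_square_swap[OF f] J(3,4,1,2)] sint_def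
    using J by (auto simp: sw)
qed

lemma dint_bound:
  assumes f: "cont_square f" and J: "a \<in> J" "b \<in> J" "c \<in> J" "d \<in> J"
    and B: "\<And>s t. s \<in> {min a b..max a b} \<Longrightarrow> t \<in> {min c d..max c d} \<Longrightarrow> \<bar>f s t\<bar> \<le> B"
  shows "\<bar>dint f a b c d\<bar> \<le> B * (\<bar>b - a\<bar> * \<bar>d - c\<bar>)"
proof -
  have "\<bar>sint a b (\<lambda>s. sint c d (f s))\<bar> \<le> (B * \<bar>d - c\<bar>) * \<bar>b - a\<bar>"
  proof (rule sint_bound[OF cont_square_sint[OF f J(3,4)] J(1,2)])
    fix s assume s: "s \<in> {min a b..max a b}"
    then have "s \<in> J" using J by (auto simp: min_def max_def split: if_splits)
    then show "\<bar>sint c d (f s)\<bar> \<le> B * \<bar>d - c\<bar>"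
      using B[OF s] by (intro sint_bound cont_square_row[OF f] J)
  qed
  then show ?thesis by (simp add: dint_eq_sint[OF f J] algebra_simps)
qed

lemma cont_square_bounded:
  assumes "cont_square f"
  shows "\<exists>M\<ge>0. \<forall>s\<in>J. \<forall>t\<in>J. \<bar>f s t\<bar> \<le> M"
proof -
  have "compact ((\<lambda>p. f (fst p) (snd p)) ` (J \<times> J))"
    using assms unfolding cont_square_def by (intro compact_continuous_image compact_Times compact_Icc)
  then have "bounded ((\<lambda>p. f (fst p) (snd p)) ` (J \<times> J))" by (rule compact_imp_bounded)
  then obtain M where M: "\<forall>v\<in>(\<lambda>p. f (fst p) (snd p)) ` (J \<times> J). norm v \<le> M"
    unfolding bounded_iff by (elim exE)
  have "\<bar>f s t\<bar> \<le> \<bar>M\<bar>" if "s \<in> J" "t \<in> J" for s t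
  proof -
    have "(\<lambda>p. f (fst p) (snd p)) (s, t) \<in> (\<lambda>p. f (fst p) (snd p)) ` (J \<times> J)"
      using that by (intro imageI) simp
    from M[rule_format, OF this] show ?thesis by simp
  qed
  then show ?thesis by (intro exI[of _ "\<bar>M\<bar>"]) auto
qed

lemma cont_square_ccont:
  shows "ccont 1 1 g \<Longrightarrow> t \<in> J \<Longrightarrow> cont_square (\<lambda>s _. g [s] [t])"
    and "ccont 1 1 g \<Longrightarrow> s \<in> J \<Longrightarrow> cont_square (\<lambda>_ t. g [s] [t])"
    and "ccont 1 1 g \<Longrightarrow> cont_square (\<lambda>s t. g [s] [t])"
    and "ccont 2 1 h \<Longrightarrow> s \<in> J \<Longrightarrow> t \<in> J \<Longrightarrow> cont_square (\<lambda>r _. h [s, r] [t])"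
    and "ccont 2 2 k \<Longrightarrow> s \<in> J \<Longrightarrow> t \<in> J \<Longrightarrow> cont_square (\<lambda>r r'. k [s, r] [t, r'])"
    and "ccont 2 2 k \<Longrightarrow> s \<in> J \<Longrightarrow> s' \<in> J \<Longrightarrow> t \<in> J \<Longrightarrow> cont_square (\<lambda>_ r'. k [s, s'] [t, r'])"
proof -
  have m: "maps_into (J \<times> J) (\<lambda>_. r)" if "r \<in> J" for r :: real using that by simp
  note m = m maps_into_pair
  show "ccont 1 1 g \<Longrightarrow> t \<in> J \<Longrightarrow> cont_square (\<lambda>s _. g [s] [t])"
    and "ccont 1 1 g \<Longrightarrow> s \<in> J \<Longrightarrow> cont_square (\<lambda>_ t. g [s] [t])"
    and "ccont 1 1 g \<Longrightarrow> cont_square (\<lambda>s t. g [s] [t])"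
    unfolding cont_square_def by (rule ccont_compose_intros(1); (assumption | rule m); assumption?)+
  show "ccont 2 1 h \<Longrightarrow> s \<in> J \<Longrightarrow> t \<in> J \<Longrightarrow> cont_square (\<lambda>r _. h [s, r] [t])"
    unfolding cont_square_def by (rule ccont_compose_intros(2); (assumption | rule m); assumption?)
  show "ccont 2 2 k \<Longrightarrow> s \<in> J \<Longrightarrow> t \<in> J \<Longrightarrow> cont_square (\<lambda>r r'. k [s, r] [t, r'])"
    and "ccont 2 2 k \<Longrightarrow> s \<in> J \<Longrightarrow> s' \<in> J \<Longrightarrow> t \<in> J \<Longrightarrow> cont_square (\<lambda>_ r'. k [s, s'] [t, r'])"
    unfolding cont_square_def by (rule ccont_compose_intros(3); (assumption | rule m); assumption?)+
qed

lemma pw_between: "z \<ge> 0 \<Longrightarrow> s \<in> {min a b..max a b} \<Longrightarrow> pw z a s \<le> pw z a b"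
  unfolding pw_def by (intro powr_mono2) (auto simp: min_def max_def split: if_splits)

lemma between_mem: "a \<in> J \<Longrightarrow> b \<in> J \<Longrightarrow> s \<in> {min a b..max a b} \<Longrightarrow> s \<in> J"
  by (auto simp: min_def max_def split: if_splits)

lemma powr_add_one: "\<bar>r\<bar> powr z * \<bar>r\<bar> = \<bar>r :: real\<bar> powr (z + 1)"
  by (cases "r = 0") (simp_all add: powr_add)

section \<open>Boundary integrals against continuous densities\<close>

text \<open>
  The case in which the data are iterated integrals against continuous densities \<open>\<theta>\<close> for \<open>w\<close> and \<open>\<theta>u\<close> for \<open>u\<close>.
\<close>

locale smooth_double_integrand = controlled_double_integrand +
  fixes \<theta> \<theta>u :: "real \<Rightarrow> real \<Rightarrow> real"
  assumes \<theta>: "cont_square \<theta>" "cont_square \<theta>u"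
    and A_int': "\<forall>s1\<in>J. \<forall>s2\<in>J. \<forall>t1\<in>J. \<forall>t2\<in>J. A [s1, s2] [t1, t2] = dint \<theta> s1 s2 t1 t2"
    and B_int': "\<forall>s1\<in>J. \<forall>s2\<in>J. \<forall>t1\<in>J. \<forall>t2\<in>J.
       B [s1, s2] [t1, t2] = dint (\<lambda>s t. (x [s] [t1] - x [s1] [t1]) * \<theta> s t) s1 s2 t1 t2"
    and C_int': "\<forall>s1\<in>J. \<forall>s2\<in>J. \<forall>t1\<in>J. \<forall>t2\<in>J.
       C [s1, s2] [t1, t2] = dint (\<lambda>s t. A [s1, s] [t1, t] * \<theta>u s t) s1 s2 t1 t2"
    and D_int': "\<forall>s1\<in>J. \<forall>s2\<in>J. \<forall>s3\<in>J. \<forall>s4\<in>J. \<forall>t1\<in>J. \<forall>t2\<in>J.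
       D [s1, s2, s3, s4] [t1, t2] = dint (\<lambda>s t. A [s1, s2] [t1, t] * \<theta>u s t) s3 s4 t1 t2"
    and E_int': "\<forall>s1\<in>J. \<forall>s2\<in>J. \<forall>s3\<in>J. \<forall>s4\<in>J. \<forall>t1\<in>J. \<forall>t2\<in>J.
       E [s1, s2, s3, s4] [t1, t2] = dint (\<lambda>s t. B [s1, s2] [t1, t] * \<theta>u s t) s3 s4 t1 t2"
begin

lemmas A_int = A_int'[rule_format] and B_int = B_int'[rule_format] and C_int = C_int'[rule_format]
  and D_int = D_int'[rule_format] and E_int = E_int'[rule_format]

text \<open>
  With \<open>y\<close> expanded from the left end \<open>s\<^sub>1\<close>, the Riemann integral minus \<open>yA + y\<^sup>xB\<close> is the integral of \<open>y\<^sup>\<sharp>\<close>, of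
  exponent \<open>2p + 1\<close>.  It has the same image under \<open>\<delta>\<^sub>1\<close> as the sewn function, hence equals it.
\<close>

lemma bnd_eq_integral:
  assumes J: "s1 \<in> J" "s2 \<in> J" "t1 \<in> J" "t2 \<in> J"
  shows "bnd [s1, s2] [t1, t2] = dint (\<lambda>s t. y [s] [t1] * \<theta> s t) s1 s2 t1 t2"
proof -
  obtain M where M: "M \<ge> 0" "\<And>s t. s \<in> J \<Longrightarrow> t \<in> J \<Longrightarrow> \<bar>\<theta> s t\<bar> \<le> M"
    using cont_square_bounded[OF \<theta>(1)] by blast
  let ?P = "\<lambda>a b. dint (\<lambda>s t. y [s] [t1] * \<theta> s t) a b t1 t2"
  have cy: "cont_square (\<lambda>s t. y [s] [t1] * \<theta> s t)"
    by (intro cont_square_mult cont_square_ccont(1) cont \<theta> J)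
  have rem: "?P a b + arg_prim [a, b] [t1, t2] = dint (\<lambda>s t. yr [a, s] [t1] * \<theta> s t) a b t1 t2"
    if ab: "a \<in> J" "b \<in> J" for a b
  proof -
    have cx: "cont_square (\<lambda>s t. (x [s] [t1] - x [a] [t1]) * \<theta> s t)"
    proof -
      have "cont_square (\<lambda>s t. (x [s] [t1] + - x [a] [t1]) * \<theta> s t)"
        by (rule cont_square_mult[OF cont_square_add[OF cont_square_ccont(1)[OF cont(1) J(3)]
              cont_square_const] \<theta>(1)])
      then show ?thesis by simp
    qed
    have cr: "cont_square (\<lambda>s t. yr [a, s] [t1] * \<theta> s t)"
      by (intro cont_square_mult cont_square_ccont(4) cont \<theta> J ab)
    have "?P a b = dint (\<lambda>s t. (y [a] [t1] * \<theta> s t + yd [a] [t1] * ((x [s] [t1] - x [a] [t1]) * \<theta> s t))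
        + yr [a, s] [t1] * \<theta> s t) a b t1 t2"
    proof (rule dint_cong[OF _ ab J(3,4)])
      fix s t assume "s \<in> J" "t \<in> J"
      then show "y [s] [t1] * \<theta> s t = (y [a] [t1] * \<theta> s t + yd [a] [t1] * ((x [s] [t1] - x [a] [t1]) * \<theta> s t))
        + yr [a, s] [t1] * \<theta> s t"
        unfolding y_eq[OF ab(1) \<open>s \<in> J\<close> J(3)] by (simp add: algebra_simps)
    qed
    also have "\<dots> = y [a] [t1] * dint \<theta> a b t1 t2
        + yd [a] [t1] * dint (\<lambda>s t. (x [s] [t1] - x [a] [t1]) * \<theta> s t) a b t1 t2
        + dint (\<lambda>s t. yr [a, s] [t1] * \<theta> s t) a b t1 t2"
      using ab J
      by (simp only: dint_add dint_cmult cont_square_add cont_square_cmult \<theta> cx cr)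
    finally show ?thesis
      unfolding arg_prim_apply A_int[OF ab J(3,4)] B_int[OF ab J(3,4)] by simp
  qed
  have "Lam Dir1 arg [s1, s2] [t1, t2] = ?P s1 s2 + arg_prim [s1, s2] [t1, t2]"
  proof (rule coboundary_unique[where f = "\<lambda>a b. Lam Dir1 arg [a, b] [t1, t2]"
        and g = "\<lambda>a b. ?P a b + arg_prim [a, b] [t1, t2]" and ?z1.0 = "3 * p" and ?z2.0 = "2 * p + 1"])
    fix a b assume ab: "a \<in> J" "b \<in> J"
    show "\<bar>Lam Dir1 arg [a, b] [t1, t2]\<bar>
        \<le> sewing_const (3 * p) * (2 * (K * K * pw q t1 t2)) * \<bar>b - a\<bar> powr (3 * p)"
      using Lam_arg_bound[OF ab J(3,4)] by (simp add: pw_def)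
    have cr: "cont_square (\<lambda>s t. yr [a, s] [t1] * \<theta> s t)"
      by (intro cont_square_mult cont_square_ccont(4) cont \<theta> J ab)
    have "\<bar>dint (\<lambda>s t. yr [a, s] [t1] * \<theta> s t) a b t1 t2\<bar>
       \<le> (K * pw (2 * p) a b * M) * (\<bar>b - a\<bar> * \<bar>t2 - t1\<bar>)"
    proof (rule dint_bound[OF cr ab J(3,4)])
      fix s t assume s: "s \<in> {min a b..max a b}" and t: "t \<in> {min t1 t2..max t1 t2}"
      note sJ = between_mem[OF ab s] and tJ = between_mem[OF J(3,4) t]
      have "\<bar>yr [a, s] [t1] * \<theta> s t\<bar> \<le> K * pw (2 * p) a s * M"
        by (intro abs_mult_le yr_bd M(2) ab sJ tJ J)
      also have "\<dots> \<le> K * pw (2 * p) a b * M"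
        using K0 M(1) p_pos s by (intro mult_right_mono mult_left_mono pw_between) auto
      finally show "\<bar>yr [a, s] [t1] * \<theta> s t\<bar> \<le> K * pw (2 * p) a b * M" .
    qed
    also have "\<dots> = (K * M * \<bar>t2 - t1\<bar>) * (\<bar>b - a\<bar> powr (2 * p) * \<bar>b - a\<bar>)"
      by (simp add: pw_def algebra_simps)
    also have "\<dots> = (K * M * \<bar>t2 - t1\<bar>) * \<bar>b - a\<bar> powr (2 * p + 1)" by (simp only: powr_add_one)
    finally show "\<bar>?P a b + arg_prim [a, b] [t1, t2]\<bar> \<le> (K * M * \<bar>t2 - t1\<bar>) * \<bar>b - a\<bar> powr (2 * p + 1)"
      unfolding rem[OF ab] .
  next
    fix a b c assume abc: "a \<in> J" "b \<in> J" "c \<in> J"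
    show "Lam Dir1 arg [a, c] [t1, t2] - Lam Dir1 arg [a, b] [t1, t2] - Lam Dir1 arg [b, c] [t1, t2] =
       ?P a c + arg_prim [a, c] [t1, t2] - (?P a b + arg_prim [a, b] [t1, t2]) - (?P b c + arg_prim [b, c] [t1, t2])"
      using Lam_arg_eq[OF abc J(3,4)] arg_eq[OF abc J(3,4)] dint_combine1[OF cy abc J(3,4)] by simp
  qed (use p_pos J in auto)
  then show ?thesis unfolding bnd_eq_arg_prim by simp
qed

lemma weight_u: "cont_square f \<Longrightarrow> cont_square (\<lambda>s t. f s t * \<theta>u s t)"
  by (rule cont_square_mult[OF _ \<theta>(2)])

text \<open>
  Integrating the definition of the boundary integral against \<open>\<theta>u\<close> turns \<open>yA + y\<^sup>xB\<close> into \<open>yD + y\<^sup>xE\<close>; the rest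
  is the integral of \<open>\<Lambda>\<^sub>1 arg\<close>, still of exponent \<open>3p\<close> in the first pair of variables.
\<close>

lemma inner_int_eq_integral:
  assumes J: "s1 \<in> J" "s2 \<in> J" "s3 \<in> J" "s4 \<in> J" "t1 \<in> J" "t2 \<in> J"
  shows "inner_int [s1, s2, s3, s4] [t1, t2] = dint (\<lambda>s t. bnd [s1, s2] [t1, t] * \<theta>u s t) s3 s4 t1 t2"
proof -
  obtain M where M: "M \<ge> 0" "\<And>s t. s \<in> J \<Longrightarrow> t \<in> J \<Longrightarrow> \<bar>\<theta>u s t\<bar> \<le> M"
    using cont_square_bounded[OF \<theta>(2)] by blast
  let ?V = "\<lambda>a b. dint (\<lambda>s t. bnd [a, b] [t1, t] * \<theta>u s t) s3 s4 t1 t2"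
  note J' = J(3-6)
  have cb: "cont_square (\<lambda>s t. g [a, b] [t1, t] * \<theta>u s t)" if "ccont 2 2 g" "a \<in> J" "b \<in> J" for g a b
    by (intro weight_u cont_square_ccont(6) that J)
  have rem: "?V a b + darg_prim [a, b, s3, s4] [t1, t2]
      = dint (\<lambda>s t. Lam Dir1 arg [a, b] [t1, t] * \<theta>u s t) s3 s4 t1 t2"
    if ab: "a \<in> J" "b \<in> J" for a b
  proof -
    have "?V a b = dint (\<lambda>s t. (y [a] [t1] * (A [a, b] [t1, t] * \<theta>u s t)
        + yd [a] [t1] * (B [a, b] [t1, t] * \<theta>u s t)) + Lam Dir1 arg [a, b] [t1, t] * \<theta>u s t) s3 s4 t1 t2"
      by (rule dint_cong[OF _ J']) (simp add: bint1_apply algebra_simps)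
    also have "\<dots> = y [a] [t1] * dint (\<lambda>s t. A [a, b] [t1, t] * \<theta>u s t) s3 s4 t1 t2
        + yd [a] [t1] * dint (\<lambda>s t. B [a, b] [t1, t] * \<theta>u s t) s3 s4 t1 t2
        + dint (\<lambda>s t. Lam Dir1 arg [a, b] [t1, t] * \<theta>u s t) s3 s4 t1 t2"
      using J' ab cont ccont_Lam_arg
      by (simp only: dint_add dint_cmult cont_square_add cont_square_cmult cb)
    finally show ?thesis
      unfolding darg_prim_apply D_int[OF ab J'] E_int[OF ab J'] by simp
  qed
  have "LamL Dir1 darg [s1, s2, s3, s4] [t1, t2] = ?V s1 s2 + darg_prim [s1, s2, s3, s4] [t1, t2]"
  proof (rule coboundary_unique[OF p_pos(3) p_pos(3), where f = "\<lambda>a b. LamL Dir1 darg [a, b, s3, s4] [t1, t2]"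
        and g = "\<lambda>a b. ?V a b + darg_prim [a, b, s3, s4] [t1, t2]"])
    fix a b assume ab: "a \<in> J" "b \<in> J"
    show "\<bar>LamL Dir1 darg [a, b, s3, s4] [t1, t2]\<bar> \<le> sc * (2 * (K * K)) * \<bar>b - a\<bar> powr (3 * p)"
      by (rule LamL_inner_bound'[OF ab J'])
    have "\<bar>dint (\<lambda>s t. Lam Dir1 arg [a, b] [t1, t] * \<theta>u s t) s3 s4 t1 t2\<bar>
       \<le> (sc * (2 * (K * K)) * pw (3 * p) a b * M) * (\<bar>s4 - s3\<bar> * \<bar>t2 - t1\<bar>)"
    proof (rule dint_bound[OF cb[OF ccont_Lam_arg ab] J'])
      fix s t assume s: "s \<in> {min s3 s4..max s3 s4}" and t: "t \<in> {min t1 t2..max t1 t2}"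
      note sJ = between_mem[OF J(3,4) s] and tJ = between_mem[OF J(5,6) t]
      have "sc * (2 * (K * K * pw q t1 t)) * pw (3 * p) a b \<le> sc * (2 * (K * K)) * pw (3 * p) a b"
        using sc_pos K0 pw_le_1[of q t1 t] J tJ p_pos
        by (intro mult_right_mono mult_left_mono mult_left_le) auto
      then have "\<bar>Lam Dir1 arg [a, b] [t1, t]\<bar> \<le> sc * (2 * (K * K)) * pw (3 * p) a b"
        using Lam_arg_bound[OF ab J(5) tJ] unfolding sc_def by linarith
      then show "\<bar>Lam Dir1 arg [a, b] [t1, t] * \<theta>u s t\<bar> \<le> sc * (2 * (K * K)) * pw (3 * p) a b * M"
        by (intro abs_mult_le M(2) sJ tJ)
    qed
    then show "\<bar>?V a b + darg_prim [a, b, s3, s4] [t1, t2]\<bar>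
       \<le> (sc * (2 * (K * K)) * M * (\<bar>s4 - s3\<bar> * \<bar>t2 - t1\<bar>)) * \<bar>b - a\<bar> powr (3 * p)"
      unfolding rem[OF ab] by (simp add: pw_def algebra_simps)
  next
    fix a b c assume abc: "a \<in> J" "b \<in> J" "c \<in> J"
    have "?V a c = dint (\<lambda>s t. bnd [a, b] [t1, t] * \<theta>u s t + bnd [b, c] [t1, t] * \<theta>u s t) s3 s4 t1 t2"
      by (rule dint_cong[OF _ J']) (simp add: bnd_additive[OF abc J(5)] algebra_simps del: atLeastAtMost_iff)
    also have "\<dots> = ?V a b + ?V b c"
      by (rule dint_add[OF cb[OF ccont_bnd abc(1,2)] cb[OF ccont_bnd abc(2,3)] J'])
    finally show "LamL Dir1 darg [a, c, s3, s4] [t1, t2] - LamL Dir1 darg [a, b, s3, s4] [t1, t2]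
       - LamL Dir1 darg [b, c, s3, s4] [t1, t2] =
       ?V a c + darg_prim [a, c, s3, s4] [t1, t2] - (?V a b + darg_prim [a, b, s3, s4] [t1, t2])
       - (?V b c + darg_prim [b, c, s3, s4] [t1, t2])"
      using LamL_inner_eq[OF abc J'] inner_eq[OF abc J'] by linarith
  qed (use J in auto)
  then show ?thesis unfolding inner_int_def by simp
qed

text \<open>
  The Riemann integral minus \<open>yC\<close> is the integral of \<open>y\<^sup>xB + \<Lambda>\<^sub>1 arg\<close>, of exponent \<open>2p + 1\<close>.  Splitting the
  inner boundary integral at the middle point shows that its image under \<open>\<delta>\<^sub>1\<close> is the required one.
\<close>

lemma dbl_eq_integral:
  assumes J: "s1 \<in> J" "s2 \<in> J" "t1 \<in> J" "t2 \<in> J"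
  shows "dbl [s1, s2] [t1, t2] = dint (\<lambda>s t. bnd [s1, s] [t1, t] * \<theta>u s t) s1 s2 t1 t2"
proof -
  obtain M where M: "M \<ge> 0" "\<And>s t. s \<in> J \<Longrightarrow> t \<in> J \<Longrightarrow> \<bar>\<theta>u s t\<bar> \<le> M"
    using cont_square_bounded[OF \<theta>(2)] by blast
  let ?Q = "\<lambda>a b. dint (\<lambda>s t. bnd [a, s] [t1, t] * \<theta>u s t) a b t1 t2"
  let ?e = "\<lambda>a s t. bnd [a, s] [t1, t] + (- y [a] [t1]) * A [a, s] [t1, t]"
  define c where "c = K * K + sc * (2 * (K * K))"
  have cb: "cont_square (\<lambda>s t. g [a, s] [t1, t] * \<theta>u s t)" if "ccont 2 2 g" "a \<in> J" for g a
    by (intro weight_u cont_square_ccont(5) that J)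
  have ce: "cont_square (\<lambda>s t. ?e a s t * \<theta>u s t)" if "a \<in> J" for a
    by (intro weight_u cont_square_add cont_square_cmult cont_square_ccont(5) ccont_bnd cont that J)
  have rem: "?Q a b - y [a] [t1] * C [a, b] [t1, t2] = dint (\<lambda>s t. ?e a s t * \<theta>u s t) a b t1 t2"
    if ab: "a \<in> J" "b \<in> J" for a b
  proof -
    have "dint (\<lambda>s t. ?e a s t * \<theta>u s t) a b t1 t2 = dint (\<lambda>s t. bnd [a, s] [t1, t] * \<theta>u s t
        + (- y [a] [t1]) * (A [a, s] [t1, t] * \<theta>u s t)) a b t1 t2"
      by (rule dint_cong[OF _ ab J(3,4)]) (simp add: algebra_simps)
    also have "\<dots> = ?Q a b + (- y [a] [t1]) * dint (\<lambda>s t. A [a, s] [t1, t] * \<theta>u s t) a b t1 t2"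
      using ab J ccont_bnd cont by (simp only: dint_add dint_cmult cont_square_cmult cb)
    finally show ?thesis unfolding C_int[OF ab J(3,4)] by simp
  qed
  have "Lam Dir1 arg2 [s1, s2] [t1, t2] = ?Q s1 s2 - y [s1] [t1] * C [s1, s2] [t1, t2]"
  proof (rule coboundary_unique[where f = "\<lambda>a b. Lam Dir1 arg2 [a, b] [t1, t2]"
        and g = "\<lambda>a b. ?Q a b - y [a] [t1] * C [a, b] [t1, t2]" and ?z1.0 = "3 * p" and ?z2.0 = "2 * p + 1"])
    fix a b assume ab: "a \<in> J" "b \<in> J"
    show "\<bar>Lam Dir1 arg2 [a, b] [t1, t2]\<bar> \<le> sc * (2 * (K2 * pw (2 * q) t1 t2)) * \<bar>b - a\<bar> powr (3 * p)"
      using Lam_arg2_bound[OF ab J(3,4)] by (simp add: pw_def)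
    have "\<bar>dint (\<lambda>s t. ?e a s t * \<theta>u s t) a b t1 t2\<bar> \<le> (c * pw (2 * p) a b * M) * (\<bar>b - a\<bar> * \<bar>t2 - t1\<bar>)"
    proof (rule dint_bound[OF ce[OF ab(1)] ab J(3,4)])
      fix s t assume s: "s \<in> {min a b..max a b}" and t: "t \<in> {min t1 t2..max t1 t2}"
      note sJ = between_mem[OF ab s] and tJ = between_mem[OF J(3,4) t]
      have b: "pw (2 * p) a s \<le> pw (2 * p) a b" using p_pos s by (intro pw_between) auto
      have q1: "pw q t1 t \<le> 1" using pw_le_1[of q t1 t] J tJ p_pos by simp
      have "\<bar>yd [a] [t1] * B [a, s] [t1, t]\<bar> \<le> K * (K * (pw (2 * p) a s * pw q t1 t))"
        by (intro abs_mult_le yd_bd B_bd ab sJ J tJ)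
      also have "\<dots> \<le> K * (K * (pw (2 * p) a b * 1))"
        using K0 b q1 by (intro mult_left_mono mult_mono) auto
      finally have 1: "\<bar>yd [a] [t1] * B [a, s] [t1, t]\<bar> \<le> K * K * pw (2 * p) a b" by simp
      have "pw (3 * p) a s \<le> pw (2 * p) a s" using p_pos ab sJ by (intro pw_antimono) auto
      then have b3: "pw (3 * p) a s \<le> pw (2 * p) a b" using b by linarith
      have "\<bar>Lam Dir1 arg [a, s] [t1, t]\<bar> \<le> sc * (2 * (K * K * pw q t1 t)) * pw (3 * p) a s"
        using Lam_arg_bound[OF ab(1) sJ J(3) tJ] unfolding sc_def .
      also have "\<dots> \<le> sc * (2 * (K * K * 1)) * pw (2 * p) a b"
        using K0 sc_pos q1 b3 by (intro mult_mono mult_left_mono) auto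
      finally have 2: "\<bar>Lam Dir1 arg [a, s] [t1, t]\<bar> \<le> sc * (2 * (K * K)) * pw (2 * p) a b" by simp
      have "?e a s t = yd [a] [t1] * B [a, s] [t1, t] + Lam Dir1 arg [a, s] [t1, t]"
        by (simp add: bint1_apply)
      then have "\<bar>?e a s t\<bar> \<le> c * pw (2 * p) a b" using 1 2 unfolding c_def distrib_right by linarith
      then show "\<bar>?e a s t * \<theta>u s t\<bar> \<le> c * pw (2 * p) a b * M" by (intro abs_mult_le M(2) sJ tJ)
    qed
    also have "\<dots> = (c * M * \<bar>t2 - t1\<bar>) * (\<bar>b - a\<bar> powr (2 * p) * \<bar>b - a\<bar>)"
      by (simp add: pw_def algebra_simps)
    also have "\<dots> = (c * M * \<bar>t2 - t1\<bar>) * \<bar>b - a\<bar> powr (2 * p + 1)" by (simp only: powr_add_one)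
    finally show "\<bar>?Q a b - y [a] [t1] * C [a, b] [t1, t2]\<bar> \<le> (c * M * \<bar>t2 - t1\<bar>) * \<bar>b - a\<bar> powr (2 * p + 1)"
      unfolding rem[OF ab] .
  next
    fix a b d assume abc: "a \<in> J" "b \<in> J" "d \<in> J"
    have c6: "cont_square (\<lambda>s t. bnd [a, b] [t1, t] * \<theta>u s t)"
      by (intro weight_u cont_square_ccont(6) ccont_bnd abc J)
    have "?Q a d = ?Q a b + dint (\<lambda>s t. bnd [a, s] [t1, t] * \<theta>u s t) b d t1 t2"
      by (rule dint_combine1[OF cb[OF ccont_bnd abc(1)] abc J(3,4)])
    also have "dint (\<lambda>s t. bnd [a, s] [t1, t] * \<theta>u s t) b d t1 t2
       = dint (\<lambda>s t. bnd [a, b] [t1, t] * \<theta>u s t + bnd [b, s] [t1, t] * \<theta>u s t) b d t1 t2"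
    proof (rule dint_cong[OF _ abc(2,3) J(3,4)])
      fix s t assume "s \<in> J" "t \<in> J"
      then show "bnd [a, s] [t1, t] * \<theta>u s t = bnd [a, b] [t1, t] * \<theta>u s t + bnd [b, s] [t1, t] * \<theta>u s t"
        unfolding bnd_additive[OF abc(1,2) \<open>s \<in> J\<close> J(3) \<open>t \<in> J\<close>] by (simp add: algebra_simps)
    qed
    also have "\<dots> = inner_int [a, b, b, d] [t1, t2] + ?Q b d"
      unfolding inner_int_eq_integral[OF abc(1,2,2,3) J(3,4)]
      by (rule dint_add[OF c6 cb[OF ccont_bnd abc(2)] abc(2,3) J(3,4)])
    finally have "?Q a d - ?Q a b - ?Q b d = inner_int [a, b, b, d] [t1, t2]" by simp
    then show "Lam Dir1 arg2 [a, d] [t1, t2] - Lam Dir1 arg2 [a, b] [t1, t2] - Lam Dir1 arg2 [b, d] [t1, t2] =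
       ?Q a d - y [a] [t1] * C [a, d] [t1, t2] - (?Q a b - y [a] [t1] * C [a, b] [t1, t2])
       - (?Q b d - y [b] [t1] * C [b, d] [t1, t2])"
      using Lam_arg2_eq[OF abc J(3,4)] arg2_eq_inner_int[OF abc J(3,4)] by linarith
  qed (use p_pos J in auto)
  then show ?thesis unfolding bint21_apply by simp
qed

end

section \<open>Smooth sheets\<close>

text \<open>
  Uniqueness of sewing in \<open>t\<close> shows that \<open>\<delta>\<^sub>1f = \<delta>\<^sub>1g\<close>, and then uniqueness in \<open>s\<close> applies.
\<close>

lemma ddelta_unique:
  assumes z: "z1 > 1" "z2 > 1" "z1' > 1" "z2' > 1" and K: "K \<ge> 0" "K' \<ge> 0"
    and f: "\<And>s1 s2 t1 t2. s1 \<in> J \<Longrightarrow> s2 \<in> J \<Longrightarrow> t1 \<in> J \<Longrightarrow> t2 \<in> J \<Longrightarrow>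
      \<bar>f [s1, s2] [t1, t2]\<bar> \<le> K * (pw z1 s1 s2 * pw z2 t1 t2)"
    and g: "\<And>s1 s2 t1 t2. s1 \<in> J \<Longrightarrow> s2 \<in> J \<Longrightarrow> t1 \<in> J \<Longrightarrow> t2 \<in> J \<Longrightarrow>
      \<bar>g [s1, s2] [t1, t2]\<bar> \<le> K' * (pw z1' s1 s2 * pw z2' t1 t2)"
    and eq: "\<And>s1 s2 s3 t1 t2 t3. s1 \<in> J \<Longrightarrow> s2 \<in> J \<Longrightarrow> s3 \<in> J \<Longrightarrow> t1 \<in> J \<Longrightarrow> t2 \<in> J \<Longrightarrow> t3 \<in> J \<Longrightarrow>
      ddelta f [s1, s2, s3] [t1, t2, t3] = ddelta g [s1, s2, s3] [t1, t2, t3]"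
    and J: "s1 \<in> J" "s2 \<in> J" "t1 \<in> J" "t2 \<in> J"
  shows "f [s1, s2] [t1, t2] = g [s1, s2] [t1, t2]"
proof -
  have s_bound: "\<bar>h [a, b] [c, d]\<bar> \<le> L * pw w2 c d"
    if "\<And>s1 s2 t1 t2. s1 \<in> J \<Longrightarrow> s2 \<in> J \<Longrightarrow> t1 \<in> J \<Longrightarrow> t2 \<in> J \<Longrightarrow>
      \<bar>h [s1, s2] [t1, t2]\<bar> \<le> L * (pw w1 s1 s2 * pw w2 t1 t2)" "L \<ge> 0" "w1 > 1"
      "a \<in> J" "b \<in> J" "c \<in> J" "d \<in> J" for h L w1 w2 a b c d
  proof -
    have "L * (pw w1 a b * pw w2 c d) \<le> L * (1 * pw w2 c d)"
      using that by (intro mult_left_mono mult_right_mono pw_le_1) auto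
    then show ?thesis using that(1)[OF that(4-7)] by simp
  qed
  have step: "f [a, c] [t1, t2] - f [a, b] [t1, t2] - f [b, c] [t1, t2] =
      g [a, c] [t1, t2] - g [a, b] [t1, t2] - g [b, c] [t1, t2]"
    if abc: "a \<in> J" "b \<in> J" "c \<in> J" for a b c
  proof (rule coboundary_unique[OF z(2,4),
        where f = "\<lambda>u v. f [a, c] [u, v] - f [a, b] [u, v] - f [b, c] [u, v]"
          and g = "\<lambda>u v. g [a, c] [u, v] - g [a, b] [u, v] - g [b, c] [u, v]"])
    fix u v assume uv: "u \<in> J" "v \<in> J"
    show "\<bar>f [a, c] [u, v] - f [a, b] [u, v] - f [b, c] [u, v]\<bar> \<le> (3 * K) * \<bar>v - u\<bar> powr z2"
      using s_bound[OF f K(1) z(1) abc(1,3) uv] s_bound[OF f K(1) z(1) abc(1,2) uv]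
        s_bound[OF f K(1) z(1) abc(2,3) uv] unfolding pw_def by linarith
    show "\<bar>g [a, c] [u, v] - g [a, b] [u, v] - g [b, c] [u, v]\<bar> \<le> (3 * K') * \<bar>v - u\<bar> powr z2'"
      using s_bound[OF g K(2) z(3) abc(1,3) uv] s_bound[OF g K(2) z(3) abc(1,2) uv]
        s_bound[OF g K(2) z(3) abc(2,3) uv] unfolding pw_def by linarith
  next
    fix u v w assume "u \<in> J" "v \<in> J" "w \<in> J"
    from eq[OF abc this]
    show "f [a, c] [u, w] - f [a, b] [u, w] - f [b, c] [u, w] - (f [a, c] [u, v] - f [a, b] [u, v] - f [b, c] [u, v])
        - (f [a, c] [v, w] - f [a, b] [v, w] - f [b, c] [v, w]) =
      g [a, c] [u, w] - g [a, b] [u, w] - g [b, c] [u, w] - (g [a, c] [u, v] - g [a, b] [u, v] - g [b, c] [u, v])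
        - (g [a, c] [v, w] - g [a, b] [v, w] - g [b, c] [v, w])"
      unfolding ddelta_apply by linarith
  qed (use J in auto)
  show ?thesis
  proof (rule coboundary_unique[OF z(1,3), where f = "\<lambda>a b. f [a, b] [t1, t2]" and g = "\<lambda>a b. g [a, b] [t1, t2]"])
    fix a b assume ab: "a \<in> J" "b \<in> J"
    show "\<bar>f [a, b] [t1, t2]\<bar> \<le> (K * pw z2 t1 t2) * \<bar>b - a\<bar> powr z1"
      using f[OF ab J(3,4)] by (simp add: pw_def algebra_simps)
    show "\<bar>g [a, b] [t1, t2]\<bar> \<le> (K' * pw z2' t1 t2) * \<bar>b - a\<bar> powr z1'"
      using g[OF ab J(3,4)] by (simp add: pw_def algebra_simps)
  qed (use step J in auto)
qed

lemma smooth_cont_square: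
  assumes "smooth (sheet x)"
  shows "cont_square (theta x u)"
proof -
  have w: "cont_square (foldr pd w (sheet x))" for w
    using assms unfolding smooth_def cont_square_def by (simp add: Let_def split_def)
  have d: "cont_square (pd Dir1 (pd Dir2 (sheet x)))" "cont_square (pd Dir1 (sheet x))"
      "cont_square (pd Dir2 (sheet x))"
    using w[of "[Dir1, Dir2]"] w[of "[Dir1]"] w[of "[Dir2]"] by (simp_all del: pd.simps)
  show ?thesis
    using d(1) cont_square_mult[OF d(2,3)] by (cases u) (simp_all del: pd.simps)
qed

lemma cont_square_orient: "cont_square f \<Longrightarrow> cont_square (orient a f)"
  using cont_square_swap[of f] by (cases a) simp_all

lemma dint_orient_swap:
  assumes "cont_square f" "a \<in> J" "b \<in> J" "c \<in> J" "d \<in> J"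
  shows "dint (orient Dir2 f) c d a b = dint f a b c d"
  using dint_swap[OF assms] by simp

lemma itA_dint: "itA \<theta> [a, b] [c, d] = dint \<theta> a b c d"
  by (simp add: itA_def dint_def)

lemma itB_dint: "itB x \<theta> [a, b] [c, d] = dint (\<lambda>s t. (x [s] [c] - x [a] [c]) * \<theta> s t) a b c d"
  by (simp add: itB_def dint_def)

lemma itC_dint: "itC \<theta> \<theta>' [a, b] [c, d] = dint (\<lambda>s t. itA \<theta> [a, s] [c, t] * \<theta>' s t) a b c d"
  by (simp add: itC_def dint_def)

lemma itD_dint: "itD \<theta> \<theta>' [a, b, a', b'] [c, d] = dint (\<lambda>s t. itA \<theta> [a, b] [c, t] * \<theta>' s t) a' b' c d"
  by (simp add: itD_def dint_def numeral_2_eq_2 numeral_3_eq_3)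

lemma itE_dint: "itE x \<theta> \<theta>' [a, b, a', b'] [c, d] = dint (\<lambda>s t. itB x \<theta> [a, b] [c, t] * \<theta>' s t) a' b' c d"
  by (simp add: itE_def dint_def numeral_2_eq_2 numeral_3_eq_3)

locale smooth_sheet = rough_sheet +
  assumes smooth: "smooth (sheet x)" and it: "iterated_integrals x R"
begin

lemma iterated:
  "ceq Dir1 2 2 (rA R u) (itA (theta x u))"
  "ceq a 2 2 (rB R a u) (orient a (itB (orient a x) (orient a (theta x u))))"
  "ceq Dir1 2 2 (rC R u v) (itC (theta x u) (theta x v))"
  "ceq a 4 2 (rD R a u v) (orient a (itD (orient a (theta x u)) (orient a (theta x v))))"
  "ceq a 4 2 (rE R a u v) (orient a (itE (orient a x) (orient a (theta x u)) (orient a (theta x v))))"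
  using it unfolding iterated_integrals_def by blast+

lemma theta_cont: "cont_square (orient a (theta x u))"
  by (rule cont_square_orient[OF smooth_cont_square[OF smooth]])

lemma A_integral:
  assumes J: "s1 \<in> J" "s2 \<in> J" "t1 \<in> J" "t2 \<in> J"
  shows "orient a (rA R u) [s1, s2] [t1, t2] = dint (orient a (theta x u)) s1 s2 t1 t2"
proof -
  have *: "rA R u [a, b] [c, d] = dint (theta x u) a b c d" if "a \<in> J" "b \<in> J" "c \<in> J" "d \<in> J" for a b c d
    using iterated(1)[of u] that unfolding ceq_def ball_cube orient.simps itA_dint by blast
  show ?thesis
    using *[OF J] *[OF J(3,4,1,2)] dint_orient_swap[OF smooth_cont_square[OF smooth] J(3,4,1,2)]
    by (cases a) simp_all
qed

lemma B_integral:
  assumes J: "s1 \<in> J" "s2 \<in> J" "t1 \<in> J" "t2 \<in> J"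
  shows "orient a (rB R a u) [s1, s2] [t1, t2] =
    dint (\<lambda>s t. (orient a x [s] [t1] - orient a x [s1] [t1]) * orient a (theta x u) s t) s1 s2 t1 t2"
  using iterated(2)[of a u] J unfolding ceq_def ball_cube orient_orient itB_dint by blast

lemma A_density_cont: "s1 \<in> J \<Longrightarrow> t1 \<in> J \<Longrightarrow>
   cont_square (\<lambda>s t. orient a (rA R u) [s1, s] [t1, t] * orient a (theta x v) s t)"
proof -
  assume J: "s1 \<in> J" "t1 \<in> J"
  have "CC22 \<alpha> \<beta> (rA R u)" using R unfolding algebraic_hypothesis_def rough_regularity_def by blast
  then have "ccont 2 2 (orient a (rA R u))" by (intro ccont_orient) (simp add: CC22_def CC_def)
  then show ?thesis by (intro cont_square_mult cont_square_ccont(5) theta_cont J)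
qed

text \<open>
  \<open>C\<close> is the same function for both directions, so for \<open>a = 2\<close> the order of integration is exchanged.
\<close>

lemma C_integral:
  assumes J: "s1 \<in> J" "s2 \<in> J" "t1 \<in> J" "t2 \<in> J"
  shows "orient a (rC R u v) [s1, s2] [t1, t2] =
    dint (\<lambda>s t. orient a (rA R u) [s1, s] [t1, t] * orient a (theta x v) s t) s1 s2 t1 t2"
proof -
  have *: "rC R u v [a, b] [c, d] = dint (\<lambda>s t. rA R u [a, s] [c, t] * theta x v s t) a b c d"
    if J: "a \<in> J" "b \<in> J" "c \<in> J" "d \<in> J" for a b c d
  proof -
    have "rC R u v [a, b] [c, d] = dint (\<lambda>s t. itA (theta x u) [a, s] [c, t] * theta x v s t) a b c d"
      using iterated(3)[of u v] J unfolding ceq_def ball_cube orient.simps itC_dint by blast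
    also have "\<dots> = dint (\<lambda>s t. rA R u [a, s] [c, t] * theta x v s t) a b c d"
    proof (rule dint_cong[OF _ J])
      fix s t assume "s \<in> J" "t \<in> J"
      then show "itA (theta x u) [a, s] [c, t] * theta x v s t = rA R u [a, s] [c, t] * theta x v s t"
        using A_integral[of a s c t Dir1 u] J by (simp add: itA_dint)
    qed
    finally show ?thesis .
  qed
  show ?thesis
  proof (cases a)
    case Dir1
    then show ?thesis using *[OF J] by simp
  next
    case Dir2
    have "dint (\<lambda>t s. rA R u [t1, s] [s1, t] * theta x v s t) s1 s2 t1 t2
       = dint (\<lambda>s t. rA R u [t1, s] [s1, t] * theta x v s t) t1 t2 s1 s2"
      using A_density_cont[of t1 s1 Dir1 u v] J by (intro dint_swap) simp_all
    then show ?thesis using *[OF J(3,4,1,2)] Dir2 by simp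
  qed
qed

lemma D_integral:
  assumes J: "s1 \<in> J" "s2 \<in> J" "s3 \<in> J" "s4 \<in> J" "t1 \<in> J" "t2 \<in> J"
  shows "orient a (rD R a u v) [s1, s2, s3, s4] [t1, t2] =
    dint (\<lambda>s t. orient a (rA R u) [s1, s2] [t1, t] * orient a (theta x v) s t) s3 s4 t1 t2"
proof -
  have "orient a (rD R a u v) [s1, s2, s3, s4] [t1, t2] =
    dint (\<lambda>s t. itA (orient a (theta x u)) [s1, s2] [t1, t] * orient a (theta x v) s t) s3 s4 t1 t2"
    using iterated(4)[of a u v] J unfolding ceq_def ball_cube orient_orient itD_dint by blast
  also have "\<dots> = dint (\<lambda>s t. orient a (rA R u) [s1, s2] [t1, t] * orient a (theta x v) s t) s3 s4 t1 t2"
    by (rule dint_cong[OF _ J(3-6)]) (simp only: itA_dint A_integral[OF J(1,2,5)])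
  finally show ?thesis .
qed

lemma E_integral:
  assumes J: "s1 \<in> J" "s2 \<in> J" "s3 \<in> J" "s4 \<in> J" "t1 \<in> J" "t2 \<in> J"
  shows "orient a (rE R a u v) [s1, s2, s3, s4] [t1, t2] =
    dint (\<lambda>s t. orient a (rB R a u) [s1, s2] [t1, t] * orient a (theta x v) s t) s3 s4 t1 t2"
proof -
  have "orient a (rE R a u v) [s1, s2, s3, s4] [t1, t2] =
    dint (\<lambda>s t. itB (orient a x) (orient a (theta x u)) [s1, s2] [t1, t] * orient a (theta x v) s t) s3 s4 t1 t2"
    using iterated(5)[of a u v] J unfolding ceq_def ball_cube orient_orient itE_dint by blast
  also have "\<dots> = dint (\<lambda>s t. orient a (rB R a u) [s1, s2] [t1, t] * orient a (theta x v) s t) s3 s4 t1 t2"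
    by (rule dint_cong[OF _ J(3-6)]) (simp only: itB_dint B_integral[OF J(1,2,5)])
  finally show ?thesis .
qed

lemma path_integrals:
  assumes Y: "controlled_path \<alpha> \<beta> x Y" and J: "s1 \<in> J" "s2 \<in> J" "t1 \<in> J" "t2 \<in> J"
  shows "orient a (bint R a Y w) [s1, s2] [t1, t2] =
      dint (\<lambda>s t. orient a (cfun Y) [s] [t1] * orient a (theta x w) s t) s1 s2 t1 t2"
    and "orient a (bint2 R a Y w u) [s1, s2] [t1, t2] =
      dint (\<lambda>s t. orient a (bint R a Y w) [s1, s] [t1, t] * orient a (theta x u) s t) s1 s2 t1 t2"
proof -
  obtain K W where loc: "oriented_integrand a Y w u K W" by (rule oriented_integrand_exists[OF Y])
  interpret smooth_double_integrand "expo \<alpha> \<beta> a" "expo \<alpha> \<beta> (opp a)" K "orient a x"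
      "orient a (cfun Y)" "orient a (cder Y a)" "orient a (crem Y a)" "orient a (rA R w)" "orient a (rB R a w)"
      "orient a (rA R u)" "orient a (rC R w u)" "orient a (rD R a w u)" "orient a (rE R a w u)"
      "orient a (rF R a w u)" W "orient a (theta x w)" "orient a (theta x u)"
    by (intro smooth_double_integrand.intro loc smooth_double_integrand_axioms.intro theta_cont ballI
        A_integral B_integral C_integral D_integral E_integral)
  show "orient a (bint R a Y w) [s1, s2] [t1, t2] =
      dint (\<lambda>s t. orient a (cfun Y) [s] [t1] * orient a (theta x w) s t) s1 s2 t1 t2"
    unfolding orient_bint by (rule bnd_eq_integral[OF J])
  show "orient a (bint2 R a Y w u) [s1, s2] [t1, t2] =
      dint (\<lambda>s t. orient a (bint R a Y w) [s1, s] [t1, t] * orient a (theta x u) s t) s1 s2 t1 t2"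
    unfolding orient_bint orient_bint2 by (rule dbl_eq_integral[OF J])
qed

lemma ccont_path: "controlled_path \<alpha> \<beta> x Y \<Longrightarrow> ccont 1 1 (cfun Y)"
  by (rule controlled_path_regular(1)[OF ab_pos(1,2) x])

lemma ccont_bint: "controlled_path \<alpha> \<beta> x Y \<Longrightarrow> ccont 2 2 (bint R a Y w)"
  using holder22_bint unfolding holder22_def by blast

lemma density: "cont_square f \<Longrightarrow> cont_square (\<lambda>s t. f s t * theta x u s t)"
  by (rule cont_square_mult[OF _ smooth_cont_square[OF smooth]])

lemma bint_integrals:
  assumes Y: "controlled_path \<alpha> \<beta> x Y" and J: "s1 \<in> J" "s2 \<in> J" "t1 \<in> J" "t2 \<in> J"
  shows "bint R Dir1 Y w [s1, s2] [t1, t2] = dint (\<lambda>s t. cfun Y [s] [t1] * theta x w s t) s1 s2 t1 t2"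
    and "bint R Dir2 Y w [s1, s2] [t1, t2] = dint (\<lambda>s t. cfun Y [s1] [t] * theta x w s t) s1 s2 t1 t2"
    and "bint2 R a Y w u [s1, s2] [t1, t2] =
      dint (\<lambda>s t. bint R a Y w [s1, s] [t1, t] * theta x u s t) s1 s2 t1 t2"
proof -
  show "bint R Dir1 Y w [s1, s2] [t1, t2] = dint (\<lambda>s t. cfun Y [s] [t1] * theta x w s t) s1 s2 t1 t2"
    using path_integrals(1)[OF Y J, of Dir1 w] by simp
  have "dint (\<lambda>t s. cfun Y [s1] [t] * theta x w s t) t1 t2 s1 s2
      = dint (\<lambda>s t. cfun Y [s1] [t] * theta x w s t) s1 s2 t1 t2"
    by (rule dint_swap[OF density[OF cont_square_ccont(2)[OF ccont_path[OF Y] J(1)]] J])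
  then show "bint R Dir2 Y w [s1, s2] [t1, t2] = dint (\<lambda>s t. cfun Y [s1] [t] * theta x w s t) s1 s2 t1 t2"
    using path_integrals(1)[OF Y J(3,4,1,2), of Dir2 w] by simp
  show "bint2 R a Y w u [s1, s2] [t1, t2] =
      dint (\<lambda>s t. bint R a Y w [s1, s] [t1, t] * theta x u s t) s1 s2 t1 t2"
  proof (cases a)
    case Dir1
    then show ?thesis using path_integrals(2)[OF Y J, of Dir1 w u] by simp
  next
    case Dir2
    have "dint (\<lambda>t s. bint R Dir2 Y w [s1, s] [t1, t] * theta x u s t) t1 t2 s1 s2
      = dint (\<lambda>s t. bint R Dir2 Y w [s1, s] [t1, t] * theta x u s t) s1 s2 t1 t2"
      by (rule dint_swap[OF density[OF cont_square_ccont(5)[OF ccont_bint[OF Y] J(1,3)]] J])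
    then show ?thesis using path_integrals(2)[OF Y J(3,4,1,2), of Dir2 w u] Dir2 by simp
  qed
qed

text \<open>
  At a point \<open>(s, t)\<close>, \<open>y\<^bsub>st\<^esub> = -y\<^bsub>ac\<^esub> + y\<^bsub>sc\<^esub> + y\<^bsub>at\<^esub> + \<delta>y\<^bsub>as;ct\<^esub>\<close>, and \<open>\<delta>y\<close> is expanded by the definition of a
  controlled sheet.  Each term integrates to one of the terms of \<open>\<integral>\<integral>y du\<close>, except for \<open>y\<^sup>\<sharp>\<close>.
\<close>

lemma integral_decomposition:
  assumes S: "controlled_sheet \<alpha> \<beta> x R Y Yx Yw"
    and yr: "ccont 2 2 yr" and yr_eq: "\<And>s1 s2 t1 t2. s1 \<in> J \<Longrightarrow> s2 \<in> J \<Longrightarrow> t1 \<in> J \<Longrightarrow> t2 \<in> J \<Longrightarrow>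
      ddelta (cfun Y) [s1, s2] [t1, t2] = path_part Yx LX [s1, s2] [t1, t2]
        + path_part Yw LW [s1, s2] [t1, t2] + yr [s1, s2] [t1, t2]"
    and J: "a \<in> J" "b \<in> J" "c \<in> J" "d \<in> J"
  shows "dint (\<lambda>s t. cfun Y [s] [t] * theta x u s t) a b c d =
      - cprod Dir1 1 1 (cfun Y) (rA R u) [a, b] [c, d] + (bint R Dir1 Y u + bint R Dir2 Y u) [a, b] [c, d]
      + boundary_part Yx Yw u [a, b] [c, d] + dint (\<lambda>s t. yr [a, s] [c, t] * theta x u s t) a b c d"
proof -
  note path = controlled_sheetD(1-3)[OF S]
  let ?\<theta> = "theta x u"
  note \<theta> = smooth_cont_square[OF smooth, of u]
  have cA: "cont_square (\<lambda>s t. rA R w [a, s] [c, t] * ?\<theta> s t)" for w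
    using A_density_cont[OF J(1,3), of Dir1 w u] by simp
  have cb: "cont_square (\<lambda>s t. bint R e Z w [a, s] [c, t] * ?\<theta> s t)" if "controlled_path \<alpha> \<beta> x Z" for e Z w
    by (rule density[OF cont_square_ccont(5)[OF ccont_bint[OF that] J(1,3)]])
  have cy1: "cont_square (\<lambda>s t. cfun Y [s] [c] * ?\<theta> s t)"
    by (rule density[OF cont_square_ccont(1)[OF ccont_path[OF path(1)] J(3)]])
  have cy2: "cont_square (\<lambda>s t. cfun Y [a] [t] * ?\<theta> s t)"
    by (rule density[OF cont_square_ccont(2)[OF ccont_path[OF path(1)] J(1)]])
  have cr: "cont_square (\<lambda>s t. yr [a, s] [c, t] * ?\<theta> s t)"
    by (rule density[OF cont_square_ccont(5)[OF yr J(1,3)]])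
  have C: "dint (\<lambda>s t. rA R w [a, s] [c, t] * ?\<theta> s t) a b c d = rC R w u [a, b] [c, d]" for w
    using C_integral[OF J, of Dir1 w u] by simp
  have A: "dint ?\<theta> a b c d = rA R u [a, b] [c, d]"
    using A_integral[OF J, of Dir1 u] by simp
  have "dint (\<lambda>s t. cfun Y [s] [t] * ?\<theta> s t) a b c d = dint (\<lambda>s t.
      ((((((((((- cfun Y [a] [c]) * ?\<theta> s t + cfun Y [s] [c] * ?\<theta> s t) + cfun Y [a] [t] * ?\<theta> s t)
      + (- cfun Yx [a] [c]) * (rA R LX [a, s] [c, t] * ?\<theta> s t))
      + bint R Dir1 Yx LX [a, s] [c, t] * ?\<theta> s t) + bint R Dir2 Yx LX [a, s] [c, t] * ?\<theta> s t)
      + (- cfun Yw [a] [c]) * (rA R LW [a, s] [c, t] * ?\<theta> s t))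
      + bint R Dir1 Yw LW [a, s] [c, t] * ?\<theta> s t) + bint R Dir2 Yw LW [a, s] [c, t] * ?\<theta> s t)
      + yr [a, s] [c, t] * ?\<theta> s t)) a b c d"
  proof (rule dint_cong[OF _ J])
    fix s t assume st: "s \<in> J" "t \<in> J"
    have "cfun Y [s] [t] = - cfun Y [a] [c] + cfun Y [s] [c] + cfun Y [a] [t]
        - cfun Yx [a] [c] * rA R LX [a, s] [c, t]
        + bint R Dir1 Yx LX [a, s] [c, t] + bint R Dir2 Yx LX [a, s] [c, t]
        - cfun Yw [a] [c] * rA R LW [a, s] [c, t]
        + bint R Dir1 Yw LW [a, s] [c, t] + bint R Dir2 Yw LW [a, s] [c, t] + yr [a, s] [c, t]"
      using yr_eq[OF J(1) st(1) J(3) st(2)] unfolding ddelta_apply path_part_apply by linarith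
    then have "cfun Y [s] [t] * ?\<theta> s t = (- cfun Y [a] [c] + cfun Y [s] [c] + cfun Y [a] [t]
        - cfun Yx [a] [c] * rA R LX [a, s] [c, t]
        + bint R Dir1 Yx LX [a, s] [c, t] + bint R Dir2 Yx LX [a, s] [c, t]
        - cfun Yw [a] [c] * rA R LW [a, s] [c, t]
        + bint R Dir1 Yw LW [a, s] [c, t] + bint R Dir2 Yw LW [a, s] [c, t] + yr [a, s] [c, t]) * ?\<theta> s t"
      by (rule arg_cong)
    then show "cfun Y [s] [t] * ?\<theta> s t =
      ((((((((((- cfun Y [a] [c]) * ?\<theta> s t + cfun Y [s] [c] * ?\<theta> s t) + cfun Y [a] [t] * ?\<theta> s t)
      + (- cfun Yx [a] [c]) * (rA R LX [a, s] [c, t] * ?\<theta> s t))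
      + bint R Dir1 Yx LX [a, s] [c, t] * ?\<theta> s t) + bint R Dir2 Yx LX [a, s] [c, t] * ?\<theta> s t)
      + (- cfun Yw [a] [c]) * (rA R LW [a, s] [c, t] * ?\<theta> s t))
      + bint R Dir1 Yw LW [a, s] [c, t] * ?\<theta> s t) + bint R Dir2 Yw LW [a, s] [c, t] * ?\<theta> s t)
      + yr [a, s] [c, t] * ?\<theta> s t)" by (simp only: distrib_right left_diff_distrib mult.assoc minus_mult_left[symmetric] diff_conv_add_uminus)
  qed
  also have "\<dots> = - cfun Y [a] [c] * rA R u [a, b] [c, d] + bint R Dir1 Y u [a, b] [c, d]
      + bint R Dir2 Y u [a, b] [c, d] + - cfun Yx [a] [c] * rC R LX u [a, b] [c, d]
      + bint2 R Dir1 Yx LX u [a, b] [c, d] + bint2 R Dir2 Yx LX u [a, b] [c, d]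
      + - cfun Yw [a] [c] * rC R LW u [a, b] [c, d]
      + bint2 R Dir1 Yw LW u [a, b] [c, d] + bint2 R Dir2 Yw LW u [a, b] [c, d]
      + dint (\<lambda>s t. yr [a, s] [c, t] * ?\<theta> s t) a b c d"
    using J
    by (simp only: dint_add dint_cmult cont_square_add cont_square_cmult \<theta> cA cb path cy1 cy2 cr C A
        bint_integrals[OF path(1) J] bint_integrals(3)[OF path(2) J] bint_integrals(3)[OF path(3) J])
  finally show ?thesis
    unfolding boundary_part_def sum_dirs by (simp add: cprod_def)
qed

text \<open>
  The integral of \<open>y\<^sup>\<sharp>\<close> has exponents \<open>2\<alpha> + 1\<close> and \<open>2\<beta> + 1\<close> and the same image under \<open>\<delta>\<close> as \<open>r\<^sup>u\<close>, because both
  the Riemann integral and \<open>\<integral>\<integral>y du\<close> are annihilated by \<open>\<delta>\<close>.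
\<close>

lemma iint_eq_integral:
  assumes S: "controlled_sheet \<alpha> \<beta> x R Y Yx Yw" and J: "s1 \<in> J" "s2 \<in> J" "t1 \<in> J" "t2 \<in> J"
  shows "iint R Y Yx Yw u [s1, s2] [t1, t2] = dint (\<lambda>s t. cfun Y [s] [t] * theta x u s t) s1 s2 t1 t2"
proof -
  let ?h = "iint_rem_arg R Y Yx Yw u"
  note path = controlled_sheetD(1-3)[OF S]
  obtain yr where yr: "holder22 (2 * \<alpha>) (2 * \<beta>) yr" and
    yr_eq: "\<And>s1 s2 t1 t2. s1 \<in> J \<Longrightarrow> s2 \<in> J \<Longrightarrow> t1 \<in> J \<Longrightarrow> t2 \<in> J \<Longrightarrow>
      ddelta (cfun Y) [s1, s2] [t1, t2] = path_part Yx LX [s1, s2] [t1, t2]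
        + path_part Yw LW [s1, s2] [t1, t2] + yr [s1, s2] [t1, t2]"
    using controlled_sheetD(4)[OF S] by blast
  have yrc: "ccont 2 2 yr" using yr by (simp add: holder22_def)
  obtain K where K: "K \<ge> 0" "\<And>s1 s2 t1 t2. s1 \<in> J \<Longrightarrow> s2 \<in> J \<Longrightarrow> t1 \<in> J \<Longrightarrow> t2 \<in> J \<Longrightarrow>
     \<bar>yr [s1, s2] [t1, t2]\<bar> \<le> K * (pw (2 * \<alpha>) s1 s2 * pw (2 * \<beta>) t1 t2)"
    using yr unfolding holder22_def by blast
  obtain M where M: "M \<ge> 0" "\<And>s t. s \<in> J \<Longrightarrow> t \<in> J \<Longrightarrow> \<bar>theta x u s t\<bar> \<le> M"
    using cont_square_bounded[OF smooth_cont_square[OF smooth]] by blast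
  obtain L where L: "L \<ge> 0" "\<And>s1 s2 t1 t2. s1 \<in> J \<Longrightarrow> s2 \<in> J \<Longrightarrow> t1 \<in> J \<Longrightarrow> t2 \<in> J \<Longrightarrow>
     \<bar>Lam12 ?h [s1, s2] [t1, t2]\<bar> \<le> L * (pw (3 * \<alpha>) s1 s2 * pw (3 * \<beta>) t1 t2)"
    using iint_rem_arg_Lam12(2)[OF S, of u] unfolding holder22_def by blast
  define I where "I ss ts = dint (\<lambda>s t. cfun Y [s] [t] * theta x u s t) (ss ! 0) (ss ! 1) (ts ! 0) (ts ! 1)"
    for ss ts :: "real list"
  define r where "r = I - (iint R Y Yx Yw u - Lam12 ?h)"
  have I: "I [a, b] [c, d] = dint (\<lambda>s t. cfun Y [s] [t] * theta x u s t) a b c d" for a b c d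
    by (simp add: I_def)
  have cy: "cont_square (\<lambda>s t. cfun Y [s] [t] * theta x u s t)"
    by (rule density[OF cont_square_ccont(3)[OF ccont_path[OF path(1)]]])
  have r_eq: "r [a, b] [c, d] = dint (\<lambda>s t. yr [a, s] [c, t] * theta x u s t) a b c d"
    if "a \<in> J" "b \<in> J" "c \<in> J" "d \<in> J" for a b c d
    using integral_decomposition[OF S yrc yr_eq that, of u] by (simp add: r_def I iint_eq)
  have "Lam12 ?h [s1, s2] [t1, t2] = r [s1, s2] [t1, t2]"
  proof (rule ddelta_unique[OF ab_pos(3,4), of "2 * \<alpha> + 1" "2 * \<beta> + 1" L "K * M"])
    fix a b c d assume abcd: "a \<in> J" "b \<in> J" "c \<in> J" "d \<in> J"
    show "\<bar>Lam12 ?h [a, b] [c, d]\<bar> \<le> L * (pw (3 * \<alpha>) a b * pw (3 * \<beta>) c d)" by (rule L(2)[OF abcd])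
    have "\<bar>dint (\<lambda>s t. yr [a, s] [c, t] * theta x u s t) a b c d\<bar>
       \<le> (K * (pw (2 * \<alpha>) a b * pw (2 * \<beta>) c d) * M) * (\<bar>b - a\<bar> * \<bar>d - c\<bar>)"
    proof (rule dint_bound[OF density[OF cont_square_ccont(5)[OF yrc abcd(1,3)]] abcd])
      fix s t assume s: "s \<in> {min a b..max a b}" and t: "t \<in> {min c d..max c d}"
      note sJ = between_mem[OF abcd(1,2) s] and tJ = between_mem[OF abcd(3,4) t]
      have "\<bar>yr [a, s] [c, t] * theta x u s t\<bar> \<le> K * (pw (2 * \<alpha>) a s * pw (2 * \<beta>) c t) * M"
        by (intro abs_mult_le K(2) M(2) abcd sJ tJ)
      also have "\<dots> \<le> K * (pw (2 * \<alpha>) a b * pw (2 * \<beta>) c d) * M"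
        using K(1) M(1) ab_pos s t by (intro mult_right_mono mult_left_mono mult_mono pw_between) auto
      finally show "\<bar>yr [a, s] [c, t] * theta x u s t\<bar> \<le> K * (pw (2 * \<alpha>) a b * pw (2 * \<beta>) c d) * M" .
    qed
    also have "\<dots> = K * M * ((\<bar>b - a\<bar> powr (2 * \<alpha>) * \<bar>b - a\<bar>) * (\<bar>d - c\<bar> powr (2 * \<beta>) * \<bar>d - c\<bar>))"
      by (simp add: pw_def algebra_simps)
    also have "\<dots> = K * M * (pw (2 * \<alpha> + 1) a b * pw (2 * \<beta> + 1) c d)"
      unfolding pw_def powr_add_one ..
    finally show "\<bar>r [a, b] [c, d]\<bar> \<le> K * M * (pw (2 * \<alpha> + 1) a b * pw (2 * \<beta> + 1) c d)"
      unfolding r_eq[OF abcd] .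
  next
    fix a b c a' b' c' assume J: "a \<in> J" "b \<in> J" "c \<in> J" "a' \<in> J" "b' \<in> J" "c' \<in> J"
    have I0: "ddelta I [a, b, c] [a', b', c'] = 0"
      unfolding ddelta_apply I
      using dint_combine1[OF cy J(1,2,3,4,6)] dint_combine1[OF cy J(1,2,3,4,5)] dint_combine1[OF cy J(1,2,3,5,6)]
      by linarith
    show "ddelta (Lam12 ?h) [a, b, c] [a', b', c'] = ddelta r [a, b, c] [a', b', c']"
      unfolding r_def ddelta_linear I0 ddelta_iint[OF S J] by simp
  qed (use ab_pos L(1) K(1) M(1) J in auto)
  then show ?thesis unfolding r_def minus_apply I by simp
qed

end

theorem theorem5p6:
  fixes \<alpha> \<beta> :: real and x :: cochain and R :: rough_data and Y Yx Yw :: cpath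
  assumes "\<alpha> > 1/3" and "\<beta> > 1/3"
    and "CC11 \<alpha> \<beta> x"
    and "algebraic_hypothesis \<alpha> \<beta> x R"
    and "controlled_sheet \<alpha> \<beta> x R Y Yx Yw"
  shows "(\<forall>u. iint_well_defined R Y Yx Yw u \<and> CC22 \<alpha> \<beta> (iint R Y Yx Yw u)) \<and>
     (smooth (sheet x) \<and> iterated_integrals x R \<longrightarrow>
      (\<forall>s1\<in>{0..1}. \<forall>s2\<in>{0..1}. \<forall>t1\<in>{0..1}. \<forall>t2\<in>{0..1}.
        iint R Y Yx Yw LX [s1, s2] [t1, t2] =
          (LBINT s=s1..s2. (LBINT t=t1..t2.
             cfun Y [s] [t] * pd Dir1 (pd Dir2 (sheet x)) s t)) \<and>
        iint R Y Yx Yw LW [s1, s2] [t1, t2] =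
          (LBINT s=s1..s2. (LBINT t=t1..t2.
             cfun Y [s] [t] * pd Dir1 (sheet x) s t * pd Dir2 (sheet x) s t))))"
proof -
  interpret rough_sheet \<alpha> \<beta> x R by (rule rough_sheet.intro[OF assms(1-4)])
  have integral: "iint R Y Yx Yw u [s1, s2] [t1, t2] = dint (\<lambda>s t. cfun Y [s] [t] * theta x u s t) s1 s2 t1 t2"
    if smooth: "smooth (sheet x) \<and> iterated_integrals x R" and "s1 \<in> J" "s2 \<in> J" "t1 \<in> J" "t2 \<in> J"
    for u s1 s2 t1 t2
  proof -
    interpret smooth_sheet \<alpha> \<beta> x R
      using smooth by (intro smooth_sheet.intro rough_sheet_axioms smooth_sheet_axioms.intro) simp_all
    show ?thesis by (rule iint_eq_integral[OF assms(5) that(2-5)])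
  qed
  show ?thesis
  proof (intro conjI allI impI ballI)
    show "iint_well_defined R Y Yx Yw u" "CC22 \<alpha> \<beta> (iint R Y Yx Yw u)" for u
      by (rule iint_well_defined_CC22[OF assms(5)])+
    fix s1 s2 t1 t2 :: real
    assume H: "smooth (sheet x) \<and> iterated_integrals x R" "s1 \<in> J" "s2 \<in> J" "t1 \<in> J" "t2 \<in> J"
    show "iint R Y Yx Yw LX [s1, s2] [t1, t2] =
          (LBINT s=s1..s2. (LBINT t=t1..t2. cfun Y [s] [t] * pd Dir1 (pd Dir2 (sheet x)) s t))"
      using integral[OF H, of LX] by (simp only: dint_def theta.simps)
    show "iint R Y Yx Yw LW [s1, s2] [t1, t2] =
          (LBINT s=s1..s2. (LBINT t=t1..t2. cfun Y [s] [t] * pd Dir1 (sheet x) s t * pd Dir2 (sheet x) s t))"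
      using integral[OF H, of LW] by (simp only: dint_def theta.simps mult.assoc)
  qed
qed

end
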